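(* Let $(X,\mu)$ and $(Y,\nu)$ be standard $\sigma$-finite measure spaces. The set $\mathfrak{S}_{w^*}(X,Y)$ of all w*-closable multipliers is a subalgebra of the algebra $\mathfrak{B}(X\times Y)$ of all measurable complex-valued functions on $X\times Y$ (with pointwise operations), and it contains the set $\mathfrak{S}_{\mathrm{loc}}(X,Y)$ of all local Schur multipliers. Moreover, every w*-closable multiplier $\varphi$ is equivalent to an $\omega$-continuous function.
   Context: Two measurable functions on $X\times Y$ are equivalent if they coincide $\mu\times\nu$-almost everywhere. Write $H_1=L^2(X,\mu)$, $H_2=L^2(Y,\nu)$; for $k\in L^2(X\times Y,\mu\times\nu)$ let $I_k:H_1\to H_2$ be $(I_k\xi)(y)=\int_X k(x,y)\xi(x)\,d\mu(x)$. For measurable $\varphi:X\times Y\to\mathbb{C}$ let $D(\varphi)=\{k\in L^2(X\times Y):\varphi k\in L^2(X\times Y)\}$ and let $S_\varphi$ be the densely defined operator on the space $\mathcal{K}(H_1,H_2)$ of compact operators with domain $\{I_k:k\in D(\varphi)\}$ given by $S_\varphi(I_k)=I_{\varphi k}$. The function $\varphi$ is a w*-closable multiplier if $S_\varphi$ is w*-closable: the weak* closure of its graph in $\mathcal{K}(H_1,H_2)^{**}\oplus\mathcal{K}(H_1,H_2)^{**}=\mathcal{B}(H_1,H_2)\oplus\mathcal{B}(H_1,H_2)$ is the graph of an operator. A rectangle is a set $\alpha\times\beta$ with $\alpha\subseteq X$, $\beta\subseteq Y$ measurable. A set $E\subseteq X\times Y$ is marginally null if $E\subseteq (X_0\times Y)\cup(X\times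 Y_0)$ with $\mu(X_0)=\nu(Y_0)=0$; two sets are marginally equivalent if their symmetric difference is marginally null. A set is $\omega$-open if it is marginally equivalent to a countable union of rectangles. A measurable function $g:X\times Y\to\mathbb{C}$ is $\omega$-continuous if $g^{-1}(U)$ is $\omega$-open for every open $U\subseteq\mathbb{C}$. A function $\psi\in L^\infty(X\times Y)$ is a Schur multiplier if there is $C>0$ with $\|I_{\psi k}\|_{\mathrm{op}}\le C\|I_k\|_{\mathrm{op}}$ for all $k\in L^2(X\times Y)$; the same definition applies on rectangles with restricted measures. A measurable function $\varphi$ on $X\times Y$ is a local Schur multiplier if there is a countable family $\{\kappa_m\}$ of rectangles whose union is marginally equivalent to $X\times Y$ such that $\varphi|_{\kappa_m}$ is a Schur multiplier on $\kappa_m$ for every $m$. *)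

theory Defs
  imports "HOL-Analysis.Analysis"
begin

section \<open>Complex normed spaces with explicit carriers\<close>

text \<open>The space L2 depends on a measure, which is a term, so normed spaces are records here.
  All maps are extensional on the carrier, so that equality of maps is HOL equality.\<close>

record 'v cnormed =
  vecs :: "'v set"
  vadd :: "'v \<Rightarrow> 'v \<Rightarrow> 'v"
  vscale :: "complex \<Rightarrow> 'v \<Rightarrow> 'v"
  vnorm :: "'v \<Rightarrow> real"

definition complex_scalars :: "complex cnormed" where
  "complex_scalars = \<lparr>vecs = UNIV, vadd = (+), vscale = (*), vnorm = cmod\<rparr>"

definition vdist :: "'v cnormed \<Rightarrow> 'v \<Rightarrow> 'v \<Rightarrow> real" where
  "vdist V v w = vnorm V (vadd V v (vscale V (-1) w))"

definition linear_maps :: "'v cnormed \<Rightarrow> 'w cnormed \<Rightarrow> ('v \<Rightarrow> 'w) set" where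
  "linear_maps V W = {T \<in> vecs V \<rightarrow>\<^sub>E vecs W.
     (\<forall>v\<in>vecs V. \<forall>w\<in>vecs V. T (vadd V v w) = vadd W (T v) (T w)) \<and>
     (\<forall>c. \<forall>v\<in>vecs V. T (vscale V c v) = vscale W c (T v))}"

definition bounded_ops :: "'v cnormed \<Rightarrow> 'w cnormed \<Rightarrow> ('v \<Rightarrow> 'w) cnormed" where
  "bounded_ops V W =
    \<lparr>vecs = {T \<in> linear_maps V W. \<exists>C. \<forall>v\<in>vecs V. vnorm W (T v) \<le> C * vnorm V v},
     vadd = (\<lambda>S T. \<lambda>v\<in>vecs V. vadd W (S v) (T v)),
     vscale = (\<lambda>c T. \<lambda>v\<in>vecs V. vscale W c (T v)),
     vnorm = (\<lambda>T. SUP v\<in>{v \<in> vecs V. vnorm V v \<le> 1}. vnorm W (T v))\<rparr>"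

definition is_compact_op :: "'v cnormed \<Rightarrow> 'w cnormed \<Rightarrow> ('v \<Rightarrow> 'w) \<Rightarrow> bool" where
  "is_compact_op V W T \<longleftrightarrow> T \<in> vecs (bounded_ops V W) \<and>
     (\<forall>s :: nat \<Rightarrow> 'v. (\<forall>n. s n \<in> vecs V \<and> vnorm V (s n) \<le> 1) \<longrightarrow>
       (\<exists>r. strict_mono r \<and> (\<exists>w\<in>vecs W. (\<lambda>n. vdist W (T (s (r n))) w) \<longlonglongrightarrow> 0)))"

definition compact_ops :: "'v cnormed \<Rightarrow> 'w cnormed \<Rightarrow> ('v \<Rightarrow> 'w) cnormed" where
  "compact_ops V W = (bounded_ops V W)\<lparr>vecs := {T. is_compact_op V W T}\<rparr>"

definition dual :: "'v cnormed \<Rightarrow> ('v \<Rightarrow> complex) cnormed" where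
  "dual V = bounded_ops V complex_scalars"

definition bidual_embed :: "'v cnormed \<Rightarrow> 'v \<Rightarrow> (('v \<Rightarrow> complex) \<Rightarrow> complex)" where
  "bidual_embed V v = (\<lambda>F\<in>vecs (dual V). F v)"

text \<open>The weak* topology on the dual of \<open>V\<close>: pointwise convergence on \<open>V\<close>.\<close>

definition weak_star_topology :: "'v cnormed \<Rightarrow> ('v \<Rightarrow> complex) topology" where
  "weak_star_topology V =
     subtopology (product_topology (\<lambda>_. euclidean) (vecs V)) (vecs (dual V))"

text \<open>\<open>G\<close> is the graph of a (partially defined) operator from \<open>V\<close> to \<open>V\<close>. Its closure is taken in
  the direct sum of two copies of the bidual of \<open>V\<close>, whose weak* topology (as the dual of a direct
  sum of two copies of \<open>dual V\<close>) is the product of the weak* topologies. The bidual is taken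
  literally; for \<open>V\<close> the compact operators between Hilbert spaces it is canonically
  the space of all bounded operators, with its weak* topology as the dual of the trace class.\<close>

definition wstar_closable_graph :: "'v cnormed \<Rightarrow> ('v \<times> 'v) set \<Rightarrow> bool" where
  "wstar_closable_graph V G \<longleftrightarrow>
     single_valued
       (prod_topology (weak_star_topology (dual V)) (weak_star_topology (dual V))
          closure_of (\<lambda>(S, T). (bidual_embed V S, bidual_embed V T)) ` G)"


section \<open>Standard measure spaces and L2\<close>

text \<open>The measurable sets are the Borel sets of some Polish topology on the underlying space.\<close>

definition standard_borel_measure :: "'a measure \<Rightarrow> bool" where
  "standard_borel_measure M \<longleftrightarrow>
     (\<exists>X. topspace X = space M \<and> completely_metrizable_space X \<and> second_countable X \<and>
          sets M = sigma_sets (space M) {U. openin X U})"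

definition square_integrable :: "'a measure \<Rightarrow> ('a \<Rightarrow> complex) set" where
  "square_integrable M =
     {f \<in> borel_measurable M. integrable M (\<lambda>x. (cmod (f x))\<^sup>2)}"

definition ae_class :: "'a measure \<Rightarrow> ('a \<Rightarrow> complex) \<Rightarrow> ('a \<Rightarrow> complex) set" where
  "ae_class M f = {g \<in> borel_measurable M. AE x in M. g x = f x}"

definition rep :: "('a \<Rightarrow> complex) set \<Rightarrow> 'a \<Rightarrow> complex" where
  "rep A = (SOME f. f \<in> A)"

definition L2 :: "'a measure \<Rightarrow> ('a \<Rightarrow> complex) set cnormed" where
  "L2 M =
    \<lparr>vecs = ae_class M ` square_integrable M,
     vadd = (\<lambda>A B. ae_class M (\<lambda>x. rep A x + rep B x)),
     vscale = (\<lambda>c A. ae_class M (\<lambda>x. c * rep A x)),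
     vnorm = (\<lambda>A. sqrt (LINT x|M. (cmod (rep A x))\<^sup>2))\<rparr>"


section \<open>Closable multipliers\<close>

text \<open>Kernels are functions rather than classes; the operator below depends only on the
  almost-everywhere class of \<open>k\<close>.\<close>

definition int_op :: "'a measure \<Rightarrow> 'b measure \<Rightarrow> ('a \<times> 'b \<Rightarrow> complex)
    \<Rightarrow> (('a \<Rightarrow> complex) set \<Rightarrow> ('b \<Rightarrow> complex) set)" where
  "int_op \<mu> \<nu> k = (\<lambda>A\<in>vecs (L2 \<mu>). ae_class \<nu> (\<lambda>y. LINT x|\<mu>. k (x, y) * rep A x))"

definition mult_domain :: "'a measure \<Rightarrow> 'b measure \<Rightarrow> ('a \<times> 'b \<Rightarrow> complex)
    \<Rightarrow> ('a \<times> 'b \<Rightarrow> complex) set" where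
  "mult_domain \<mu> \<nu> \<phi> = {k \<in> square_integrable (\<mu> \<Otimes>\<^sub>M \<nu>).
     (\<lambda>z. \<phi> z * k z) \<in> square_integrable (\<mu> \<Otimes>\<^sub>M \<nu>)}"

definition mult_graph :: "'a measure \<Rightarrow> 'b measure \<Rightarrow> ('a \<times> 'b \<Rightarrow> complex)
    \<Rightarrow> ((('a \<Rightarrow> complex) set \<Rightarrow> ('b \<Rightarrow> complex) set) \<times>
        (('a \<Rightarrow> complex) set \<Rightarrow> ('b \<Rightarrow> complex) set)) set" where
  "mult_graph \<mu> \<nu> \<phi> =
     (\<lambda>k. (int_op \<mu> \<nu> k, int_op \<mu> \<nu> (\<lambda>z. \<phi> z * k z))) ` mult_domain \<mu> \<nu> \<phi>"

definition wstar_closable_multipliers ::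
    "'a measure \<Rightarrow> 'b measure \<Rightarrow> ('a \<times> 'b \<Rightarrow> complex) set" where
  "wstar_closable_multipliers \<mu> \<nu> = {\<phi> \<in> borel_measurable (\<mu> \<Otimes>\<^sub>M \<nu>).
     wstar_closable_graph (compact_ops (L2 \<mu>) (L2 \<nu>)) (mult_graph \<mu> \<nu> \<phi>)}"


section \<open>Rectangles and the omega-topology\<close>

definition marginally_null :: "'a measure \<Rightarrow> 'b measure \<Rightarrow> ('a \<times> 'b) set \<Rightarrow> bool" where
  "marginally_null \<mu> \<nu> E \<longleftrightarrow>
     (\<exists>X\<^sub>0\<in>null_sets \<mu>. \<exists>Y\<^sub>0\<in>null_sets \<nu>. E \<subseteq> (X\<^sub>0 \<times> space \<nu>) \<union> (space \<mu> \<times> Y\<^sub>0))"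

definition marginally_equiv ::
    "'a measure \<Rightarrow> 'b measure \<Rightarrow> ('a \<times> 'b) set \<Rightarrow> ('a \<times> 'b) set \<Rightarrow> bool" where
  "marginally_equiv \<mu> \<nu> E F \<longleftrightarrow> marginally_null \<mu> \<nu> (sym_diff E F)"

definition omega_open :: "'a measure \<Rightarrow> 'b measure \<Rightarrow> ('a \<times> 'b) set \<Rightarrow> bool" where
  "omega_open \<mu> \<nu> E \<longleftrightarrow>
     (\<exists>K. countable K \<and> K \<subseteq> sets \<mu> \<times> sets \<nu> \<and>
          marginally_equiv \<mu> \<nu> E (\<Union>(\<alpha>, \<beta>)\<in>K. \<alpha> \<times> \<beta>))"

definition omega_continuous ::
    "'a measure \<Rightarrow> 'b measure \<Rightarrow> ('a \<times> 'b \<Rightarrow> complex) \<Rightarrow> bool" where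
  "omega_continuous \<mu> \<nu> g \<longleftrightarrow> g \<in> borel_measurable (\<mu> \<Otimes>\<^sub>M \<nu>) \<and>
     (\<forall>U. open U \<longrightarrow> omega_open \<mu> \<nu> (g -` U \<inter> space (\<mu> \<Otimes>\<^sub>M \<nu>)))"


section \<open>Schur multipliers\<close>

definition schur_multiplier ::
    "'a measure \<Rightarrow> 'b measure \<Rightarrow> ('a \<times> 'b \<Rightarrow> complex) \<Rightarrow> bool" where
  "schur_multiplier \<mu> \<nu> \<psi> \<longleftrightarrow>
     \<psi> \<in> borel_measurable (\<mu> \<Otimes>\<^sub>M \<nu>) \<and> (\<exists>B. AE z in \<mu> \<Otimes>\<^sub>M \<nu>. cmod (\<psi> z) \<le> B) \<and>
     (\<exists>C>0. \<forall>k\<in>square_integrable (\<mu> \<Otimes>\<^sub>M \<nu>).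
        vnorm (bounded_ops (L2 \<mu>) (L2 \<nu>)) (int_op \<mu> \<nu> (\<lambda>z. \<psi> z * k z))
          \<le> C * vnorm (bounded_ops (L2 \<mu>) (L2 \<nu>)) (int_op \<mu> \<nu> k))"

definition local_schur_multipliers ::
    "'a measure \<Rightarrow> 'b measure \<Rightarrow> ('a \<times> 'b \<Rightarrow> complex) set" where
  "local_schur_multipliers \<mu> \<nu> = {\<phi> \<in> borel_measurable (\<mu> \<Otimes>\<^sub>M \<nu>).
     \<exists>K. countable K \<and> K \<subseteq> sets \<mu> \<times> sets \<nu> \<and>
         marginally_equiv \<mu> \<nu> (\<Union>(\<alpha>, \<beta>)\<in>K. \<alpha> \<times> \<beta>) (space \<mu> \<times> space \<nu>) \<and>
         (\<forall>(\<alpha>, \<beta>)\<in>K. schur_multiplier (restrict_space \<mu> \<alpha>) (restrict_space \<nu> \<beta>) \<phi>)}"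

end

theory Submission imports Defs begin

text \<open>
 Why the theorem holds. A bounded functional on the compact operators \<open>L2 M \<rightarrow> L2 N\<close> is the same thing as a
 functional \<open>k \<mapsto> \<integral> k h\<close> on square integrable kernels with
 \<open>h(x,y) = \<Sum>\<^sub>i f\<^sub>i(x) g\<^sub>i(y)\<close> and \<open>\<Sum> \<parallel>f\<^sub>i\<parallel>\<^sup>2, \<Sum> \<parallel>g\<^sub>i\<parallel>\<^sup>2 < \<infinity>\<close>
 (\<open>functional_kernel\<close>, \<open>kernel_functional_extension\<close>): this is trace duality, obtained from a singular value
 decomposition. By Hahn-Banach, the weak* closure of the graph of a linear map is single valued if and only
 if the functionals on which its adjoint is defined are dense in norm (\<open>closable_if_adjoint_dense\<close>,
 \<open>adjoint_dense_if_closable\<close>). So closability of \<open>S\<^sub>\<phi>\<close> becomes a question about trace class kernels.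

 Let \<open>\<phi>\<close> be closable and let \<open>w\<close>, \<open>w'\<close> be strictly positive and square integrable. Approximating the functional
 of \<open>w(x) w'(y)\<close> from the domain of the adjoint gives, almost everywhere,
 \<open>\<phi> (w w' - \<Sum> f\<^sub>i g\<^sub>i) = \<Sum> a\<^sub>i b\<^sub>i\<close> with \<open>\<Sum> \<parallel>f\<^sub>i\<parallel>\<^sup>2\<close> and \<open>\<Sum> \<parallel>g\<^sub>i\<parallel>\<^sup>2\<close> small. On a rectangle where
 the pointwise sums of squares are controlled by the weights, division by \<open>w w'\<close> turns this into
 \<open>\<phi> (1 - v) = u\<close>, where \<open>u\<close>, \<open>v\<close> are sums of products with bounded square sums and \<open>\<bar>v\<bar> \<le> 1/4\<close>. Rectangles
 \<open>A\<^sub>n \<times> B\<^sub>n\<close> with \<open>A\<^sub>n\<close>, \<open>B\<^sub>n\<close> increasing to sets of full measure have this property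
 (\<open>closable_factored_on_exhaustion\<close>). Sums such as \<open>u\<close> and \<open>v\<close> are Schur multipliers (\<open>schur_bound\<close>), and
 multiplication by \<open>1 - v\<close> is invertible by a contraction argument, so \<open>\<phi>\<close> is a Schur multiplier on each
 \<open>A\<^sub>n \<times> B\<^sub>n\<close> (\<open>factored_on_schur_on\<close>). Conversely, an exhaustion by such rectangles makes \<open>\<phi>\<close> closable:
 restricting a functional to \<open>A\<^sub>n \<times> B\<^sub>n\<close> changes it little in norm and moves it into the domain of the adjoint
 (\<open>closable_if_schur_exhaustion\<close>).

 Everything else follows from this characterisation. Two exhaustions can be intersected, and Schur
 multipliers on a rectangle form an algebra. For a local Schur multiplier the countable cover by rectangles has to
 be replaced by increasing rectangles, each of which meets only finitely many members of the cover; this is a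
 compactness argument in the spirit of Lusin's theorem and is where the Polish topologies enter
 (\<open>finite_cover_exhaustion\<close>). Finally, preimages of open sets under \<open>u / (1 - v)\<close> are countable unions of rectangles,
 and two such representatives of \<open>\<phi>\<close> can differ on an overlap only in a marginally null set, so
 they glue to an \<open>\<omega>\<close>-continuous function (\<open>closable_omega_continuous_representative\<close>).
\<close>

section \<open>The Hahn-Banach theorem for function spaces\<close>

text \<open>The spaces carry no type of their own; they are sets of functions with pointwise operations, so that spaces over an arbitrary index type, in particular dual spaces, are covered.\<close>

definition complex_subspace :: "('i => complex) set => bool" where
 "complex_subspace V \<longleftrightarrow> (\<lambda>_. 0) \<in> V \<and> (\<forall>f\<in>V. \<forall>g\<in>V. (\<lambda>i. f i + g i) \<in> V)
   \<and> (\<forall>c. \<forall>f\<in>V. (\<lambda>i. c * f i) \<in> V)"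

definition seminorm_on :: "('i => complex) set => (('i => complex) => real) => bool" where
 "seminorm_on V p \<longleftrightarrow> (\<forall>f\<in>V. \<forall>g\<in>V. p (\<lambda>i. f i + g i) \<le> p f + p g)
   \<and> (\<forall>c. \<forall>f\<in>V. p (\<lambda>i. c * f i) = cmod c * p f)"

definition linear_on_space :: "('i => complex) set => (('i => complex) => complex) => bool" where
 "linear_on_space V l \<longleftrightarrow> (\<forall>f\<in>V. \<forall>g\<in>V. l (\<lambda>i. f i + g i) = l f + l g)
   \<and> (\<forall>c. \<forall>f\<in>V. l (\<lambda>i. c * f i) = c * l f)"

definition sublinear_on :: "('i => complex) set => (('i => complex) => real) => bool" where
 "sublinear_on V q \<longleftrightarrow> (\<forall>f\<in>V. \<forall>g\<in>V. q (\<lambda>i. f i + g i) \<le> q f + q g)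
   \<and> (\<forall>t>0. \<forall>f\<in>V. q (\<lambda>i. of_real t * f i) = t * q f)"

lemma complex_subspaceD:
 assumes "complex_subspace V"
 shows "(\<lambda>_. 0) \<in> V" "f \<in> V ==> g \<in> V ==> (\<lambda>i. f i + g i) \<in> V" "f \<in> V ==> (\<lambda>i. c * f i) \<in> V"
  "f \<in> V ==> (\<lambda>i. - f i) \<in> V"
proof -
 show "f \<in> V ==> (\<lambda>i. - f i) \<in> V"
  using assms[unfolded complex_subspace_def, THEN conjunct2, THEN conjunct2, THEN spec, of "-1"] by simp
qed (use assms in \<open>auto simp: complex_subspace_def\<close>)

lemma sublinear_on_add:
 assumes "sublinear_on V q" "f \<in> V" "g \<in> V"
 shows "q (\<lambda>i. f i + g i) \<le> q f + q g"
 by (rule assms(1)[unfolded sublinear_on_def, THEN conjunct1, THEN bspec, OF assms(2), THEN bspec, OF assms(3)])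

lemma sublinear_on_scale:
 assumes "sublinear_on V q" "t > 0" "f \<in> V"
 shows "q (\<lambda>i. of_real t * f i) = t * q f"
 by (rule assms(1)[unfolded sublinear_on_def, THEN conjunct2, THEN spec, THEN mp, OF assms(2), THEN bspec, OF assms(3)])

lemma seminorm_on_add:
 assumes "seminorm_on V q" "f \<in> V" "g \<in> V"
 shows "q (\<lambda>i. f i + g i) \<le> q f + q g"
 by (rule assms(1)[unfolded seminorm_on_def, THEN conjunct1, THEN bspec, OF assms(2), THEN bspec, OF assms(3)])

lemma seminorm_on_scale:
 assumes "seminorm_on V q" "f \<in> V"
 shows "q (\<lambda>i. c * f i) = cmod c * q f"
 by (rule assms(1)[unfolded seminorm_on_def, THEN conjunct2, THEN spec, THEN bspec, OF assms(2)])

lemma linear_on_space_add: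
 assumes "linear_on_space V q" "f \<in> V" "g \<in> V"
 shows "q (\<lambda>i. f i + g i) = q f + q g"
 by (rule assms(1)[unfolded linear_on_space_def, THEN conjunct1, THEN bspec, OF assms(2), THEN bspec, OF assms(3)])

lemma linear_on_space_scale:
 assumes "linear_on_space V q" "f \<in> V"
 shows "q (\<lambda>i. c * f i) = c * q f"
 by (rule assms(1)[unfolded linear_on_space_def, THEN conjunct2, THEN spec, THEN bspec, OF assms(2)])

lemma sublinear_on_zero:
 assumes "complex_subspace V" "sublinear_on V q"
 shows "q (\<lambda>_. 0) = 0"
proof -
 have "q (\<lambda>i. of_real 2 * (\<lambda>_. 0) i) = 2 * q (\<lambda>_. 0)"
  by (rule sublinear_on_scale[OF assms(2) _ complex_subspaceD(1)[OF assms(1)]]) simp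
 then show ?thesis by simp
qed

lemma sublinear_on_neg:
 assumes V: "complex_subspace V" and q: "sublinear_on V q" and f: "f \<in> V"
 shows "- q (\<lambda>i. - f i) \<le> q f"
proof -
 have "q (\<lambda>i. f i + - f i) \<le> q f + q (\<lambda>i. - f i)"
  by (rule sublinear_on_add[OF q f complex_subspaceD(4)[OF V f]])
 moreover have "(\<lambda>i. f i + - f i) = (\<lambda>_. 0)" by auto
 ultimately have "q (\<lambda>_. 0) \<le> q f + q (\<lambda>i. - f i)" by simp
 then show ?thesis using sublinear_on_zero[OF V q] by linarith
qed

lemma sublinear_on_directed_Inf:
 assumes V: "complex_subspace V" and p: "sublinear_on V p"
  and Q: "Q \<noteq> {}" "\<And>q. q \<in> Q ==> sublinear_on V q \<and> (\<forall>f\<in>V. q f \<le> p f)"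
  and dir: "\<And>q r. q \<in> Q ==> r \<in> Q ==> \<exists>s\<in>Q. \<forall>f\<in>V. s f \<le> q f \<and> s f \<le> r f"
 shows "sublinear_on V (\<lambda>f. INF q\<in>Q. q f)" and "\<And>q f. q \<in> Q ==> f \<in> V ==> (INF q\<in>Q. q f) \<le> q f"
proof -
 have bdd: "bdd_below ((\<lambda>q. q f) ` Q)" if f: "f \<in> V" for f
 proof (rule bdd_belowI2)
  fix q assume q: "q \<in> Q"
  show "- p (\<lambda>i. - f i) \<le> q f"
  proof -
   have "q (\<lambda>i. - f i) \<le> p (\<lambda>i. - f i)" using Q(2)[OF q] complex_subspaceD(4)[OF V f] by blast
   moreover have "- q (\<lambda>i. - f i) \<le> q f" using sublinear_on_neg[OF V _ f] Q(2)[OF q] by blast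
   ultimately show ?thesis by linarith
  qed
 qed
 show low: "(INF q\<in>Q. q f) \<le> q f" if "q \<in> Q" "f \<in> V" for q f
  using cINF_lower[OF bdd] that by auto
 have add: "(INF q\<in>Q. q (\<lambda>i. f i + g i)) \<le> (INF q\<in>Q. q f) + (INF q\<in>Q. q g)"
  if f: "f \<in> V" and g: "g \<in> V" for f g
 proof -
  have *: "(INF q\<in>Q. q (\<lambda>i. f i + g i)) \<le> q f + r g" if q: "q \<in> Q" and r: "r \<in> Q" for q r
  proof -
   obtain s where s: "s \<in> Q" "\<forall>f\<in>V. s f \<le> q f \<and> s f \<le> r f" using dir[OF q r] by blast
   have "(INF q\<in>Q. q (\<lambda>i. f i + g i)) \<le> s (\<lambda>i. f i + g i)"
    by (rule low[OF s(1) complex_subspaceD(2)[OF V f g]])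
   also have "\<dots> \<le> s f + s g" using sublinear_on_add[OF _ f g] Q(2)[OF s(1)] by blast
   also have "\<dots> \<le> q f + r g" using s f g by (meson add_mono)
   finally show ?thesis .
  qed
  have "(INF q\<in>Q. q (\<lambda>i. f i + g i)) - r g \<le> (INF q\<in>Q. q f)" if r: "r \<in> Q" for r
   by (rule cINF_greatest[OF Q(1)]) (use *[OF _ r] in \<open>simp add: algebra_simps\<close>)
  then have "(INF q\<in>Q. q (\<lambda>i. f i + g i)) - (INF q\<in>Q. q f) \<le> (INF q\<in>Q. q g)"
   by (intro cINF_greatest[OF Q(1)]) (simp add: algebra_simps)
  then show ?thesis by simp
 qed
 have scale: "(INF q\<in>Q. q (\<lambda>i. of_real t * f i)) = t * (INF q\<in>Q. q f)" if t: "t > 0" and f: "f \<in> V" for t f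
 proof -
  have "(INF q\<in>Q. q (\<lambda>i. of_real t * f i)) = (INF q\<in>Q. t * q f)"
   using Q(2) by (intro INF_cong refl sublinear_on_scale[OF _ t f]) blast
  also have "\<dots> = t * (INF q\<in>Q. q f)"
  proof (rule antisym)
   show "(INF q\<in>Q. t * q f) \<le> t * (INF q\<in>Q. q f)"
   proof -
    have "(INF q\<in>Q. t * q f) / t \<le> (INF q\<in>Q. q f)"
    proof (rule cINF_greatest[OF Q(1)])
     fix q assume "q \<in> Q"
     moreover have "bdd_below ((\<lambda>q. t * q f) ` Q)"
      by (rule bdd_belowI2[of _ "t * (INF q\<in>Q. q f)"]) (use low f t in \<open>simp add: mult_left_mono\<close>)
     ultimately have "(INF q\<in>Q. t * q f) \<le> t * q f" by (intro cINF_lower)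
     then show "(INF q\<in>Q. t * q f) / t \<le> q f" using t by (simp add: field_simps)
    qed
    then show ?thesis using t by (simp add: field_simps)
   qed
   show "t * (INF q\<in>Q. q f) \<le> (INF q\<in>Q. t * q f)"
    by (rule cINF_greatest[OF Q(1)]) (use low f t in \<open>simp add: mult_left_mono\<close>)
  qed
  finally show ?thesis .
 qed
 show "sublinear_on V (\<lambda>f. INF q\<in>Q. q f)"
  unfolding sublinear_on_def using add scale by blast
qed

text \<open>Zorn applies because the infimum of a chain of sublinear functionals below \<open>p\<close> is finite and sublinear.\<close>

lemma minimal_sublinear_below:
 fixes V :: "('i => complex) set"
 assumes V: "complex_subspace V" and p: "sublinear_on V p"
 obtains m where "sublinear_on V m" "\<And>f. f \<in> V ==> m f \<le> p f"
  "\<And>q. sublinear_on V q ==> (\<And>f. f \<in> V ==> q f \<le> m f) ==> (\<forall>f\<in>V. q f = m f)"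
proof -
 define cut :: "(('i => complex) => real) => ('i => complex) => real" where "cut q = (\<lambda>f. if f \<in> V then q f else 0)" for q
 define A where "A = {q. sublinear_on V q \<and> (\<forall>f\<in>V. q f \<le> p f) \<and> (\<forall>f. f \<notin> V \<longrightarrow> q f = 0)}"
 define P :: "(('i => complex) => real) => (('i => complex) => real) => bool" where "P q r \<longleftrightarrow> r \<le> q" for q r
 have AD: "sublinear_on V q" "\<And>f. f \<in> V ==> q f \<le> p f" "\<And>f. f \<notin> V ==> q f = 0" if "q \<in> A" for q
  using that unfolding A_def by blast+
 have AI: "q \<in> A" if "sublinear_on V q" "\<And>f. f \<in> V ==> q f \<le> p f" "\<And>f. f \<notin> V ==> q f = 0" for q
  using that unfolding A_def by blast
 have cut_in: "cut q f = q f" if "f \<in> V" for q f using that by (simp add: cut_def)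
 have cut_out: "cut q f = 0" if "f \<notin> V" for q f using that by (simp add: cut_def)
 have cut: "sublinear_on V (cut q)" if "sublinear_on V q" for q
  unfolding sublinear_on_def
  by (intro conjI ballI allI impI)
   (simp_all only: cut_in complex_subspaceD[OF V] sublinear_on_add[OF that] sublinear_on_scale[OF that])
 have "\<exists>m\<in>A. \<forall>a\<in>A. P m a \<longrightarrow> a = m"
 proof (rule predicate_Zorn)
  show "partial_order_on A (relation_of P A)"
   by (rule partial_order_on_relation_ofI) (auto simp: P_def)
  fix C assume C: "C \<in> Chains (relation_of P A)"
  show "\<exists>u\<in>A. \<forall>a\<in>C. P a u"
  proof (cases "C = {}")
   case True
   have "cut p \<in> A" by (rule AI[OF cut[OF p]]) (simp_all add: cut_in cut_out)
   then show ?thesis using True by blast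
  next
   case False
   have CA: "C \<subseteq> A" using C by (auto simp: Chains_def relation_of_def)
   have tot: "q \<le> r \<or> r \<le> q" if "q \<in> C" "r \<in> C" for q r
   proof -
    have "(q, r) \<in> relation_of P A \<or> (r, q) \<in> relation_of P A"
     using C that unfolding Chains_def by blast
    then show ?thesis unfolding relation_of_def P_def by blast
   qed
   have dir: "\<exists>s\<in>C. \<forall>f\<in>V. s f \<le> q f \<and> s f \<le> r f" if "q \<in> C" "r \<in> C" for q r
   proof (cases "q \<le> r")
    case True then show ?thesis using that(1) by (intro bexI[of _ q]) (auto simp: le_fun_def)
   next
    case False then show ?thesis using that tot[OF that] by (intro bexI[of _ r]) (auto simp: le_fun_def)
   qed
   have sub: "\<And>q. q \<in> C ==> sublinear_on V q \<and> (\<forall>f\<in>V. q f \<le> p f)"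
    using CA AD by blast
   have inf1: "sublinear_on V (\<lambda>f. INF q\<in>C. q f)"
    by (rule sublinear_on_directed_Inf(1)[OF V p False]; (rule sub | rule dir); assumption)
   have inf2: "(INF q\<in>C. q f) \<le> q f" if "q \<in> C" "f \<in> V" for q f
    by (rule sublinear_on_directed_Inf(2)[OF V p False _ _ that]; (rule sub | rule dir); assumption)
   have "cut (\<lambda>f. INF q\<in>C. q f) \<in> A"
   proof (rule AI[OF cut[OF inf1]])
    fix f assume f: "f \<in> V"
    obtain a where a: "a \<in> C" using False by blast
    have "(INF q\<in>C. q f) \<le> a f" by (rule inf2[OF a f])
    also have "a f \<le> p f" by (rule AD(2)) (use CA a f in auto)
    finally show "cut (\<lambda>f. INF q\<in>C. q f) f \<le> p f" by (simp add: cut_in[OF f])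
   qed (rule cut_out)
   moreover have "P a (cut (\<lambda>f. INF q\<in>C. q f))" if a: "a \<in> C" for a
    unfolding P_def le_fun_def
   proof
    fix f show "cut (\<lambda>f. INF q\<in>C. q f) f \<le> a f"
    proof (cases "f \<in> V")
     case True then show ?thesis using inf2[OF a True] by (simp add: cut_in)
    next
     case False
     then have "a f = 0" by (intro AD(3)) (use CA a in auto)
     then show ?thesis using cut_out[OF False] by simp
    qed
   qed
   ultimately show ?thesis by blast
  qed
 qed
 then obtain m where m: "m \<in> A" "\<And>a. a \<in> A ==> a \<le> m ==> a = m" by (auto simp: P_def)
 show ?thesis
 proof (rule that[of m])
  show "sublinear_on V m" by (rule AD(1)[OF m(1)])
  show "\<And>f. f \<in> V ==> m f \<le> p f" by (rule AD(2)[OF m(1)])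
  fix q assume q: "sublinear_on V q" "\<And>f. f \<in> V ==> q f \<le> m f"
  have "cut q = m"
  proof (rule m(2))
   show "cut q \<in> A"
    by (rule AI[OF cut[OF q(1)]])
     (use cut_in cut_out order_trans[OF q(2) AD(2)[OF m(1)]] in simp_all)
   show "cut q \<le> m"
    unfolding le_fun_def by (metis q(2) AD(3)[OF m(1)] cut_in cut_out order_refl)
  qed
  then show "\<forall>f\<in>V. q f = m f" using cut_in by metis
 qed
qed

text \<open>The functional \<open>r\<close> lies below \<open>q\<close>, so it equals \<open>q\<close> when \<open>q\<close> is minimal; the last inequality then makes \<open>q\<close> additive.\<close>

lemma sublinear_on_slope:
 assumes V: "complex_subspace V" and q: "sublinear_on V q" and y: "y \<in> V"
 defines "r \<equiv> (\<lambda>f. INF t\<in>{0..}. q (\<lambda>i. f i + of_real t * y i) - t * q y)"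
 shows "sublinear_on V r" "\<And>f. f \<in> V ==> r f \<le> q f" "\<And>f. f \<in> V ==> r f \<le> q (\<lambda>i. f i + y i) - q y"
proof -
 note VD = complex_subspaceD[OF V]
 note qadd = sublinear_on_add[OF q]
 have qsc: "q (\<lambda>i. of_real t * f i) = t * q f" if "f \<in> V" "t \<ge> 0" for f t
  using sublinear_on_scale[OF q _ that(1), of t] that sublinear_on_zero[OF V q] by (cases "t = 0") auto
 have bdd: "bdd_below ((\<lambda>t. q (\<lambda>i. f i + of_real t * y i) - t * q y) ` {0..})" if f: "f \<in> V" for f
 proof (rule bdd_belowI2)
  fix t :: real assume t: "t \<in> {0..}"
  have "t * q y = q (\<lambda>i. (\<lambda>i. f i + of_real t * y i) i + (\<lambda>i. - f i) i)"
   using qsc[OF y, of t] t by simp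
  also have "\<dots> \<le> q (\<lambda>i. f i + of_real t * y i) + q (\<lambda>i. - f i)"
   by (intro qadd VD f y)
  finally show "- q (\<lambda>i. - f i) \<le> q (\<lambda>i. f i + of_real t * y i) - t * q y" by simp
 qed
 have low: "r f \<le> q (\<lambda>i. f i + of_real t * y i) - t * q y" if "f \<in> V" "t \<ge> 0" for f t
  unfolding r_def using cINF_lower[OF bdd] that by auto
 show "\<And>f. f \<in> V ==> r f \<le> q f" using low[of _ 0] by simp
 show "\<And>f. f \<in> V ==> r f \<le> q (\<lambda>i. f i + y i) - q y" using low[of _ 1] by simp
 have great: "c \<le> r f" if "\<And>t. t \<ge> 0 ==> c \<le> q (\<lambda>i. f i + of_real t * y i) - t * q y" for c f
  unfolding r_def by (rule cINF_greatest) (use that in auto)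
 have add: "r (\<lambda>i. f i + g i) \<le> r f + r g" if f: "f \<in> V" and g: "g \<in> V" for f g
 proof -
  have *: "r (\<lambda>i. f i + g i) \<le> (q (\<lambda>i. f i + of_real t * y i) - t * q y) + (q (\<lambda>i. g i + of_real s * y i) - s * q y)"
   if "t \<ge> 0" "s \<ge> 0" for s t
  proof -
   have "r (\<lambda>i. f i + g i) \<le> q (\<lambda>i. f i + g i + of_real (t + s) * y i) - (t + s) * q y"
    using low[OF VD(2)[OF f g], of "t + s"] that by simp
   also have "(\<lambda>i. f i + g i + of_real (t + s) * y i)
     = (\<lambda>i. (\<lambda>i. f i + of_real t * y i) i + (\<lambda>i. g i + of_real s * y i) i)"
    by (auto simp: algebra_simps)
   also have "q \<dots> \<le> q (\<lambda>i. f i + of_real t * y i) + q (\<lambda>i. g i + of_real s * y i)"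
    by (intro qadd VD f g y)
   finally show ?thesis by (simp add: algebra_simps)
  qed
  have "r (\<lambda>i. f i + g i) - (q (\<lambda>i. g i + of_real s * y i) - s * q y) \<le> r f" if "s \<ge> 0" for s
   by (rule great) (use *[OF _ that] in \<open>simp add: algebra_simps\<close>)
  then have "r (\<lambda>i. f i + g i) - r f \<le> r g"
   by (intro great) (simp add: algebra_simps)
  then show ?thesis by simp
 qed
 have scale_le: "s * r f \<le> r (\<lambda>i. of_real s * f i)" if s: "s > 0" and f: "f \<in> V" for s f
 proof (rule great)
  fix t :: real assume t: "t \<ge> 0"
  have "s * r f \<le> s * (q (\<lambda>i. f i + of_real (t / s) * y i) - (t / s) * q y)"
   using low[OF f, of "t / s"] s t by (intro mult_left_mono) auto
  also have "\<dots> = s * q (\<lambda>i. f i + of_real (t / s) * y i) - t * q y"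
   using s by (simp add: field_simps)
  also have "s * q (\<lambda>i. f i + of_real (t / s) * y i) = q (\<lambda>i. of_real s * (\<lambda>i. f i + of_real (t / s) * y i) i)"
   by (rule qsc[symmetric, OF VD(2)[OF f VD(3)[OF y]]]) (use s in simp)
  also have "(\<lambda>i. of_real s * (\<lambda>i. f i + of_real (t / s) * y i) i) = (\<lambda>i. of_real s * f i + of_real t * y i)"
   using s by (auto simp: field_simps)
  finally show "s * r f \<le> q (\<lambda>i. of_real s * f i + of_real t * y i) - t * q y" .
 qed
 have scale: "r (\<lambda>i. of_real s * f i) = s * r f" if s: "s > 0" and f: "f \<in> V" for s f
 proof -
  have "(1 / s) * r (\<lambda>i. of_real s * f i) \<le> r (\<lambda>i. of_real (1 / s) * (of_real s * f i))"
   using s by (intro scale_le VD f) auto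
  also have "(\<lambda>i. of_real (1 / s) * (of_real s * f i)) = f" using s by auto
  finally show ?thesis using scale_le[OF s f] s by (simp add: field_simps)
 qed
 show "sublinear_on V r" unfolding sublinear_on_def using add scale by blast
qed

text \<open>A minimal sublinear functional below \<open>p\<close> is real linear by the slope construction; starting that construction at \<open>z\<close> forces the value \<open>p z\<close>. The complex functional is recovered from its real part \<open>m\<close> as \<open>m f - \<i> m (\<i> f)\<close>.\<close>

theorem hahn_banach_seminorm:
 assumes V: "complex_subspace V" and p: "seminorm_on V p" and z: "z \<in> V"
 obtains l where "linear_on_space V l" "\<And>f. f \<in> V ==> cmod (l f) \<le> p f" "l z = of_real (p z)"
proof -
 note VD = complex_subspaceD[OF V]
 note padd = seminorm_on_add[OF p] and psc = seminorm_on_scale[OF p]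
 have sub: "sublinear_on V p" unfolding sublinear_on_def using padd psc by auto
 define q where "q = (\<lambda>f. INF t\<in>{0..}. p (\<lambda>i. f i + of_real t * z i) - t * p z)"
 have q: "sublinear_on V q" "\<And>f. f \<in> V ==> q f \<le> p f" "\<And>f. f \<in> V ==> q f \<le> p (\<lambda>i. f i + z i) - p z"
  unfolding q_def by (rule sublinear_on_slope[OF V sub z]; assumption)+
 obtain m where m: "sublinear_on V m" "\<And>f. f \<in> V ==> m f \<le> q f"
  "\<And>r. sublinear_on V r ==> (\<And>f. f \<in> V ==> r f \<le> m f) ==> (\<forall>f\<in>V. r f = m f)"
  using minimal_sublinear_below[OF V q(1)] by blast
 have madd: "m (\<lambda>i. f i + y i) = m f + m y" if f: "f \<in> V" and y: "y \<in> V" for f y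
 proof -
  define r where "r = (\<lambda>f. INF t\<in>{0..}. m (\<lambda>i. f i + of_real t * y i) - t * m y)"
  have r: "sublinear_on V r" "\<And>f. f \<in> V ==> r f \<le> m f" "\<And>f. f \<in> V ==> r f \<le> m (\<lambda>i. f i + y i) - m y"
   unfolding r_def by (rule sublinear_on_slope[OF V m(1) y]; assumption)+
  have "\<forall>f\<in>V. r f = m f" by (rule m(3)[OF r(1,2)])
  then have "m f \<le> m (\<lambda>i. f i + y i) - m y" using r(3)[OF f] f by simp
  moreover have "m (\<lambda>i. f i + y i) \<le> m f + m y" by (rule sublinear_on_add[OF m(1) f y])
  ultimately show ?thesis by simp
 qed
 have m0: "m (\<lambda>_. 0) = 0" by (rule sublinear_on_zero[OF V m(1)])
 have mneg: "m (\<lambda>i. - f i) = - m f" if f: "f \<in> V" for f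
  using madd[OF f VD(4)[OF f]] m0 by simp
 have mpos: "m (\<lambda>i. of_real t * f i) = t * m f" if "f \<in> V" "t > 0" for f t
  by (rule sublinear_on_scale[OF m(1) that(2,1)])
 have msc: "m (\<lambda>i. of_real t * f i) = t * m f" if f: "f \<in> V" for f t
 proof -
  consider "t > 0" | "t = 0" | "- t > 0" by linarith
  then show ?thesis
  proof cases
   case 3
   have "(\<lambda>i. of_real t * f i) = (\<lambda>i. - (of_real (- t) * f i))" by auto
   then have "m (\<lambda>i. of_real t * f i) = m (\<lambda>i. - (of_real (- t) * f i))" by simp
   also have "\<dots> = - m (\<lambda>i. of_real (- t) * f i)" by (rule mneg[OF VD(3)[OF f]])
   also have "\<dots> = t * m f" using mpos[OF f 3] by simp
   finally show ?thesis .
  qed (use mpos[OF f] m0 in auto)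
 qed
 define l where "l = (\<lambda>f. Complex (m f) (- m (\<lambda>i. \<i> * f i)))"
 have ladd: "l (\<lambda>i. f i + g i) = l f + l g" if "f \<in> V" "g \<in> V" for f g
  using madd[OF that] madd[OF VD(3)[OF that(1), of \<i>] VD(3)[OF that(2), of \<i>]]
  by (simp add: l_def complex_eq_iff distrib_left)
 have lreal: "l (\<lambda>i. of_real t * f i) = of_real t * l f" if "f \<in> V" for f t
 proof -
  have "(\<lambda>i. \<i> * (of_real t * f i)) = (\<lambda>i. of_real t * (\<i> * f i))" by (auto simp: algebra_simps)
  then show ?thesis using msc[OF that, of t] msc[OF VD(3)[OF that, of \<i>], of t]
   by (simp add: l_def complex_eq_iff)
 qed
 have li: "l (\<lambda>i. \<i> * f i) = \<i> * l f" if f: "f \<in> V" for f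
 proof -
  have "(\<lambda>i. \<i> * (\<i> * f i)) = (\<lambda>i. - f i)" by (auto simp: algebra_simps)
  then show ?thesis using mneg[OF f] by (simp add: l_def complex_eq_iff)
 qed
 have lsc: "l (\<lambda>i. c * f i) = c * l f" if f: "f \<in> V" for f c
 proof -
  have "(\<lambda>i. c * f i) = (\<lambda>i. (\<lambda>i. of_real (Re c) * f i) i + (\<lambda>i. of_real (Im c) * (\<i> * f i)) i)"
   by (rule ext) (subst complex_eq[of c], simp add: algebra_simps)
  then have "l (\<lambda>i. c * f i) = l (\<lambda>i. (\<lambda>i. of_real (Re c) * f i) i + (\<lambda>i. of_real (Im c) * (\<i> * f i)) i)"
   by simp
  also have "\<dots> = of_real (Re c) * l f + of_real (Im c) * (\<i> * l f)"
   by (subst ladd) (auto simp: VD f lreal li)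
  also have "\<dots> = c * l f" by (subst (3) complex_eq[of c]) (simp add: algebra_simps)
  finally show ?thesis .
 qed
 have bound: "cmod (l f) \<le> p f" if f: "f \<in> V" for f
 proof (cases "l f = 0")
  case True
  have "p (\<lambda>i. 0) \<le> p f + p (\<lambda>i. - f i)" using padd[OF f VD(4)[OF f]] by simp
  then show ?thesis using True psc[OF f, of "-1"] psc[OF f, of 0] by simp
 next
  case False
  define c where "c = cnj (l f) / of_real (cmod (l f))"
  have c: "cmod c = 1" using False by (simp add: c_def norm_divide)
  have "c * l f = of_real (cmod (l f))"
   using False by (simp add: c_def complex_norm_square[symmetric] power2_eq_square mult.commute)
  then have "of_real (cmod (l f)) = l (\<lambda>i. c * f i)" using lsc[OF f] by simp
  then have "cmod (l f) = m (\<lambda>i. c * f i)" by (simp add: l_def complex_eq_iff)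
  also have "\<dots> \<le> p (\<lambda>i. c * f i)" using m(2) q(2) VD(3)[OF f] by (meson order_trans)
  also have "\<dots> = p f" using psc[OF f] c by simp
  finally show ?thesis .
 qed
 have "m (\<lambda>i. - z i) \<le> - p z"
  using m(2)[OF VD(4)[OF z]] q(3)[OF VD(4)[OF z]] psc[OF VD(1), of 0] by simp
 then have "p z \<le> Re (l z)" using mneg[OF z] by (simp add: l_def)
 moreover have "cmod (l z) \<le> p z" by (rule bound[OF z])
 ultimately have *: "Re (l z) = cmod (l z)" "cmod (l z) = p z"
  using complex_Re_le_cmod[of "l z"] by linarith+
 then have "(Im (l z))\<^sup>2 = 0" using cmod_power2[of "l z"] by simp
 then have "l z = of_real (p z)" using * by (simp add: complex_eq_iff)
 then show ?thesis using that[of l] ladd lsc bound by (auto simp: linear_on_space_def)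
qed

text \<open>Apply the previous theorem to the seminorm \<open>f \<mapsto> inf {p (f - w) | w \<in> W}\<close>.\<close>

theorem hahn_banach_distance:
 assumes V: "complex_subspace V" and p: "seminorm_on V p" and z: "z \<in> V"
  and W: "complex_subspace W" "W \<subseteq> V" and e: "e > 0" "\<And>w. w \<in> W ==> e \<le> p (\<lambda>i. z i - w i)"
 obtains l where "linear_on_space V l" "\<And>f. f \<in> V ==> cmod (l f) \<le> p f" "\<And>w. w \<in> W ==> l w = 0" "l z \<noteq> 0"
proof -
 note VD = complex_subspaceD[OF V] and WD = complex_subspaceD[OF W(1)]
 note padd = seminorm_on_add[OF p] and psc = seminorm_on_scale[OF p]
 have p0: "p f \<ge> 0" if f: "f \<in> V" for f
  using padd[OF f VD(4)[OF f]] psc[OF f, of "-1"] psc[OF f, of 0] by simp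
 have Vm: "(\<lambda>i. f i - w i) \<in> V" if "f \<in> V" "w \<in> W" for f w
  using VD(2)[OF that(1) VD(4)] W(2) that by auto
 define d where "d = (\<lambda>f. INF w\<in>W. p (\<lambda>i. f i - w i))"
 have Wne: "W \<noteq> {}" using WD(1) by auto
 have low: "d f \<le> p (\<lambda>i. f i - w i)" if "f \<in> V" "w \<in> W" for f w
  unfolding d_def by (rule cINF_lower[OF bdd_belowI2[of _ 0]]) (use that p0[OF Vm] in auto)
 have great: "c \<le> d f" if "\<And>w. w \<in> W ==> c \<le> p (\<lambda>i. f i - w i)" for c f
  unfolding d_def by (rule cINF_greatest[OF Wne]) (use that in auto)
 have dadd: "d (\<lambda>i. f i + g i) \<le> d f + d g" if f: "f \<in> V" and g: "g \<in> V" for f g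
 proof -
  have *: "d (\<lambda>i. f i + g i) \<le> p (\<lambda>i. f i - w i) + p (\<lambda>i. g i - v i)" if w: "w \<in> W" "v \<in> W" for w v
  proof -
   have "d (\<lambda>i. f i + g i) \<le> p (\<lambda>i. f i + g i - (w i + v i))"
    by (rule low[OF VD(2)[OF f g] WD(2)[OF w]])
   also have "(\<lambda>i. f i + g i - (w i + v i)) = (\<lambda>i. (\<lambda>i. f i - w i) i + (\<lambda>i. g i - v i) i)" by auto
   also have "p \<dots> \<le> p (\<lambda>i. f i - w i) + p (\<lambda>i. g i - v i)" by (intro padd Vm f g w)
   finally show ?thesis .
  qed
  have "d (\<lambda>i. f i + g i) - p (\<lambda>i. g i - v i) \<le> d f" if "v \<in> W" for v
   by (rule great) (use *[OF _ that] in \<open>simp add: algebra_simps\<close>)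
  then have "d (\<lambda>i. f i + g i) - d f \<le> d g" by (intro great) (simp add: algebra_simps)
  then show ?thesis by simp
 qed
 have dsc_le: "cmod c * d f \<le> d (\<lambda>i. c * f i)" if c: "c \<noteq> 0" and f: "f \<in> V" for c f
 proof (rule great)
  fix w assume w: "w \<in> W"
  have w': "(\<lambda>i. (1 / c) * w i) \<in> W" by (rule WD(3)[OF w])
  have "cmod c * d f \<le> cmod c * p (\<lambda>i. f i - (1 / c) * w i)" by (intro mult_left_mono low f w') auto
  also have "\<dots> = p (\<lambda>i. c * (\<lambda>i. f i - (1 / c) * w i) i)" by (rule psc[symmetric, OF Vm[OF f w']])
  also have "(\<lambda>i. c * (\<lambda>i. f i - (1 / c) * w i) i) = (\<lambda>i. c * f i - w i)" using c by (auto simp: field_simps)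
  finally show "cmod c * d f \<le> p (\<lambda>i. c * f i - w i)" .
 qed
 have d0: "d w = 0" if "w \<in> W" for w
 proof (rule antisym)
  show "d w \<le> 0" using low[of w w] W(2) that psc[OF VD(1), of 0] by auto
  show "0 \<le> d w" by (rule great) (use W(2) that p0 Vm in blast)
 qed
 have dsc: "d (\<lambda>i. c * f i) = cmod c * d f" if f: "f \<in> V" for c f
 proof (cases "c = 0")
  case True then show ?thesis using d0[OF WD(1)] by simp
 next
  case False
  have "cmod (1 / c) * d (\<lambda>i. c * f i) \<le> d (\<lambda>i. (1 / c) * (c * f i))"
   by (rule dsc_le[OF _ VD(3)[OF f]]) (use False in auto)
  also have "(\<lambda>i. (1 / c) * (c * f i)) = f" using False by auto
  finally show ?thesis using dsc_le[OF False f] False by (simp add: norm_divide field_simps)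
 qed
 have "seminorm_on V d" unfolding seminorm_on_def using dadd dsc by blast
 then obtain l where l: "linear_on_space V l" "\<And>f. f \<in> V ==> cmod (l f) \<le> d f" "l z = of_real (d z)"
  using hahn_banach_seminorm[OF V _ z] by blast
 have "d z \<ge> e" by (rule great) (rule e(2))
 then have "l z \<noteq> 0" using l(3) e(1) by auto
 moreover have "cmod (l f) \<le> p f" if "f \<in> V" for f
  using l(2)[OF that] low[OF that WD(1)] by simp
 moreover have "l w = 0" if "w \<in> W" for w using l(2)[of w] d0[OF that] W(2) that by auto
 ultimately show ?thesis using that[of l] l(1) by blast
qed

section \<open>Square integrable functions\<close>

abbreviation sq :: "'a measure => ('a => complex) set" where
 "sq \<equiv> square_integrable"

abbreviation ksq :: "'a measure => 'b measure => ('a \<times> 'b => complex) set" where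
 "ksq M N \<equiv> sq (M \<Otimes>\<^sub>M N)"

abbreviation kmeasurable :: "'a measure => 'b measure => ('a \<times> 'b => complex) set" where
 "kmeasurable M N \<equiv> borel_measurable (M \<Otimes>\<^sub>M N)"

abbreviation real_sq :: "'a measure => ('a => real) => bool" where
 "real_sq M s \<equiv> (\<lambda>x. complex_of_real (s x)) \<in> sq M"

definition l2norm :: "'a measure => ('a => complex) => real" where
 "l2norm M f = sqrt (LINT x|M. (cmod (f x))\<^sup>2)"

lemma sqD:
 assumes "f \<in> sq M"
 shows "f \<in> borel_measurable M" "integrable M (\<lambda>x. (cmod (f x))\<^sup>2)"
 using assms by (auto simp: square_integrable_def)

lemma sqI: "f \<in> borel_measurable M ==> integrable M (\<lambda>x. (cmod (f x))\<^sup>2) ==> f \<in> sq M"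
 by (auto simp: square_integrable_def)

lemma l2norm_nonneg [simp]: "l2norm M f \<ge> 0"
 by (simp add: l2norm_def)

lemma l2norm_square: "(l2norm M f)\<^sup>2 = (LINT x|M. (cmod (f x))\<^sup>2)"
 by (simp add: l2norm_def)

lemma l2norm_cong_AE:
 assumes "AE x in M. f x = g x" "f \<in> borel_measurable M" "g \<in> borel_measurable M"
 shows "l2norm M f = l2norm M g"
 unfolding l2norm_def using assms by (intro arg_cong[where f=sqrt] integral_cong_AE) auto

lemma l2norm_cong: "(\<And>x. x \<in> space M ==> cmod (f x) = cmod (g x)) ==> l2norm M f = l2norm M g"
 unfolding l2norm_def by (intro arg_cong[where f=sqrt] Bochner_Integration.integral_cong) auto

lemma sq_dominated:
 assumes g: "g \<in> sq M" and f: "f \<in> borel_measurable M" and le: "AE x in M. cmod (f x) \<le> c * cmod (g x)"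
 shows "f \<in> sq M" "c \<ge> 0 ==> l2norm M f \<le> c * l2norm M g"
proof -
 have le2: "AE x in M. (cmod (f x))\<^sup>2 \<le> c\<^sup>2 * (cmod (g x))\<^sup>2"
  using le by eventually_elim (metis norm_ge_zero power_mono power_mult_distrib)
 have i: "integrable M (\<lambda>x. c\<^sup>2 * (cmod (g x))\<^sup>2)" using sqD(2)[OF g] by simp
 have f2: "integrable M (\<lambda>x. (cmod (f x))\<^sup>2)"
  by (rule Bochner_Integration.integrable_bound[OF i]) (use f le2 in auto)
 show "f \<in> sq M" by (rule sqI[OF f f2])
 assume c: "c \<ge> 0"
 have "(l2norm M f)\<^sup>2 \<le> (LINT x|M. c\<^sup>2 * (cmod (g x))\<^sup>2)"
  unfolding l2norm_square by (rule integral_mono_AE[OF f2 i le2])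
 also have "\<dots> = (c * l2norm M g)\<^sup>2" by (simp add: power_mult_distrib l2norm_square)
 finally show "l2norm M f \<le> c * l2norm M g" by (rule power2_le_imp_le) (use c in simp)
qed

lemma sq_cong_AE: "f \<in> sq M ==> g \<in> borel_measurable M ==> AE x in M. g x = f x ==> g \<in> sq M"
 by (rule sq_dominated(1)[of f _ _ 1]) auto

lemma sq_scale [simp, intro]: "f \<in> sq M ==> (\<lambda>x. c * f x) \<in> sq M"
 by (rule sq_dominated(1)[of f _ _ "cmod c"]) (auto simp: norm_mult dest: sqD)

lemma sq_minus [simp, intro]: "f \<in> sq M ==> (\<lambda>x. - f x) \<in> sq M"
 using sq_scale[of f M "-1"] by simp

lemma sq_cnj [simp, intro]: "f \<in> sq M ==> (\<lambda>x. cnj (f x)) \<in> sq M"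
 by (rule sq_dominated(1)[of f _ _ "1"])
   (auto dest: sqD intro!: borel_measurable_continuous_on[of cnj] continuous_intros)

lemma sq_zero [simp, intro]: "(\<lambda>x. 0) \<in> sq M"
 by (auto simp: square_integrable_def)

lemma sq_add [simp, intro]:
 assumes "f \<in> sq M" "g \<in> sq M"
 shows "(\<lambda>x. f x + g x) \<in> sq M"
proof (rule sqI)
 have i: "integrable M (\<lambda>x. 2 * ((cmod (f x))\<^sup>2 + (cmod (g x))\<^sup>2))"
  using sqD(2)[OF assms(1)] sqD(2)[OF assms(2)] by simp
 show "(\<lambda>x. f x + g x) \<in> borel_measurable M"
  by (intro borel_measurable_add sqD(1) assms)
 show "integrable M (\<lambda>x. (cmod (f x + g x))\<^sup>2)"
 proof (rule Bochner_Integration.integrable_bound[OF i])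
  show "(\<lambda>x. (cmod (f x + g x))\<^sup>2) \<in> borel_measurable M"
   using assms by (auto dest!: sqD(1))
  show "AE x in M. norm ((cmod (f x + g x))\<^sup>2) \<le> norm (2 * ((cmod (f x))\<^sup>2 + (cmod (g x))\<^sup>2))"
  proof (rule AE_I2)
   fix x
   have "(cmod (f x + g x))\<^sup>2 \<le> (cmod (f x) + cmod (g x))\<^sup>2"
    by (intro power_mono norm_triangle_ineq) auto
   also have "\<dots> \<le> 2 * ((cmod (f x))\<^sup>2 + (cmod (g x))\<^sup>2)"
    using sum_squares_bound[of "cmod (f x)" "cmod (g x)"] by (simp add: power2_sum)
   finally show "norm ((cmod (f x + g x))\<^sup>2) \<le> norm (2 * ((cmod (f x))\<^sup>2 + (cmod (g x))\<^sup>2))" by simp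
  qed
 qed
qed

lemma sq_diff [simp, intro]: "f \<in> sq M ==> g \<in> sq M ==> (\<lambda>x. f x - g x) \<in> sq M"
 using sq_add[of f M "\<lambda>x. - g x"] sq_minus[of g M] by simp

lemma sq_sum [intro]: "(\<And>i. i \<in> I ==> f i \<in> sq M) ==> (\<lambda>x. \<Sum>i\<in>I. f i x) \<in> sq M"
 by (induction I rule: infinite_finite_induct) auto

lemma sq_indicator:
 assumes "A \<in> sets M" "emeasure M A < \<infinity>"
 shows "(\<lambda>x. indicator A x) \<in> sq M" "l2norm M (\<lambda>x. indicator A x) = sqrt (measure M A)"
proof -
 have e: "(\<lambda>x. (cmod (indicator A x))\<^sup>2) = (\<lambda>x. indicator A x :: real)" by (auto simp: indicator_def)
 show "(\<lambda>x. indicator A x) \<in> sq M"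
  by (rule sqI) (use assms in \<open>auto simp: e\<close>)
 show "l2norm M (\<lambda>x. indicator A x) = sqrt (measure M A)"
  using assms unfolding l2norm_def e by simp
qed

lemma sq_restrict:
 assumes "f \<in> sq M" "A \<in> sets M"
 shows "(\<lambda>x. indicator A x * f x) \<in> sq M" "l2norm M (\<lambda>x. indicator A x * f x) \<le> l2norm M f"
 using sq_dominated[OF assms(1), of "\<lambda>x. indicator A x * f x" 1] assms
 by (auto simp: indicator_def dest: sqD)

lemma l2norm_zero_iff:
 assumes "f \<in> sq M"
 shows "l2norm M f = 0 \<longleftrightarrow> (AE x in M. f x = 0)"
 using integral_nonneg_eq_0_iff_AE[OF sqD(2)[OF assms]] by (simp add: l2norm_def)

lemma sq_cauchy_schwarz:
 assumes f: "f \<in> sq M" and g: "g \<in> sq M"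
 shows "integrable M (\<lambda>x. f x * g x)"
  and "(LINT x|M. cmod (f x) * cmod (g x)) \<le> l2norm M f * l2norm M g"
  and "cmod (LINT x|M. f x * g x) \<le> l2norm M f * l2norm M g"
proof -
 note [measurable] = sqD(1)[OF f] sqD(1)[OF g]
 note [simp] = sqD(2)[OF f] sqD(2)[OF g]
 have 1: "integrable M (\<lambda>x. cmod (f x) * cmod (g x))"
 proof (rule Bochner_Integration.integrable_bound[where f="\<lambda>x. (cmod (f x))\<^sup>2 + (cmod (g x))\<^sup>2"])
  have "a * b \<le> a\<^sup>2 + b\<^sup>2" if "a \<ge> 0" "b \<ge> 0" for a b :: real
   using sum_squares_bound[of a b] mult_nonneg_nonneg[OF that] by linarith
  then show "AE x in M. norm (cmod (f x) * cmod (g x)) \<le> norm ((cmod (f x))\<^sup>2 + (cmod (g x))\<^sup>2)"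
   by (intro AE_I2) (simp add: norm_mult)
 qed (auto simp: intro!: sqD)
 show i: "integrable M (\<lambda>x. f x * g x)"
  by (rule Bochner_Integration.integrable_bound[OF 1]) (auto simp: norm_mult)
 show 2: "(LINT x|M. cmod (f x) * cmod (g x)) \<le> l2norm M f * l2norm M g"
 proof (cases "l2norm M f = 0 \<or> l2norm M g = 0")
  case True
  then have "(AE x in M. f x = 0) \<or> (AE x in M. g x = 0)"
   using l2norm_zero_iff f g by blast
  then have "AE x in M. cmod (f x) * cmod (g x) = 0" by (auto elim: eventually_mono)
  then have "(LINT x|M. cmod (f x) * cmod (g x)) = 0"
   by (subst integral_cong_AE[of _ _ "\<lambda>_. 0"]) auto
  then show ?thesis by simp
 next
  case False
  define a b where "a = l2norm M f" and "b = l2norm M g"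
  have pos: "a > 0" "b > 0" using False by (auto simp: a_def b_def less_le)
  have le: "s * t \<le> (a * b / 2) * (s\<^sup>2 / a\<^sup>2 + t\<^sup>2 / b\<^sup>2)" for s t
  proof -
   have "2 * (s / a) * (t / b) \<le> (s / a)\<^sup>2 + (t / b)\<^sup>2" using sum_squares_bound[of "s / a" "t / b"] .
   then have "(a * b / 2) * (2 * (s / a) * (t / b)) \<le> (a * b / 2) * ((s / a)\<^sup>2 + (t / b)\<^sup>2)"
    using pos by (intro mult_left_mono) auto
   then show ?thesis using pos by (simp add: power_divide)
  qed
  have "(LINT x|M. cmod (f x) * cmod (g x))
    \<le> (LINT x|M. (a * b / 2) * ((cmod (f x))\<^sup>2 / a\<^sup>2 + (cmod (g x))\<^sup>2 / b\<^sup>2))"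
   by (rule integral_mono[OF 1 _ le]) auto
  also have "\<dots> = (a * b / 2) * (a\<^sup>2 / a\<^sup>2 + b\<^sup>2 / b\<^sup>2)"
   by (simp add: l2norm_square[symmetric] a_def b_def)
  also have "\<dots> = a * b" using pos by simp
  finally show ?thesis by (simp add: a_def b_def)
 qed
 have "cmod (LINT x|M. f x * g x) \<le> (LINT x|M. cmod (f x * g x))" by (rule integral_norm_bound)
 then show "cmod (LINT x|M. f x * g x) \<le> l2norm M f * l2norm M g" using 2 by (simp add: norm_mult)
qed

lemma l2norm_scale [simp]: "l2norm M (\<lambda>x. c * f x) = cmod c * l2norm M f"
 by (simp add: l2norm_def norm_mult power_mult_distrib real_sqrt_mult)

lemma l2norm_minus [simp]: "l2norm M (\<lambda>x. - f x) = l2norm M f"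
 by (simp add: l2norm_def)

lemma l2norm_minus_commute: "l2norm M (\<lambda>x. f x - g x) = l2norm M (\<lambda>x. g x - f x)"
 by (simp add: l2norm_def norm_minus_commute)

lemma l2norm_zero [simp]: "l2norm M (\<lambda>x. 0) = 0"
 by (simp add: l2norm_def)

lemma l2norm_cnj [simp]: "l2norm M (\<lambda>x. cnj (f x)) = l2norm M f"
 by (simp add: l2norm_def)

lemma l2norm_triangle:
 assumes f: "f \<in> sq M" and g: "g \<in> sq M"
 shows "l2norm M (\<lambda>x. f x + g x) \<le> l2norm M f + l2norm M g"
proof (rule power2_le_imp_le)
 note [simp] = sqD(2)[OF f] sqD(2)[OF g] sqD(2)[OF sq_add[OF f g]]
 have [simp]: "integrable M (\<lambda>x. cmod (f x) * cmod (g x))"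
  using integrable_norm[OF sq_cauchy_schwarz(1)[OF f g]] by (simp add: norm_mult)
 have "(l2norm M (\<lambda>x. f x + g x))\<^sup>2 \<le> (LINT x|M. (cmod (f x))\<^sup>2 + (cmod (g x))\<^sup>2 + 2 * (cmod (f x) * cmod (g x)))"
  unfolding l2norm_square
 proof (rule integral_mono)
  fix x
  have "(cmod (f x + g x))\<^sup>2 \<le> (cmod (f x) + cmod (g x))\<^sup>2"
   by (intro power_mono norm_triangle_ineq) auto
  then show "(cmod (f x + g x))\<^sup>2 \<le> (cmod (f x))\<^sup>2 + (cmod (g x))\<^sup>2 + 2 * (cmod (f x) * cmod (g x))"
   by (simp add: power2_sum)
 qed auto
 also have "\<dots> \<le> (l2norm M f)\<^sup>2 + (l2norm M g)\<^sup>2 + 2 * (l2norm M f * l2norm M g)"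
  using sq_cauchy_schwarz(2)[OF f g] by (simp add: l2norm_square)
 also have "\<dots> = (l2norm M f + l2norm M g)\<^sup>2" by (simp add: power2_sum)
 finally show "(l2norm M (\<lambda>x. f x + g x))\<^sup>2 \<le> (l2norm M f + l2norm M g)\<^sup>2" .
qed simp

lemma l2norm_triangle_diff:
 assumes f: "f \<in> sq M" and g: "g \<in> sq M" and h: "h \<in> sq M"
 shows "l2norm M (\<lambda>x. f x - h x) \<le> l2norm M (\<lambda>x. f x - g x) + l2norm M (\<lambda>x. g x - h x)"
 using l2norm_triangle[OF sq_diff[OF f g] sq_diff[OF g h]] by simp

text \<open>The test function is the conjugate of \<open>f\<close>.\<close>

lemma l2norm_le_by_duality:
 assumes f: "f \<in> sq M" and C: "\<And>g. g \<in> sq M ==> cmod (LINT x|M. f x * g x) \<le> C * l2norm M g"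
  and "C \<ge> 0"
 shows "l2norm M f \<le> C"
proof (cases "l2norm M f = 0")
 case True
 then show ?thesis using \<open>C \<ge> 0\<close> by simp
next
 case False
 have "(LINT x|M. f x * cnj (f x)) = of_real ((l2norm M f)\<^sup>2)"
  unfolding l2norm_square integral_complex_of_real[symmetric] by (simp add: complex_norm_square[symmetric])
 then have "(l2norm M f)\<^sup>2 \<le> C * l2norm M f"
  using C[OF sq_cnj[OF f]] by (simp add: norm_power)
 then show ?thesis using False by (simp add: power2_eq_square less_le)
qed

inductive_set lin_span :: "('a => complex) set => ('a => complex) set" for G where
 zero: "(\<lambda>x. 0) \<in> lin_span G"
| add: "s \<in> lin_span G ==> g \<in> G ==> (\<lambda>x. s x + c * g x) \<in> lin_span G"

lemma lin_span_plus:
 assumes "s \<in> lin_span G" "t \<in> lin_span G"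
 shows "(\<lambda>x. s x + t x) \<in> lin_span G"
 using assms(2)
proof induction
 case zero then show ?case using assms(1) by simp
next
 case (add t g c)
 then show ?case using lin_span.add[OF add.IH add.hyps(2), of c] by (simp add: add.assoc)
qed

lemma lin_span_scale:
 assumes "s \<in> lin_span G"
 shows "(\<lambda>x. d * s x) \<in> lin_span G"
 using assms
proof induction
 case zero then show ?case using lin_span.zero by simp
next
 case (add t g c)
 then show ?case using lin_span.add[OF add.IH add.hyps(2), of "d * c"] by (simp add: algebra_simps)
qed

lemma lin_span_sum:
 assumes "finite I" "\<And>i. i \<in> I ==> g i \<in> G"
 shows "(\<lambda>x. \<Sum>i\<in>I. c i * g i x) \<in> lin_span G"
 using assms
proof (induction I)
 case empty then show ?case using lin_span.zero by simp
next
 case (insert i I)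
 then show ?case using lin_span.add[of "\<lambda>x. \<Sum>i\<in>I. c i * g i x" G "g i" "c i"] by (simp add: add.commute)
qed

lemma lin_span_gen: "g \<in> G ==> g \<in> lin_span G"
 using lin_span.add[OF lin_span.zero, of g G 1] by simp

lemma lin_span_sq: "G \<subseteq> sq M ==> s \<in> lin_span G ==> s \<in> sq M"
proof -
 assume G: "G \<subseteq> sq M" and s: "s \<in> lin_span G"
 from s show "s \<in> sq M" by induction (use G in auto)
qed

definition l2closure :: "'a measure => ('a => complex) set => ('a => complex) set" where
 "l2closure M G = {f \<in> sq M. \<forall>e>0. \<exists>s\<in>lin_span G. l2norm M (\<lambda>x. f x - s x) < e}"

lemma l2closure_limit:
 assumes G: "G \<subseteq> sq M" and f: "f \<in> sq M" and h: "\<And>e. e > 0 ==> \<exists>h\<in>l2closure M G. l2norm M (\<lambda>x. f x - h x) < e"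
 shows "f \<in> l2closure M G"
 unfolding l2closure_def
proof (intro CollectI conjI f allI impI)
 fix e :: real assume e: "e > 0"
 obtain h where h: "h \<in> l2closure M G" "l2norm M (\<lambda>x. f x - h x) < e / 2" using h[of "e / 2"] e by auto
 obtain s where s: "s \<in> lin_span G" "l2norm M (\<lambda>x. h x - s x) < e / 2"
  using h(1) e unfolding l2closure_def by (auto dest: spec[of _ "e / 2"])
 have "l2norm M (\<lambda>x. f x - s x) < e"
  using l2norm_triangle_diff[OF f, of h s] h s lin_span_sq[OF G s(1)] by (simp add: l2closure_def)
 then show "\<exists>s\<in>lin_span G. l2norm M (\<lambda>x. f x - s x) < e" using s(1) by blast
qed

lemma l2closure_span: "G \<subseteq> sq M ==> s \<in> lin_span G ==> s \<in> l2closure M G"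
 unfolding l2closure_def using lin_span_sq[of G M s] by (auto intro!: bexI[of _ s])

lemma l2closure_add_scale:
 assumes G: "G \<subseteq> sq M" and f: "f \<in> l2closure M G" and g: "g \<in> l2closure M G"
 shows "(\<lambda>x. f x + c * g x) \<in> l2closure M G"
 unfolding l2closure_def
proof (intro CollectI conjI allI impI)
 have fs: "f \<in> sq M" and gs: "g \<in> sq M" using f g by (auto simp: l2closure_def)
 then show "(\<lambda>x. f x + c * g x) \<in> sq M" by auto
 fix e :: real assume e: "e > 0"
 define d where "d = e / (2 * (cmod c + 1))"
 have c1: "cmod c + 1 > 0" by (simp add: add_nonneg_pos)
 have d: "d > 0" unfolding d_def using e c1 by (intro divide_pos_pos mult_pos_pos) auto
 have cd: "cmod c * d \<le> e / 2"
 proof -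
  have "cmod c * d \<le> (cmod c + 1) * d" using d by (intro mult_right_mono) auto
  also have "\<dots> = e / 2" using c1 by (simp add: d_def field_simps)
  finally show ?thesis .
 qed
 obtain s where s: "s \<in> lin_span G" "l2norm M (\<lambda>x. f x - s x) < e / 2"
  using f e unfolding l2closure_def by (auto dest: spec[of _ "e / 2"])
 obtain t where t: "t \<in> lin_span G" "l2norm M (\<lambda>x. g x - t x) < d"
  using g d unfolding l2closure_def by auto
 note sq' = lin_span_sq[OF G s(1)] lin_span_sq[OF G t(1)]
 have "l2norm M (\<lambda>x. (f x + c * g x) - (s x + c * t x)) = l2norm M (\<lambda>x. (f x - s x) + c * (g x - t x))"
  by (simp add: algebra_simps)
 also have "\<dots> \<le> l2norm M (\<lambda>x. f x - s x) + cmod c * l2norm M (\<lambda>x. g x - t x)"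
  using l2norm_triangle[OF sq_diff[OF fs sq'(1)] sq_scale[OF sq_diff[OF gs sq'(2)], of c]] by simp
 also have "cmod c * l2norm M (\<lambda>x. g x - t x) \<le> cmod c * d" using t by (intro mult_left_mono) auto
 finally have "l2norm M (\<lambda>x. (f x + c * g x) - (s x + c * t x)) < e" using s(2) cd by linarith
 then show "\<exists>s\<in>lin_span G. l2norm M (\<lambda>x. f x + c * g x - s x) < e"
  by (rule bexI[OF _ lin_span_plus[OF s(1) lin_span_scale[OF t(1), of c]]])
qed

lemma l2_dominated_convergence:
 assumes g: "g \<in> sq M" and f: "f \<in> borel_measurable M" and s: "\<And>i. s i \<in> borel_measurable M"
  and lim: "AE x in M. (\<lambda>i. s i x) \<longlonglongrightarrow> f x" and le: "\<And>i. AE x in M. cmod (s i x) \<le> c * cmod (g x)"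
 shows "f \<in> sq M" "\<And>i. s i \<in> sq M" "(\<lambda>i. l2norm M (\<lambda>x. f x - s i x)) \<longlonglongrightarrow> 0"
proof -
 have le': "AE x in M. \<forall>i. cmod (s i x) \<le> c * cmod (g x)" using le by (simp add: AE_all_countable)
 have fle: "AE x in M. cmod (f x) \<le> c * cmod (g x)"
  using lim le' by eventually_elim (rule LIMSEQ_le_const2[OF tendsto_norm], auto)
 show "f \<in> sq M" by (rule sq_dominated(1)[OF g f fle])
 show "\<And>i. s i \<in> sq M" by (rule sq_dominated(1)[OF g s le])
 have "(\<lambda>i. LINT x|M. (cmod (f x - s i x))\<^sup>2) \<longlonglongrightarrow> (LINT x|M. 0)"
 proof (rule integral_dominated_convergence)
  show "integrable M (\<lambda>x. (2 * c)\<^sup>2 * (cmod (g x))\<^sup>2)" using sqD(2)[OF g] by simp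
  show "AE x in M. (\<lambda>i. (cmod (f x - s i x))\<^sup>2) \<longlonglongrightarrow> 0"
   using lim
  proof eventually_elim
   case (elim x)
   have "(\<lambda>i. (cmod (f x - s i x))\<^sup>2) \<longlonglongrightarrow> (cmod (f x - f x))\<^sup>2"
    by (intro tendsto_intros elim)
   then show ?case by simp
  qed
  show "AE x in M. norm ((cmod (f x - s i x))\<^sup>2) \<le> (2 * c)\<^sup>2 * (cmod (g x))\<^sup>2" for i
   using fle le[of i]
  proof eventually_elim
   case (elim x)
   have "cmod (f x - s i x) \<le> 2 * c * cmod (g x)"
    using norm_triangle_ineq4[of "f x" "s i x"] elim by linarith
   then show ?case by (metis norm_ge_zero power_mono power_mult_distrib real_norm_def abs_of_nonneg zero_le_power2)
  qed
 qed (use f s in auto)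
 then have "(\<lambda>i. sqrt (LINT x|M. (cmod (f x - s i x))\<^sup>2)) \<longlonglongrightarrow> sqrt 0"
  by (intro tendsto_real_sqrt) simp
 then show "(\<lambda>i. l2norm M (\<lambda>x. f x - s i x)) \<longlonglongrightarrow> 0" by (simp add: l2norm_def)
qed

definition finite_indicators :: "'a measure => ('a => complex) set" where
 "finite_indicators M = {indicator A | A. A \<in> sets M \<and> emeasure M A < \<infinity>}"

lemma finite_indicators_sq: "finite_indicators M \<subseteq> sq M"
 by (auto simp: finite_indicators_def intro: sq_indicator)

lemma simple_functions_l2dense:
 assumes f: "f \<in> sq M"
 shows "f \<in> l2closure M (finite_indicators M)"
proof -
 obtain s where s: "\<And>i. simple_function M (s i)" "\<And>x. x \<in> space M ==> (\<lambda>i. s i x) \<longlonglongrightarrow> f x"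
  "\<And>i x. x \<in> space M ==> cmod (s i x) \<le> 2 * cmod (f x)"
  using borel_measurable_implies_sequence_metric[OF sqD(1)[OF f], of 0] unfolding dist_0_norm diff_0_right dist_norm by metis
 have sm: "s i \<in> sq M" for i
  by (rule sq_dominated(1)[OF f borel_measurable_simple_function[OF s(1)], where c=2]) (use s(3) in auto)
 have sl: "(\<lambda>i. l2norm M (\<lambda>x. f x - s i x)) \<longlonglongrightarrow> 0"
  by (rule l2_dominated_convergence(3)[OF f sqD(1)[OF f], where c=2])
    (use s sqD(1)[OF sm] in auto)
 have span: "\<exists>t\<in>lin_span (finite_indicators M). \<forall>x\<in>space M. t x = s i x" for i
 proof -
  let ?Y = "s i ` space M - {0}"
  have fin: "finite ?Y" using simple_functionD(1)[OF s(1)] by auto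
  have gen: "indicator (s i -` {y} \<inter> space M) \<in> finite_indicators M" if y: "y \<in> ?Y" for y
  proof -
   have A: "s i -` {y} \<inter> space M \<in> sets M" using simple_functionD(2)[OF s(1)] .
   have "(\<lambda>x. (1 / (cmod y)\<^sup>2) * (cmod (s i x))\<^sup>2) \<in> borel_measurable M"
    using sqD(1)[OF sm] by simp
   have "integrable M (\<lambda>x. indicator (s i -` {y} \<inter> space M) x :: real)"
   proof (rule Bochner_Integration.integrable_bound)
    show "integrable M (\<lambda>x. (1 / (cmod y)\<^sup>2) * (cmod (s i x))\<^sup>2)" using sqD(2)[OF sm] by simp
    show "AE x in M. norm (indicator (s i -` {y} \<inter> space M) x :: real) \<le> norm (1 / (cmod y)\<^sup>2 * (cmod (s i x))\<^sup>2)"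
     using y by (intro AE_I2) (auto simp: indicator_def)
   qed (use A in auto)
   then have "emeasure M (s i -` {y} \<inter> space M \<inter> space M) < \<infinity>"
    using integrable_indicator_iff[of M "s i -` {y} \<inter> space M"] by auto
   then have "emeasure M (s i -` {y} \<inter> space M) < \<infinity>" by (simp add: Int_assoc)
   then show ?thesis unfolding finite_indicators_def using A by blast
  qed
  have eq: "(\<Sum>y\<in>?Y. y * indicator (s i -` {y} \<inter> space M) x) = s i x" if x: "x \<in> space M" for x
  proof -
   have "(\<Sum>y\<in>?Y. y * indicator (s i -` {y} \<inter> space M) x) = (\<Sum>y\<in>?Y. if y = s i x then y else 0)"
    by (intro sum.cong) (auto simp: indicator_def x)
   also have "\<dots> = s i x" using fin x by (subst sum.delta) auto
   finally show ?thesis .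
  qed
  show ?thesis
   by (rule bexI[OF _ lin_span_sum[OF fin gen, of "\<lambda>y. y"]]) (use eq in auto)
 qed
 show ?thesis unfolding l2closure_def
 proof (intro CollectI conjI f allI impI)
  fix e :: real assume "e > 0"
  then obtain i where i: "l2norm M (\<lambda>x. f x - s i x) < e"
   using order_tendstoD(2)[OF sl, of e] by (auto dest: eventually_happens)
  obtain t where t: "t \<in> lin_span (finite_indicators M)" "\<forall>x\<in>space M. t x = s i x" using span by blast
  have "l2norm M (\<lambda>x. f x - t x) = l2norm M (\<lambda>x. f x - s i x)" by (rule l2norm_cong) (use t in auto)
  then have "l2norm M (\<lambda>x. f x - t x) < e" using i by simp
  then show "\<exists>s\<in>lin_span (finite_indicators M). l2norm M (\<lambda>x. f x - s x) < e"
   by (rule bexI[OF _ t(1)])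
 qed
qed

section \<open>Density of rectangles\<close>

definition finite_rectangles :: "'a measure => 'b measure => ('a \<times> 'b => complex) set" where
 "finite_rectangles M N = {\<lambda>z. indicator A (fst z) * indicator B (snd z) | A B.
   A \<in> sets M \<and> B \<in> sets N \<and> emeasure M A < \<infinity> \<and> emeasure N B < \<infinity>}"

lemma l2closure_mono:
 assumes G: "G \<subseteq> sq M" and H: "H \<subseteq> l2closure M G"
 shows "l2closure M H \<subseteq> l2closure M G"
proof
 fix f assume f: "f \<in> l2closure M H"
 have zero: "(\<lambda>x. 0) \<in> l2closure M G" by (rule l2closure_span[OF G lin_span.zero])
 have span: "s \<in> l2closure M G" if "s \<in> lin_span H" for s
  using that
 proof induction
  case zero then show ?case using l2closure_span[OF G lin_span.zero] .
 next
  case (add s g c)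
  then show ?case using l2closure_add_scale[OF G add.IH] H by blast
 qed
 show "f \<in> l2closure M G"
 proof (rule l2closure_limit[OF G])
  show "f \<in> sq M" using f by (simp add: l2closure_def)
  fix e :: real assume "e > 0"
  then have "\<exists>s\<in>lin_span H. l2norm M (\<lambda>x. f x - s x) < e" using f by (simp add: l2closure_def)
  then obtain s where s: "s \<in> lin_span H" "l2norm M (\<lambda>x. f x - s x) < e" by (elim bexE)
  show "\<exists>h\<in>l2closure M G. l2norm M (\<lambda>x. f x - h x) < e" by (rule bexI, rule s(2), rule span[OF s(1)])
 qed
qed

lemma l2closure_limit_seq:
 assumes G: "G \<subseteq> sq M" and f: "f \<in> sq M" and s: "\<And>i. s i \<in> l2closure M G"
  and lim: "(\<lambda>i. l2norm M (\<lambda>x. f x - s i x)) \<longlonglongrightarrow> 0"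
 shows "f \<in> l2closure M G"
proof (rule l2closure_limit[OF G f])
 fix e :: real assume "e > 0"
 then obtain i where "l2norm M (\<lambda>x. f x - s i x) < e"
  using order_tendstoD(2)[OF lim, of e] by (auto dest: eventually_happens)
 then show "\<exists>h\<in>l2closure M G. l2norm M (\<lambda>x. f x - h x) < e" by (rule bexI[OF _ s])
qed

lemma finite_rectangle_indicator:
 "(\<lambda>z. indicator A (fst z) * indicator B (snd z)) = (indicator (A \<times> B) :: _ => complex)"
 by (auto simp: indicator_def fun_eq_iff)

lemma finite_rectangles_sq:
 assumes "sigma_finite_measure N"
 shows "finite_rectangles M N \<subseteq> ksq M N"
proof
 fix f assume "f \<in> finite_rectangles M N"
 then obtain A B where AB: "f = indicator (A \<times> B)" "A \<in> sets M" "B \<in> sets N" "emeasure M A < \<infinity>" "emeasure N B < \<infinity>"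
  unfolding finite_rectangles_def finite_rectangle_indicator by blast
 have "emeasure (M \<Otimes>\<^sub>M N) (A \<times> B) < \<infinity>"
  using AB by (simp add: sigma_finite_measure.emeasure_pair_measure_Times[OF assms] ennreal_mult_less_top)
 then show "f \<in> ksq M N" unfolding AB(1) using AB(2,3) by (intro sq_indicator(1)) auto
qed

text \<open>Induction over the product sigma algebra, inside a box of finite measure so that complements and countable unions stay square integrable.\<close>

lemma rectangles_approximate_in_box:
 assumes N: "sigma_finite_measure N"
  and A: "A \<in> sets M" "emeasure M A < \<infinity>" and B: "B \<in> sets N" "emeasure N B < \<infinity>"
  and S: "S \<in> sets (M \<Otimes>\<^sub>M N)"
 shows "indicator (S \<inter> A \<times> B) \<in> l2closure (M \<Otimes>\<^sub>M N) (finite_rectangles M N)"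
proof -
 let ?P = "M \<Otimes>\<^sub>M N" and ?G = "finite_rectangles M N"
 note G = finite_rectangles_sq[OF N, of M]
 have box: "indicator (C \<times> D) \<in> l2closure ?P ?G"
  if "C \<in> sets M" "D \<in> sets N" "emeasure M C < \<infinity>" "emeasure N D < \<infinity>" for C D
  by (rule l2closure_span[OF G lin_span_gen])
    (unfold finite_rectangles_def finite_rectangle_indicator mem_Collect_eq, intro exI conjI, rule refl, (rule that)+)
 have boxm: "A \<times> B \<in> sets ?P" using A B by simp
 have AB: "(indicator (A \<times> B) :: _ => complex) \<in> sq ?P" using box[OF A(1) B(1) A(2) B(2)] by (simp add: l2closure_def)
 from S have "S \<in> sigma_sets (space M \<times> space N) {a \<times> b | a b. a \<in> sets M \<and> b \<in> sets N}"
  by (simp add: sets_pair_measure)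
 with Int_stable_pair_measure_generator[of M N] pair_measure_closed[of M N] show ?thesis
 proof (induction rule: sigma_sets_induct_disjoint)
  case (basic S)
  then obtain a b where S: "S = a \<times> b" "a \<in> sets M" "b \<in> sets N" unfolding mem_Collect_eq by (elim exE conjE)
  have eq: "S \<inter> A \<times> B = (a \<inter> A) \<times> (b \<inter> B)" unfolding S(1) by (rule Times_Int_Times)
  show ?case unfolding eq
  proof (rule box)
   show "a \<inter> A \<in> sets M" by (rule sets.Int[OF S(2) A(1)])
   show "b \<inter> B \<in> sets N" by (rule sets.Int[OF S(3) B(1)])
   show "emeasure M (a \<inter> A) < \<infinity>" by (rule le_less_trans[OF emeasure_mono[OF Int_lower2 A(1)] A(2)])
   show "emeasure N (b \<inter> B) < \<infinity>" by (rule le_less_trans[OF emeasure_mono[OF Int_lower2 B(1)] B(2)])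
  qed
 next
  case empty
  have "(\<lambda>x. 0) \<in> l2closure ?P ?G" by (rule l2closure_span[OF G lin_span.zero])
  moreover have "indicator ({} \<inter> A \<times> B) = (\<lambda>x. 0 :: complex)" by (rule ext) simp
  ultimately show ?case by (simp only:)
 next
  case (compl S)
  have "A \<times> B \<subseteq> space M \<times> space N"
   by (rule Sigma_mono[OF sets.sets_into_space[OF A(1)] sets.sets_into_space[OF B(1)]])
  then have eq: "indicator ((space M \<times> space N - S) \<inter> A \<times> B)
    = (\<lambda>z. indicator (A \<times> B) z + (- 1) * indicator (S \<inter> A \<times> B) z :: complex)"
   by (intro ext) (auto simp: indicator_def)
  show ?case unfolding eq by (rule l2closure_add_scale[OF G box[OF A(1) B(1) A(2) B(2)] compl.IH])
 next
  case (union S)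
  have Sm: "S i \<in> sets ?P" for i
   unfolding sets_pair_measure by (rule subsetD[OF union.hyps(2) rangeI])
  define s where "s n z = (\<Sum>i<n. indicator (S i \<inter> A \<times> B) z :: complex)" for n z
  have scl: "s n \<in> l2closure ?P ?G" for n
  proof (induction n)
   case 0
   have "s 0 = (\<lambda>x. 0)" by (rule ext) (simp add: s_def)
   then show ?case using l2closure_span[OF G lin_span.zero] by (simp only:)
  next
   case (Suc n)
   have eq: "s (Suc n) = (\<lambda>z. s n z + 1 * indicator (S n \<inter> A \<times> B) z)"
    by (rule ext) (simp add: s_def)
   show ?case unfolding eq by (rule l2closure_add_scale[OF G Suc union.IH])
  qed
  have eq: "s n z = indicator ((\<Union>i<n. S i) \<inter> A \<times> B) z" for n z
  proof -
   have "indicator (\<Union>i<n. S i \<inter> A \<times> B) z = (\<Sum>i<n. indicator (S i \<inter> A \<times> B) z :: complex)"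
   proof (rule indicator_UN_disjoint)
    show "disjoint_family_on (\<lambda>i. S i \<inter> A \<times> B) {..<n}"
     unfolding disjoint_family_on_def
    proof (intro ballI impI)
     fix i j :: nat assume "i \<noteq> j"
     then have "S i \<inter> S j = {}" using union.hyps(1) unfolding disjoint_family_on_def by blast
     then show "S i \<inter> A \<times> B \<inter> (S j \<inter> A \<times> B) = {}" by blast
    qed
   qed simp
   moreover have "(\<Union>i<n. S i \<inter> A \<times> B) = (\<Union>i<n. S i) \<inter> A \<times> B" by (simp only: UN_extend_simps)
   ultimately show ?thesis by (simp add: s_def)
  qed
  have eq': "s n z = indicator (\<Union>i<n. S i \<inter> A \<times> B) z" for n z
   unfolding eq by (rule arg_cong[where f="\<lambda>T. indicator T z"]) (simp only: UN_extend_simps)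
  have lim: "(\<lambda>n. s n z) \<longlonglongrightarrow> indicator ((\<Union>i. S i) \<inter> A \<times> B) z" for z
  proof -
   have "(\<Union>i. S i) \<inter> A \<times> B = (\<Union>i. S i \<inter> A \<times> B)" by (simp only: UN_extend_simps)
   then show ?thesis unfolding eq' using LIMSEQ_indicator_UN[of "\<lambda>i. S i \<inter> A \<times> B" z] by simp
  qed
  have bd: "cmod (s n z) \<le> 1 * cmod (indicator (A \<times> B) z)" for n z
   unfolding eq by (simp add: indicator_def)
  have UN: "(\<Union>i. S i) \<inter> A \<times> B \<in> sets ?P"
   by (intro sets.Int[OF _ boxm] sets.countable_UN) (use Sm in blast)
  have sm: "s n \<in> borel_measurable ?P" for n using scl[of n] by (simp add: l2closure_def sqD)
  have alim: "AE z in ?P. (\<lambda>n. s n z) \<longlonglongrightarrow> indicator ((\<Union>i. S i) \<inter> A \<times> B) z" by (rule AE_I2) (rule lim)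
  have abd: "AE z in ?P. cmod (s n z) \<le> 1 * cmod (indicator (A \<times> B) z)" for n by (rule AE_I2) (rule bd)
  note conv = l2_dominated_convergence[where s=s and f="indicator ((\<Union>i. S i) \<inter> A \<times> B)" and c=1,
    OF AB borel_measurable_indicator[OF UN] sm alim abd]
  show ?case
   by (rule l2closure_limit_seq[where s=s, OF G conv(1) scl conv(3)])
 qed
qed

lemma rectangles_l2dense:
 assumes M: "sigma_finite_measure M" and N: "sigma_finite_measure N" and f: "f \<in> ksq M N"
 shows "f \<in> l2closure (M \<Otimes>\<^sub>M N) (finite_rectangles M N)"
proof -
 let ?P = "M \<Otimes>\<^sub>M N" and ?G = "finite_rectangles M N"
 note G = finite_rectangles_sq[OF N, of M]
 obtain A where A: "range A \<subseteq> sets M" "(\<Union>i. A i) = space M" "\<And>i::nat. emeasure M (A i) \<noteq> \<infinity>" "incseq A"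
  by (rule sigma_finite_measure.sigma_finite_incseq[OF M], rule that)
 obtain B where B: "range B \<subseteq> sets N" "(\<Union>i. B i) = space N" "\<And>i::nat. emeasure N (B i) \<noteq> \<infinity>" "incseq B"
  by (rule sigma_finite_measure.sigma_finite_incseq[OF N], rule that)
 have "finite_indicators ?P \<subseteq> l2closure ?P ?G"
 proof
  fix g assume "g \<in> finite_indicators ?P"
  then obtain S where S: "g = indicator S" "S \<in> sets ?P" "emeasure ?P S < \<infinity>" unfolding finite_indicators_def by blast
  have cl: "indicator (S \<inter> A i \<times> B i) \<in> l2closure ?P ?G" for i
   by (rule rectangles_approximate_in_box[OF N _ _ _ _ S(2)])
     (use A B in \<open>auto simp: less_top\<close>)
  have lim: "(\<lambda>i. indicator (S \<inter> A i \<times> B i) z :: complex) \<longlonglongrightarrow> indicator S z" for z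
  proof -
   have "incseq (\<lambda>i. S \<inter> A i \<times> B i)"
    using A(4) B(4) unfolding incseq_def by blast
   moreover have "(\<Union>i. S \<inter> A i \<times> B i) = S"
   proof (intro equalityI subsetI)
    fix z assume z: "z \<in> S"
    have "z \<in> space M \<times> space N" using subsetD[OF sets.sets_into_space[OF S(2)] z] by (simp add: space_pair_measure)
    then have "fst z \<in> (\<Union>i. A i)" "snd z \<in> (\<Union>i. B i)" using A(2) B(2) by auto
    then obtain i j where ij: "fst z \<in> A i" "snd z \<in> B j" by (elim UN_E)
    have "fst z \<in> A (max i j)" "snd z \<in> B (max i j)"
     using incseqD[OF A(4), of i "max i j"] incseqD[OF B(4), of j "max i j"] ij by auto
    then show "z \<in> (\<Union>i. S \<inter> A i \<times> B i)" using z by (intro UN_I[of "max i j"]) (auto simp: mem_Times_iff)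
   qed blast
   ultimately show ?thesis using LIMSEQ_indicator_incseq[of "\<lambda>i. S \<inter> A i \<times> B i" z] by simp
  qed
  have bd: "cmod (indicator (S \<inter> A i \<times> B i) z) \<le> 1 * cmod (indicator S z)" for i z
   by (simp add: indicator_def)
  have ss: "(indicator S :: _ => complex) \<in> sq ?P" by (rule sq_indicator(1)[OF S(2,3)])
  have sm: "(indicator (S \<inter> A i \<times> B i) :: _ => complex) \<in> borel_measurable ?P" for i
   using cl[of i] by (simp add: l2closure_def sqD)
  have alim: "AE z in ?P. (\<lambda>i. indicator (S \<inter> A i \<times> B i) z :: complex) \<longlonglongrightarrow> indicator S z" by (rule AE_I2) (rule lim)
  have abd: "AE z in ?P. cmod (indicator (S \<inter> A i \<times> B i) z) \<le> 1 * cmod (indicator S z)" for i by (rule AE_I2) (rule bd)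
  note conv = l2_dominated_convergence(3)[where s="\<lambda>i. indicator (S \<inter> A i \<times> B i)" and f="indicator S" and c=1,
    OF ss sqD(1)[OF ss] sm alim abd]
  show "g \<in> l2closure ?P ?G" unfolding S(1)
   by (rule l2closure_limit_seq[where s="\<lambda>i. indicator (S \<inter> A i \<times> B i)", OF G ss cl conv])
 qed
 from l2closure_mono[OF G this] show ?thesis by (rule subsetD) (rule simple_functions_l2dense[OF f])
qed

section \<open>Kernels, their pairings and functionals\<close>

text \<open>The bilinear form of the integral operator with kernel \<open>k\<close>, without conjugation: \<open>\<integral> (I\<^sub>k f) g\<close>.\<close>

definition pairing :: "'a measure => 'b measure => ('a \<times> 'b => complex) => ('a => complex) => ('b => complex) => complex" where
 "pairing M N k f g = (LINT z|(M \<Otimes>\<^sub>M N). k z * (f (fst z) * g (snd z)))"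

text \<open>The constant \<open>c\<close> bounds the operator norm of the integral operator. Working with this relation instead of the supremum avoids all questions of attainment.\<close>

definition kernel_bound :: "'a measure => 'b measure => ('a \<times> 'b => complex) => real => bool" where
 "kernel_bound M N k c \<longleftrightarrow> c \<ge> 0 \<and> (\<forall>f\<in>sq M. \<forall>g\<in>sq N. cmod (pairing M N k f g) \<le> c * (l2norm M f * l2norm N g))"

text \<open>Functionals on Hilbert-Schmidt operators that are bounded for the operator norm.\<close>

definition kernel_functional :: "'a measure => 'b measure => (('a \<times> 'b => complex) => complex) => real => bool" where
 "kernel_functional M N F C \<longleftrightarrow> C \<ge> 0
   \<and> (\<forall>k\<in>ksq M N. \<forall>l\<in>ksq M N. F (\<lambda>z. k z + l z) = F k + F l)
   \<and> (\<forall>c. \<forall>k\<in>ksq M N. F (\<lambda>z. c * k z) = c * F k)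
   \<and> (\<forall>k\<in>ksq M N. \<forall>c. kernel_bound M N k c \<longrightarrow> cmod (F k) \<le> C * c)"

lemma kernel_functionalD:
 assumes "kernel_functional M N F C"
 shows "C \<ge> 0" "k \<in> ksq M N ==> l \<in> ksq M N ==> F (\<lambda>z. k z + l z) = F k + F l"
  "k \<in> ksq M N ==> F (\<lambda>z. c * k z) = c * F k"
  "k \<in> ksq M N ==> kernel_bound M N k d ==> cmod (F k) \<le> C * d"
 using assms by (simp_all only: kernel_functional_def)

lemma tensor_sq:
 assumes N: "sigma_finite_measure N" and f: "f \<in> sq M" and g: "g \<in> sq N"
 shows "(\<lambda>z. f (fst z) * g (snd z)) \<in> ksq M N"
  "l2norm (M \<Otimes>\<^sub>M N) (\<lambda>z. f (fst z) * g (snd z)) \<le> l2norm M f * l2norm N g"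
proof -
 interpret N: sigma_finite_measure N by (rule N)
 note [measurable] = sqD(1)[OF f] sqD(1)[OF g]
 have m: "(\<lambda>z. f (fst z) * g (snd z)) \<in> kmeasurable M N" by measurable
 have nn: "(\<integral>\<^sup>+ z. ennreal ((cmod (f (fst z) * g (snd z)))\<^sup>2) \<partial>(M \<Otimes>\<^sub>M N))
   = ennreal ((l2norm M f)\<^sup>2) * ennreal ((l2norm N g)\<^sup>2)"
 proof -
  have ni: "(\<integral>\<^sup>+ y. ennreal ((cmod (g y))\<^sup>2) \<partial>N) = ennreal ((l2norm N g)\<^sup>2)"
   "(\<integral>\<^sup>+ x. ennreal ((cmod (f x))\<^sup>2) \<partial>M) = ennreal ((l2norm M f)\<^sup>2)"
   unfolding l2norm_square by (auto intro!: nn_integral_eq_integral sqD f g)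
  have "(\<integral>\<^sup>+ z. ennreal ((cmod (f (fst z) * g (snd z)))\<^sup>2) \<partial>(M \<Otimes>\<^sub>M N))
    = (\<integral>\<^sup>+ x. \<integral>\<^sup>+ y. ennreal ((cmod (f x))\<^sup>2) * ennreal ((cmod (g y))\<^sup>2) \<partial>N \<partial>M)"
   by (subst N.nn_integral_fst[symmetric]) (auto simp: norm_mult power_mult_distrib ennreal_mult)
  also have "\<dots> = (\<integral>\<^sup>+ x. ennreal ((cmod (f x))\<^sup>2) * ennreal ((l2norm N g)\<^sup>2) \<partial>M)"
   by (subst nn_integral_cmult) (auto simp: ni)
  also have "\<dots> = ennreal ((l2norm M f)\<^sup>2) * ennreal ((l2norm N g)\<^sup>2)"
   by (subst nn_integral_multc) (auto simp: ni)
  finally show ?thesis .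
 qed
 have i: "integrable (M \<Otimes>\<^sub>M N) (\<lambda>z. (cmod (f (fst z) * g (snd z)))\<^sup>2)"
  by (rule integrableI_nonneg) (use nn in \<open>auto simp: ennreal_mult_less_top\<close>)
 show "(\<lambda>z. f (fst z) * g (snd z)) \<in> ksq M N" by (rule sqI[OF m i])
 have "ennreal ((l2norm (M \<Otimes>\<^sub>M N) (\<lambda>z. f (fst z) * g (snd z)))\<^sup>2) = ennreal ((l2norm M f)\<^sup>2 * (l2norm N g)\<^sup>2)"
  unfolding l2norm_square using nn by (subst nn_integral_eq_integral[OF i, symmetric]) (auto simp: l2norm_square ennreal_mult)
 then have "(l2norm (M \<Otimes>\<^sub>M N) (\<lambda>z. f (fst z) * g (snd z)))\<^sup>2 = (l2norm M f)\<^sup>2 * (l2norm N g)\<^sup>2"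
  by (rule ennreal_inj[THEN iffD1, rotated -1]) auto
 then have "(l2norm (M \<Otimes>\<^sub>M N) (\<lambda>z. f (fst z) * g (snd z)))\<^sup>2 = (l2norm M f * l2norm N g)\<^sup>2"
  by (simp only: power_mult_distrib)
 then show "l2norm (M \<Otimes>\<^sub>M N) (\<lambda>z. f (fst z) * g (snd z)) \<le> l2norm M f * l2norm N g"
  by (rule power2_le_imp_le[OF eq_refl]) (intro mult_nonneg_nonneg l2norm_nonneg)
qed

context
 fixes M :: "'a measure" and N :: "'b measure"
 assumes N: "sigma_finite_measure N"
begin

lemma pairing_integrable:
 assumes "k \<in> ksq M N" "f \<in> sq M" "g \<in> sq N"
 shows "integrable (M \<Otimes>\<^sub>M N) (\<lambda>z. k z * (f (fst z) * g (snd z)))"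
 by (rule sq_cauchy_schwarz(1)[OF assms(1) tensor_sq(1)[OF N assms(2,3)]])

lemma pairing_le:
 assumes "k \<in> ksq M N" "f \<in> sq M" "g \<in> sq N"
 shows "cmod (pairing M N k f g) \<le> l2norm (M \<Otimes>\<^sub>M N) k * (l2norm M f * l2norm N g)"
 unfolding pairing_def
 using sq_cauchy_schwarz(3)[OF assms(1) tensor_sq(1)[OF N assms(2,3)]]
  mult_left_mono[OF tensor_sq(2)[OF N assms(2,3)] l2norm_nonneg[of "M \<Otimes>\<^sub>M N" k]] by linarith

lemma kernel_bound_l2: "k \<in> ksq M N ==> kernel_bound M N k (l2norm (M \<Otimes>\<^sub>M N) k)"
 unfolding kernel_bound_def using pairing_le by auto

lemma pairing_add:
 assumes "k \<in> ksq M N" "l \<in> ksq M N" "f \<in> sq M" "g \<in> sq N"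
 shows "pairing M N (\<lambda>z. k z + l z) f g = pairing M N k f g + pairing M N l f g"
 unfolding pairing_def distrib_right using assms by (intro Bochner_Integration.integral_add pairing_integrable)

lemma pairing_scale: "pairing M N (\<lambda>z. c * k z) f g = c * pairing M N k f g"
 unfolding pairing_def by (simp add: mult.assoc)

lemma pairing_minus:
 assumes "k \<in> ksq M N" "l \<in> ksq M N" "f \<in> sq M" "g \<in> sq N"
 shows "pairing M N (\<lambda>z. k z - l z) f g = pairing M N k f g - pairing M N l f g"
 unfolding pairing_def left_diff_distrib using assms by (intro Bochner_Integration.integral_diff pairing_integrable)

lemma pairing_sum:
 assumes "\<And>i. i \<in> I ==> k i \<in> ksq M N" "f \<in> sq M" "g \<in> sq N"
 shows "pairing M N (\<lambda>z. \<Sum>i\<in>I. c i * k i z) f g = (\<Sum>i\<in>I. c i * pairing M N (k i) f g)"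
proof -
 have "pairing M N (\<lambda>z. \<Sum>i\<in>I. c i * k i z) f g = (\<Sum>i\<in>I. pairing M N (\<lambda>z. c i * k i z) f g)"
  unfolding pairing_def sum_distrib_right
  by (intro Bochner_Integration.integral_sum pairing_integrable) (use assms in auto)
 then show ?thesis by (simp add: pairing_scale)
qed

lemma pairing_left_diff:
 assumes "k \<in> ksq M N" "f \<in> sq M" "f' \<in> sq M" "g \<in> sq N"
 shows "pairing M N k (\<lambda>x. f x - f' x) g = pairing M N k f g - pairing M N k f' g"
 unfolding pairing_def left_diff_distrib right_diff_distrib
 using assms by (intro Bochner_Integration.integral_diff pairing_integrable)

lemma pairing_right_diff:
 assumes "k \<in> ksq M N" "f \<in> sq M" "g \<in> sq N" "g' \<in> sq N"
 shows "pairing M N k f (\<lambda>x. g x - g' x) = pairing M N k f g - pairing M N k f g'"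
 unfolding pairing_def right_diff_distrib
 using assms by (intro Bochner_Integration.integral_diff pairing_integrable)

lemma pairing_tensor:
 assumes M: "sigma_finite_measure M"
  and a: "a \<in> sq M" and b: "b \<in> sq N" and f: "f \<in> sq M" and g: "g \<in> sq N"
 shows "pairing M N (\<lambda>z. a (fst z) * b (snd z)) f g = (LINT x|M. a x * f x) * (LINT y|N. b y * g y)"
proof -
 interpret MN: pair_sigma_finite M N using M N by (simp add: pair_sigma_finite_def)
 have i: "integrable (M \<Otimes>\<^sub>M N) (\<lambda>z. (a (fst z) * f (fst z)) * (b (snd z) * g (snd z)))"
  using pairing_integrable[OF tensor_sq(1)[OF N a b] f g] by (simp add: mult_ac)
 have "pairing M N (\<lambda>z. a (fst z) * b (snd z)) f g
   = (LINT z|(M \<Otimes>\<^sub>M N). (a (fst z) * f (fst z)) * (b (snd z) * g (snd z)))"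
  unfolding pairing_def by (intro Bochner_Integration.integral_cong) (auto simp: mult_ac)
 also have "\<dots> = (LINT x|M. LINT y|N. (a x * f x) * (b y * g y))"
  using MN.integral_fst'[OF i] by simp
 also have "\<dots> = (LINT x|M. a x * f x) * (LINT y|N. b y * g y)" by simp
 finally show ?thesis .
qed

lemma kernel_boundD:
 assumes "kernel_bound M N k c"
 shows "c \<ge> 0" "f \<in> sq M ==> g \<in> sq N ==> cmod (pairing M N k f g) \<le> c * (l2norm M f * l2norm N g)"
 using assms by (simp_all only: kernel_bound_def)

lemma kernel_boundI:
 assumes "c \<ge> 0" "\<And>f g. f \<in> sq M ==> g \<in> sq N ==> cmod (pairing M N k f g) \<le> c * (l2norm M f * l2norm N g)"
 shows "kernel_bound M N k c"
 unfolding kernel_bound_def using assms by blast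

lemma kernel_bound_scale: "kernel_bound M N k c ==> kernel_bound M N (\<lambda>z. u * k z) (cmod u * c)"
 by (rule kernel_boundI)
   (auto simp: pairing_scale norm_mult mult.assoc kernel_boundD intro!: mult_left_mono)

lemma kernel_bound_mono: "kernel_bound M N k c ==> c \<le> d ==> kernel_bound M N k d"
 by (rule kernel_boundI) (use kernel_boundD(1) in fastforce,
   rule order_trans[OF kernel_boundD(2)], auto intro!: mult_right_mono)

lemma kernel_bound_minus:
 assumes "k \<in> ksq M N" "l \<in> ksq M N" "kernel_bound M N k c" "kernel_bound M N l d"
 shows "kernel_bound M N (\<lambda>z. k z - l z) (c + d)"
proof (rule kernel_boundI)
 show "c + d \<ge> 0" using kernel_boundD(1)[OF assms(3)] kernel_boundD(1)[OF assms(4)] by simp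
 fix f g assume fg: "f \<in> sq M" "g \<in> sq N"
 have "cmod (pairing M N k f g - pairing M N l f g) \<le> cmod (pairing M N k f g) + cmod (pairing M N l f g)"
  by (rule norm_triangle_ineq4)
 then show "cmod (pairing M N (\<lambda>z. k z - l z) f g) \<le> (c + d) * (l2norm M f * l2norm N g)"
  using kernel_boundD(2)[OF assms(3) fg] kernel_boundD(2)[OF assms(4) fg]
  by (simp add: pairing_minus[OF assms(1,2) fg] distrib_right)
qed

end



section \<open>Seminormed spaces, operators and duals\<close>

definition seminormed_space :: "'v cnormed => bool" where
 "seminormed_space V \<longleftrightarrow> vecs V \<noteq> {}
   \<and> (\<forall>v\<in>vecs V. \<forall>w\<in>vecs V. vadd V v w \<in> vecs V \<and> vadd V v w = vadd V w v \<and> vnorm V (vadd V v w) \<le> vnorm V v + vnorm V w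
     \<and> (\<forall>c. vscale V c (vadd V v w) = vadd V (vscale V c v) (vscale V c w))
     \<and> (\<forall>u\<in>vecs V. vadd V (vadd V v w) u = vadd V v (vadd V w u)))
   \<and> (\<forall>v\<in>vecs V. \<forall>c. vscale V c v \<in> vecs V \<and> vnorm V (vscale V c v) = cmod c * vnorm V v
     \<and> (\<forall>d. vscale V c (vscale V d v) = vscale V (c * d) v \<and> vadd V (vscale V c v) (vscale V d v) = vscale V (c + d) v))
   \<and> (\<forall>v\<in>vecs V. vnorm V v \<ge> 0 \<and> vscale V 1 v = v)"

lemma seminormed_spaceD:
 assumes "seminormed_space V"
 shows "vecs V \<noteq> {}"
  "v \<in> vecs V ==> w \<in> vecs V ==> vadd V v w \<in> vecs V"
  "v \<in> vecs V ==> w \<in> vecs V ==> vadd V v w = vadd V w v"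
  "v \<in> vecs V ==> w \<in> vecs V ==> vnorm V (vadd V v w) \<le> vnorm V v + vnorm V w"
  "v \<in> vecs V ==> w \<in> vecs V ==> vscale V c (vadd V v w) = vadd V (vscale V c v) (vscale V c w)"
  "v \<in> vecs V ==> w \<in> vecs V ==> u \<in> vecs V ==> vadd V (vadd V v w) u = vadd V v (vadd V w u)"
  "v \<in> vecs V ==> vscale V c v \<in> vecs V"
  "v \<in> vecs V ==> vnorm V (vscale V c v) = cmod c * vnorm V v"
  "v \<in> vecs V ==> vscale V c (vscale V d v) = vscale V (c * d) v"
  "v \<in> vecs V ==> vnorm V v \<ge> 0"
  "v \<in> vecs V ==> vadd V (vscale V c v) (vscale V d v) = vscale V (c + d) v"
  "v \<in> vecs V ==> vscale V 1 v = v"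
 using assms unfolding seminormed_space_def by blast+

lemma seminormed_space_zero:
 assumes V: "seminormed_space V" obtains z where "z \<in> vecs V" "vnorm V z = 0"
proof -
 obtain v where v: "v \<in> vecs V" using seminormed_spaceD(1)[OF V] by blast
 show thesis by (rule that[of "vscale V 0 v"]) (simp_all add: seminormed_spaceD(7,8)[OF V v])
qed

lemma seminormed_complex_scalars: "seminormed_space complex_scalars"
 by (auto simp: seminormed_space_def complex_scalars_def norm_triangle_ineq norm_mult algebra_simps)

lemma bounded_ops_simps:
 "vadd (bounded_ops V W) = (\<lambda>S T. \<lambda>v\<in>vecs V. vadd W (S v) (T v))"
 "vscale (bounded_ops V W) = (\<lambda>c T. \<lambda>v\<in>vecs V. vscale W c (T v))"
 "vnorm (bounded_ops V W) = (\<lambda>T. SUP v\<in>{v \<in> vecs V. vnorm V v \<le> 1}. vnorm W (T v))"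
 by (simp_all add: bounded_ops_def)

lemma bounded_opsI:
 assumes "T \<in> extensional (vecs V)" "\<And>v. v \<in> vecs V ==> T v \<in> vecs W"
  "\<And>v w. v \<in> vecs V ==> w \<in> vecs V ==> T (vadd V v w) = vadd W (T v) (T w)"
  "\<And>c v. v \<in> vecs V ==> T (vscale V c v) = vscale W c (T v)"
  "\<And>v. v \<in> vecs V ==> vnorm W (T v) \<le> C * vnorm V v"
 shows "T \<in> vecs (bounded_ops V W)"
proof -
 have "T \<in> linear_maps V W"
  unfolding linear_maps_def mem_Collect_eq PiE_def by (intro conjI IntI Pi_I ballI allI assms)
 then show ?thesis unfolding bounded_ops_def using assms(5) by auto
qed

lemma bounded_opsD:
 assumes "T \<in> vecs (bounded_ops V W)"
 shows "T \<in> extensional (vecs V)" "v \<in> vecs V ==> T v \<in> vecs W"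
  "v \<in> vecs V ==> w \<in> vecs V ==> T (vadd V v w) = vadd W (T v) (T w)"
  "v \<in> vecs V ==> T (vscale V c v) = vscale W c (T v)"
  "\<exists>C. \<forall>v\<in>vecs V. vnorm W (T v) \<le> C * vnorm V v"
proof -
 have T: "T \<in> linear_maps V W" "\<exists>C. \<forall>v\<in>vecs V. vnorm W (T v) \<le> C * vnorm V v"
  using assms by (simp_all add: bounded_ops_def)
 show "\<exists>C. \<forall>v\<in>vecs V. vnorm W (T v) \<le> C * vnorm V v" by (rule T(2))
 show "T \<in> extensional (vecs V)" "v \<in> vecs V ==> T v \<in> vecs W" using T(1) by (auto simp: linear_maps_def PiE_def)
 show "v \<in> vecs V ==> w \<in> vecs V ==> T (vadd V v w) = vadd W (T v) (T w)"
  "v \<in> vecs V ==> T (vscale V c v) = vscale W c (T v)"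
  using T(1) by (auto simp: linear_maps_def)
qed

lemma bounded_ops_norm:
 assumes V: "seminormed_space V" and W: "seminormed_space W" and T: "T \<in> vecs (bounded_ops V W)"
 shows "vnorm (bounded_ops V W) T \<ge> 0"
  and "v \<in> vecs V ==> vnorm W (T v) \<le> vnorm (bounded_ops V W) T * vnorm V v"
  and "(\<And>v. v \<in> vecs V ==> vnorm W (T v) \<le> C * vnorm V v) ==> C \<ge> 0 ==> vnorm (bounded_ops V W) T \<le> C"
proof -
 note VD = seminormed_spaceD[OF V] and WD = seminormed_spaceD[OF W] and TD = bounded_opsD[OF T]
 obtain B where B: "\<And>v. v \<in> vecs V ==> vnorm W (T v) \<le> B * vnorm V v" using TD(5) by blast
 let ?U = "{v \<in> vecs V. vnorm V v \<le> 1}"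
 have bdd: "bdd_above ((\<lambda>v. vnorm W (T v)) ` ?U)"
 proof (rule bdd_aboveI2)
  fix v assume v: "v \<in> ?U"
  have "vnorm W (T v) \<le> B * vnorm V v" using B v by simp
  also have "\<dots> \<le> \<bar>B\<bar> * 1" using v VD(10) by (intro mult_mono) auto
  finally show "vnorm W (T v) \<le> \<bar>B\<bar>" by simp
 qed
 obtain z where z: "z \<in> vecs V" "vnorm V z = 0" by (rule seminormed_space_zero[OF V])
 have up: "vnorm W (T v) \<le> vnorm (bounded_ops V W) T" if "v \<in> ?U" for v
  unfolding bounded_ops_simps by (rule cSUP_upper[OF that bdd])
 have "vnorm W (T z) \<le> vnorm (bounded_ops V W) T" by (rule up) (use z in simp)
 then show n0: "vnorm (bounded_ops V W) T \<ge> 0" using WD(10)[OF TD(2)[OF z(1)]] by linarith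
 show "vnorm W (T v) \<le> vnorm (bounded_ops V W) T * vnorm V v" if v: "v \<in> vecs V"
 proof (cases "vnorm V v = 0")
  case True then show ?thesis using B[OF v] by simp
 next
  case False
  then have pos: "vnorm V v > 0" using VD(10)[OF v] by simp
  define u where "u = vscale V (of_real (1 / vnorm V v)) v"
  have u: "u \<in> vecs V" "vnorm V u = 1" using VD(7,8)[OF v] pos by (simp_all add: u_def norm_divide)
  have "T u = vscale W (of_real (1 / vnorm V v)) (T v)" unfolding u_def by (rule TD(4)[OF v])
  then have "vnorm W (T u) = vnorm W (T v) / vnorm V v" using WD(8)[OF TD(2)[OF v]] pos by (simp add: norm_divide)
  moreover have "vnorm W (T u) \<le> vnorm (bounded_ops V W) T" by (rule up) (use u in simp)
  ultimately have "vnorm W (T v) / vnorm V v \<le> vnorm (bounded_ops V W) T" by simp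
  then show ?thesis using pos by (simp only: pos_divide_le_eq)
 qed
 assume C: "\<And>v. v \<in> vecs V ==> vnorm W (T v) \<le> C * vnorm V v" "C \<ge> 0"
 show "vnorm (bounded_ops V W) T \<le> C" unfolding bounded_ops_simps
 proof (rule cSUP_least)
  show "?U \<noteq> {}" using z by auto
  fix v assume v: "v \<in> ?U"
  have "vnorm W (T v) \<le> C * vnorm V v" using C(1) v by simp
  also have "\<dots> \<le> C * 1" using v C(2) by (intro mult_left_mono) auto
  finally show "vnorm W (T v) \<le> C" by simp
 qed
qed

lemma bounded_ops_closed:
 assumes V: "seminormed_space V" and W: "seminormed_space W"
  and S: "S \<in> vecs (bounded_ops V W)" and T: "T \<in> vecs (bounded_ops V W)"
 shows "vadd (bounded_ops V W) S T \<in> vecs (bounded_ops V W)" "vscale (bounded_ops V W) c T \<in> vecs (bounded_ops V W)"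
proof -
 note VD = seminormed_spaceD[OF V] and WD = seminormed_spaceD[OF W] and SD = bounded_opsD[OF S] and TD = bounded_opsD[OF T]
 note Sn = bounded_ops_norm[OF V W S] and Tn = bounded_ops_norm[OF V W T]
 show "vadd (bounded_ops V W) S T \<in> vecs (bounded_ops V W)" unfolding bounded_ops_simps
 proof (rule bounded_opsI[where C="vnorm (bounded_ops V W) S + vnorm (bounded_ops V W) T"])
  show "(\<lambda>v\<in>vecs V. vadd W (S v) (T v)) \<in> extensional (vecs V)" by simp
  fix v assume v: "v \<in> vecs V"
  show "(\<lambda>v\<in>vecs V. vadd W (S v) (T v)) v \<in> vecs W" using v WD(2) SD(2) TD(2) by simp
  show "(\<lambda>v\<in>vecs V. vadd W (S v) (T v)) (vscale V c v) = vscale W c ((\<lambda>v\<in>vecs V. vadd W (S v) (T v)) v)" for c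
   using v VD(7)[OF v] WD(5)[OF SD(2)[OF v] TD(2)[OF v]] SD(4)[OF v] TD(4)[OF v] by simp
  have "vnorm W (vadd W (S v) (T v)) \<le> vnorm W (S v) + vnorm W (T v)" by (rule WD(4)[OF SD(2)[OF v] TD(2)[OF v]])
  then show "vnorm W ((\<lambda>v\<in>vecs V. vadd W (S v) (T v)) v) \<le> (vnorm (bounded_ops V W) S + vnorm (bounded_ops V W) T) * vnorm V v"
   using Sn(2)[OF v] Tn(2)[OF v] v by (simp add: distrib_right)
  fix w assume w: "w \<in> vecs V"
  have "vadd W (vadd W (S v) (S w)) (vadd W (T v) (T w)) = vadd W (S v) (vadd W (S w) (vadd W (T v) (T w)))"
   by (intro WD(6) WD(2) SD(2) TD(2) v w)
  also have "vadd W (S w) (vadd W (T v) (T w)) = vadd W (vadd W (S w) (T v)) (T w)"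
   by (intro WD(6)[symmetric] SD(2) TD(2) v w)
  also have "vadd W (S w) (T v) = vadd W (T v) (S w)" by (intro WD(3) SD(2) TD(2) v w)
  also have "vadd W (vadd W (T v) (S w)) (T w) = vadd W (T v) (vadd W (S w) (T w))" by (intro WD(6) SD(2) TD(2) v w)
  also have "vadd W (S v) (vadd W (T v) (vadd W (S w) (T w))) = vadd W (vadd W (S v) (T v)) (vadd W (S w) (T w))"
   by (intro WD(6)[symmetric] WD(2) SD(2) TD(2) v w)
  finally show "(\<lambda>v\<in>vecs V. vadd W (S v) (T v)) (vadd V v w)
    = vadd W ((\<lambda>v\<in>vecs V. vadd W (S v) (T v)) v) ((\<lambda>v\<in>vecs V. vadd W (S v) (T v)) w)"
   using v w VD(2)[OF v w] SD(3)[OF v w] TD(3)[OF v w] by simp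
 qed
 show "vscale (bounded_ops V W) c T \<in> vecs (bounded_ops V W)" unfolding bounded_ops_simps
 proof (rule bounded_opsI[where C="cmod c * vnorm (bounded_ops V W) T"])
  show "(\<lambda>v\<in>vecs V. vscale W c (T v)) \<in> extensional (vecs V)" by simp
  fix v assume v: "v \<in> vecs V"
  show "(\<lambda>v\<in>vecs V. vscale W c (T v)) v \<in> vecs W" using v WD(7) TD(2) by simp
  show "(\<lambda>v\<in>vecs V. vscale W c (T v)) (vscale V d v) = vscale W d ((\<lambda>v\<in>vecs V. vscale W c (T v)) v)" for d
   using v VD(7)[OF v] WD(9)[OF TD(2)[OF v]] TD(4)[OF v] by (simp add: mult.commute)
  show "vnorm W ((\<lambda>v\<in>vecs V. vscale W c (T v)) v) \<le> cmod c * vnorm (bounded_ops V W) T * vnorm V v"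
   using v WD(8)[OF TD(2)[OF v]] mult_left_mono[OF Tn(2)[OF v], of "cmod c"] by (simp add: mult.assoc)
  fix w assume w: "w \<in> vecs V"
  show "(\<lambda>v\<in>vecs V. vscale W c (T v)) (vadd V v w)
    = vadd W ((\<lambda>v\<in>vecs V. vscale W c (T v)) v) ((\<lambda>v\<in>vecs V. vscale W c (T v)) w)"
   using v w VD(2)[OF v w] TD(3)[OF v w] WD(5)[OF TD(2)[OF v] TD(2)[OF w]] by simp
 qed
qed

lemma seminormed_bounded_ops:
 assumes V: "seminormed_space V" and W: "seminormed_space W"
 shows "seminormed_space (bounded_ops V W)"
proof -
 note VD = seminormed_spaceD[OF V] and WD = seminormed_spaceD[OF W]
 let ?B = "bounded_ops V W"
 note SD = bounded_opsD[where V=V and W=W]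
 have ne: "vecs ?B \<noteq> {}"
 proof -
  obtain z where z: "z \<in> vecs W" using WD(1) by blast
  have "(\<lambda>v\<in>vecs V. vscale W 0 z) \<in> vecs ?B"
  proof (rule bounded_opsI[where C=0])
   fix v assume v: "v \<in> vecs V"
   show "(\<lambda>v\<in>vecs V. vscale W 0 z) (vscale V c v) = vscale W c ((\<lambda>v\<in>vecs V. vscale W 0 z) v)" for c
    using v VD(7)[OF v] WD(9)[OF z] by simp
   show "vnorm W ((\<lambda>v\<in>vecs V. vscale W 0 z) v) \<le> 0 * vnorm V v" using v WD(8)[OF z] by simp
   fix w assume w: "w \<in> vecs V"
   show "(\<lambda>v\<in>vecs V. vscale W 0 z) (vadd V v w)
     = vadd W ((\<lambda>v\<in>vecs V. vscale W 0 z) v) ((\<lambda>v\<in>vecs V. vscale W 0 z) w)"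
    using v w VD(2)[OF v w] WD(11)[OF z, of 0 0] by simp
  qed (simp_all add: WD(7)[OF z])
  then show ?thesis by blast
 qed
 have add: "vadd ?B S T v = vadd W (S v) (T v)" if "v \<in> vecs V" for S T v
  using that by (simp add: bounded_ops_simps)
 have sc: "vscale ?B c T v = vscale W c (T v)" if "v \<in> vecs V" for c T v
  using that by (simp add: bounded_ops_simps)
 have ext: "S = T" if "S \<in> vecs ?B" "T \<in> vecs ?B" "\<And>v. v \<in> vecs V ==> S v = T v" for S T
  by (rule extensionalityI[OF SD(1)[OF that(1)] SD(1)[OF that(2)]]) (rule that(3))
 note cl = bounded_ops_closed[OF V W] and norm = bounded_ops_norm[OF V W]
 show ?thesis unfolding seminormed_space_def
 proof (intro conjI ballI allI ne)
  fix S assume S: "S \<in> vecs ?B"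
  show "vnorm ?B S \<ge> 0" by (rule norm(1)[OF S])
  fix c :: complex
  have cS: "vscale ?B c S \<in> vecs ?B" for c by (rule cl(2)[OF S S])
  show "vscale ?B 1 S = S" by (rule ext) (simp_all add: cS S sc WD(12)[OF SD(2)[OF S]])
  show "vscale ?B c S \<in> vecs ?B" by (rule cS)
  show "vscale ?B c (vscale ?B d S) = vscale ?B (c * d) S" for d
   by (rule ext) (simp_all add: cl(2)[OF cS cS] cS sc WD(9) SD(2)[OF S])
  show "vadd ?B (vscale ?B c S) (vscale ?B d S) = vscale ?B (c + d) S" for d
   by (rule ext) (simp_all add: cl(1)[OF cS cS] cS sc add WD(11) SD(2)[OF S])
  have le: "vnorm ?B (vscale ?B c S) \<le> cmod c * vnorm ?B S" if S: "S \<in> vecs ?B" for c S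
  proof (rule norm(3)[OF cl(2)[OF S S]])
   fix v assume v: "v \<in> vecs V"
   show "vnorm W (vscale ?B c S v) \<le> cmod c * vnorm ?B S * vnorm V v"
    using mult_left_mono[OF norm(2)[OF S v], of "cmod c"] by (simp add: sc[OF v] WD(8)[OF SD(2)[OF S v]] mult.assoc)
  qed (use norm(1)[OF S] in simp)
  show "vnorm ?B (vscale ?B c S) = cmod c * vnorm ?B S"
  proof (cases "c = 0")
   case True then show ?thesis using le[OF S, of 0] norm(1)[OF cS[of 0]] by simp
  next
   case False
   have "vscale ?B (1 / c) (vscale ?B c S) = S"
   proof (rule ext)
    fix v assume v: "v \<in> vecs V"
    show "vscale ?B (1 / c) (vscale ?B c S) v = S v" using False by (simp add: sc[OF v] WD(9,12)[OF SD(2)[OF S v]])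
   qed (simp_all add: cl(2)[OF cS cS] S)
   then have "vnorm ?B S \<le> cmod (1 / c) * vnorm ?B (vscale ?B c S)" using le[OF cS, of "1 / c" c] by simp
   then show ?thesis using le[OF S, of c] False by (simp add: norm_divide field_simps)
  qed
  fix T assume T: "T \<in> vecs ?B"
  have ST: "vadd ?B S T \<in> vecs ?B" by (rule cl(1)[OF S T])
  show "vadd ?B S T \<in> vecs ?B" by (rule ST)
  show "vadd ?B S T = vadd ?B T S"
   by (rule ext) (simp_all add: ST cl(1)[OF T S] add WD(3)[OF SD(2)[OF S] SD(2)[OF T]])
  show "vnorm ?B (vadd ?B S T) \<le> vnorm ?B S + vnorm ?B T"
  proof (rule norm(3)[OF ST])
   fix v assume v: "v \<in> vecs V"
   show "vnorm W (vadd ?B S T v) \<le> (vnorm ?B S + vnorm ?B T) * vnorm V v"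
    using WD(4)[OF SD(2)[OF S v] SD(2)[OF T v]] norm(2)[OF S v] norm(2)[OF T v] by (simp add: add[OF v] distrib_right)
  qed (use norm(1)[OF S] norm(1)[OF T] in simp)
  show "vscale ?B c (vadd ?B S T) = vadd ?B (vscale ?B c S) (vscale ?B c T)" for c
   by (rule ext) (simp_all add: cl(2)[OF ST ST] cl(1)[OF cS cl(2)[OF T T]] sc add WD(5)[OF SD(2)[OF S] SD(2)[OF T]])
  show "vadd ?B (vadd ?B S T) U = vadd ?B S (vadd ?B T U)" if U: "U \<in> vecs ?B" for U
   by (rule ext) (simp_all add: cl(1)[OF ST U] cl(1)[OF S cl(1)[OF T U]] add WD(6)[OF SD(2)[OF S] SD(2)[OF T] SD(2)[OF U]])
 qed
qed

lemma dualI: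
 assumes "F \<in> extensional (vecs V)"
  "\<And>v w. v \<in> vecs V ==> w \<in> vecs V ==> F (vadd V v w) = F v + F w"
  "\<And>c v. v \<in> vecs V ==> F (vscale V c v) = c * F v"
  "\<And>v. v \<in> vecs V ==> cmod (F v) \<le> C * vnorm V v"
 shows "F \<in> vecs (dual V)"
 unfolding dual_def by (rule bounded_opsI[where C=C]) (use assms in \<open>simp_all add: complex_scalars_def\<close>)

lemma dualD:
 assumes "F \<in> vecs (dual V)"
 shows "F \<in> extensional (vecs V)" "v \<in> vecs V ==> w \<in> vecs V ==> F (vadd V v w) = F v + F w"
  "v \<in> vecs V ==> F (vscale V c v) = c * F v"
 using bounded_opsD[OF assms[unfolded dual_def]] by (simp_all add: complex_scalars_def)

lemma dual_norm:
 assumes V: "seminormed_space V" and F: "F \<in> vecs (dual V)"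
 shows "vnorm (dual V) F \<ge> 0" "v \<in> vecs V ==> cmod (F v) \<le> vnorm (dual V) F * vnorm V v"
  "(\<And>v. v \<in> vecs V ==> cmod (F v) \<le> C * vnorm V v) ==> C \<ge> 0 ==> vnorm (dual V) F \<le> C"
 using bounded_ops_norm[OF V seminormed_complex_scalars F[unfolded dual_def]]
 by (simp_all add: dual_def complex_scalars_def)

lemma dual_simps:
 "vadd (dual V) = (\<lambda>F G. \<lambda>v\<in>vecs V. F v + G v)" "vscale (dual V) = (\<lambda>c F. \<lambda>v\<in>vecs V. c * F v)"
 by (simp_all add: dual_def bounded_ops_simps complex_scalars_def)

lemma seminormed_dual: "seminormed_space V ==> seminormed_space (dual V)"
 unfolding dual_def by (rule seminormed_bounded_ops[OF _ seminormed_complex_scalars])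

definition dual_combination :: "'v cnormed => ('v => complex) set => (('v => complex) => complex) => 'v => complex" where
 "dual_combination V J \<beta> = (\<lambda>v\<in>vecs V. \<Sum>F\<in>J. \<beta> F * F v)"

lemma dual_combination:
 assumes V: "seminormed_space V" and fin: "finite J" and J: "J \<subseteq> vecs (dual V)"
 shows "dual_combination V J \<beta> \<in> vecs (dual V)"
  and "Q \<in> vecs (dual (dual V)) ==> Q (dual_combination V J \<beta>) = (\<Sum>F\<in>J. \<beta> F * Q F)"
proof -
 note DD = seminormed_spaceD[OF seminormed_dual[OF V]]
 have "dual_combination V J \<beta> \<in> vecs (dual V) \<and>
   (\<forall>Q\<in>vecs (dual (dual V)). Q (dual_combination V J \<beta>) = (\<Sum>F\<in>J. \<beta> F * Q F))"
  using fin J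
 proof (induction J)
  case empty
  obtain F where F: "F \<in> vecs (dual V)" using DD(1) by blast
  have eq: "dual_combination V {} \<beta> = vscale (dual V) 0 F" by (simp add: dual_combination_def dual_simps)
  show ?case unfolding eq using DD(7)[OF F] dualD(3)[OF _ F, of _ 0] by simp
 next
  case (insert F J)
  have F: "F \<in> vecs (dual V)" and c: "dual_combination V J \<beta> \<in> vecs (dual V)" using insert by auto
  have eq: "dual_combination V (insert F J) \<beta> = vadd (dual V) (vscale (dual V) (\<beta> F) F) (dual_combination V J \<beta>)"
   unfolding dual_combination_def dual_simps using insert.hyps by (intro restrict_ext) simp
  show ?case unfolding eq
   using DD(2)[OF DD(7)[OF F] c] dualD(2)[OF _ DD(7)[OF F] c] dualD(3)[OF _ F] insert by simp
 qed
 then show "dual_combination V J \<beta> \<in> vecs (dual V)"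
  "Q \<in> vecs (dual (dual V)) ==> Q (dual_combination V J \<beta>) = (\<Sum>F\<in>J. \<beta> F * Q F)" by blast+
qed

section \<open>Closability and the domain of the adjoint\<close>

text \<open>The functionals \<open>F\<close> for which \<open>v \<mapsto> F w\<close>, with \<open>(v, w)\<close> in the graph, extends to a bounded functional.\<close>

definition adjoint_domain :: "'v cnormed => ('v \<times> 'v) set => ('v => complex) set" where
 "adjoint_domain V G = {F \<in> vecs (dual V). \<exists>H\<in>vecs (dual V). \<forall>(v, w)\<in>G. F w = H v}"

definition linear_graph :: "'v cnormed => ('v \<times> 'v) set => bool" where
 "linear_graph V G \<longleftrightarrow> G \<subseteq> vecs V \<times> vecs V \<and> G \<noteq> {}
   \<and> (\<forall>v w v' w'. (v, w) \<in> G \<longrightarrow> (v', w') \<in> G \<longrightarrow> (vadd V v v', vadd V w w') \<in> G)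
   \<and> (\<forall>c v w. (v, w) \<in> G \<longrightarrow> (vscale V c v, vscale V c w) \<in> G)"

lemma linear_graphD:
 assumes "linear_graph V G"
 shows "(v, w) \<in> G ==> v \<in> vecs V" "(v, w) \<in> G ==> w \<in> vecs V" "G \<noteq> {}"
  "(v, w) \<in> G ==> (v', w') \<in> G ==> (vadd V v v', vadd V w w') \<in> G"
  "(v, w) \<in> G ==> (vscale V c v, vscale V c w) \<in> G"
 using assms unfolding linear_graph_def by blast+

lemma bidual_embed_dual:
 assumes V: "seminormed_space V" and v: "v \<in> vecs V"
 shows "bidual_embed V v \<in> vecs (dual (dual V))"
proof (rule dualI[where C="vnorm V v"])
 note DD = seminormed_spaceD[OF seminormed_dual[OF V]]
 show "bidual_embed V v \<in> extensional (vecs (dual V))" by (simp add: bidual_embed_def)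
 fix F assume F: "F \<in> vecs (dual V)"
 show "cmod (bidual_embed V v F) \<le> vnorm V v * vnorm (dual V) F"
  using dual_norm(2)[OF V F v] F by (simp add: bidual_embed_def mult.commute)
 show "bidual_embed V v (vscale (dual V) c F) = c * bidual_embed V v F" for c
  using F DD(7)[OF F] v by (simp add: bidual_embed_def dual_simps)
 fix H assume H: "H \<in> vecs (dual V)"
 show "bidual_embed V v (vadd (dual V) F H) = bidual_embed V v F + bidual_embed V v H"
  using F H DD(2)[OF F H] v by (simp add: bidual_embed_def dual_simps)
qed

lemma topspace_weak_star: "topspace (weak_star_topology D) = vecs (dual D)"
proof -
 have "vecs (dual D) \<subseteq> (\<Pi>\<^sub>E i\<in>vecs D. UNIV)" using dualD(1) by (auto simp: PiE_def)
 then show ?thesis unfolding weak_star_topology_def by (auto simp: topspace_subtopology topspace_product_topology)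
qed

lemma weak_star_evaluation:
 "F \<in> vecs D ==> continuous_map (weak_star_topology D) euclidean (\<lambda>Q. Q F)"
 unfolding weak_star_topology_def
 by (intro continuous_map_from_subtopology continuous_map_product_projection)

lemma weak_star_neighbourhood:
 assumes U: "openin (weak_star_topology D) U" and P: "P \<in> U"
 obtains I \<epsilon> where "finite I" "I \<subseteq> vecs D" "\<epsilon> > 0"
  "\<forall>P'\<in>vecs (dual D). (\<forall>F\<in>I. cmod (P' F - P F) < \<epsilon>) \<longrightarrow> P' \<in> U"
proof -
 obtain T where T: "openin (product_topology (\<lambda>_. euclidean) (vecs D)) T" "U = T \<inter> vecs (dual D)"
  using U unfolding weak_star_topology_def openin_subtopology by blast
 obtain B where B: "finite {i \<in> vecs D. B i \<noteq> (UNIV :: complex set)}" "\<And>i. i \<in> vecs D ==> open (B i)"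
  "P \<in> Pi\<^sub>E (vecs D) B" "Pi\<^sub>E (vecs D) B \<subseteq> T"
  using T(1) P unfolding T(2) openin_product_topology_alt by auto
 let ?I = "{i \<in> vecs D. B i \<noteq> UNIV}"
 have "\<exists>e>0. ball (P F) e \<subseteq> B F" if "F \<in> ?I" for F
  using B(2)[of F] B(3) that unfolding open_contains_ball by (auto simp: PiE_def Pi_def)
 then obtain e where e: "\<And>F. F \<in> ?I ==> e F > 0 \<and> ball (P F) (e F) \<subseteq> B F" by metis
 define \<epsilon> where "\<epsilon> = Min (insert 1 (e ` ?I))"
 have \<epsilon>: "\<epsilon> > 0" "\<And>F. F \<in> ?I ==> \<epsilon> \<le> e F" using B(1) e by (auto simp: \<epsilon>_def)
 show thesis
 proof (rule that[OF B(1) _ \<epsilon>(1)], goal_cases)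
  case 2
  show ?case
  proof (intro ballI impI)
  fix P' assume P': "P' \<in> vecs (dual D)" and "\<forall>F\<in>?I. cmod (P' F - P F) < \<epsilon>"
  then have P'2: "\<And>F. F \<in> ?I ==> cmod (P' F - P F) < \<epsilon>" by blast
  have "P' F \<in> B F" if F: "F \<in> vecs D" for F
  proof (cases "B F = UNIV")
   case False
   then have FI: "F \<in> ?I" using F by simp
   have "dist (P F) (P' F) < e F" using P'2[OF FI] \<epsilon>(2)[OF FI] by (simp add: dist_norm norm_minus_commute)
   then show ?thesis using e[OF FI] by (auto simp: mem_ball)
  qed simp
  then have "P' \<in> Pi\<^sub>E (vecs D) B" using dualD(1)[OF P'] by (auto simp: PiE_def)
  then show "P' \<in> U" using B(4) P' T(2) by blast
  qed
 qed auto
qed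

text \<open>If \<open>(P, Q)\<close> is in the closure and \<open>F\<close> has adjoint image \<open>H\<close>, then \<open>Q F = P H\<close>. So two limits \<open>Q\<close> over the same \<open>P\<close> agree on a norm dense set of functionals, hence everywhere.\<close>

theorem closable_if_adjoint_dense:
 assumes V: "seminormed_space V" and G: "G \<subseteq> vecs V \<times> vecs V"
  and dense: "\<And>F \<epsilon>. F \<in> vecs (dual V) ==> \<epsilon> > 0 ==> \<exists>F'\<in>adjoint_domain V G. \<forall>v\<in>vecs V. cmod (F v - F' v) \<le> \<epsilon> * vnorm V v"
 shows "wstar_closable_graph V G"
 unfolding wstar_closable_graph_def single_valued_def
proof (intro allI impI)
 let ?X = "prod_topology (weak_star_topology (dual V)) (weak_star_topology (dual V))"
 let ?E = "(\<lambda>(S, T). (bidual_embed V S, bidual_embed V T)) ` G"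
 note SD = seminormed_dual[OF V]
 fix P Q1 Q2 assume Q: "(P, Q1) \<in> ?X closure_of ?E" "(P, Q2) \<in> ?X closure_of ?E"
 have top: "topspace ?X = vecs (dual (dual V)) \<times> vecs (dual (dual V))" by (simp add: topspace_weak_star)
 have adj: "Q F = P H" if "(P, Q) \<in> ?X closure_of ?E" and F: "F \<in> vecs (dual V)" and H: "H \<in> vecs (dual V)"
   and FH: "\<forall>(v, w)\<in>G. F w = H v" for P Q F H
 proof -
  have c1: "continuous_map ?X euclidean (\<lambda>p. snd p F)"
   using continuous_map_compose[OF continuous_map_snd weak_star_evaluation[OF F]] by (simp add: comp_def)
  have c2: "continuous_map ?X euclidean (\<lambda>p. fst p H)"
   using continuous_map_compose[OF continuous_map_fst weak_star_evaluation[OF H]] by (simp add: comp_def)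
  have "closedin ?X {p \<in> topspace ?X. snd p F = fst p H}"
   by (rule closedin_continuous_maps_eq[OF _ c1 c2]) simp
  moreover have "?E \<subseteq> {p \<in> topspace ?X. snd p F = fst p H}"
  proof
   fix p assume "p \<in> ?E"
   then obtain v w where vw: "(v, w) \<in> G" "p = (bidual_embed V v, bidual_embed V w)" by auto
   have "bidual_embed V v \<in> vecs (dual (dual V))" "bidual_embed V w \<in> vecs (dual (dual V))"
    using bidual_embed_dual[OF V] vw(1) G by blast+
   moreover have "F w = H v" using FH vw(1) by blast
   ultimately show "p \<in> {p \<in> topspace ?X. snd p F = fst p H}" using F H unfolding mem_Collect_eq top vw(2) by (simp add: bidual_embed_def)
  qed
  ultimately have "?X closure_of ?E \<subseteq> {p \<in> topspace ?X. snd p F = fst p H}" by (rule closure_of_minimal[rotated])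
  then show ?thesis using that(1) by auto
 qed
 have mem: "Q1 \<in> vecs (dual (dual V))" "Q2 \<in> vecs (dual (dual V))"
  using Q closure_of_subset_topspace[of ?X ?E] unfolding top by auto
 show "Q1 = Q2"
 proof (rule extensionalityI[OF dualD(1)[OF mem(1)] dualD(1)[OF mem(2)]])
  fix F assume F: "F \<in> vecs (dual V)"
  define C where "C = vnorm (dual (dual V)) Q1 + vnorm (dual (dual V)) Q2"
  have C: "C \<ge> 0" unfolding C_def using dual_norm(1)[OF SD mem(1)] dual_norm(1)[OF SD mem(2)] by simp
  have le: "cmod (Q1 F - Q2 F) \<le> C * \<epsilon>" if e: "\<epsilon> > 0" for \<epsilon>
  proof -
   obtain F' where F': "F' \<in> adjoint_domain V G" "\<forall>v\<in>vecs V. cmod (F v - F' v) \<le> \<epsilon> * vnorm V v"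
    using dense[OF F e] by blast
   obtain H where H: "F' \<in> vecs (dual V)" "H \<in> vecs (dual V)" "\<forall>(v, w)\<in>G. F' w = H v"
    using F'(1) unfolding adjoint_domain_def by blast
   have eq: "Q1 F' = Q2 F'" using adj[OF Q(1) H] adj[OF Q(2) H] by simp
   define D where "D = vadd (dual V) F (vscale (dual V) (- 1) F')"
   have sF': "vscale (dual V) (- 1) F' \<in> vecs (dual V)" by (rule seminormed_spaceD(7)[OF SD H(1)])
   have D: "D \<in> vecs (dual V)" unfolding D_def by (rule seminormed_spaceD(2)[OF SD F sF'])
   have "vnorm (dual V) D \<le> \<epsilon>"
    by (rule dual_norm(3)[OF V D]) (use F'(2) e in \<open>simp_all add: D_def dual_simps\<close>)
   have QD: "Q D = Q F - Q F'" if "Q \<in> vecs (dual (dual V))" for Q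
    unfolding D_def dualD(2)[OF that F sF'] dualD(3)[OF that H(1)] by simp
   have "cmod (Q D) \<le> vnorm (dual (dual V)) Q * \<epsilon>" if "Q \<in> vecs (dual (dual V))" for Q
    using dual_norm(2)[OF SD that D] mult_left_mono[OF \<open>vnorm (dual V) D \<le> \<epsilon>\<close> dual_norm(1)[OF SD that]] by linarith
   from this[OF mem(1)] this[OF mem(2)] have "cmod (Q1 D) + cmod (Q2 D) \<le> C * \<epsilon>"
    by (simp add: C_def distrib_right)
   moreover have "Q1 F - Q2 F = Q1 D - Q2 D" using eq by (simp add: QD mem)
   ultimately show ?thesis using norm_triangle_ineq4[of "Q1 D" "Q2 D"] by simp
  qed
  have "cmod (Q1 F - Q2 F) \<le> 0 + \<epsilon>" if "\<epsilon> > 0" for \<epsilon>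
  proof -
   have "cmod (Q1 F - Q2 F) \<le> C * (\<epsilon> / (C + 1))" by (rule le) (use that C in simp)
   also have "\<dots> = \<epsilon> * (C / (C + 1))" by simp
   also have "\<dots> \<le> \<epsilon> * 1" using C that by (intro mult_left_mono) auto
   finally show ?thesis by simp
  qed
  then have "cmod (Q1 F - Q2 F) \<le> 0" by (rule field_le_epsilon)
  then show "Q1 F = Q2 F" by simp
 qed
qed

text \<open>If no such pair existed, the finite vectors of values \<open>(H v, F w)\<close> would miss the target \<open>(0, Q F)\<close>, and a linear functional separating them would produce a combination \<open>F\<close> of \<open>J\<close> in the adjoint domain with \<open>Q F \<noteq> 0\<close>.\<close>

lemma graph_weakly_dense:
 assumes V: "seminormed_space V" and G: "linear_graph V G"
  and Q: "Q \<in> vecs (dual (dual V))" and kill: "\<And>F. F \<in> adjoint_domain V G ==> Q F = 0"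
  and I: "finite I" "I \<subseteq> vecs (dual V)" and J: "finite J" "J \<subseteq> vecs (dual V)" and \<epsilon>: "\<epsilon> > 0"
 obtains v w where "(v, w) \<in> G" "\<And>H. H \<in> I ==> cmod (H v) < \<epsilon>" "\<And>F. F \<in> J ==> cmod (F w - Q F) < \<epsilon>"
proof -
 note VD = seminormed_spaceD[OF V] and GD = linear_graphD[OF G]
 define x where "x = (\<lambda>(v, w) i. case i of Inl H => if H \<in> I then H v else 0 | Inr F => if F \<in> J then F w else (0 :: complex))"
 define z where "z = (\<lambda>i :: ('a => complex) + ('a => complex). case i of Inl H => 0 | Inr F => if F \<in> J then Q F else (0 :: complex))"
 define p where "p f = (\<Sum>i\<in>Inl ` I \<union> Inr ` J. cmod (f i))" for f :: "('a => complex) + ('a => complex) => complex"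
 have fin: "finite (Inl ` I \<union> Inr ` J)" using I J by simp
 have UV: "complex_subspace (UNIV :: (('a => complex) + ('a => complex) => complex) set)" by (simp add: complex_subspace_def)
 have p: "seminorm_on UNIV p" unfolding seminorm_on_def p_def
  by (auto simp: norm_mult sum_distrib_left sum.distrib[symmetric] intro!: sum_mono norm_triangle_ineq)
 have add: "(\<lambda>i. x (v, w) i + x (v', w') i) = x (vadd V v v', vadd V w w')" if "(v, w) \<in> G" "(v', w') \<in> G" for v w v' w'
 proof
  fix i show "x (v, w) i + x (v', w') i = x (vadd V v v', vadd V w w') i"
   using dualD(2)[of _ V v v'] dualD(2)[of _ V w w'] GD(1,2)[OF that(1)] GD(1,2)[OF that(2)] I(2) J(2)
   by (auto simp: x_def split: sum.split)
 qed
 have sc: "(\<lambda>i. c * x (v, w) i) = x (vscale V c v, vscale V c w)" if "(v, w) \<in> G" for v w c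
 proof
  fix i show "c * x (v, w) i = x (vscale V c v, vscale V c w) i"
   using dualD(3)[of _ V v c] dualD(3)[of _ V w c] GD(1,2)[OF that] I(2) J(2)
   by (auto simp: x_def split: sum.split)
 qed
 have W: "complex_subspace (x ` G)" unfolding complex_subspace_def
 proof (intro conjI ballI allI)
  obtain v w where vw: "(v, w) \<in> G" using GD(3) by fastforce
  have "(\<lambda>i. 0) = x (vscale V 0 v, vscale V 0 w)" using sc[OF vw, of 0] by simp
  then show "(\<lambda>_. 0) \<in> x ` G" using GD(5)[OF vw, of 0] by (rule image_eqI)
  fix f assume "f \<in> x ` G"
  then obtain v w where f: "f = x (v, w)" "(v, w) \<in> G" by auto
  show "(\<lambda>i. c * f i) \<in> x ` G" for c unfolding f(1) sc[OF f(2)] by (rule imageI[OF GD(5)[OF f(2)]])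
  fix g assume "g \<in> x ` G"
  then obtain v' w' where g: "g = x (v', w')" "(v', w') \<in> G" by auto
  show "(\<lambda>i. f i + g i) \<in> x ` G" unfolding f(1) g(1) add[OF f(2) g(2)] by (rule imageI[OF GD(4)[OF f(2) g(2)]])
 qed
 have "\<exists>f\<in>x ` G. p (\<lambda>i. z i - f i) < \<epsilon>"
 proof (rule ccontr)
  assume "\<not> ?thesis"
  then have far: "\<And>f. f \<in> x ` G ==> \<epsilon> \<le> p (\<lambda>i. z i - f i)" by (meson not_le)
  obtain l where l: "linear_on_space UNIV l" "\<And>f. f \<in> UNIV ==> cmod (l f) \<le> p f" "\<And>f. f \<in> x ` G ==> l f = 0" "l z \<noteq> 0"
   by (rule hahn_banach_distance[OF UV p UNIV_I[of z] W subset_UNIV \<epsilon> far], assumption, rule that)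
  have lp: "cmod (l f) \<le> p f" for f by (rule l(2)) simp
  define \<delta> where "\<delta> i = (\<lambda>j. if j = i then 1 else 0 :: complex)" for i :: "('a => complex) + ('a => complex)"
  have expand: "l (\<lambda>j. \<Sum>i\<in>S. f i * \<delta> i j) = (\<Sum>i\<in>S. f i * l (\<delta> i))" if "finite S" for S f
   using that
  proof (induction S)
   case empty
   have "l (\<lambda>z. 0 * (\<lambda>_. 0) z) = 0 * l (\<lambda>_. 0)" by (rule linear_on_space_scale[OF l(1)]) simp
   then show ?case by simp
  next
   case (insert i S)
   have "l (\<lambda>j. f i * \<delta> i j + (\<Sum>i\<in>S. f i * \<delta> i j)) = l (\<lambda>j. f i * \<delta> i j) + l (\<lambda>j. \<Sum>i\<in>S. f i * \<delta> i j)"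
    by (rule linear_on_space_add[OF l(1)]) auto
   moreover have "l (\<lambda>j. f i * \<delta> i j) = f i * l (\<delta> i)" by (rule linear_on_space_scale[OF l(1)]) simp
   ultimately show ?case using insert by simp
  qed
  have lf: "l f = (\<Sum>H\<in>I. f (Inl H) * l (\<delta> (Inl H))) + (\<Sum>F\<in>J. f (Inr F) * l (\<delta> (Inr F)))" for f
  proof -
   let ?g = "\<lambda>j. \<Sum>i\<in>Inl ` I \<union> Inr ` J. f i * \<delta> i j"
   have gf: "?g j = f j" if "j \<in> Inl ` I \<union> Inr ` J" for j
   proof -
    have "?g j = (\<Sum>i\<in>Inl ` I \<union> Inr ` J. if j = i then f i else 0)" by (intro sum.cong) (auto simp: \<delta>_def)
    then show ?thesis using fin that by simp
   qed
   have "p (\<lambda>j. f j - ?g j) = 0" unfolding p_def by (intro sum.neutral ballI) (simp only: gf diff_self norm_zero)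
   then have "l (\<lambda>j. f j - ?g j) = 0" using lp[of "\<lambda>j. f j - ?g j"] by simp
   moreover have "l (\<lambda>j. (f j - ?g j) + ?g j) = l (\<lambda>j. f j - ?g j) + l ?g" by (rule linear_on_space_add[OF l(1)]) auto
   ultimately have "l f = l ?g" by simp
   also have "\<dots> = (\<Sum>i\<in>Inl ` I \<union> Inr ` J. f i * l (\<delta> i))" by (rule expand[OF fin])
   also have "\<dots> = (\<Sum>i\<in>Inl ` I. f i * l (\<delta> i)) + (\<Sum>i\<in>Inr ` J. f i * l (\<delta> i))"
    by (rule sum.union_disjoint) (use I J in auto)
   also have "\<dots> = (\<Sum>H\<in>I. f (Inl H) * l (\<delta> (Inl H))) + (\<Sum>F\<in>J. f (Inr F) * l (\<delta> (Inr F)))"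
    by (simp add: sum.reindex)
   finally show ?thesis .
  qed
  define F' where "F' = dual_combination V J (\<lambda>F. l (\<delta> (Inr F)))"
  define H' where "H' = dual_combination V I (\<lambda>H. - l (\<delta> (Inl H)))"
  have F': "F' \<in> vecs (dual V)" "Q F' = (\<Sum>F\<in>J. l (\<delta> (Inr F)) * Q F)"
   unfolding F'_def using dual_combination[OF V J] Q by blast+
  have H': "H' \<in> vecs (dual V)" unfolding H'_def by (rule dual_combination(1)[OF V I])
  have "F' w = H' v" if vw: "(v, w) \<in> G" for v w
  proof -
   have "l (x (v, w)) = 0" using l(3) vw by blast
   then have "(\<Sum>H\<in>I. H v * l (\<delta> (Inl H))) + (\<Sum>F\<in>J. F w * l (\<delta> (Inr F))) = 0"
    using lf[of "x (v, w)"] by (simp add: x_def)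
   then show ?thesis using GD(1,2)[OF vw]
    by (simp add: F'_def H'_def dual_combination_def sum_negf mult.commute eq_neg_iff_add_eq_0 add.commute)
  qed
  then have "F' \<in> adjoint_domain V G" unfolding adjoint_domain_def using F'(1) H' by blast
  then have "Q F' = 0" by (rule kill)
  moreover have "l z = Q F'" using lf[of z] F'(2) by (simp add: z_def mult.commute)
  ultimately show False using l(4) by simp
 qed
 then obtain v w where vw: "(v, w) \<in> G" "p (\<lambda>i. z i - x (v, w) i) < \<epsilon>" by auto
 have le: "cmod (z i - x (v, w) i) < \<epsilon>" if "i \<in> Inl ` I \<union> Inr ` J" for i
 proof -
  have "cmod (z i - x (v, w) i) \<le> p (\<lambda>i. z i - x (v, w) i)"
   unfolding p_def by (rule member_le_sum[OF that]) (use fin in auto)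
  then show ?thesis using vw(2) by simp
 qed
 show thesis
 proof (rule that[OF vw(1)])
  show "cmod (H v) < \<epsilon>" if "H \<in> I" for H using le[of "Inl H"] that by (simp add: z_def x_def)
  show "cmod (F w - Q F) < \<epsilon>" if "F \<in> J" for F using le[of "Inr F"] that by (simp add: z_def x_def norm_minus_commute)
 qed
qed

text \<open>Otherwise Hahn-Banach in the dual gives a nonzero \<open>Q\<close> in the bidual that vanishes on the adjoint domain, and \<open>(0, Q)\<close> lies in the weak* closure of the graph by the preceding lemma.\<close>

theorem adjoint_dense_if_closable:
 assumes V: "seminormed_space V" and G: "linear_graph V G" and cl: "wstar_closable_graph V G"
  and F0: "F0 \<in> vecs (dual V)" and \<epsilon>: "\<epsilon> > 0"
 shows "\<exists>F\<in>adjoint_domain V G. \<forall>v\<in>vecs V. cmod (F0 v - F v) \<le> \<epsilon> * vnorm V v"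
proof (rule ccontr)
 assume no: "\<not> ?thesis"
 note VD = seminormed_spaceD[OF V] and GD = linear_graphD[OF G] and SD = seminormed_dual[OF V]
 note DD = seminormed_spaceD[OF SD]
 define \<phi> where "\<phi> F v = (if v \<in> vecs V then F v else 0)" for F :: "'a => complex" and v
 define p where "p f = vnorm (dual V) (restrict f (vecs V))" for f :: "'a => complex"
 have res: "restrict (\<phi> F) (vecs V) = F" if "F \<in> vecs (dual V)" for F
  by (rule extensionalityI[of _ "vecs V"]) (use dualD(1)[OF that] in \<open>auto simp: \<phi>_def\<close>)
 have add: "(\<lambda>v. \<phi> F v + \<phi> H v) = \<phi> (vadd (dual V) F H)" for F H
  by (auto simp: \<phi>_def dual_simps)
 have sc: "(\<lambda>v. c * \<phi> F v) = \<phi> (vscale (dual V) c F)" for c F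
  by (auto simp: \<phi>_def dual_simps)
 have sub: "complex_subspace (\<phi> ` S)" if S: "S \<subseteq> vecs (dual V)" "S \<noteq> {}" "\<And>F H. F \<in> S ==> H \<in> S ==> vadd (dual V) F H \<in> S"
   "\<And>c F. F \<in> S ==> vscale (dual V) c F \<in> S" for S
  unfolding complex_subspace_def
 proof (intro conjI ballI allI)
  obtain F where F: "F \<in> S" using S(2) by blast
  have "(\<lambda>_. 0) = \<phi> (vscale (dual V) 0 F)" by (auto simp: \<phi>_def dual_simps)
  then show "(\<lambda>_. 0) \<in> \<phi> ` S" using S(4)[OF F, of 0] by (rule image_eqI)
  fix f assume "f \<in> \<phi> ` S"
  then obtain F where f: "f = \<phi> F" "F \<in> S" by auto
  show "(\<lambda>i. c * f i) \<in> \<phi> ` S" for c unfolding f(1) sc by (rule imageI[OF S(4)[OF f(2)]])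
  fix g assume "g \<in> \<phi> ` S"
  then obtain H where g: "g = \<phi> H" "H \<in> S" by auto
  show "(\<lambda>i. f i + g i) \<in> \<phi> ` S" unfolding f(1) g(1) add by (rule imageI[OF S(3)[OF f(2) g(2)]])
 qed
 have subV: "complex_subspace (\<phi> ` vecs (dual V))" by (rule sub) (use DD(1,2,7) in auto)
 have adjI: "F \<in> adjoint_domain V G" if "F \<in> vecs (dual V)" "H \<in> vecs (dual V)" "\<And>v w. (v, w) \<in> G ==> F w = H v" for F H
  using that unfolding adjoint_domain_def by blast
 have adjE: "\<exists>H\<in>vecs (dual V). F \<in> vecs (dual V) \<and> (\<forall>v w. (v, w) \<in> G \<longrightarrow> F w = H v)" if "F \<in> adjoint_domain V G" for F
  using that unfolding adjoint_domain_def by blast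
 have subA: "complex_subspace (\<phi> ` adjoint_domain V G)"
 proof (rule sub)
  show "adjoint_domain V G \<subseteq> vecs (dual V)" by (auto simp: adjoint_domain_def)
  obtain F where F: "F \<in> vecs (dual V)" using DD(1) by blast
  have "vscale (dual V) 0 F \<in> adjoint_domain V G"
   by (rule adjI[OF DD(7)[OF F] DD(7)[OF F]]) (use GD(1,2) in \<open>auto simp: dual_simps\<close>)
  then show "adjoint_domain V G \<noteq> {}" by blast
  fix F assume F: "F \<in> adjoint_domain V G"
  obtain F' where F': "F' \<in> vecs (dual V)" "F \<in> vecs (dual V)" "\<And>v w. (v, w) \<in> G ==> F w = F' v" using adjE[OF F] by blast
  show "vscale (dual V) c F \<in> adjoint_domain V G" for c
   by (rule adjI[OF DD(7)[OF F'(2)] DD(7)[OF F'(1)]]) (use GD(1,2) F'(3) in \<open>auto simp: dual_simps\<close>)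
  fix H assume H: "H \<in> adjoint_domain V G"
  obtain H' where H': "H' \<in> vecs (dual V)" "H \<in> vecs (dual V)" "\<And>v w. (v, w) \<in> G ==> H w = H' v" using adjE[OF H] by blast
  show "vadd (dual V) F H \<in> adjoint_domain V G"
   by (rule adjI[OF DD(2)[OF F'(2) H'(2)] DD(2)[OF F'(1) H'(1)]]) (use GD(1,2) F'(3) H'(3) in \<open>auto simp: dual_simps\<close>)
 qed
 have p: "seminorm_on (\<phi> ` vecs (dual V)) p" unfolding seminorm_on_def
 proof (intro conjI ballI allI)
  fix f assume "f \<in> \<phi> ` vecs (dual V)"
  then obtain F where f: "f = \<phi> F" "F \<in> vecs (dual V)" by auto
  show "p (\<lambda>i. c * f i) = cmod c * p f" for c
   unfolding f(1) sc p_def res[OF DD(7)[OF f(2)]] res[OF f(2)] by (rule DD(8)[OF f(2)])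
  fix g assume "g \<in> \<phi> ` vecs (dual V)"
  then obtain H where g: "g = \<phi> H" "H \<in> vecs (dual V)" by auto
  show "p (\<lambda>i. f i + g i) \<le> p f + p g"
   unfolding f(1) g(1) add p_def res[OF DD(2)[OF f(2) g(2)]] res[OF f(2)] res[OF g(2)] by (rule DD(4)[OF f(2) g(2)])
 qed
 have far: "\<epsilon> \<le> p (\<lambda>v. \<phi> F0 v - f v)" if f: "f \<in> \<phi> ` adjoint_domain V G" for f
 proof (rule ccontr)
  assume near: "\<not> ?thesis"
  obtain F where F: "f = \<phi> F" "F \<in> adjoint_domain V G" using f by auto
  have Fd: "F \<in> vecs (dual V)" using F(2) by (simp add: adjoint_domain_def)
  define D where "D = vadd (dual V) F0 (vscale (dual V) (- 1) F)"
  have D: "D \<in> vecs (dual V)" unfolding D_def by (rule DD(2)[OF F0 DD(7)[OF Fd]])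
  have "(\<lambda>v. \<phi> F0 v - f v) = \<phi> D" by (auto simp: F(1) \<phi>_def D_def dual_simps)
  then have n: "vnorm (dual V) D \<le> \<epsilon>" using near by (simp add: p_def res[OF D])
  have "cmod (F0 v - F v) \<le> \<epsilon> * vnorm V v" if v: "v \<in> vecs V" for v
   using dual_norm(2)[OF V D v] mult_right_mono[OF n VD(10)[OF v]] v by (simp add: D_def dual_simps)
  then show False using no F(2) by blast
 qed
 have AV: "\<phi> ` adjoint_domain V G \<subseteq> \<phi> ` vecs (dual V)" by (auto simp: adjoint_domain_def)
 obtain l where l: "linear_on_space (\<phi> ` vecs (dual V)) l" "\<And>f. f \<in> \<phi> ` vecs (dual V) ==> cmod (l f) \<le> p f"
  "\<And>f. f \<in> \<phi> ` adjoint_domain V G ==> l f = 0" "l (\<phi> F0) \<noteq> 0"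
  by (rule hahn_banach_distance[OF subV p imageI[OF F0] subA AV \<epsilon> far], assumption, rule that)
 define Q where "Q = (\<lambda>F\<in>vecs (dual V). l (\<phi> F))"
 have Q: "Q \<in> vecs (dual (dual V))"
 proof (rule dualI[where C=1])
  show "Q \<in> extensional (vecs (dual V))" by (simp add: Q_def)
  fix F assume F: "F \<in> vecs (dual V)"
  show "cmod (Q F) \<le> 1 * vnorm (dual V) F" using l(2)[OF imageI[OF F]] F by (simp add: Q_def p_def res)
  show "Q (vscale (dual V) c F) = c * Q F" for c
   using linear_on_space_scale[OF l(1) imageI[OF F], of c] F DD(7)[OF F] by (simp add: Q_def sc)
  fix H assume H: "H \<in> vecs (dual V)"
  show "Q (vadd (dual V) F H) = Q F + Q H"
   using linear_on_space_add[OF l(1) imageI[OF F] imageI[OF H]] F H DD(2)[OF F H] by (simp add: Q_def add)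
 qed
 have kill: "Q F = 0" if "F \<in> adjoint_domain V G" for F
  using l(3)[OF imageI[OF that]] that by (simp add: Q_def adjoint_domain_def)
 define Z where "Z = vscale (dual (dual V)) 0 Q"
 have Z: "Z \<in> vecs (dual (dual V))" unfolding Z_def by (rule seminormed_spaceD(7)[OF seminormed_dual[OF SD] Q])
 have Z0: "Z F = 0" if "F \<in> vecs (dual V)" for F using that by (simp add: Z_def dual_simps)
 let ?X = "prod_topology (weak_star_topology (dual V)) (weak_star_topology (dual V))"
 let ?E = "(\<lambda>(S, T). (bidual_embed V S, bidual_embed V T)) ` G"
 have top: "topspace ?X = vecs (dual (dual V)) \<times> vecs (dual (dual V))" by (simp add: topspace_weak_star)
 have closure: "(Z, R) \<in> ?X closure_of ?E" if R: "R \<in> vecs (dual (dual V))" and killR: "\<And>F. F \<in> adjoint_domain V G ==> R F = 0" for R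
  unfolding in_closure_of
 proof (intro conjI allI impI)
  show "(Z, R) \<in> topspace ?X" using Z R unfolding top by blast
  fix T assume T: "(Z, R) \<in> T \<and> openin ?X T"
  then obtain A B where AB: "openin (weak_star_topology (dual V)) A" "openin (weak_star_topology (dual V)) B" "Z \<in> A" "R \<in> B" "A \<times> B \<subseteq> T"
   unfolding openin_prod_topology_alt by blast
  obtain I e where I: "finite I" "I \<subseteq> vecs (dual V)" "e > 0"
   "\<forall>P'\<in>vecs (dual (dual V)). (\<forall>F\<in>I. cmod (P' F - Z F) < e) \<longrightarrow> P' \<in> A"
   by (rule weak_star_neighbourhood[OF AB(1,3)], rule that)
  obtain J d where J: "finite J" "J \<subseteq> vecs (dual V)" "d > 0"
   "\<forall>P'\<in>vecs (dual (dual V)). (\<forall>F\<in>J. cmod (P' F - R F) < d) \<longrightarrow> P' \<in> B"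
   by (rule weak_star_neighbourhood[OF AB(2,4)], rule that)
  have ed: "min e d > 0" using I(3) J(3) by simp
  obtain v w where vw: "(v, w) \<in> G" "\<And>H. H \<in> I ==> cmod (H v) < min e d" "\<And>F. F \<in> J ==> cmod (F w - R F) < min e d"
   by (rule graph_weakly_dense[OF V G R killR I(1,2) J(1,2) ed], assumption, rule that)
  note v = GD(1)[OF vw(1)] and w = GD(2)[OF vw(1)]
  have "bidual_embed V v \<in> A"
  proof (rule I(4)[rule_format, OF bidual_embed_dual[OF V v]])
   fix F assume F: "F \<in> I"
   then have Fd: "F \<in> vecs (dual V)" using I(2) by blast
   show "cmod (bidual_embed V v F - Z F) < e" using vw(2)[OF F] Fd by (simp add: bidual_embed_def Z0)
  qed
  moreover have "bidual_embed V w \<in> B"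
  proof (rule J(4)[rule_format, OF bidual_embed_dual[OF V w]])
   fix F assume F: "F \<in> J"
   then have Fd: "F \<in> vecs (dual V)" using J(2) by blast
   show "cmod (bidual_embed V w F - R F) < d" using vw(3)[OF F] Fd by (simp add: bidual_embed_def)
  qed
  ultimately have "(bidual_embed V v, bidual_embed V w) \<in> T" using AB(5) by blast
  moreover have "(bidual_embed V v, bidual_embed V w) \<in> ?E" using vw(1) by force
  ultimately show "\<exists>y. y \<in> ?E \<and> y \<in> T" by blast
 qed
 have "(Z, Q) \<in> ?X closure_of ?E" by (rule closure[OF Q kill])
 moreover have "(Z, Z) \<in> ?X closure_of ?E"
  by (rule closure[OF Z]) (simp add: Z0 adjoint_domain_def)
 ultimately have "Q = Z" using cl unfolding wstar_closable_graph_def single_valued_def by blast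
 then have "Q F0 = 0" using Z0[OF F0] by simp
 moreover have "Q F0 = l (\<phi> F0)" using F0 by (simp add: Q_def)
 ultimately show False using l(4) by simp
qed

section \<open>Square integrable functions as a seminormed space and integral operators\<close>

lemma ae_class_eq_iff:
 assumes "f \<in> borel_measurable M" "g \<in> borel_measurable M"
 shows "ae_class M f = ae_class M g \<longleftrightarrow> (AE x in M. f x = g x)"
proof
 assume "ae_class M f = ae_class M g"
 moreover have "f \<in> ae_class M f" using assms by (simp add: ae_class_def)
 ultimately show "AE x in M. f x = g x" by (simp add: ae_class_def)
next
 assume eq: "AE x in M. f x = g x"
 have "(AE x in M. h x = f x) \<longleftrightarrow> (AE x in M. h x = g x)" for h
 proof
  assume "AE x in M. h x = f x" with eq show "AE x in M. h x = g x" by eventually_elim simp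
 next
  assume "AE x in M. h x = g x" with eq show "AE x in M. h x = f x" by eventually_elim simp
 qed
 then show "ae_class M f = ae_class M g" by (simp add: ae_class_def)
qed

lemma rep_ae_class:
 assumes "f \<in> borel_measurable M"
 shows "rep (ae_class M f) \<in> borel_measurable M" "AE x in M. rep (ae_class M f) x = f x"
proof -
 have "f \<in> ae_class M f" using assms by (simp add: ae_class_def)
 then have "rep (ae_class M f) \<in> ae_class M f" unfolding rep_def by (rule someI[of "\<lambda>h. h \<in> ae_class M f"])
 then show "rep (ae_class M f) \<in> borel_measurable M" "AE x in M. rep (ae_class M f) x = f x"
  by (simp_all add: ae_class_def)
qed

lemma L2_simps:
 "vecs (L2 M) = ae_class M ` sq M" "vadd (L2 M) = (\<lambda>A B. ae_class M (\<lambda>x. rep A x + rep B x))"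
 "vscale (L2 M) = (\<lambda>c A. ae_class M (\<lambda>x. c * rep A x))" "vnorm (L2 M) A = l2norm M (rep A)"
 by (simp_all add: L2_def l2norm_def)

lemma L2_memI: "f \<in> sq M ==> ae_class M f \<in> vecs (L2 M)"
 by (simp add: L2_simps)

lemma L2_memE:
 assumes "A \<in> vecs (L2 M)"
 obtains f where "f \<in> sq M" "A = ae_class M f"
 using assms by (auto simp: L2_simps)

lemma rep_sq: "f \<in> sq M ==> rep (ae_class M f) \<in> sq M"
 using rep_ae_class[OF sqD(1), of f M] sq_cong_AE by blast

lemma L2_rep:
 assumes "A \<in> vecs (L2 M)"
 shows "rep A \<in> sq M" "ae_class M (rep A) = A"
proof -
 obtain f where f: "f \<in> sq M" "A = ae_class M f" using assms by (rule L2_memE)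
 show "rep A \<in> sq M" unfolding f(2) by (rule rep_sq[OF f(1)])
 show "ae_class M (rep A) = A" unfolding f(2)
  using ae_class_eq_iff[OF rep_ae_class(1)[OF sqD(1)[OF f(1)]] sqD(1)[OF f(1)]] rep_ae_class(2)[OF sqD(1)[OF f(1)]] by blast
qed

lemma L2_add:
 assumes "f \<in> sq M" "g \<in> sq M"
 shows "vadd (L2 M) (ae_class M f) (ae_class M g) = ae_class M (\<lambda>x. f x + g x)"
proof -
 have "AE x in M. rep (ae_class M f) x + rep (ae_class M g) x = f x + g x"
  using rep_ae_class(2)[OF sqD(1)[OF assms(1)]] rep_ae_class(2)[OF sqD(1)[OF assms(2)]] by eventually_elim simp
 then show ?thesis unfolding L2_simps
  by (subst ae_class_eq_iff[OF sqD(1)[OF sq_add[OF rep_sq[OF assms(1)] rep_sq[OF assms(2)]]] sqD(1)[OF sq_add[OF assms]]])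
qed

lemma L2_scale:
 assumes "f \<in> sq M"
 shows "vscale (L2 M) c (ae_class M f) = ae_class M (\<lambda>x. c * f x)"
proof -
 have "AE x in M. c * rep (ae_class M f) x = c * f x"
  using rep_ae_class(2)[OF sqD(1)[OF assms]] by eventually_elim simp
 then show ?thesis unfolding L2_simps
  by (subst ae_class_eq_iff[OF sqD(1)[OF sq_scale[OF rep_sq[OF assms]]] sqD(1)[OF sq_scale[OF assms]]])
qed

lemma L2_norm: "f \<in> sq M ==> vnorm (L2 M) (ae_class M f) = l2norm M f"
 unfolding L2_simps using rep_ae_class[OF sqD(1)] by (intro l2norm_cong_AE) (auto dest: sqD)

lemma L2_dist: "f \<in> sq M ==> g \<in> sq M ==> vdist (L2 M) (ae_class M f) (ae_class M g) = l2norm M (\<lambda>x. f x - g x)"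
 unfolding vdist_def using L2_scale[of g M "-1"] L2_add[of f M "\<lambda>x. - g x"] L2_norm[OF sq_diff, of f M g] by simp

lemma seminormed_L2: "seminormed_space (L2 M)"
 unfolding seminormed_space_def
proof (intro conjI ballI allI)
 show "vecs (L2 M) \<noteq> {}" using L2_memI[OF sq_zero] by blast
 fix A assume "A \<in> vecs (L2 M)"
 then obtain f where f: "f \<in> sq M" "A = ae_class M f" by (rule L2_memE)
 note fs = sq_scale[OF f(1)]
 show "vnorm (L2 M) A \<ge> 0" by (simp add: f(2) L2_norm[OF f(1)])
 show "vscale (L2 M) 1 A = A" by (simp add: f(2) L2_scale[OF f(1)])
 fix c :: complex
 show "vscale (L2 M) c A \<in> vecs (L2 M)" unfolding f(2) L2_scale[OF f(1)] by (rule L2_memI[OF fs])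
 show "vnorm (L2 M) (vscale (L2 M) c A) = cmod c * vnorm (L2 M) A"
  unfolding f(2) L2_scale[OF f(1)] L2_norm[OF fs] L2_norm[OF f(1)] by (rule l2norm_scale)
 show "vscale (L2 M) c (vscale (L2 M) d A) = vscale (L2 M) (c * d) A" for d
  unfolding f(2) L2_scale[OF f(1)] L2_scale[OF fs] by (simp only: mult.assoc)
 show "vadd (L2 M) (vscale (L2 M) c A) (vscale (L2 M) d A) = vscale (L2 M) (c + d) A" for d
  unfolding f(2) L2_scale[OF f(1)] L2_add[OF fs fs] by (simp only: distrib_right)
 fix B assume "B \<in> vecs (L2 M)"
 then obtain g where g: "g \<in> sq M" "B = ae_class M g" by (rule L2_memE)
 note gs = sq_scale[OF g(1)] and fg = sq_add[OF f(1) g(1)]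
 show "vadd (L2 M) A B \<in> vecs (L2 M)" unfolding f(2) g(2) L2_add[OF f(1) g(1)] by (rule L2_memI[OF fg])
 show "vadd (L2 M) A B = vadd (L2 M) B A" unfolding f(2) g(2) L2_add[OF f(1) g(1)] L2_add[OF g(1) f(1)] by (simp only: add.commute)
 show "vnorm (L2 M) (vadd (L2 M) A B) \<le> vnorm (L2 M) A + vnorm (L2 M) B"
  unfolding f(2) g(2) L2_add[OF f(1) g(1)] L2_norm[OF fg] L2_norm[OF f(1)] L2_norm[OF g(1)] by (rule l2norm_triangle[OF f(1) g(1)])
 show "vscale (L2 M) d (vadd (L2 M) A B) = vadd (L2 M) (vscale (L2 M) d A) (vscale (L2 M) d B)" for d
  unfolding f(2) g(2) L2_add[OF f(1) g(1)] L2_scale[OF fg] L2_scale[OF f(1)] L2_scale[OF g(1)] L2_add[OF fs gs]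
  by (simp only: distrib_left)
 fix C assume "C \<in> vecs (L2 M)"
 then obtain h where h: "h \<in> sq M" "C = ae_class M h" by (rule L2_memE)
 show "vadd (L2 M) (vadd (L2 M) A B) C = vadd (L2 M) A (vadd (L2 M) B C)"
  unfolding f(2) g(2) h(2) L2_add[OF f(1) g(1)] L2_add[OF g(1) h(1)] L2_add[OF fg h(1)] L2_add[OF f(1) sq_add[OF g(1) h(1)]]
  by (simp only: add.assoc)
qed

definition kernel_apply :: "'a measure => ('a \<times> 'b => complex) => ('a => complex) => 'b => complex" where
 "kernel_apply M k f y = (LINT x|M. k (x, y) * f x)"

context
 fixes M :: "'a measure" and N :: "'b measure"
 assumes M: "sigma_finite_measure M" and N: "sigma_finite_measure N"
begin

interpretation MN: pair_sigma_finite M N using M N by (simp add: pair_sigma_finite_def)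

lemma sq_section:
 assumes k: "k \<in> ksq M N"
 shows "AE y in N. (\<lambda>x. k (x, y)) \<in> sq M"
proof -
 have e: "(\<lambda>(x, y). (cmod (k (x, y)))\<^sup>2) = (\<lambda>z. (cmod (k z))\<^sup>2)" by (rule ext) (simp add: case_prod_beta)
 have "AE y in N. integrable M (\<lambda>x. (cmod (k (x, y)))\<^sup>2)"
  by (rule MN.AE_integrable_snd) (simp only: e sqD(2)[OF k])
 moreover have "AE y in N. (\<lambda>x. k (x, y)) \<in> borel_measurable M"
  using measurable_Pair1[OF sqD(1)[OF k]] by (intro AE_I2) auto
 ultimately show ?thesis by eventually_elim (simp add: sqI)
qed

lemma kernel_apply_measurable:
 assumes "k \<in> kmeasurable M N" "f \<in> borel_measurable M"
 shows "kernel_apply M k f \<in> borel_measurable N"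
proof -
 note [measurable] = assms
 have "(\<lambda>(y, x). k (x, y) * f x) \<in> borel_measurable (N \<Otimes>\<^sub>M M)" by measurable
 then show ?thesis unfolding kernel_apply_def[abs_def] by (rule MN.M1.borel_measurable_lebesgue_integral)
qed

lemma kernel_apply_sq:
 assumes k: "k \<in> ksq M N" and f: "f \<in> sq M"
 shows "kernel_apply M k f \<in> sq N"
proof (rule sqI)
 show m: "kernel_apply M k f \<in> borel_measurable N" by (rule kernel_apply_measurable[OF sqD(1)[OF k] sqD(1)[OF f]])
 have e: "(\<lambda>(x, y). (cmod (k (x, y)))\<^sup>2) = (\<lambda>z. (cmod (k z))\<^sup>2)" by (rule ext) (simp add: case_prod_beta)
 have i: "integrable N (\<lambda>y. LINT x|M. (cmod (k (x, y)))\<^sup>2)"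
  by (rule MN.integrable_snd) (simp only: e sqD(2)[OF k])
 show "integrable N (\<lambda>y. (cmod (kernel_apply M k f y))\<^sup>2)"
 proof (rule Bochner_Integration.integrable_bound[OF integrable_mult_left[OF i, of "(l2norm M f)\<^sup>2"]])
  show "AE y in N. norm ((cmod (kernel_apply M k f y))\<^sup>2) \<le> norm ((LINT x|M. (cmod (k (x, y)))\<^sup>2) * (l2norm M f)\<^sup>2)"
   using sq_section[OF k]
  proof eventually_elim
   case (elim y)
   have "(cmod (kernel_apply M k f y))\<^sup>2 \<le> (l2norm M (\<lambda>x. k (x, y)) * l2norm M f)\<^sup>2"
    unfolding kernel_apply_def by (intro power_mono sq_cauchy_schwarz(3)[OF elim f]) simp
   then show ?case by (simp add: power_mult_distrib l2norm_square)
  qed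
 qed (use m in simp)
qed

lemma integral_kernel_apply:
 assumes k: "k \<in> ksq M N" and f: "f \<in> sq M" and g: "g \<in> sq N"
 shows "(LINT y|N. kernel_apply M k f y * g y) = pairing M N k f g"
proof -
 have e: "(\<lambda>(x, y). k (x, y) * (f x * g y)) = (\<lambda>z. k z * (f (fst z) * g (snd z)))"
  by (rule ext) (simp add: case_prod_beta)
 have "(LINT y|N. LINT x|M. k (x, y) * (f x * g y)) = integral\<^sup>L (M \<Otimes>\<^sub>M N) (\<lambda>(x, y). k (x, y) * (f x * g y))"
  by (rule MN.integral_snd) (simp only: e pairing_integrable[OF N k f g])
 then have "pairing M N k f g = (LINT y|N. LINT x|M. k (x, y) * (f x * g y))"
  by (simp only: pairing_def e)
 also have "\<dots> = (LINT y|N. kernel_apply M k f y * g y)"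
  by (simp add: kernel_apply_def mult.assoc[symmetric])
 finally show ?thesis by simp
qed

lemma int_op_apply:
 assumes k: "k \<in> ksq M N" and f: "f \<in> sq M"
 shows "int_op M N k (ae_class M f) = ae_class N (kernel_apply M k f)"
proof -
 have "(\<lambda>y. LINT x|M. k (x, y) * rep (ae_class M f) x) = kernel_apply M k (rep (ae_class M f))"
  by (simp add: kernel_apply_def[abs_def])
 moreover have "AE y in N. kernel_apply M k (rep (ae_class M f)) y = kernel_apply M k f y"
  using sq_section[OF k]
 proof eventually_elim
  case (elim y)
  have "AE x in M. k (x, y) * rep (ae_class M f) x = k (x, y) * f x"
   using rep_ae_class(2)[OF sqD(1)[OF f]] by eventually_elim simp
  then show ?case unfolding kernel_apply_def
   using sqD(1)[OF elim] sqD(1)[OF f] sqD(1)[OF rep_sq[OF f]] by (intro integral_cong_AE) auto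
 qed
 ultimately show ?thesis unfolding int_op_def
  using L2_memI[OF f] ae_class_eq_iff[OF sqD(1)[OF kernel_apply_sq[OF k rep_sq[OF f]]] sqD(1)[OF kernel_apply_sq[OF k f]]] by simp
qed

lemma kernel_apply_norm:
 assumes k: "k \<in> ksq M N" and f: "f \<in> sq M" and c: "kernel_bound M N k c"
 shows "l2norm N (kernel_apply M k f) \<le> c * l2norm M f"
proof (rule l2norm_le_by_duality[OF kernel_apply_sq[OF k f]])
 show "c * l2norm M f \<ge> 0" using kernel_boundD(1)[OF N c] by simp
 fix g assume g: "g \<in> sq N"
 show "cmod (LINT y|N. kernel_apply M k f y * g y) \<le> c * l2norm M f * l2norm N g"
  using kernel_boundD(2)[OF N c f g] by (simp add: integral_kernel_apply[OF k f g] mult.assoc)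
qed

lemma kernel_apply_add:
 assumes k: "k \<in> ksq M N" and f: "f \<in> sq M" "g \<in> sq M"
 shows "AE y in N. kernel_apply M k (\<lambda>x. f x + c * g x) y = kernel_apply M k f y + c * kernel_apply M k g y"
 using sq_section[OF k]
proof eventually_elim
 case (elim y)
 have "kernel_apply M k (\<lambda>x. f x + c * g x) y = (LINT x|M. k (x, y) * f x + c * (k (x, y) * g x))"
  unfolding kernel_apply_def by (simp add: distrib_left mult_ac)
 then show ?case unfolding kernel_apply_def
  using sq_cauchy_schwarz(1)[OF elim f(1)] sq_cauchy_schwarz(1)[OF elim f(2)] by simp
qed

lemma int_op_bounded:
 assumes k: "k \<in> ksq M N"
 shows "int_op M N k \<in> vecs (bounded_ops (L2 M) (L2 N))"
proof (rule bounded_opsI[where C="l2norm (M \<Otimes>\<^sub>M N) k"])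
 show "int_op M N k \<in> extensional (vecs (L2 M))" by (simp add: int_op_def)
 fix A assume "A \<in> vecs (L2 M)"
 then obtain f where f: "f \<in> sq M" "A = ae_class M f" by (rule L2_memE)
 note kf = kernel_apply_sq[OF k f(1)]
 show "int_op M N k A \<in> vecs (L2 N)" unfolding f(2) int_op_apply[OF k f(1)] by (rule L2_memI[OF kf])
 show "vnorm (L2 N) (int_op M N k A) \<le> l2norm (M \<Otimes>\<^sub>M N) k * vnorm (L2 M) A"
  unfolding f(2) int_op_apply[OF k f(1)] L2_norm[OF kf] L2_norm[OF f(1)]
  by (rule kernel_apply_norm[OF k f(1) kernel_bound_l2[OF N k]])
 show "int_op M N k (vscale (L2 M) c A) = vscale (L2 N) c (int_op M N k A)" for c
 proof -
  have "kernel_apply M k (\<lambda>x. c * f x) = (\<lambda>y. c * kernel_apply M k f y)"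
   by (rule ext) (simp add: kernel_apply_def mult.left_commute)
  then show ?thesis
   unfolding f(2) L2_scale[OF f(1)] int_op_apply[OF k f(1)] int_op_apply[OF k sq_scale[OF f(1)]] L2_scale[OF kf] by simp
 qed
 fix B assume "B \<in> vecs (L2 M)"
 then obtain g where g: "g \<in> sq M" "B = ae_class M g" by (rule L2_memE)
 note kg = kernel_apply_sq[OF k g(1)]
 have "AE y in N. kernel_apply M k (\<lambda>x. f x + g x) y = kernel_apply M k f y + kernel_apply M k g y"
  using kernel_apply_add[OF k f(1) g(1), of 1] by simp
 then show "int_op M N k (vadd (L2 M) A B) = vadd (L2 N) (int_op M N k A) (int_op M N k B)"
  unfolding f(2) g(2) L2_add[OF f(1) g(1)] int_op_apply[OF k f(1)] int_op_apply[OF k g(1)]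
   int_op_apply[OF k sq_add[OF f(1) g(1)]] L2_add[OF kf kg]
  by (subst ae_class_eq_iff[OF sqD(1)[OF kernel_apply_sq[OF k sq_add[OF f(1) g(1)]]] sqD(1)[OF sq_add[OF kf kg]]])
qed

text \<open>The link between the operator norm and bounds on the bilinear form.\<close>

lemma int_op_norm_le_iff:
 assumes k: "k \<in> ksq M N" and c: "c \<ge> 0"
 shows "vnorm (bounded_ops (L2 M) (L2 N)) (int_op M N k) \<le> c \<longleftrightarrow> kernel_bound M N k c"
proof
 note nm = bounded_ops_norm[OF seminormed_L2 seminormed_L2 int_op_bounded[OF k]]
 assume le: "vnorm (bounded_ops (L2 M) (L2 N)) (int_op M N k) \<le> c"
 show "kernel_bound M N k c"
 proof (rule kernel_boundI[OF N c])
  fix f g assume f: "f \<in> sq M" and g: "g \<in> sq N"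
  have "l2norm N (kernel_apply M k f) \<le> vnorm (bounded_ops (L2 M) (L2 N)) (int_op M N k) * l2norm M f"
   using nm(2)[OF L2_memI[OF f]] by (simp add: int_op_apply[OF k f] L2_norm[OF f] L2_norm[OF kernel_apply_sq[OF k f]])
  also have "\<dots> \<le> c * l2norm M f" by (rule mult_right_mono[OF le l2norm_nonneg])
  finally have "l2norm N (kernel_apply M k f) * l2norm N g \<le> c * l2norm M f * l2norm N g" by (rule mult_right_mono) simp
  moreover have "cmod (pairing M N k f g) \<le> l2norm N (kernel_apply M k f) * l2norm N g"
   unfolding integral_kernel_apply[OF k f g, symmetric] by (rule sq_cauchy_schwarz(3)[OF kernel_apply_sq[OF k f] g])
  ultimately show "cmod (pairing M N k f g) \<le> c * (l2norm M f * l2norm N g)" by (simp add: mult.assoc)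
 qed
next
 note nm = bounded_ops_norm[OF seminormed_L2 seminormed_L2 int_op_bounded[OF k]]
 assume b: "kernel_bound M N k c"
 show "vnorm (bounded_ops (L2 M) (L2 N)) (int_op M N k) \<le> c"
 proof (rule nm(3)[OF _ c])
  fix A assume "A \<in> vecs (L2 M)"
  then obtain f where f: "f \<in> sq M" "A = ae_class M f" by (rule L2_memE)
  show "vnorm (L2 N) (int_op M N k A) \<le> c * vnorm (L2 M) A"
   unfolding f(2) int_op_apply[OF k f(1)] L2_norm[OF f(1)] L2_norm[OF kernel_apply_sq[OF k f(1)]]
   by (rule kernel_apply_norm[OF k f(1) b])
 qed
qed

end

section \<open>Compactness of integral operators\<close>

lemma lin_span_mono: "s \<in> lin_span S ==> S \<subseteq> T ==> s \<in> lin_span T"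
proof (induction rule: lin_span.induct)
 case zero show ?case by (rule lin_span.zero)
next
 case (add s g c) then show ?case by (intro lin_span.add) auto
qed

lemma span_rectangle_sections:
 assumes "k \<in> lin_span (finite_rectangles M N)"
 shows "\<exists>S. finite S \<and> S \<subseteq> finite_indicators M \<and> (\<forall>y. (\<lambda>x. k (x, y)) \<in> lin_span S)"
 using assms
proof induction
 case zero
 show ?case by (rule exI[of _ "{}"]) (simp add: lin_span.zero)
next
 case (add k r c)
 obtain S where S: "finite S" "S \<subseteq> finite_indicators M" "\<And>y. (\<lambda>x. k (x, y)) \<in> lin_span S" using add.IH by blast
 obtain A B where AB: "r = (\<lambda>z. indicator A (fst z) * indicator B (snd z))" "A \<in> sets M" "emeasure M A < \<infinity>"
  using add.hyps(2) unfolding finite_rectangles_def mem_Collect_eq by (elim exE conjE)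
 show ?case
 proof (intro exI[of _ "insert (indicator A) S"] conjI allI)
  show "insert (indicator A) S \<subseteq> finite_indicators M" using S(2) AB unfolding finite_indicators_def by blast
  fix y
  have "(\<lambda>x. k (x, y)) \<in> lin_span (insert (indicator A) S)" by (rule lin_span_mono[OF S(3)]) blast
  from lin_span.add[OF this insertI1, of "c * indicator B y"]
  show "(\<lambda>x. k (x, y) + c * r (x, y)) \<in> lin_span (insert (indicator A) S)" by (simp add: AB(1) mult_ac)
 qed (use S(1) in simp)
qed

lemma bounded_functionals_diagonal:
 fixes c :: "nat => nat => complex"
 assumes "\<And>n j. cmod (c n j) \<le> B j"
 obtains r where "strict_mono r" "\<And>j. convergent (\<lambda>n. c (r n) j)"
proof -
 have "compactin (product_topology (\<lambda>_. euclidean) UNIV) (\<Pi>\<^sub>E j\<in>UNIV. cball (0 :: complex) (B j))"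
  unfolding compactin_PiE by simp
 then have "compact (\<Pi>\<^sub>E j\<in>UNIV. cball (0 :: complex) (B j))"
  unfolding euclidean_product_topology by simp
 then have "seq_compact (\<Pi>\<^sub>E j\<in>UNIV. cball (0 :: complex) (B j))" by (rule compact_imp_seq_compact)
 moreover have "\<forall>n. c n \<in> (\<Pi>\<^sub>E j\<in>UNIV. cball (0 :: complex) (B j))" using assms by (auto simp: PiE_def)
 ultimately obtain l r where r: "strict_mono r" "(c \<circ> r) \<longlonglongrightarrow> l"
  unfolding seq_compact_def by metis
 show thesis
 proof (rule that[OF r(1)])
  fix j
  have "(\<lambda>n. (c \<circ> r) n j) \<longlonglongrightarrow> l j"
   by (rule continuous_on_tendsto_compose[OF continuous_on_product_coordinates[of j] r(2)]) auto
  then show "convergent (\<lambda>n. c (r n) j)" unfolding convergent_def by (auto simp: comp_def)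
 qed
qed

lemma convergent_by_approximation:
 fixes x :: "nat => complex"
 assumes "\<And>e. e > 0 ==> \<exists>y. convergent y \<and> (\<forall>n. cmod (x n - y n) \<le> e)"
 shows "convergent x"
proof -
 have "Cauchy x" unfolding Cauchy_def
 proof (intro allI impI)
  fix e :: real assume e: "e > 0"
  obtain y where y: "convergent y" "\<And>n. cmod (x n - y n) \<le> e / 4" using assms[of "e / 4"] e by auto
  obtain K where K: "\<And>m n. m \<ge> K ==> n \<ge> K ==> dist (y m) (y n) < e / 4"
   using convergent_Cauchy[OF y(1)] e unfolding Cauchy_def by (metis zero_less_divide_iff zero_less_numeral)
  show "\<exists>K. \<forall>m\<ge>K. \<forall>n\<ge>K. dist (x m) (x n) < e"
  proof (intro exI[of _ K] allI impI)
   fix m n assume "m \<ge> K" "n \<ge> K"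
   then have "cmod (y m - y n) < e / 4" using K by (simp add: dist_norm)
   moreover have "x m - x n = (x m - y m) + (y m - y n) - (x n - y n)" by simp
   then have "cmod (x m - x n) \<le> cmod ((x m - y m) + (y m - y n)) + cmod (x n - y n)"
    using norm_triangle_ineq4[of "(x m - y m) + (y m - y n)" "x n - y n"] by (simp only:)
   then have "cmod (x m - x n) \<le> cmod (x m - y m) + cmod (y m - y n) + cmod (x n - y n)"
    using norm_triangle_ineq[of "x m - y m" "y m - y n"] by linarith
   ultimately show "dist (x m) (x n) < e" using y(2)[of m] y(2)[of n] e by (simp add: dist_norm)
  qed
 qed
 then show ?thesis by (rule Cauchy_convergent)
qed

lemma convergent_on_span:
 assumes S: "S \<subseteq> sq M" and f: "\<And>n. f n \<in> sq M" and conv: "\<And>s. s \<in> S ==> convergent (\<lambda>n. LINT x|M. s x * f n x)"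
  and s: "s \<in> lin_span S"
 shows "convergent (\<lambda>n. LINT x|M. s x * f n x)"
 using s
proof induction
 case zero then show ?case by (simp add: convergent_const)
next
 case (add s g c)
 have "s \<in> sq M" "g \<in> sq M" using lin_span_sq[OF S add.hyps(1)] add.hyps(2) S by auto
 then have eq: "(LINT x|M. (s x + c * g x) * f n x) = (LINT x|M. s x * f n x) + c * (LINT x|M. g x * f n x)" for n
  using sq_cauchy_schwarz(1)[of s M "f n"] sq_cauchy_schwarz(1)[of g M "f n"] f[of n] by (simp add: distrib_right mult.assoc)
 show ?case unfolding eq by (intro convergent_add convergent_mult convergent_const add.IH conv[OF add.hyps(2)])
qed

context
 fixes M :: "'a measure" and N :: "'b measure"
 assumes M: "sigma_finite_measure M" and N: "sigma_finite_measure N"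
begin

interpretation MN: pair_sigma_finite M N using M N by (simp add: pair_sigma_finite_def)

lemma section_norm:
 assumes k: "k \<in> ksq M N"
 shows "integrable N (\<lambda>y. LINT x|M. (cmod (k (x, y)))\<^sup>2)"
  "(LINT y|N. LINT x|M. (cmod (k (x, y)))\<^sup>2) = (l2norm (M \<Otimes>\<^sub>M N) k)\<^sup>2"
proof -
 have e: "(\<lambda>(x, y). (cmod (k (x, y)))\<^sup>2) = (\<lambda>z. (cmod (k z))\<^sup>2)" by (rule ext) (simp add: case_prod_beta)
 show "integrable N (\<lambda>y. LINT x|M. (cmod (k (x, y)))\<^sup>2)"
  by (rule MN.integrable_snd) (simp only: e sqD(2)[OF k])
 have "(LINT y|N. LINT x|M. (cmod (k (x, y)))\<^sup>2) = integral\<^sup>L (M \<Otimes>\<^sub>M N) (\<lambda>(x, y). (cmod (k (x, y)))\<^sup>2)"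
  by (rule MN.integral_snd) (simp only: e sqD(2)[OF k])
 then show "(LINT y|N. LINT x|M. (cmod (k (x, y)))\<^sup>2) = (l2norm (M \<Otimes>\<^sub>M N) k)\<^sup>2" by (simp only: e l2norm_square)
qed

text \<open>Almost all sections of \<open>k\<close> lie in the closed span of countably many indicators, because \<open>k\<close> is a limit of combinations of rectangles, each of which has all its sections in the span of finitely many indicators. So weak convergence of a bounded sequence along a diagonal subsequence can be tested on all sections at once.\<close>

lemma kernel_sections_separable:
 assumes k: "k \<in> ksq M N"
 obtains S where "countable S" "S \<noteq> {}" "S \<subseteq> finite_indicators M"
  "AE y in N. \<forall>e>0. \<exists>s\<in>lin_span S. l2norm M (\<lambda>x. k (x, y) - s x) < e"
proof -
 have G: "finite_rectangles M N \<subseteq> ksq M N" by (rule finite_rectangles_sq[OF N])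
 have "\<exists>s\<in>lin_span (finite_rectangles M N). l2norm (M \<Otimes>\<^sub>M N) (\<lambda>z. k z - s z) < 1 / real (Suc m)" for m
  using rectangles_l2dense[OF M N k] unfolding l2closure_def by simp
 then obtain s where s: "\<And>m. s m \<in> lin_span (finite_rectangles M N)" "\<And>m. l2norm (M \<Otimes>\<^sub>M N) (\<lambda>z. k z - s m z) < 1 / real (Suc m)"
  by metis
 have ss: "s m \<in> ksq M N" for m by (rule lin_span_sq[OF G s(1)])
 define d where "d m z = k z - s m z" for m z
 have ds: "d m \<in> ksq M N" for m unfolding d_def using k ss by auto
 have dn: "l2norm (M \<Otimes>\<^sub>M N) (d m) < 1 / real (Suc m)" for m using s(2)[of m] by (simp add: d_def[abs_def])
 define u where "u m y = (LINT x|M. (cmod (d m (x, y)))\<^sup>2)" for m y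
 have "(\<lambda>m. LINT y|N. norm (u m y)) \<longlonglongrightarrow> 0"
 proof (rule tendsto_sandwich[of "\<lambda>_. 0" _ _ "\<lambda>m. 1 / real (Suc m)"])
  show "\<forall>\<^sub>F m in sequentially. (LINT y|N. norm (u m y)) \<le> 1 / real (Suc m)"
  proof (rule always_eventually, rule allI)
   fix m
   have "(LINT y|N. norm (u m y)) = (l2norm (M \<Otimes>\<^sub>M N) (d m))\<^sup>2"
    using section_norm(2)[OF ds[of m]] by (simp add: u_def)
   also have "\<dots> \<le> (1 / real (Suc m))\<^sup>2" by (rule power_mono[OF less_imp_le[OF dn]]) simp
   also have "\<dots> \<le> (1 / real (Suc m)) * 1" unfolding power2_eq_square by (intro mult_left_mono) auto
   finally show "(LINT y|N. norm (u m y)) \<le> 1 / real (Suc m)" by simp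
  qed
 qed (use LIMSEQ_inverse_real_of_nat in \<open>auto simp: inverse_eq_divide\<close>)
 then obtain r where r: "strict_mono r" "AE y in N. (\<lambda>m. u (r m) y) \<longlonglongrightarrow> 0"
  using tendsto_L1_AE_subseq[of N u] section_norm(1)[OF ds] unfolding u_def by auto
 have "\<exists>S. finite S \<and> S \<subseteq> finite_indicators M \<and> (\<forall>y. (\<lambda>x. s m (x, y)) \<in> lin_span S)" for m
  by (rule span_rectangle_sections[OF s(1)])
 then obtain S where S: "\<And>m. finite (S m)" "\<And>m. S m \<subseteq> finite_indicators M" "\<And>m y. (\<lambda>x. s m (x, y)) \<in> lin_span (S m)" by metis
 define T where "T = insert (indicator {}) (\<Union>m. S m)"
 show thesis
 proof (rule that[of T])
  show "countable T" unfolding T_def using S(1) by (auto intro: countable_finite)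
  show "T \<noteq> {}" by (simp add: T_def)
  show "T \<subseteq> finite_indicators M" using S(2) unfolding T_def finite_indicators_def by force
  show "AE y in N. \<forall>e>0. \<exists>s\<in>lin_span T. l2norm M (\<lambda>x. k (x, y) - s x) < e"
   using r(2)
  proof eventually_elim
   case (elim y)
   show ?case
   proof (intro allI impI)
    fix e :: real assume "e > 0"
    then have "\<forall>\<^sub>F m in sequentially. u (r m) y < e\<^sup>2" using order_tendstoD(2)[OF elim, of "e\<^sup>2"] by simp
    then obtain m where m: "u (r m) y < e\<^sup>2" by (auto dest: eventually_happens)
    have "(l2norm M (\<lambda>x. k (x, y) - s (r m) (x, y)))\<^sup>2 < e\<^sup>2" using m by (simp add: l2norm_square u_def d_def)
    then have "l2norm M (\<lambda>x. k (x, y) - s (r m) (x, y)) < e" using \<open>e > 0\<close> by (simp add: power_less_imp_less_base)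
    moreover have "(\<lambda>x. s (r m) (x, y)) \<in> lin_span T" by (rule lin_span_mono[OF S(3)]) (auto simp: T_def)
    ultimately show "\<exists>s\<in>lin_span T. l2norm M (\<lambda>x. k (x, y) - s x) < e" by (intro bexI[of _ "\<lambda>x. s (r m) (x, y)"])
   qed
  qed
 qed
qed

text \<open>A diagonal subsequence converges weakly against all sections of the kernel; the images then converge pointwise and are dominated by the norms of the sections, hence converge in norm.\<close>

theorem int_op_compact:
 assumes k: "k \<in> ksq M N"
 shows "is_compact_op (L2 M) (L2 N) (int_op M N k)"
 unfolding is_compact_op_def
proof (intro conjI allI impI int_op_bounded[OF M N k])
 fix a :: "nat => ('a => complex) set" assume a: "\<forall>n. a n \<in> vecs (L2 M) \<and> vnorm (L2 M) (a n) \<le> 1"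
 define f where "f n = rep (a n)" for n
 have f: "f n \<in> sq M" "a n = ae_class M (f n)" for n using L2_rep[of "a n"] a by (auto simp: f_def)
 have fn: "l2norm M (f n) \<le> 1" for n using a L2_norm[OF f(1)] f(2) by metis
 obtain S where S: "countable S" "S \<noteq> {}" "S \<subseteq> finite_indicators M"
  "AE y in N. \<forall>e>0. \<exists>s\<in>lin_span S. l2norm M (\<lambda>x. k (x, y) - s x) < e"
  by (rule kernel_sections_separable[OF k])
 have Ssq: "S \<subseteq> sq M" using S(3) finite_indicators_sq by blast
 define s where "s = from_nat_into S"
 have s: "s j \<in> S" for j unfolding s_def by (rule from_nat_into[OF S(2)])
 have bnd: "cmod (LINT x|M. s j x * f n x) \<le> l2norm M (s j)" for n j
 proof -
  have "cmod (LINT x|M. s j x * f n x) \<le> l2norm M (s j) * l2norm M (f n)"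
   by (rule sq_cauchy_schwarz(3)) (use s Ssq f in blast)+
  also have "\<dots> \<le> l2norm M (s j) * 1" by (intro mult_left_mono fn) simp
  finally show ?thesis by simp
 qed
 obtain r where r: "strict_mono r" "\<And>j. convergent (\<lambda>n. LINT x|M. s j x * f (r n) x)"
  by (rule bounded_functionals_diagonal[of "\<lambda>n j. LINT x|M. s j x * f n x" "\<lambda>j. l2norm M (s j)", OF bnd], rule that)
 have convS: "convergent (\<lambda>n. LINT x|M. t x * f (r n) x)" if "t \<in> S" for t
  using r(2)[of "to_nat_on S t"] from_nat_into_to_nat_on[OF S(1) that] by (simp add: s_def)
 define h where "h n = kernel_apply M k (f (r n))" for n
 have hs: "h n \<in> sq N" for n unfolding h_def by (rule kernel_apply_sq[OF M N k f(1)])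
 have conv: "AE y in N. convergent (\<lambda>n. h n y)"
  using S(4) sq_section[OF M N k]
 proof eventually_elim
  case (elim y)
  show ?case
  proof (rule convergent_by_approximation)
   fix e :: real assume "e > 0"
   then obtain t where t: "t \<in> lin_span S" "l2norm M (\<lambda>x. k (x, y) - t x) < e" using elim(1) by blast
   have ts: "t \<in> sq M" by (rule lin_span_sq[OF Ssq t(1)])
   have "cmod (h n y - (LINT x|M. t x * f (r n) x)) \<le> e" for n
   proof -
    have "h n y - (LINT x|M. t x * f (r n) x) = (LINT x|M. (k (x, y) - t x) * f (r n) x)"
     unfolding h_def kernel_apply_def left_diff_distrib
     by (rule Bochner_Integration.integral_diff[symmetric]) (rule sq_cauchy_schwarz(1)[OF elim(2) f(1)] sq_cauchy_schwarz(1)[OF ts f(1)])+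
    also have "cmod \<dots> \<le> l2norm M (\<lambda>x. k (x, y) - t x) * l2norm M (f (r n))"
     by (rule sq_cauchy_schwarz(3)[OF sq_diff[OF elim(2) ts] f(1)])
    also have "\<dots> \<le> e * 1" using t(2) fn \<open>e > 0\<close> by (intro mult_mono) auto
    finally show ?thesis by simp
   qed
   then show "\<exists>z. convergent z \<and> (\<forall>n. cmod (h n y - z n) \<le> e)"
    using convergent_on_span[OF Ssq f(1) convS t(1)] by (intro exI[of _ "\<lambda>n. LINT x|M. t x * f (r n) x"]) simp
  qed
 qed
 define w where "w y = lim (\<lambda>n. h n y)" for y
 have w: "w \<in> borel_measurable N" unfolding w_def by (rule borel_measurable_lim_metric) (rule sqD(1)[OF hs])
 define g where "g y = complex_of_real (sqrt (LINT x|M. (cmod (k (x, y)))\<^sup>2))" for y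
 have gs: "g \<in> sq N"
 proof (rule sqI)
  have "(\<lambda>y. LINT x|M. (cmod (k (x, y)))\<^sup>2) \<in> borel_measurable N" by (rule borel_measurable_integrable[OF section_norm(1)[OF k]])
  then show "g \<in> borel_measurable N" unfolding g_def by measurable
  have "(cmod (g y))\<^sup>2 = (LINT x|M. (cmod (k (x, y)))\<^sup>2)" for y by (simp add: g_def)
  then show "integrable N (\<lambda>y. (cmod (g y))\<^sup>2)" using section_norm(1)[OF k] by simp
 qed
 have lim: "AE y in N. (\<lambda>n. h n y) \<longlonglongrightarrow> w y"
  using conv by eventually_elim (simp add: w_def convergent_LIMSEQ_iff)
 have dom: "AE y in N. cmod (h n y) \<le> 1 * cmod (g y)" for n
  using sq_section[OF M N k]
 proof eventually_elim
  case (elim y)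
  have "cmod (h n y) \<le> l2norm M (\<lambda>x. k (x, y)) * l2norm M (f (r n))"
   unfolding h_def kernel_apply_def by (rule sq_cauchy_schwarz(3)[OF elim f(1)])
  also have "\<dots> \<le> l2norm M (\<lambda>x. k (x, y)) * 1" by (intro mult_left_mono fn) simp
  finally show ?case by (simp add: g_def l2norm_def)
 qed
 note conv = l2_dominated_convergence[where s=h and f=w and c=1, OF gs w sqD(1)[OF hs] lim dom]
 have "vdist (L2 N) (int_op M N k (a (r n))) (ae_class N w) = l2norm N (\<lambda>y. w y - h n y)" for n
  unfolding f(2) int_op_apply[OF M N k f(1)] h_def[symmetric] L2_dist[OF hs conv(1)] by (rule l2norm_minus_commute)
 then show "\<exists>r. strict_mono r \<and> (\<exists>w\<in>vecs (L2 N). (\<lambda>n. vdist (L2 N) (int_op M N k (a (r n))) w) \<longlonglongrightarrow> 0)"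
  using r(1) conv(3) L2_memI[OF conv(1)] by (intro exI[of _ r] conjI bexI[of _ "ae_class N w"]) simp_all
qed

end

lemma seminormed_subspace:
 assumes B: "seminormed_space B" and S: "S \<subseteq> vecs B" "S \<noteq> {}"
  and add: "\<And>v w. v \<in> S ==> w \<in> S ==> vadd B v w \<in> S" and sc: "\<And>c v. v \<in> S ==> vscale B c v \<in> S"
 shows "seminormed_space (B\<lparr>vecs := S\<rparr>)"
proof -
 have r: "vecs (B\<lparr>vecs := S\<rparr>) = S" "vadd (B\<lparr>vecs := S\<rparr>) = vadd B" "vscale (B\<lparr>vecs := S\<rparr>) = vscale B"
  "vnorm (B\<lparr>vecs := S\<rparr>) = vnorm B" by simp_all
 show ?thesis
  unfolding seminormed_space_def r
  by (intro conjI ballI allI S(2) add sc; (assumption | (rule seminormed_spaceD[OF B]; (rule subsetD[OF S(1)], assumption))))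
qed

lemma L2_dist_add:
 assumes "A \<in> vecs (L2 M)" "B \<in> vecs (L2 M)" "C \<in> vecs (L2 M)" "D \<in> vecs (L2 M)"
 shows "vdist (L2 M) (vadd (L2 M) A B) (vadd (L2 M) C D) \<le> vdist (L2 M) A C + vdist (L2 M) B D"
proof -
 obtain a b c d where f: "a \<in> sq M" "A = ae_class M a" "b \<in> sq M" "B = ae_class M b"
  "c \<in> sq M" "C = ae_class M c" "d \<in> sq M" "D = ae_class M d" using assms by (meson L2_memE)
 have "l2norm M (\<lambda>x. (a x + b x) - (c x + d x)) = l2norm M (\<lambda>x. (a x - c x) + (b x - d x))" by (simp add: algebra_simps)
 also have "\<dots> \<le> l2norm M (\<lambda>x. a x - c x) + l2norm M (\<lambda>x. b x - d x)" by (intro l2norm_triangle sq_diff f)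
 finally show ?thesis by (simp add: f L2_add L2_dist)
qed

lemma L2_dist_scale:
 assumes "A \<in> vecs (L2 M)" "B \<in> vecs (L2 M)"
 shows "vdist (L2 M) (vscale (L2 M) c A) (vscale (L2 M) c B) = cmod c * vdist (L2 M) A B"
proof -
 obtain a b where f: "a \<in> sq M" "A = ae_class M a" "b \<in> sq M" "B = ae_class M b" using assms by (meson L2_memE)
 have "l2norm M (\<lambda>x. c * a x - c * b x) = l2norm M (\<lambda>x. c * (a x - b x))" by (simp add: algebra_simps)
 then show ?thesis by (simp add: f L2_scale L2_dist)
qed

lemma L2_dist_nonneg: "A \<in> vecs (L2 M) ==> B \<in> vecs (L2 M) ==> vdist (L2 M) A B \<ge> 0"
 by (elim L2_memE) (simp add: L2_dist)

lemma compact_ops_simps: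
 "vecs (compact_ops V W) = {T. is_compact_op V W T}" "vadd (compact_ops V W) = vadd (bounded_ops V W)"
 "vscale (compact_ops V W) = vscale (bounded_ops V W)" "vnorm (compact_ops V W) = vnorm (bounded_ops V W)"
 by (simp_all add: compact_ops_def)

lemma seminormed_compact_ops:
 assumes M: "sigma_finite_measure M" and N: "sigma_finite_measure N"
 shows "seminormed_space (compact_ops (L2 M) (L2 N))"
 unfolding compact_ops_def
proof (rule seminormed_subspace[OF seminormed_bounded_ops[OF seminormed_L2 seminormed_L2]])
 let ?B = "bounded_ops (L2 M) (L2 N)"
 show "{T. is_compact_op (L2 M) (L2 N) T} \<subseteq> vecs ?B" by (auto simp: is_compact_op_def)
 show "{T. is_compact_op (L2 M) (L2 N) T} \<noteq> {}" using int_op_compact[OF M N sq_zero] by blast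
 fix S assume S0: "S \<in> {T. is_compact_op (L2 M) (L2 N) T}"
 note S = S0[unfolded mem_Collect_eq is_compact_op_def, THEN conjunct1] S0[unfolded mem_Collect_eq is_compact_op_def, THEN conjunct2]
 show "vscale ?B c S \<in> {T. is_compact_op (L2 M) (L2 N) T}" for c
  unfolding mem_Collect_eq is_compact_op_def
 proof (intro conjI allI impI bounded_ops_closed(2)[OF seminormed_L2 seminormed_L2 S(1) S(1)])
  fix a :: "nat => _" assume a: "\<forall>n. a n \<in> vecs (L2 M) \<and> vnorm (L2 M) (a n) \<le> 1"
  obtain r w where r: "strict_mono r" "w \<in> vecs (L2 N)" "(\<lambda>n. vdist (L2 N) (S (a (r n))) w) \<longlonglongrightarrow> 0" using S(2)[THEN spec, THEN mp, OF a] by blast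
  have "vdist (L2 N) (vscale ?B c S (a (r n))) (vscale (L2 N) c w) = cmod c * vdist (L2 N) (S (a (r n))) w" for n
   using a L2_dist_scale[OF bounded_opsD(2)[OF S(1)] r(2), of "a (r n)" c] by (simp add: bounded_ops_simps)
  moreover have "(\<lambda>n. cmod c * vdist (L2 N) (S (a (r n))) w) \<longlonglongrightarrow> 0" using tendsto_mult_right_zero[OF r(3)] by simp
  ultimately show "\<exists>r. strict_mono r \<and> (\<exists>w\<in>vecs (L2 N). (\<lambda>n. vdist (L2 N) (vscale ?B c S (a (r n))) w) \<longlonglongrightarrow> 0)"
   using r(1) seminormed_spaceD(7)[OF seminormed_L2 r(2), of c] by (intro exI[of _ r] conjI bexI[of _ "vscale (L2 N) c w"]) simp_all
 qed
 fix T assume T0: "T \<in> {T. is_compact_op (L2 M) (L2 N) T}"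
 note T = T0[unfolded mem_Collect_eq is_compact_op_def, THEN conjunct1] T0[unfolded mem_Collect_eq is_compact_op_def, THEN conjunct2]
 show "vadd ?B S T \<in> {T. is_compact_op (L2 M) (L2 N) T}"
  unfolding mem_Collect_eq is_compact_op_def
 proof (intro conjI allI impI bounded_ops_closed(1)[OF seminormed_L2 seminormed_L2 S(1) T(1)])
  fix a :: "nat => _" assume a: "\<forall>n. a n \<in> vecs (L2 M) \<and> vnorm (L2 M) (a n) \<le> 1"
  obtain r v where r: "strict_mono r" "v \<in> vecs (L2 N)" "(\<lambda>n. vdist (L2 N) (S (a (r n))) v) \<longlonglongrightarrow> 0" using S(2)[THEN spec, THEN mp, OF a] by blast
  have ar: "\<forall>n. a (r n) \<in> vecs (L2 M) \<and> vnorm (L2 M) (a (r n)) \<le> 1" using a by blast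
  obtain q w where q: "strict_mono q" "w \<in> vecs (L2 N)" "(\<lambda>n. vdist (L2 N) (T (a (r (q n)))) w) \<longlonglongrightarrow> 0" using T(2)[THEN spec, THEN mp, OF ar] by blast
  have lim: "(\<lambda>n. vdist (L2 N) (S (a (r (q n)))) v + vdist (L2 N) (T (a (r (q n)))) w) \<longlonglongrightarrow> 0"
   using tendsto_add[OF LIMSEQ_subseq_LIMSEQ[OF r(3) q(1)] q(3)] by (simp add: comp_def)
  have le: "vdist (L2 N) (vadd ?B S T (a (r (q n)))) (vadd (L2 N) v w)
    \<le> vdist (L2 N) (S (a (r (q n)))) v + vdist (L2 N) (T (a (r (q n)))) w" for n
   using L2_dist_add[OF bounded_opsD(2)[OF S(1)] bounded_opsD(2)[OF T(1)] r(2) q(2), of "a (r (q n))" "a (r (q n))"] a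
   by (simp add: bounded_ops_simps)
  have vw: "vadd (L2 N) v w \<in> vecs (L2 N)" by (rule seminormed_spaceD(2)[OF seminormed_L2 r(2) q(2)])
  have nn: "0 \<le> vdist (L2 N) (vadd ?B S T (a (r (q n)))) (vadd (L2 N) v w)" for n
   by (rule L2_dist_nonneg[OF bounded_opsD(2)[OF bounded_ops_closed(1)[OF seminormed_L2 seminormed_L2 S(1) T(1)]] vw]) (use a in blast)
  have "(\<lambda>n. vdist (L2 N) (vadd ?B S T (a (r (q n)))) (vadd (L2 N) v w)) \<longlonglongrightarrow> 0"
   by (rule tendsto_sandwich[OF _ _ tendsto_const lim]) (simp_all add: nn le)
  then show "\<exists>r. strict_mono r \<and> (\<exists>w\<in>vecs (L2 N). (\<lambda>n. vdist (L2 N) (vadd ?B S T (a (r n))) w) \<longlonglongrightarrow> 0)"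
   using strict_mono_o[OF r(1) q(1)] vw by (intro exI[of _ "r \<circ> q"] conjI bexI[of _ "vadd (L2 N) v w"]) simp_all
 qed
qed

text \<open>The family \<open>a\<close> is read as a map \<open>x \<mapsto> (a\<^sub>i(x))\<^sub>i\<close> into the square summable sequences with norm at most \<open>s x\<close>. Finite sums in the definition make summability a consequence instead of a side condition.\<close>

definition row_bound :: "'a measure => (nat => 'a => complex) => ('a => real) => bool" where
 "row_bound M a s \<longleftrightarrow> (\<forall>i. a i \<in> borel_measurable M)
   \<and> (\<forall>x\<in>space M. s x \<ge> 0 \<and> (\<forall>n. (\<Sum>i<n. (cmod (a i x))\<^sup>2) \<le> (s x)\<^sup>2))"

lemma row_boundD:
 assumes "row_bound M a s"
 shows "a i \<in> borel_measurable M" "x \<in> space M ==> s x \<ge> 0" "x \<in> space M ==> (\<Sum>i<n. (cmod (a i x))\<^sup>2) \<le> (s x)\<^sup>2"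
 using assms by (auto simp: row_bound_def)

text \<open>By monotone convergence the pointwise square sum is integrable; changing the family on the null set where it is infinite makes the bound hold at every point.\<close>

lemma rows_square_integrable:
 assumes f: "\<And>i. f i \<in> sq M" and C: "\<And>n. (\<Sum>i<n. (l2norm M (f i))\<^sup>2) \<le> C"
 obtains f' s where "row_bound M f' s" "real_sq M s" "(l2norm M (\<lambda>x. complex_of_real (s x)))\<^sup>2 \<le> C"
  "\<And>i. AE x in M. f' i x = f i x"
proof -
 note [measurable] = sqD(1)[OF f]
 define S where "S x = (\<Sum>i. ennreal ((cmod (f i x))\<^sup>2))" for x
 have [measurable]: "S \<in> borel_measurable M" unfolding S_def[abs_def] by measurable
 define s where "s x = sqrt (enn2real (S x))" for x
 have [measurable]: "s \<in> borel_measurable M" unfolding s_def[abs_def] by measurable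
 have "C \<ge> 0" using C[of 0] by simp
 have I: "(\<integral>\<^sup>+x. S x \<partial>M) \<le> ennreal C"
 proof -
  have one: "(\<integral>\<^sup>+x. ennreal ((cmod (f i x))\<^sup>2) \<partial>M) = ennreal ((l2norm M (f i))\<^sup>2)" for i
   unfolding l2norm_square by (rule nn_integral_eq_integral[OF sqD(2)[OF f]]) simp
  have "(\<integral>\<^sup>+x. S x \<partial>M) = (\<Sum>i. ennreal ((l2norm M (f i))\<^sup>2))"
   unfolding S_def one[symmetric] by (rule nn_integral_suminf) measurable
  also have "\<dots> \<le> ennreal C"
   by (rule suminf_le_const[OF summableI]) (use C \<open>C \<ge> 0\<close> in \<open>simp add: sum_ennreal\<close>)
  finally show ?thesis .
 qed
 then have fin: "AE x in M. S x \<noteq> \<infinity>" by (intro nn_integral_PInf_AE) (auto simp: top_unique)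
 define f' where "f' i x = (if S x = \<infinity> then 0 else f i x)" for i x
 have le: "(cmod (complex_of_real (s x)))\<^sup>2 = enn2real (S x)" for x by (simp add: s_def)
 have nnI: "(\<integral>\<^sup>+x. ennreal (enn2real (S x)) \<partial>M) \<le> ennreal C"
  using I fin by (subst nn_integral_cong_AE[of _ S]) (auto elim!: eventually_mono simp: less_top)
 have ints: "integrable M (\<lambda>x. enn2real (S x))"
  by (rule integrableI_nonneg) (use nnI in \<open>auto intro: le_less_trans\<close>)
 show thesis
 proof (rule that[of f' s])
  show "row_bound M f' s" unfolding row_bound_def
  proof (intro conjI allI ballI)
   show "f' i \<in> borel_measurable M" for i unfolding f'_def[abs_def] by measurable
   fix x
   show "s x \<ge> 0" by (simp add: s_def)
   fix n
   show "(\<Sum>i<n. (cmod (f' i x))\<^sup>2) \<le> (s x)\<^sup>2"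
   proof (cases "S x = \<infinity>")
    case False
    have "ennreal (\<Sum>i<n. (cmod (f i x))\<^sup>2) \<le> S x"
     unfolding S_def by (subst sum_ennreal[symmetric], simp, rule sum_le_suminf[OF summableI], auto)
    also have "S x = ennreal (enn2real (S x))" using False by (simp add: less_top)
    finally show ?thesis using False by (simp add: s_def f'_def)
   qed (simp add: f'_def)
  qed
  show sI: "real_sq M s" by (rule sqI) (use ints in \<open>simp_all add: s_def\<close>)
  have "ennreal (LINT x|M. enn2real (S x)) \<le> ennreal C"
   using nnI nn_integral_eq_integral[OF ints] by simp
  then show "(l2norm M (\<lambda>x. complex_of_real (s x)))\<^sup>2 \<le> C" using \<open>C \<ge> 0\<close> unfolding l2norm_square le by simp
  show "AE x in M. f' i x = f i x" for i using fin by eventually_elim (simp add: f'_def)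
 qed
qed

section \<open>Completeness and the Riesz representation\<close>

text \<open>The weighted increments \<open>2\<^sup>n (f\<^sub>n\<^sub>+\<^sub>1 - f\<^sub>n)\<close> have square integrable square sum, which gives geometric convergence at almost every point together with a dominating function.\<close>

lemma l2_fast_limit:
 assumes f: "\<And>n::nat. f n \<in> sq M" and d: "\<And>n. (l2norm M (\<lambda>x. f (Suc n) x - f n x))\<^sup>2 \<le> (1/8) ^ n"
 obtains g where "g \<in> sq M" "(\<lambda>n. l2norm M (\<lambda>x. g x - f n x)) \<longlonglongrightarrow> 0"
proof -
 (* the weight 2 ^ n is absorbed by the rate (1/8) ^ n of the squared norms *)
 define h where "h n x = 2 ^ n * (f (Suc n) x - f n x)" for n x
 have h: "h n \<in> sq M" for n unfolding h_def[abs_def] by (intro sq_scale sq_diff f)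
 have "(\<Sum>i<n. (l2norm M (h i))\<^sup>2) \<le> 2" for n
 proof -
  have "(l2norm M (h i))\<^sup>2 \<le> (1/2) ^ i" for i
  proof -
   have "(l2norm M (h i))\<^sup>2 = 4 ^ i * (l2norm M (\<lambda>x. f (Suc i) x - f i x))\<^sup>2"
    unfolding h_def[abs_def] l2norm_scale by (simp add: power_mult_distrib norm_power power_mult[symmetric] mult.commute[of i] power_mult)
   also have "\<dots> \<le> 4 ^ i * (1/8) ^ i" by (intro mult_left_mono d) simp
   also have "\<dots> = (1/2) ^ i" by (simp add: power_mult_distrib[symmetric])
   finally show ?thesis .
  qed
  then have "(\<Sum>i<n. (l2norm M (h i))\<^sup>2) \<le> (\<Sum>i<n. (1/2) ^ i)" by (rule sum_mono)
  also have "\<dots> \<le> 2" by (simp add: sum_gp_strict)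
  finally show ?thesis .
 qed
 then obtain h' s where h': "row_bound M h' s" "real_sq M s" "\<And>i. AE x in M. h' i x = h i x"
  using rows_square_integrable[of h M 2, OF h] by metis
 define b where "b x = complex_of_real (cmod (f 0 x) + 2 * s x)" for x
 have "(\<lambda>x. complex_of_real (cmod (f 0 x))) \<in> sq M"
  by (rule sq_dominated(1)[OF f[of 0], of _ 1]) (use sqD(1)[OF f] in auto)
 from sq_add[OF this sq_scale[OF h'(2), of 2]] have b: "b \<in> sq M" by (simp add: b_def[abs_def])
 have ae: "AE x in M. (\<forall>n. cmod (f n x) \<le> cmod (b x)) \<and> convergent (\<lambda>n. f n x)"
 proof -
  have "AE x in M. \<forall>i. h' i x = h i x" using h'(3) by (simp add: AE_all_countable)
  with AE_space show ?thesis
  proof eventually_elim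
   case (elim x)
   note R = row_boundD[OF h'(1)]
   have s0: "s x \<ge> 0" by (rule R(2)[OF elim(1)])
   have step: "cmod (f (Suc i) x - f i x) \<le> s x * (1/2) ^ i" for i
   proof -
    have "(cmod (h' i x))\<^sup>2 \<le> (\<Sum>i<Suc i. (cmod (h' i x))\<^sup>2)" by (simp add: sum_nonneg)
    also have "\<dots> \<le> (s x)\<^sup>2" by (rule R(3)[OF elim(1)])
    finally have "cmod (h' i x) \<le> s x" by (rule power2_le_imp_le) (rule s0)
    then have "2 ^ i * cmod (f (Suc i) x - f i x) \<le> s x" using elim(2) by (simp add: h_def norm_mult norm_power)
    then show ?thesis by (simp add: power_one_over field_simps)
   qed
   have tel: "f n x = f 0 x + (\<Sum>i<n. f (Suc i) x - f i x)" for n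
    using sum_lessThan_telescope[of "\<lambda>i. f i x" n] by simp
   have sm: "summable (\<lambda>i. s x * (1/2) ^ i)" by (intro summable_mult summable_geometric) simp
   have "summable (\<lambda>i. f (Suc i) x - f i x)" by (rule summable_comparison_test'[OF sm step])
   then have "(\<lambda>n. f 0 x + (\<Sum>i<n. f (Suc i) x - f i x)) \<longlonglongrightarrow> f 0 x + (\<Sum>i. f (Suc i) x - f i x)"
    by (intro tendsto_intros summable_LIMSEQ)
   then have "convergent (\<lambda>n. f n x)" unfolding tel[symmetric] by (rule convergentI)
   moreover have "cmod (f n x) \<le> cmod (b x)" for n
   proof -
    have "cmod (f n x) \<le> cmod (f 0 x) + (\<Sum>i<n. s x * (1/2) ^ i)"
     unfolding tel[of n] by (rule order_trans[OF norm_triangle_ineq add_left_mono[OF order_trans[OF norm_sum sum_mono[OF step]]]])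
    also have "(\<Sum>i<n. s x * (1/2) ^ i) \<le> s x * 2"
     unfolding sum_distrib_left[symmetric] by (rule mult_left_mono[OF _ s0]) (simp add: sum_gp_strict)
    finally show ?thesis using s0 unfolding b_def norm_of_real by simp
   qed
   ultimately show ?case by blast
  qed
 qed
 define g where "g x = lim (\<lambda>n. f n x)" for x
 have gm: "g \<in> borel_measurable M" unfolding g_def[abs_def] by (intro borel_measurable_lim_metric sqD(1)[OF f])
 have lim: "AE x in M. (\<lambda>n. f n x) \<longlonglongrightarrow> g x" using ae by eventually_elim (simp add: g_def convergent_LIMSEQ_iff)
 have le: "AE x in M. cmod (f n x) \<le> 1 * cmod (b x)" for n using ae by eventually_elim simp
 note dc = l2_dominated_convergence[OF b gm sqD(1)[OF f] lim le]
 show thesis by (rule that[OF dc(1) dc(3)])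
qed

definition ip :: "'a measure => ('a => complex) => ('a => complex) => complex" where
 "ip M f g = (LINT x|M. f x * cnj (g x))"

lemma ip_le: "f \<in> sq M ==> g \<in> sq M ==> cmod (ip M f g) \<le> l2norm M f * l2norm M g"
 unfolding ip_def using sq_cauchy_schwarz(3)[of f M "\<lambda>x. cnj (g x)"] by simp

lemma ip_cnj: "cnj (ip M f g) = ip M g f"
 unfolding ip_def Bochner_Integration.integral_cnj[symmetric] by (simp add: mult.commute)

lemma ip_self: "f \<in> sq M ==> ip M f f = of_real ((l2norm M f)\<^sup>2)"
 unfolding ip_def l2norm_square by (simp add: complex_norm_square[symmetric] del: of_real_power)

lemma ip_sum:
 assumes f: "\<And>i. i \<in> I ==> f i \<in> sq M" and g: "g \<in> sq M"
 shows "ip M (\<lambda>x. \<Sum>i\<in>I. c i * f i x) g = (\<Sum>i\<in>I. c i * ip M (f i) g)"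
  "ip M g (\<lambda>x. \<Sum>i\<in>I. c i * f i x) = (\<Sum>i\<in>I. cnj (c i) * ip M g (f i))"
proof -
 have "(\<lambda>x. (\<Sum>i\<in>I. c i * f i x) * cnj (g x)) = (\<lambda>x. \<Sum>i\<in>I. c i * (f i x * cnj (g x)))" by (simp add: sum_distrib_right mult.assoc)
 then show 1: "ip M (\<lambda>x. \<Sum>i\<in>I. c i * f i x) g = (\<Sum>i\<in>I. c i * ip M (f i) g)"
  unfolding ip_def by (simp add: Bochner_Integration.integral_sum sq_cauchy_schwarz(1) f g)
 show "ip M g (\<lambda>x. \<Sum>i\<in>I. c i * f i x) = (\<Sum>i\<in>I. cnj (c i) * ip M g (f i))"
  using arg_cong[OF 1, of cnj] by (simp add: ip_cnj)
qed

lemma ip_combine: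
 assumes f: "f \<in> sq M" and g: "g \<in> sq M" and h: "h \<in> sq M"
 shows "ip M (\<lambda>x. f x + c * g x) h = ip M f h + c * ip M g h" "ip M (\<lambda>x. f x - g x) h = ip M f h - ip M g h"
  "ip M h (\<lambda>x. f x - g x) = ip M h f - ip M h g" "ip M (\<lambda>x. c * f x) h = c * ip M f h" "ip M h (\<lambda>x. c * f x) = cnj c * ip M h f"
  "(l2norm M (\<lambda>x. f x - g x))\<^sup>2 = (l2norm M f)\<^sup>2 - 2 * Re (ip M f g) + (l2norm M g)\<^sup>2"
  "(l2norm M (\<lambda>x. f x + g x))\<^sup>2 = (l2norm M f)\<^sup>2 + 2 * Re (ip M f g) + (l2norm M g)\<^sup>2"
proof -
 note i = sq_cauchy_schwarz(1)[OF _ sq_cnj]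
 show "ip M (\<lambda>x. f x + c * g x) h = ip M f h + c * ip M g h" "ip M (\<lambda>x. c * f x) h = c * ip M f h" "ip M h (\<lambda>x. c * f x) = cnj c * ip M h f"
  unfolding ip_def using i[OF f h] i[OF g h] by (simp_all add: distrib_right mult.assoc mult.left_commute)
 have D: "ip M (\<lambda>x. f x - g x) h = ip M f h - ip M g h" "ip M h (\<lambda>x. f x - g x) = ip M h f - ip M h g"
  if "f \<in> sq M" "g \<in> sq M" "h \<in> sq M" for f g h
  unfolding ip_def using i[OF that(1,3)] i[OF that(2,3)] i[OF that(3,1)] i[OF that(3,2)] by (simp_all add: left_diff_distrib right_diff_distrib)
 then show "ip M (\<lambda>x. f x - g x) h = ip M f h - ip M g h" "ip M h (\<lambda>x. f x - g x) = ip M h f - ip M h g" using f g h by simp_all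
 have sqn: "(l2norm M (\<lambda>x. f x - g x))\<^sup>2 = (l2norm M f)\<^sup>2 - 2 * Re (ip M f g) + (l2norm M g)\<^sup>2" if g: "g \<in> sq M" for g
 proof -
  have "complex_of_real ((l2norm M (\<lambda>x. f x - g x))\<^sup>2) = ip M f f - ip M f g - (cnj (ip M f g) - ip M g g)"
   unfolding ip_self[OF sq_diff[OF f g], symmetric] D(1)[OF f g sq_diff[OF f g]] D(2)[OF f g f] D(2)[OF f g g] ip_cnj ..
  then have "Re (complex_of_real ((l2norm M (\<lambda>x. f x - g x))\<^sup>2)) = Re (ip M f f - ip M f g - (cnj (ip M f g) - ip M g g))" by simp
  then show ?thesis by (simp add: ip_self[OF f] ip_self[OF g])
 qed
 then show "(l2norm M (\<lambda>x. f x - g x))\<^sup>2 = (l2norm M f)\<^sup>2 - 2 * Re (ip M f g) + (l2norm M g)\<^sup>2" using g by blast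
 have "ip M f (\<lambda>x. - g x) = - ip M f g" by (simp add: ip_def)
 then show "(l2norm M (\<lambda>x. f x + g x))\<^sup>2 = (l2norm M f)\<^sup>2 + 2 * Re (ip M f g) + (l2norm M g)\<^sup>2"
  using sqn[OF sq_minus[OF g]] by simp
qed

text \<open>The functional \<open>J f = \<parallel>f\<parallel>\<^sup>2 - 2 Re (\<phi> f)\<close> is bounded below, the parallelogram law makes minimising sequences Cauchy, and the first variation at the minimiser \<open>p\<close> is the equation \<open>\<phi> g = \<langle>g, p\<rangle>\<close>.\<close>

theorem riesz_representation:
 assumes lin: "\<And>f g c. f \<in> sq M ==> g \<in> sq M ==> \<phi> (\<lambda>x. f x + c * g x) = \<phi> f + c * \<phi> g"
  and bd: "\<And>f. f \<in> sq M ==> cmod (\<phi> f) \<le> C * l2norm M f"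
 obtains p where "p \<in> sq M" "\<And>f. f \<in> sq M ==> \<phi> f = ip M f p"
proof -
 define J where "J f = (l2norm M f)\<^sup>2 - 2 * Re (\<phi> f)" for f
 define S where "S = J ` sq M"
 have below: "- (C\<^sup>2) \<le> J f" if "f \<in> sq M" for f
 proof -
  have "Re (\<phi> f) \<le> C * l2norm M f" using bd[OF that] complex_Re_le_cmod[of "\<phi> f"] by linarith
  then show ?thesis using zero_le_power2[of "l2norm M f - C"] unfolding J_def power2_diff by (simp add: mult.commute)
 qed
 have ne: "S \<noteq> {}" unfolding S_def using sq_zero by blast
 have bdd: "bdd_below S" unfolding S_def by (rule bdd_belowI[of _ "- (C\<^sup>2)"]) (use below in auto)
 define m where "m = Inf S"
 have low: "m \<le> J f" if "f \<in> sq M" for f unfolding m_def S_def by (rule cInf_lower) (use that bdd S_def in auto)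
 have "\<exists>f. f \<in> sq M \<and> J f < m + (1/8) ^ n / 4" for n :: nat
  using cInf_lessD[OF ne, of "m + (1/8) ^ n / 4"] unfolding m_def S_def by auto
 then obtain f where f: "\<And>n::nat. f n \<in> sq M" "\<And>n. J (f n) < m + (1/8) ^ n / 4" by metis
 have sc: "\<phi> (\<lambda>x. c * g x) = c * \<phi> g" if "g \<in> sq M" for c g
  using lin[OF sq_zero that, of c] lin[OF sq_zero sq_zero, of 1] by simp
 have par: "(l2norm M (\<lambda>x. g x - h x))\<^sup>2 \<le> 2 * (J g - m) + 2 * (J h - m)" if g: "g \<in> sq M" and h: "h \<in> sq M" for g h
 proof -
  (* the midpoint, for the parallelogram law *)
  define k where "k x = (1/2) * (g x + 1 * h x)" for x
  have k: "k \<in> sq M" unfolding k_def using g h by (intro sq_scale sq_add) auto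
  have "\<phi> k = (1/2) * (\<phi> g + \<phi> h)" unfolding k_def using sc[OF sq_add[OF g h], of "1/2"] lin[OF g h, of 1] by simp
  then have "2 * \<phi> k = \<phi> g + \<phi> h" by (simp add: mult.commute)
  from arg_cong[OF this, of Re] have rk: "Re (\<phi> k) = (Re (\<phi> g) + Re (\<phi> h)) / 2" by simp
  have "(l2norm M k)\<^sup>2 = (l2norm M (\<lambda>x. g x + h x))\<^sup>2 / 4" unfolding k_def l2norm_scale by (simp add: power_divide)
  then have "4 * J k = 2 * J g + 2 * J h - (l2norm M (\<lambda>x. g x - h x))\<^sup>2"
   unfolding J_def rk ip_combine(6)[OF g h g] using ip_combine(7)[OF g h g] by (simp add: field_simps)
  moreover have "4 * m \<le> 4 * J k" using low[OF k] by simp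
  ultimately show ?thesis by (simp add: algebra_simps)
 qed
 have "(l2norm M (\<lambda>x. f (Suc n) x - f n x))\<^sup>2 \<le> (1/8) ^ n" for n
 proof -
  have lin: "D \<le> a" if a: "0 \<le> a" and D: "D \<le> 2 * (j' - b) + 2 * (j - b)" and j: "j < b + a / 4" and j': "j' < b + 1/8 * a / 4" for D a b j j' :: real
  proof -
   have "2 * (j - b) \<le> a / 2" "2 * (j' - b) \<le> a / 16" using j j' by (simp_all add: field_simps)
   then have "D \<le> a / 2 + a / 16" using D by (rule_tac order_trans[OF D]) (simp add: add.commute add_mono)
   also have "\<dots> \<le> a" using a by simp
   finally show ?thesis .
  qed
  show ?thesis by (rule lin[OF _ par[OF f(1) f(1)] f(2) f(2)[of "Suc n", unfolded power_Suc]]) simp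
 qed
 then obtain p where p: "p \<in> sq M" "(\<lambda>n. l2norm M (\<lambda>x. p x - f n x)) \<longlonglongrightarrow> 0" by (rule l2_fast_limit[of f, OF f(1)])
 have Jp: "J p \<le> m"
 proof (rule LIMSEQ_le_const)
  have \<phi>d: "\<phi> g - \<phi> h = \<phi> (\<lambda>x. g x - h x)" if "g \<in> sq M" "h \<in> sq M" for g h using lin[OF that, of "-1"] by simp
  have "(\<lambda>n. C * l2norm M (\<lambda>x. p x - f n x)) \<longlonglongrightarrow> C * 0" by (intro tendsto_intros p(2))
  then have l0: "(\<lambda>n. C * l2norm M (\<lambda>x. p x - f n x)) \<longlonglongrightarrow> 0" by simp
  have "norm (\<phi> p - \<phi> (f n)) \<le> C * l2norm M (\<lambda>x. p x - f n x)" for n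
   unfolding \<phi>d[OF p(1) f(1)] by (rule bd[OF sq_diff[OF p(1) f(1)]])
  then have "(\<lambda>n. \<phi> p - \<phi> (f n)) \<longlonglongrightarrow> 0" by (intro Lim_null_comparison[OF always_eventually l0]) blast
  from tendsto_diff[OF tendsto_const[of "\<phi> p"] this] have "(\<lambda>n. \<phi> (f n)) \<longlonglongrightarrow> \<phi> p" by simp
  moreover have "(\<lambda>n. l2norm M (f n)) \<longlonglongrightarrow> l2norm M p"
  proof -
   have "norm (l2norm M (f n) - l2norm M p) \<le> l2norm M (\<lambda>x. p x - f n x)" for n
    using l2norm_triangle_diff[OF f(1)[of n] p(1) sq_zero] l2norm_triangle_diff[OF p(1) f(1)[of n] sq_zero]
     l2norm_minus_commute[of M p "f n"] by simp
   then have "(\<lambda>n. l2norm M (f n) - l2norm M p) \<longlonglongrightarrow> 0" by (intro Lim_null_comparison[OF _ p(2)]) auto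
   then show ?thesis by (simp add: LIM_zero_iff)
  qed
  ultimately have "(\<lambda>n. J (f n)) \<longlonglongrightarrow> J p" unfolding J_def by (intro tendsto_intros)
  then have "(\<lambda>n. (m + (1/8) ^ n / 4) - J (f n)) \<longlonglongrightarrow> (m + 0 / 4) - J p" by (intro tendsto_intros LIMSEQ_power_zero) auto
  then show "(\<lambda>n. J p + ((m + (1/8) ^ n / 4) - J (f n))) \<longlonglongrightarrow> m" using tendsto_add[OF tendsto_const[of "J p"]] by fastforce
  show "\<exists>k. \<forall>n\<ge>k. J p \<le> J p + ((m + (1/8) ^ n / 4) - J (f n))" using f(2) by (auto intro: less_imp_le)
 qed
 show thesis
 proof (rule that[OF p(1)])
  fix g assume g: "g \<in> sq M"
  define d where "d = ip M g p - \<phi> g"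
  have all: "2 * (cmod d)\<^sup>2 \<le> t * ((cmod d)\<^sup>2 * (l2norm M g)\<^sup>2)" if t: "t > 0" for t :: real
  proof -
   define c where "c = - of_real t * cnj d"
   have q: "(\<lambda>x. p x + c * g x) \<in> sq M" by (intro sq_add sq_scale p(1) g)
   have "J p \<le> J (\<lambda>x. p x + c * g x)" using Jp low[OF q] by linarith
   also have "\<dots> = J p + 2 * Re (cnj (ip M p (\<lambda>x. c * g x)) - c * \<phi> g) + (l2norm M (\<lambda>x. c * g x))\<^sup>2"
    unfolding J_def lin[OF p(1) g] ip_combine(7)[OF p(1) sq_scale[OF g] g] by simp
   also have "cnj (ip M p (\<lambda>x. c * g x)) - c * \<phi> g = c * d"
    unfolding ip_combine(5)[OF g g p(1)] by (simp add: ip_cnj d_def right_diff_distrib)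
   also have "c * d = of_real (- t * (cmod d)\<^sup>2)" by (simp add: c_def complex_norm_square mult.assoc mult.commute[of "cnj d"] del: of_real_power)
   also have "(l2norm M (\<lambda>x. c * g x))\<^sup>2 = t * (t * ((cmod d)\<^sup>2 * (l2norm M g)\<^sup>2))"
    using t by (simp add: c_def norm_mult power_mult_distrib power2_eq_square mult_ac)
   finally have "t * (2 * (cmod d)\<^sup>2) \<le> t * (t * ((cmod d)\<^sup>2 * (l2norm M g)\<^sup>2))" by simp
   then show ?thesis using t by (simp only: mult_le_cancel_left_pos)
  qed
  have "2 * (cmod d)\<^sup>2 \<le> 0"
  proof (rule field_le_epsilon)
   fix e :: real assume e: "e > 0"
   define K where "K = (cmod d)\<^sup>2 * (l2norm M g)\<^sup>2"
   have K: "K \<ge> 0" by (simp add: K_def)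
   have "e / (K + 1) > 0" using e K by simp
   then have "2 * (cmod d)\<^sup>2 \<le> e / (K + 1) * K" unfolding K_def by (rule all)
   also have "\<dots> \<le> e / (K + 1) * (K + 1)" using e K by (intro mult_left_mono) auto
   also have "\<dots> = e" using K by simp
   finally show "2 * (cmod d)\<^sup>2 \<le> 0 + e" by simp
  qed
  then show "\<phi> g = ip M g p" by (simp add: d_def)
 qed
qed

lemma bessel:
 assumes S: "finite S" and u: "\<And>t. t \<in> S ==> u t \<in> sq M" "\<And>t. t \<in> S ==> l2norm M (u t) = 1"
  and orth: "\<And>t t'. t \<in> S ==> t' \<in> S ==> t \<noteq> t' ==> ip M (u t) (u t') = 0" and f: "f \<in> sq M"
 shows "(l2norm M (\<lambda>x. f x - (\<Sum>t\<in>S. ip M f (u t) * u t x)))\<^sup>2 + (\<Sum>t\<in>S. (cmod (ip M f (u t)))\<^sup>2) = (l2norm M f)\<^sup>2"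
  "t' \<in> S ==> ip M (\<lambda>x. f x - (\<Sum>t\<in>S. ip M f (u t) * u t x)) (u t') = 0"
proof -
 define q where "q x = (\<Sum>t\<in>S. ip M f (u t) * u t x)" for x
 have q: "q \<in> sq M" unfolding q_def[abs_def] by (intro sq_sum sq_scale u)
 have qu: "ip M q (u t') = ip M f (u t')" if t': "t' \<in> S" for t'
 proof -
  have "ip M q (u t') = (\<Sum>t\<in>S. ip M f (u t) * ip M (u t) (u t'))" unfolding q_def[abs_def] by (rule ip_sum(1)[OF u(1) u(1)[OF t']])
  also have "\<dots> = (\<Sum>t\<in>S. if t = t' then ip M f (u t) else 0)"
   by (rule sum.cong[OF refl]) (use orth[OF _ t'] ip_self[OF u(1)[OF t']] u(2)[OF t'] in auto)
  finally show ?thesis using S t' by simp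
 qed
 show "t' \<in> S ==> ip M (\<lambda>x. f x - (\<Sum>t\<in>S. ip M f (u t) * u t x)) (u t') = 0"
  using ip_combine(2)[OF f q u(1)] qu by (simp add: q_def)
 have "ip M h q = (\<Sum>t\<in>S. cnj (ip M f (u t)) * ip M h (u t))" if "h \<in> sq M" for h
  unfolding q_def[abs_def] by (rule ip_sum(2)[OF u(1) that])
 then have "ip M h q = (\<Sum>t\<in>S. of_real ((cmod (ip M f (u t)))\<^sup>2))" if "h = f \<or> h = q" for h
  using that f q qu by (auto simp: complex_norm_square mult.commute simp del: of_real_power intro!: sum.cong)
 then have "ip M f q = of_real (\<Sum>t\<in>S. (cmod (ip M f (u t)))\<^sup>2)" "ip M q q = of_real (\<Sum>t\<in>S. (cmod (ip M f (u t)))\<^sup>2)" by simp_all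
 then have "Re (ip M f q) = (\<Sum>t\<in>S. (cmod (ip M f (u t)))\<^sup>2)" "(l2norm M q)\<^sup>2 = (\<Sum>t\<in>S. (cmod (ip M f (u t)))\<^sup>2)"
  using ip_self[OF q] by (simp_all only: Re_complex_of_real of_real_eq_iff)
 then show "(l2norm M (\<lambda>x. f x - (\<Sum>t\<in>S. ip M f (u t) * u t x)))\<^sup>2 + (\<Sum>t\<in>S. (cmod (ip M f (u t)))\<^sup>2) = (l2norm M f)\<^sup>2"
  using ip_combine(6)[OF f q f] by (simp add: q_def[abs_def])
qed

section \<open>Singular value decomposition of compact forms\<close>

text \<open>Bilinear forms of compact operators. The form is linear in both arguments, so the limit \<open>w\<close> appears conjugated on the right of the inner product.\<close>

definition compact_form :: "'a measure => 'b measure => (('a => complex) => ('b => complex) => complex) => bool" where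
 "compact_form M N F \<longleftrightarrow>
   (\<forall>f\<in>sq M. \<forall>f'\<in>sq M. \<forall>g\<in>sq N. \<forall>c. F (\<lambda>x. f x + c * f' x) g = F f g + c * F f' g)
  \<and> (\<forall>f\<in>sq M. \<forall>g\<in>sq N. \<forall>g'\<in>sq N. \<forall>c. F f (\<lambda>y. g y + c * g' y) = F f g + c * F f g')
  \<and> (\<exists>C\<ge>0. \<forall>f\<in>sq M. \<forall>g\<in>sq N. cmod (F f g) \<le> C * (l2norm M f * l2norm N g))
  \<and> (\<forall>s. (\<forall>n::nat. s n \<in> sq M \<and> l2norm M (s n) \<le> 1) \<longrightarrow> (\<exists>r w. strict_mono r \<and> w \<in> sq N
    \<and> (\<forall>e>0. \<forall>\<^sub>F n in sequentially. \<forall>g\<in>sq N. cmod (F (s (r n)) g - ip N g w) \<le> e * l2norm N g)))"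

lemma compact_formD:
 assumes "compact_form M N F"
 shows "f \<in> sq M ==> f' \<in> sq M ==> g \<in> sq N ==> F (\<lambda>x. f x + c * f' x) g = F f g + c * F f' g"
  "f \<in> sq M ==> g \<in> sq N ==> g' \<in> sq N ==> F f (\<lambda>y. g y + c * g' y) = F f g + c * F f g'"
  "\<exists>C\<ge>0. \<forall>f\<in>sq M. \<forall>g\<in>sq N. cmod (F f g) \<le> C * (l2norm M f * l2norm N g)"
  "(\<And>n::nat. s n \<in> sq M) ==> (\<And>n. l2norm M (s n) \<le> 1) ==> \<exists>r w. strict_mono r \<and> w \<in> sq N
    \<and> (\<forall>e>0. \<forall>\<^sub>F n in sequentially. \<forall>g\<in>sq N. cmod (F (s (r n)) g - ip N g w) \<le> e * l2norm N g)"
 using assms unfolding compact_form_def by simp_all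

text \<open>A singular value with its singular vectors, for a form that is linear in both arguments: \<open>u\<close> is mapped to \<open>\<sigma>\<close> times the conjugate of \<open>v\<close> and conversely.\<close>

definition singular :: "'a measure => 'b measure => (('a => complex) => ('b => complex) => complex)
  => real \<times> ('a => complex) \<times> ('b => complex) => bool" where
 "singular M N F = (\<lambda>(\<sigma>, u, v). \<sigma> > 0 \<and> u \<in> sq M \<and> v \<in> sq N \<and> l2norm M u = 1 \<and> l2norm N v = 1
   \<and> (\<forall>g\<in>sq N. F u g = of_real \<sigma> * ip N g v) \<and> (\<forall>f\<in>sq M. F f v = of_real \<sigma> * ip M f u))"

text \<open>Compactness gives a limit \<open>w\<close> of images of near-maximisers, of norm equal to the norm \<open>\<sigma>\<close> of the form. Then \<open>v = w / \<sigma>\<close> is one singular vector, and Riesz representation of \<open>f \<mapsto> F f v\<close> gives the other one; equality in Cauchy-Schwarz yields the remaining equation.\<close>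

lemma top_singular_triple:
 assumes F: "compact_form M N F" and e: "e \<ge> 0"
  and big: "f0 \<in> sq M" "g0 \<in> sq N" "e * (l2norm M f0 * l2norm N g0) < cmod (F f0 g0)"
 shows "\<exists>\<sigma> u v. \<sigma> > e \<and> singular M N F (\<sigma>, u, v)"
proof -
 note FD = compact_formD[OF F]
 obtain C where C: "C \<ge> 0" "\<And>f g. f \<in> sq M ==> g \<in> sq N ==> cmod (F f g) \<le> C * (l2norm M f * l2norm N g)" using FD(3) by blast
 have Fs1: "F (\<lambda>x. c * f x) g = c * F f g" if "f \<in> sq M" "g \<in> sq N" for c f g
  using FD(1)[OF sq_zero that, of c] FD(1)[OF sq_zero sq_zero that(2), of 1] by simp
 have Fs2: "F f (\<lambda>x. c * g x) = c * F f g" if "f \<in> sq M" "g \<in> sq N" for c f g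
  using FD(2)[OF that(1) sq_zero that(2), of c] FD(2)[OF that(1) sq_zero sq_zero, of 1] by simp
 define S where "S = {cmod (F f g) | f g. f \<in> sq M \<and> g \<in> sq N \<and> l2norm M f \<le> 1 \<and> l2norm N g \<le> 1}"
 define \<sigma> where "\<sigma> = Sup S"
 have "cmod (F f g) \<le> C" if "f \<in> sq M" "g \<in> sq N" "l2norm M f \<le> 1" "l2norm N g \<le> 1" for f g
  using C(2)[OF that(1,2)] mult_left_mono[OF mult_mono[OF that(3,4)] C(1)] by simp
 then have bdd: "bdd_above S" unfolding S_def by (intro bdd_aboveI[of _ C]) auto
 have ne: "S \<noteq> {}" unfolding S_def using sq_zero[of M] sq_zero[of N] by (auto intro!: exI[of _ "\<lambda>x. 0"])
 have up: "cmod (F f g) \<le> \<sigma> * (l2norm M f * l2norm N g)" if f: "f \<in> sq M" and g: "g \<in> sq N" for f g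
 proof (cases "l2norm M f = 0 \<or> l2norm N g = 0")
  case True
  then show ?thesis using C(2)[OF f g] by auto
 next
  case False
  then have pos: "l2norm M f > 0" "l2norm N g > 0" by (auto simp: less_le)
  define a b where "a = complex_of_real (1 / l2norm M f)" and "b = complex_of_real (1 / l2norm N g)"
  have ab: "cmod a = 1 / l2norm M f" "cmod b = 1 / l2norm N g" unfolding a_def b_def norm_of_real using pos by simp_all
  have "cmod (F (\<lambda>x. a * f x) (\<lambda>y. b * g y)) \<le> \<sigma>" unfolding \<sigma>_def
   by (rule cSup_upper[OF _ bdd]) (use f g pos ab in \<open>auto simp: S_def intro!: exI[of _ "\<lambda>x. a * f x"] exI[of _ "\<lambda>y. b * g y"]\<close>)
  also have "F (\<lambda>x. a * f x) (\<lambda>y. b * g y) = a * (b * F f g)" using Fs1[OF f sq_scale[OF g]] Fs2[OF f g] by simp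
  finally show ?thesis using pos by (simp add: norm_mult ab field_simps)
 qed
 have "l2norm M f0 * l2norm N g0 \<noteq> 0" using C(2)[OF big(1,2)] big(3) by auto
 then have "l2norm M f0 * l2norm N g0 > 0" by (simp add: less_le)
 moreover have "e * (l2norm M f0 * l2norm N g0) < \<sigma> * (l2norm M f0 * l2norm N g0)" using up[OF big(1,2)] big(3) by linarith
 ultimately have \<sigma>e: "\<sigma> > e" by (simp add: mult_less_cancel_right_pos)
 then have \<sigma>: "\<sigma> > 0" using e by linarith
 have "\<exists>f g. f \<in> sq M \<and> g \<in> sq N \<and> l2norm M f \<le> 1 \<and> l2norm N g \<le> 1 \<and> \<sigma> - inverse (real (Suc n)) < cmod (F f g)" for n
  using less_cSup_iff[OF ne bdd, of "\<sigma> - inverse (real (Suc n))"] by (auto simp: \<sigma>_def S_def)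
 then obtain f g where fg: "\<And>n. f n \<in> sq M" "\<And>n. g n \<in> sq N" "\<And>n. l2norm M (f n) \<le> 1" "\<And>n. l2norm N (g n) \<le> 1"
  "\<And>n. \<sigma> - inverse (real (Suc n)) < cmod (F (f n) (g n))" by metis
 obtain r w where r: "strict_mono r" "w \<in> sq N" "\<And>e. e > 0 ==> \<forall>\<^sub>F n in sequentially. \<forall>g\<in>sq N. cmod (F (f (r n)) g - ip N g w) \<le> e * l2norm N g"
  using FD(4)[of f, OF fg(1,3)] by blast
 have near: "\<exists>f\<in>sq M. l2norm M f \<le> 1 \<and> (\<exists>g\<in>sq N. l2norm N g \<le> 1 \<and> \<sigma> - d < cmod (F f g)) \<and> (\<forall>g\<in>sq N. cmod (F f g - ip N g w) \<le> d * l2norm N g)"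
  if d: "d > 0" for d
 proof -
  have "\<forall>\<^sub>F n in sequentially. inverse (real (Suc n)) < d" using order_tendstoD(2)[OF LIMSEQ_inverse_real_of_nat d] .
  then have "\<forall>\<^sub>F n in sequentially. inverse (real (Suc (r n))) < d" by (rule eventually_subseq[OF r(1)])
  with r(3)[OF d] have "\<forall>\<^sub>F n in sequentially. inverse (real (Suc (r n))) < d \<and> (\<forall>g\<in>sq N. cmod (F (f (r n)) g - ip N g w) \<le> d * l2norm N g)"
   by eventually_elim simp
  then obtain n where n: "inverse (real (Suc (r n))) < d" "\<forall>g\<in>sq N. cmod (F (f (r n)) g - ip N g w) \<le> d * l2norm N g"
   unfolding eventually_sequentially by blast
  have "\<sigma> - d < cmod (F (f (r n)) (g (r n)))" using fg(5)[of "r n"] n(1) by linarith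
  then show ?thesis using fg n(2) by blast
 qed
 have w: "l2norm N w = \<sigma>"
 proof (rule antisym)
  show "l2norm N w \<le> \<sigma>"
  proof (rule field_le_epsilon)
   fix d :: real assume "d > 0"
   then obtain f where f: "f \<in> sq M" "l2norm M f \<le> 1" "\<forall>g\<in>sq N. cmod (F f g - ip N g w) \<le> d * l2norm N g" using near by blast
   have "cmod (ip N w w) \<le> cmod (F f w) + cmod (F f w - ip N w w)" using norm_triangle_ineq4[of "F f w" "F f w - ip N w w"] by simp
   also have "\<dots> \<le> \<sigma> * (1 * l2norm N w) + d * l2norm N w"
    using f(3) r(2) order_trans[OF up[OF f(1) r(2)] mult_left_mono[OF mult_right_mono[OF f(2) l2norm_nonneg] less_imp_le[OF \<sigma>]]]
    by (intro add_mono) auto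
   finally have "l2norm N w * l2norm N w \<le> (\<sigma> + d) * l2norm N w"
    unfolding ip_self[OF r(2)] norm_of_real by (simp add: power2_eq_square distrib_right)
   then show "l2norm N w \<le> \<sigma> + d" using \<sigma> \<open>d > 0\<close> by (cases "l2norm N w = 0") (auto simp: mult_le_cancel_right)
  qed
  show "\<sigma> \<le> l2norm N w"
  proof (rule field_le_epsilon)
   fix d :: real assume d: "d > 0"
   obtain f g where f: "g \<in> sq N" "l2norm N g \<le> 1" "\<sigma> - d / 2 < cmod (F f g)" "cmod (F f g - ip N g w) \<le> d / 2 * l2norm N g"
    using near[of "d / 2"] d by auto
   have "cmod (F f g) \<le> cmod (ip N g w) + cmod (F f g - ip N g w)" using norm_triangle_ineq[of "ip N g w" "F f g - ip N g w"] by simp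
   moreover have "cmod (ip N g w) \<le> 1 * l2norm N w" by (rule order_trans[OF ip_le[OF f(1) r(2)] mult_right_mono[OF f(2)]]) simp
   moreover have "d / 2 * l2norm N g \<le> d / 2 * 1" using f(2) d by (intro mult_left_mono) auto
   ultimately show "\<sigma> \<le> l2norm N w + d" using f(3,4) by linarith
  qed
 qed
 define i where "i = complex_of_real (1 / \<sigma>)"
 have i: "cmod i = 1 / \<sigma>" "of_real \<sigma> * i = 1" "cnj i = i" unfolding i_def norm_of_real using \<sigma> by simp_all
 (* w has norm \<sigma>, and i is 1 / \<sigma> *)
 define v where "v y = i * w y" for y
 have v: "v \<in> sq N" "l2norm N v = 1" unfolding v_def[abs_def] l2norm_scale w i(1) using r(2) \<sigma> by auto
 have vw: "ip N v w = of_real \<sigma>"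
  unfolding v_def[abs_def] ip_combine(4)[OF r(2) r(2) r(2)] ip_self[OF r(2)] w using i(2) by (simp add: power2_eq_square mult_ac)
 obtain p where p: "p \<in> sq M" "\<And>f. f \<in> sq M ==> F f v = ip M f p"
  by (rule riesz_representation[of M "\<lambda>f. F f v" \<sigma>]) (use FD(1)[OF _ _ v(1)] up[OF _ v(1)] v(2) in simp_all)
 have pn: "l2norm M p = \<sigma>"
 proof (rule antisym)
  have "l2norm M p * l2norm M p \<le> \<sigma> * l2norm M p"
   using up[OF p(1) v(1)] unfolding p(2)[OF p(1)] ip_self[OF p(1)] norm_of_real v(2) by (simp add: power2_eq_square)
  then show "l2norm M p \<le> \<sigma>" using \<sigma> by (cases "l2norm M p = 0") (auto simp: mult_le_cancel_right)
  show "\<sigma> \<le> l2norm M p"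
  proof (rule field_le_epsilon)
   fix d :: real assume "d > 0"
   then obtain f where f: "f \<in> sq M" "l2norm M f \<le> 1" "\<forall>g\<in>sq N. cmod (F f g - ip N g w) \<le> d * l2norm N g" using near by blast
   have "cmod (ip M f p - of_real \<sigma>) \<le> d" using f(3) v vw p(2)[OF f(1)] by fastforce
   moreover have "\<sigma> \<le> cmod (ip M f p) + cmod (ip M f p - of_real \<sigma>)"
    using norm_triangle_ineq4[of "ip M f p" "ip M f p - of_real \<sigma>"] \<sigma> by simp
   moreover have "cmod (ip M f p) \<le> 1 * l2norm M p" by (rule order_trans[OF ip_le[OF f(1) p(1)] mult_right_mono[OF f(2)]]) simp
   ultimately show "\<sigma> \<le> l2norm M p + d" by linarith
  qed
 qed
 define u where "u x = i * p x" for x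
 have u: "u \<in> sq M" "l2norm M u = 1" unfolding u_def[abs_def] l2norm_scale pn i(1) using p(1) \<sigma> by auto
 have right: "F f v = of_real \<sigma> * ip M f u" if "f \<in> sq M" for f
  unfolding p(2)[OF that] u_def[abs_def] ip_combine(5)[OF p(1) p(1) that] i(3) mult.assoc[symmetric] i(2) by simp
 obtain q where q: "q \<in> sq N" "\<And>g. g \<in> sq N ==> F u g = ip N g q"
  by (rule riesz_representation[of N "\<lambda>g. F u g" \<sigma>]) (use FD(2)[OF u(1)] up[OF u(1)] u(2) in simp_all)
 have qn: "l2norm N q \<le> \<sigma>"
 proof -
  have "l2norm N q * l2norm N q \<le> \<sigma> * l2norm N q"
   using up[OF u(1) q(1)] unfolding q(2)[OF q(1)] ip_self[OF q(1)] norm_of_real u(2) by (simp add: power2_eq_square)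
  then show ?thesis using \<sigma> by (cases "l2norm N q = 0") (auto simp: mult_le_cancel_right)
 qed
 have sv: "(\<lambda>y. of_real \<sigma> * v y) \<in> sq N" by (rule sq_scale[OF v(1)])
 have "F u v = of_real \<sigma>" using right[OF u(1)] ip_self[OF u(1)] u(2) by simp
 then have "ip N v q = of_real \<sigma>" using q(2)[OF v(1)] by simp
 moreover have "ip N q v = cnj (ip N v q)" by (simp add: ip_cnj)
 ultimately have qv: "ip N q v = of_real \<sigma>" by simp
 then have "ip N q (\<lambda>y. of_real \<sigma> * v y) = of_real (\<sigma> * \<sigma>)"
  unfolding ip_combine(5)[OF v(1) v(1) q(1)] by simp
 then have "(l2norm N (\<lambda>y. q y - of_real \<sigma> * v y))\<^sup>2 = (l2norm N q)\<^sup>2 - \<sigma>\<^sup>2"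
  unfolding ip_combine(6)[OF q(1) sv v(1)] using v(2) \<sigma> by (simp add: power2_eq_square)
 also have "\<dots> \<le> 0" using power_mono[OF qn l2norm_nonneg, of 2] by simp
 finally have z: "l2norm N (\<lambda>y. q y - of_real \<sigma> * v y) = 0" by simp
 have "F u g = of_real \<sigma> * ip N g v" if g: "g \<in> sq N" for g
 proof -
  have "cmod (ip N g q - ip N g (\<lambda>y. of_real \<sigma> * v y)) \<le> 0"
   using ip_le[OF g sq_diff[OF q(1) sv]] z unfolding ip_combine(3)[OF q(1) sv g] by simp
  then show ?thesis unfolding q(2)[OF g] using ip_combine(5)[OF v(1) v(1) g, of "of_real \<sigma>"] by simp
 qed
 then have "singular M N F (\<sigma>, u, v)" unfolding singular_def using \<sigma> u v right by blast
 then show ?thesis using \<sigma>e by blast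
qed

abbreviation lvec :: "real \<times> ('a => complex) \<times> ('b => complex) => 'a => complex" where
 "lvec t \<equiv> fst (snd t)"

abbreviation rvec :: "real \<times> ('a => complex) \<times> ('b => complex) => 'b => complex" where
 "rvec t \<equiv> snd (snd t)"

text \<open>The projection onto the orthogonal complement of the left singular vectors in \<open>S\<close>.\<close>

definition deflation :: "'a measure => (real \<times> ('a => complex) \<times> ('b => complex)) set => ('a => complex) => 'a => complex" where
 "deflation M S f x = f x - (\<Sum>t\<in>S. ip M f (lvec t) * lvec t x)"

definition singular_system :: "'a measure => 'b measure => (('a => complex) => ('b => complex) => complex) => real
  => (real \<times> ('a => complex) \<times> ('b => complex)) set => bool" where
 "singular_system M N F e S \<longleftrightarrow> (\<forall>t\<in>S. singular M N F t \<and> e < fst t)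
   \<and> (\<forall>t\<in>S. \<forall>t'\<in>S. t \<noteq> t' \<longrightarrow> ip M (lvec t) (lvec t') = 0)"

lemma singularD:
 assumes "singular M N F t"
 shows "fst t > 0" "lvec t \<in> sq M" "rvec t \<in> sq N" "l2norm M (lvec t) = 1" "l2norm N (rvec t) = 1"
  "g \<in> sq N ==> F (lvec t) g = of_real (fst t) * ip N g (rvec t)"
  "f \<in> sq M ==> F f (rvec t) = of_real (fst t) * ip M f (lvec t)"
 using assms unfolding singular_def case_prod_beta by blast+

lemma singular_systemD:
 assumes "singular_system M N F e S"
 shows "t \<in> S ==> singular M N F t" "t \<in> S ==> e < fst t"
  "t \<in> S ==> t' \<in> S ==> t \<noteq> t' ==> ip M (lvec t) (lvec t') = 0"
 using assms unfolding singular_system_def by blast+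

lemma singular_right_orthogonal:
 assumes t: "singular M N F t" and t': "singular M N F t'" and o: "ip M (lvec t) (lvec t') = 0"
 shows "ip N (rvec t) (rvec t') = 0"
proof -
 have "ip M (lvec t') (lvec t) = 0" using o ip_cnj[of M "lvec t" "lvec t'"] by simp
 then have "F (lvec t') (rvec t) = 0" using singularD(7)[OF t singularD(2)[OF t']] by simp
 then show ?thesis using singularD(6)[OF t' singularD(3)[OF t]] singularD(1)[OF t'] by simp
qed

context
 fixes M :: "'a measure" and N :: "'b measure" and F
 assumes F: "compact_form M N F"
begin

text \<open>Images of infinitely many orthonormal \<open>u\<close> with singular values above \<open>e\<close> would stay \<open>e\<close> apart and have no convergent subsequence.\<close>

lemma singular_system_finite:
 assumes S: "singular_system M N F e S" and e: "e > 0"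
 shows "finite S"
proof (rule ccontr)
 assume "infinite S"
 then obtain t :: "nat => _" where t: "inj t" "range t \<subseteq> S" using infinite_countable_subset[of S] by blast
 have tS: "t n \<in> S" for n using t(2) by blast
 note sg = singularD[OF singular_systemD(1)[OF S tS]]
 obtain r w where r: "strict_mono r" "\<And>d. d > 0 ==> \<forall>\<^sub>F n in sequentially. \<forall>g\<in>sq N. cmod (F (lvec (t (r n))) g - ip N g w) \<le> d * l2norm N g"
  using compact_formD(4)[OF F, of "\<lambda>n. lvec (t n)"] sg(2,4) by auto
 from r(2)[of "e / 2"] e obtain n where n: "\<And>m g. m \<ge> n ==> g \<in> sq N ==> cmod (F (lvec (t (r m))) g - ip N g w) \<le> e / 2 * l2norm N g"
  unfolding eventually_sequentially by auto
 let ?i = "r n" and ?j = "r (Suc n)"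
 define v where "v = rvec (t ?i)"
 have ne: "t ?i \<noteq> t ?j" using strict_monoD[OF r(1), of n "Suc n"] t(1) by (auto dest: injD)
 have v: "v \<in> sq N" "l2norm N v = 1" unfolding v_def by (rule sg)+
 have "F (lvec (t ?i)) v = of_real (fst (t ?i))" using sg(6)[of v ?i] v ip_self[OF v(1)] by (simp add: v_def)
 moreover have "F (lvec (t ?j)) v = 0"
  using sg(6)[of v ?j] v(1) singular_right_orthogonal[OF singular_systemD(1)[OF S tS] singular_systemD(1)[OF S tS] singular_systemD(3)[OF S tS tS ne]]
  by (simp add: v_def)
 moreover have "cmod (F (lvec (t ?i)) v - F (lvec (t ?j)) v) \<le> e / 2 + e / 2"
  using norm_triangle_ineq4[of "F (lvec (t ?i)) v - ip N v w" "F (lvec (t ?j)) v - ip N v w"] n[of n v] n[of "Suc n" v] v by simp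
 ultimately show False using singular_systemD(2)[OF S tS, of ?i] e by simp
qed

lemma form_left_sum:
 assumes "finite I" "\<And>i. i \<in> I ==> f i \<in> sq M" "h \<in> sq N"
 shows "F (\<lambda>x. \<Sum>i\<in>I. c i * f i x) h = (\<Sum>i\<in>I. c i * F (f i) h)"
 using assms(1,2)
proof (induction I)
 case empty
 then show ?case using compact_formD(1)[OF F sq_zero sq_zero assms(3), of 1] by simp
next
 case (insert i I)
 have "F (\<lambda>x. (\<Sum>i\<in>I. c i * f i x) + c i * f i x) h = F (\<lambda>x. \<Sum>i\<in>I. c i * f i x) h + c i * F (f i) h"
  by (rule compact_formD(1)[OF F]) (use insert.prems assms(3) in \<open>auto intro!: sq_sum\<close>)
 then show ?case using insert.IH insert.hyps insert.prems by (simp add: add.commute)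
qed

context
 fixes S e
 assumes S: "singular_system M N F e S" and fin: "finite S"
begin

lemma system_unit: "t \<in> S ==> lvec t \<in> sq M" "t \<in> S ==> l2norm M (lvec t) = 1"
 by (rule singularD(2)[OF singular_systemD(1)[OF S]] singularD(4)[OF singular_systemD(1)[OF S]], assumption)+

lemma deflation_props:
 assumes f: "f \<in> sq M"
 shows "deflation M S f \<in> sq M" "l2norm M (deflation M S f) \<le> l2norm M f"
  "t \<in> S ==> ip M (deflation M S f) (lvec t) = 0" "(\<And>t. t \<in> S ==> ip M f (lvec t) = 0) ==> deflation M S f = f"
  "g \<in> sq N ==> F (deflation M S f) g = F f g - (\<Sum>t\<in>S. of_real (fst t) * (ip M f (lvec t) * ip N g (rvec t)))"
proof -
 have q: "(\<lambda>x. \<Sum>t\<in>S. ip M f (lvec t) * lvec t x) \<in> sq M" by (intro sq_sum sq_scale system_unit(1))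
 show "deflation M S f \<in> sq M" unfolding deflation_def[abs_def] by (rule sq_diff[OF f q])
 note b = bessel[where u="\<lambda>t. lvec t", OF fin system_unit singular_systemD(3)[OF S] f]
 have "(l2norm M (deflation M S f))\<^sup>2 + (\<Sum>t\<in>S. (cmod (ip M f (lvec t)))\<^sup>2) = (l2norm M f)\<^sup>2"
  unfolding deflation_def[abs_def] by (rule b(1))
 moreover have "0 \<le> (\<Sum>t\<in>S. (cmod (ip M f (lvec t)))\<^sup>2)" by (intro sum_nonneg) simp
 ultimately have "(l2norm M (deflation M S f))\<^sup>2 \<le> (l2norm M f)\<^sup>2" by linarith
 then show "l2norm M (deflation M S f) \<le> l2norm M f" by (rule power2_le_imp_le) simp
 show "t \<in> S ==> ip M (deflation M S f) (lvec t) = 0"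
  unfolding deflation_def[abs_def] by (rule b(2))
 show "(\<And>t. t \<in> S ==> ip M f (lvec t) = 0) ==> deflation M S f = f" by (rule ext) (simp add: deflation_def)
 assume g: "g \<in> sq N"
 have "F (deflation M S f) g = F f g + (- 1) * F (\<lambda>x. \<Sum>t\<in>S. ip M f (lvec t) * lvec t x) g"
  using compact_formD(1)[OF F f q g, of "- 1"] by (simp add: deflation_def[abs_def])
 also have "F (\<lambda>x. \<Sum>t\<in>S. ip M f (lvec t) * lvec t x) g = (\<Sum>t\<in>S. ip M f (lvec t) * F (lvec t) g)"
  by (rule form_left_sum[OF fin system_unit(1) g])
 also have "\<dots> = (\<Sum>t\<in>S. of_real (fst t) * (ip M f (lvec t) * ip N g (rvec t)))"
  by (rule sum.cong[OF refl]) (simp add: singularD(6)[OF singular_systemD(1)[OF S] g] mult_ac)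
 finally show "F (deflation M S f) g = F f g - (\<Sum>t\<in>S. of_real (fst t) * (ip M f (lvec t) * ip N g (rvec t)))" by simp
qed

lemma deflation_linear:
 assumes f: "f \<in> sq M" and f': "f' \<in> sq M"
 shows "deflation M S (\<lambda>x. f x + c * f' x) = (\<lambda>x. deflation M S f x + c * deflation M S f' x)"
proof
 fix x
 have "(\<Sum>t\<in>S. ip M (\<lambda>x. f x + c * f' x) (lvec t) * lvec t x)
   = (\<Sum>t\<in>S. ip M f (lvec t) * lvec t x) + c * (\<Sum>t\<in>S. ip M f' (lvec t) * lvec t x)"
  unfolding sum_distrib_left sum.distrib[symmetric]
  by (rule sum.cong[OF refl]) (simp add: ip_combine(1)[OF f f' system_unit(1)] distrib_right mult.assoc)
 then show "deflation M S (\<lambda>x. f x + c * f' x) x = deflation M S f x + c * deflation M S f' x"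
  by (simp add: deflation_def algebra_simps)
qed

text \<open>A top singular triple of the deflated form is automatically orthogonal to the system, and therefore singular for the original form.\<close>

lemma singular_system_extend:
 assumes e: "e \<ge> 0" and big: "f0 \<in> sq M" "g0 \<in> sq N" "e * (l2norm M f0 * l2norm N g0) < cmod (F (deflation M S f0) g0)"
 shows "\<exists>t. t \<notin> S \<and> singular_system M N F e (insert t S)"
proof -
 note FD = compact_formD[OF F] and DP = deflation_props
 define G where "G f = F (deflation M S f)" for f
 have G: "compact_form M N G" unfolding compact_form_def
 proof (intro conjI ballI allI impI)
  fix f f' g c assume "f \<in> sq M" "f' \<in> sq M" "g \<in> sq N"
  then show "G (\<lambda>x. f x + c * f' x) g = G f g + c * G f' g" by (simp add: G_def deflation_linear FD(1) DP(1))
 next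
  fix f g g' c assume "f \<in> sq M" "g \<in> sq N" "g' \<in> sq N"
  then show "G f (\<lambda>y. g y + c * g' y) = G f g + c * G f g'" unfolding G_def by (intro FD(2) DP(1))
 next
  obtain C where C: "C \<ge> 0" "\<And>f g. f \<in> sq M ==> g \<in> sq N ==> cmod (F f g) \<le> C * (l2norm M f * l2norm N g)" using FD(3) by blast
  have "cmod (G f g) \<le> C * (l2norm M f * l2norm N g)" if f: "f \<in> sq M" and g: "g \<in> sq N" for f g
   unfolding G_def by (rule order_trans[OF C(2)[OF DP(1)[OF f] g]]) (intro mult_left_mono mult_right_mono DP(2) f C(1), simp)
  then show "\<exists>C\<ge>0. \<forall>f\<in>sq M. \<forall>g\<in>sq N. cmod (G f g) \<le> C * (l2norm M f * l2norm N g)" using C(1) by blast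
 next
  fix s :: "nat => _" assume s: "\<forall>n. s n \<in> sq M \<and> l2norm M (s n) \<le> 1"
  show "\<exists>r w. strict_mono r \<and> w \<in> sq N \<and> (\<forall>e>0. \<forall>\<^sub>F n in sequentially. \<forall>g\<in>sq N. cmod (G (s (r n)) g - ip N g w) \<le> e * l2norm N g)"
   unfolding G_def by (rule FD(4)[of "\<lambda>n. deflation M S (s n)"]) (use s DP(1,2) order_trans in blast)+
 qed
 obtain \<sigma> u v where t: "\<sigma> > e" "singular M N G (\<sigma>, u, v)"
  using top_singular_triple[OF G e big(1,2)] big(3) unfolding G_def by blast
 note tD = singularD[OF t(2), simplified]
 have orth: "ip M u (lvec t') = 0" if t': "t' \<in> S" for t'
 proof -
  note t'D = singularD[OF singular_systemD(1)[OF S t']]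
  have "deflation M S (lvec t') = (\<lambda>x. 0)"
  proof
   fix x
   have "(\<Sum>t\<in>S. ip M (lvec t') (lvec t) * lvec t x) = (\<Sum>t\<in>S. if t = t' then lvec t' x else 0)"
    by (rule sum.cong[OF refl]) (use singular_systemD(3)[OF S t'] ip_self[OF t'D(2)] t'D(4) in auto)
   then show "deflation M S (lvec t') x = 0" using fin t' by (simp add: deflation_def)
  qed
  then have "G (lvec t') v = 0" using FD(1)[OF sq_zero sq_zero tD(3), of 1] by (simp add: G_def)
  then have "ip M (lvec t') u = 0" using tD(7)[OF t'D(2)] tD(1) by simp
  then show ?thesis using ip_cnj[of M "lvec t'" u] by simp
 qed
 have Fu: "F u g = of_real \<sigma> * ip N g v" if "g \<in> sq N" for g
  using tD(6)[OF that] DP(4)[OF tD(2)] orth by (simp add: G_def)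
 have Fv: "F f v = of_real \<sigma> * ip M f u" if f: "f \<in> sq M" for f
 proof -
  have "ip N v (rvec t') = 0" if t': "t' \<in> S" for t'
  proof -
   note t'D = singularD[OF singular_systemD(1)[OF S t']]
   have "of_real \<sigma> * ip N (rvec t') v = 0" using Fu[OF t'D(3)] t'D(7)[OF tD(2)] orth[OF t'] by simp
   then show ?thesis using tD(1) ip_cnj[of N "rvec t'" v] by simp
  qed
  then show ?thesis using tD(7)[OF f] DP(5)[OF f tD(3)] by (simp add: G_def)
 qed
 have sing: "singular M N F (\<sigma>, u, v)" unfolding singular_def using tD(1-5) Fu Fv by simp
 have "(\<sigma>, u, v) \<notin> S"
 proof
  assume "(\<sigma>, u, v) \<in> S"
  from orth[OF this] ip_self[OF tD(2)] tD(4) show False by simp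
 qed
 moreover have "ip M (lvec t') u = 0" if "t' \<in> S" for t' using orth[OF that] ip_cnj[of M u "lvec t'"] by simp
 then have "singular_system M N F e (insert (\<sigma>, u, v) S)"
  using S sing t(1) orth unfolding singular_system_def by auto
 ultimately show ?thesis by blast
qed

end

text \<open>A system that is maximal among those with singular values above \<open>e\<close> exists by Zorn; extending it would be possible if the deflated form had norm above \<open>e\<close>.\<close>

theorem singular_approximation:
 assumes S0: "singular_system M N F e S0" and e: "e > 0"
 obtains S where "S0 \<subseteq> S" "finite S" "singular_system M N F e S"
  "\<And>f g. f \<in> sq M ==> g \<in> sq N ==> cmod (F (deflation M S f) g) \<le> e * (l2norm M f * l2norm N g)"
proof -
 let ?A = "{S. S0 \<subseteq> S \<and> singular_system M N F e S}"
 have "\<exists>S\<in>?A. \<forall>X\<in>?A. S \<subseteq> X \<longrightarrow> X = S"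
 proof (rule subset_Zorn_nonempty)
  show "?A \<noteq> {}" using S0 by blast
  fix \<C> assume ne: "\<C> \<noteq> {}" and ch: "subset.chain ?A \<C>"
  then have sys: "singular_system M N F e S" "S0 \<subseteq> S" if "S \<in> \<C>" for S using that unfolding subset.chain_def by auto
  have "ip M (lvec t) (lvec t') = 0" if "t \<in> \<Union>\<C>" "t' \<in> \<Union>\<C>" "t \<noteq> t'" for t t'
  proof -
   obtain S S' where "S \<in> \<C>" "t \<in> S" "S' \<in> \<C>" "t' \<in> S'" using \<open>t \<in> \<Union>\<C>\<close> \<open>t' \<in> \<Union>\<C>\<close> by blast
   moreover have "S \<subseteq> S' \<or> S' \<subseteq> S" using ch \<open>S \<in> \<C>\<close> \<open>S' \<in> \<C>\<close> unfolding subset_chain_def by blast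
   ultimately show ?thesis using singular_systemD(3)[OF sys(1)] \<open>t \<noteq> t'\<close> by blast
  qed
  moreover have "singular M N F t \<and> e < fst t" if "t \<in> \<Union>\<C>" for t using that singular_systemD(1,2)[OF sys(1)] by blast
  ultimately have "singular_system M N F e (\<Union>\<C>)" unfolding singular_system_def by blast
  then show "\<Union>\<C> \<in> ?A" using ne sys(2) by blast
 qed
 then obtain S where "S \<in> ?A" and max: "\<forall>X\<in>?A. S \<subseteq> X \<longrightarrow> X = S" by (elim bexE)
 then have S: "S0 \<subseteq> S" "singular_system M N F e S" by simp_all
 note fin = singular_system_finite[OF S(2) e]
 show thesis
 proof (rule that[OF S(1) fin S(2)], rule ccontr)
  fix f g assume fg: "f \<in> sq M" "g \<in> sq N" "\<not> cmod (F (deflation M S f) g) \<le> e * (l2norm M f * l2norm N g)"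
  then obtain t where "t \<notin> S" "singular_system M N F e (insert t S)"
   using singular_system_extend[OF S(2) fin less_imp_le[OF e] fg(1,2)] by auto
  then show False using bspec[OF max, of "insert t S"] S(1) by blast
 qed
qed

end

section \<open>Compact operators and trace class functionals\<close>

text \<open>The bilinear form of an operator on classes, evaluated on functions.\<close>

definition operator_form :: "'a measure => 'b measure => (('a => complex) set => ('b => complex) set)
  => ('a => complex) => ('b => complex) => complex" where
 "operator_form M N T f g = (LINT y|N. rep (T (ae_class M f)) y * g y)"

context
 fixes M :: "'a measure" and N :: "'b measure" and T
 assumes T: "T \<in> vecs (bounded_ops (L2 M) (L2 N))"
begin

lemma operator_rep_sq: "f \<in> sq M ==> rep (T (ae_class M f)) \<in> sq N"
 by (rule L2_rep(1)[OF bounded_opsD(2)[OF T L2_memI]])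

lemma operator_rep_norm: "f \<in> sq M ==> l2norm N (rep (T (ae_class M f))) \<le> vnorm (bounded_ops (L2 M) (L2 N)) T * l2norm M f"
 using bounded_ops_norm(2)[OF seminormed_L2 seminormed_L2 T L2_memI, of f] by (simp add: L2_norm L2_simps(4)[of N])

lemma operator_form_bound:
 assumes "f \<in> sq M" "g \<in> sq N"
 shows "cmod (operator_form M N T f g) \<le> vnorm (bounded_ops (L2 M) (L2 N)) T * (l2norm M f * l2norm N g)"
proof -
 have "cmod (operator_form M N T f g) \<le> l2norm N (rep (T (ae_class M f))) * l2norm N g"
  unfolding operator_form_def by (rule sq_cauchy_schwarz(3)[OF operator_rep_sq[OF assms(1)] assms(2)])
 then show ?thesis using mult_right_mono[OF operator_rep_norm[OF assms(1)] l2norm_nonneg[of N g]] by (simp add: mult.assoc)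
qed

lemma operator_form_left:
 assumes f: "f \<in> sq M" and g: "g \<in> sq M" and h: "h \<in> sq N"
 shows "operator_form M N T (\<lambda>x. f x + c * g x) h = operator_form M N T f h + c * operator_form M N T g h"
proof -
 note fs = operator_rep_sq[OF f] and gs = operator_rep_sq[OF g] and cs = sq_scale[OF operator_rep_sq[OF g], of c]
 have cls: "ae_class N (rep (T (ae_class M f'))) = T (ae_class M f')" if "f' \<in> sq M" for f'
  by (rule L2_rep(2)[OF bounded_opsD(2)[OF T L2_memI[OF that]]])
 have "T (ae_class M (\<lambda>x. f x + c * g x)) = vadd (L2 N) (T (ae_class M f)) (T (vscale (L2 M) c (ae_class M g)))"
  using bounded_opsD(3)[OF T L2_memI[OF f] L2_memI[OF sq_scale[OF g, of c]]] L2_add[OF f sq_scale[OF g, of c]] L2_scale[OF g, of c] by simp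
 also have "T (vscale (L2 M) c (ae_class M g)) = vscale (L2 N) c (T (ae_class M g))" by (rule bounded_opsD(4)[OF T L2_memI[OF g]])
 also have "vscale (L2 N) c (T (ae_class M g)) = ae_class N (\<lambda>y. c * rep (T (ae_class M g)) y)"
  using L2_scale[OF gs, of c] cls[OF g] by simp
 also have "vadd (L2 N) (T (ae_class M f)) \<dots> = ae_class N (\<lambda>y. rep (T (ae_class M f)) y + c * rep (T (ae_class M g)) y)"
  using L2_add[OF fs cs] cls[OF f] by simp
 finally have eq: "T (ae_class M (\<lambda>x. f x + c * g x)) = ae_class N (\<lambda>y. rep (T (ae_class M f)) y + c * rep (T (ae_class M g)) y)" .
 have ae: "AE y in N. rep (T (ae_class M (\<lambda>x. f x + c * g x))) y = rep (T (ae_class M f)) y + c * rep (T (ae_class M g)) y"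
  unfolding eq by (rule rep_ae_class(2)[OF sqD(1)[OF sq_add[OF fs cs]]])
 have m: "rep (T (ae_class M (\<lambda>x. f x + c * g x))) \<in> borel_measurable N" "h \<in> borel_measurable N"
  using operator_rep_sq[OF sq_add[OF f sq_scale[OF g, of c]]] h by (auto dest: sqD)
 have "operator_form M N T (\<lambda>x. f x + c * g x) h = (LINT y|N. rep (T (ae_class M f)) y * h y + c * (rep (T (ae_class M g)) y * h y))"
  unfolding operator_form_def
 proof (rule integral_cong_AE)
  show "AE y in N. rep (T (ae_class M (\<lambda>x. f x + c * g x))) y * h y = rep (T (ae_class M f)) y * h y + c * (rep (T (ae_class M g)) y * h y)"
   using ae by eventually_elim (simp add: algebra_simps)
 qed (use m sqD(1)[OF fs] sqD(1)[OF gs] in auto)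
 also have "\<dots> = operator_form M N T f h + c * operator_form M N T g h"
  unfolding operator_form_def using sq_cauchy_schwarz(1)[OF fs h] sq_cauchy_schwarz(1)[OF gs h] by simp
 finally show ?thesis .
qed

end

definition singular_kernel :: "(real \<times> ('a => complex) \<times> ('b => complex)) set => 'a \<times> 'b => complex" where
 "singular_kernel S z = (\<Sum>t\<in>S. of_real (fst t) * (cnj (lvec t (fst z)) * cnj (rvec t (snd z))))"

context
 fixes M :: "'a measure" and N :: "'b measure"
 assumes M: "sigma_finite_measure M" and N: "sigma_finite_measure N"
begin

lemma compact_operator_form:
 assumes T: "is_compact_op (L2 M) (L2 N) T"
 shows "compact_form M N (operator_form M N T)"
proof -
 note Tb = T[unfolded is_compact_op_def, THEN conjunct1] and Tc = T[unfolded is_compact_op_def, THEN conjunct2]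
 note rs = operator_rep_sq[OF Tb]
 show ?thesis unfolding compact_form_def
 proof (intro conjI ballI allI impI)
  show "operator_form M N T (\<lambda>x. f x + c * f' x) g = operator_form M N T f g + c * operator_form M N T f' g"
   if "f \<in> sq M" "f' \<in> sq M" "g \<in> sq N" for f f' g c by (rule operator_form_left[OF Tb that])
  show "operator_form M N T f (\<lambda>y. g y + c * g' y) = operator_form M N T f g + c * operator_form M N T f g'"
   if "f \<in> sq M" "g \<in> sq N" "g' \<in> sq N" for f g g' c
  proof -
   have "(\<lambda>y. rep (T (ae_class M f)) y * (g y + c * g' y)) = (\<lambda>y. rep (T (ae_class M f)) y * g y + c * (rep (T (ae_class M f)) y * g' y))"
    by (rule ext) (simp add: algebra_simps)
   then show ?thesis unfolding operator_form_def
    using sq_cauchy_schwarz(1)[OF rs[OF that(1)] that(2)] sq_cauchy_schwarz(1)[OF rs[OF that(1)] that(3)] by simp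
  qed
  show "\<exists>C\<ge>0. \<forall>f\<in>sq M. \<forall>g\<in>sq N. cmod (operator_form M N T f g) \<le> C * (l2norm M f * l2norm N g)"
   using operator_form_bound[OF Tb] bounded_ops_norm(1)[OF seminormed_L2 seminormed_L2 Tb] by blast
  fix s :: "nat => _" assume s: "\<forall>n. s n \<in> sq M \<and> l2norm M (s n) \<le> 1"
  have "\<forall>n. ae_class M (s n) \<in> vecs (L2 M) \<and> vnorm (L2 M) (ae_class M (s n)) \<le> 1"
   using s by (simp add: L2_memI L2_norm)
  from Tc[THEN spec, THEN mp, OF this] obtain r W where r: "strict_mono r" "W \<in> vecs (L2 N)"
   "(\<lambda>n. vdist (L2 N) (T (ae_class M (s (r n)))) W) \<longlonglongrightarrow> 0" by blast
  note w = L2_rep[OF r(2)]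
  have near: "cmod (operator_form M N T (s (r n)) g - ip N g (\<lambda>y. cnj (rep W y))) \<le> vdist (L2 N) (T (ae_class M (s (r n)))) W * l2norm N g"
   if g: "g \<in> sq N" for n g
  proof -
   have sn: "s (r n) \<in> sq M" using s by blast
   have "operator_form M N T (s (r n)) g - ip N g (\<lambda>y. cnj (rep W y)) = (LINT y|N. (rep (T (ae_class M (s (r n)))) y - rep W y) * g y)"
    using sq_cauchy_schwarz(1)[OF rs[OF sn] g] sq_cauchy_schwarz(1)[OF w(1) g]
    by (simp add: operator_form_def ip_def left_diff_distrib mult.commute[of "g _"])
   also have "cmod \<dots> \<le> l2norm N (\<lambda>y. rep (T (ae_class M (s (r n)))) y - rep W y) * l2norm N g"
    by (rule sq_cauchy_schwarz(3)[OF sq_diff[OF rs[OF sn] w(1)] g])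
   also have "l2norm N (\<lambda>y. rep (T (ae_class M (s (r n)))) y - rep W y) = vdist (L2 N) (T (ae_class M (s (r n)))) W"
    using L2_dist[OF rs[OF sn] w(1)] w(2) L2_rep(2)[OF bounded_opsD(2)[OF Tb L2_memI[OF sn]]] by simp
   finally show ?thesis .
  qed
  show "\<exists>r w. strict_mono r \<and> w \<in> sq N \<and> (\<forall>e>0. \<forall>\<^sub>F n in sequentially. \<forall>g\<in>sq N.
    cmod (operator_form M N T (s (r n)) g - ip N g w) \<le> e * l2norm N g)"
  proof (intro exI conjI allI impI)
   show "strict_mono r" "(\<lambda>y. cnj (rep W y)) \<in> sq N" using r(1) w(1) by auto
   fix e :: real assume "e > 0"
   from order_tendstoD(2)[OF r(3) this]
   show "\<forall>\<^sub>F n in sequentially. \<forall>g\<in>sq N. cmod (operator_form M N T (s (r n)) g - ip N g (\<lambda>y. cnj (rep W y))) \<le> e * l2norm N g"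
    by eventually_elim (blast intro: order_trans[OF near] mult_right_mono less_imp_le l2norm_nonneg)
  qed
 qed
qed

lemma operator_form_int_op:
 assumes k: "k \<in> ksq M N" and f: "f \<in> sq M" and g: "g \<in> sq N"
 shows "operator_form M N (int_op M N k) f g = pairing M N k f g"
proof -
 note ka = kernel_apply_sq[OF M N k f]
 have "(LINT y|N. rep (ae_class N (kernel_apply M k f)) y * g y) = (LINT y|N. kernel_apply M k f y * g y)"
  using rep_ae_class[OF sqD(1)[OF ka]] sqD(1)[OF ka] sqD(1)[OF g] by (intro integral_cong_AE) auto
 then show ?thesis by (simp add: operator_form_def int_op_apply[OF M N k f] integral_kernel_apply[OF M N k f g])
qed

lemma singular_kernel_pairing:
 assumes S: "singular_system M N F e S"
 shows "singular_kernel S \<in> ksq M N"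
  "f \<in> sq M ==> g \<in> sq N ==> pairing M N (singular_kernel S) f g = (\<Sum>t\<in>S. of_real (fst t) * (ip M f (lvec t) * ip N g (rvec t)))"
  "k \<in> ksq M N ==> (LINT z|(M \<Otimes>\<^sub>M N). k z * singular_kernel S z)
    = (\<Sum>t\<in>S. of_real (fst t) * pairing M N k (\<lambda>x. cnj (lvec t x)) (\<lambda>y. cnj (rvec t y)))"
proof -
 note D = singularD[OF singular_systemD(1)[OF S]]
 have ts: "(\<lambda>z. cnj (lvec t (fst z)) * cnj (rvec t (snd z))) \<in> ksq M N" if "t \<in> S" for t
  by (rule tensor_sq(1)[OF N sq_cnj[OF D(2)[OF that]] sq_cnj[OF D(3)[OF that]]])
 then show "singular_kernel S \<in> ksq M N" unfolding singular_kernel_def[abs_def] by (intro sq_sum sq_scale)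
 show "pairing M N (singular_kernel S) f g = (\<Sum>t\<in>S. of_real (fst t) * (ip M f (lvec t) * ip N g (rvec t)))"
  if f: "f \<in> sq M" and g: "g \<in> sq N"
 proof -
  have "pairing M N (singular_kernel S) f g
    = (\<Sum>t\<in>S. of_real (fst t) * pairing M N (\<lambda>z. cnj (lvec t (fst z)) * cnj (rvec t (snd z))) f g)"
   unfolding singular_kernel_def[abs_def] by (rule pairing_sum[OF N _ f g]) (rule ts)
  also have "\<dots> = (\<Sum>t\<in>S. of_real (fst t) * (ip M f (lvec t) * ip N g (rvec t)))"
   by (rule sum.cong[OF refl]) (simp add: pairing_tensor[OF N M sq_cnj[OF D(2)] sq_cnj[OF D(3)] f g] ip_def mult.commute)
  finally show ?thesis .
 qed
 show "(LINT z|(M \<Otimes>\<^sub>M N). k z * singular_kernel S z)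
    = (\<Sum>t\<in>S. of_real (fst t) * pairing M N k (\<lambda>x. cnj (lvec t x)) (\<lambda>y. cnj (rvec t y)))" if k: "k \<in> ksq M N"
 proof -
  have "(\<lambda>z. k z * singular_kernel S z) = (\<lambda>z. \<Sum>t\<in>S. of_real (fst t) * (k z * (cnj (lvec t (fst z)) * cnj (rvec t (snd z)))))"
   by (rule ext) (simp add: singular_kernel_def sum_distrib_left mult_ac)
  then show ?thesis unfolding pairing_def
   by (simp only:) (subst Bochner_Integration.integral_sum, intro integrable_mult_right sq_cauchy_schwarz(1) k ts, assumption, simp)
 qed
qed

theorem compact_op_kernel_approximation:
 assumes T: "is_compact_op (L2 M) (L2 N) T" and e: "e > 0"
 obtains k where "k \<in> ksq M N"
  "\<And>f g. f \<in> sq M ==> g \<in> sq N ==> cmod (operator_form M N T f g - pairing M N k f g) \<le> e * (l2norm M f * l2norm N g)"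
proof -
 note F = compact_operator_form[OF T]
 have s0: "singular_system M N (operator_form M N T) e {}" by (simp add: singular_system_def)
 obtain S where S: "finite S" "singular_system M N (operator_form M N T) e S"
  "\<And>f g. f \<in> sq M ==> g \<in> sq N ==> cmod (operator_form M N T (deflation M S f) g) \<le> e * (l2norm M f * l2norm N g)"
  by (rule singular_approximation[OF F s0 e], rule that)
 show thesis
  by (rule that[OF singular_kernel_pairing(1)[OF S(2)]])
   (use S(3) in \<open>simp add: singular_kernel_pairing(2)[OF S(2)] deflation_props(5)[OF F S(2,1)]\<close>)
qed

text \<open>The functional is \<open>k \<mapsto> \<integral> k h\<close> by Riesz, and \<open>h\<close> is expanded in singular vectors. Testing the functional on \<open>\<Sum> u\<^sub>t \<otimes> v\<^sub>t\<close>, an operator of norm at most one by Bessel, bounds the sum of singular values by \<open>C\<close>; the factors \<open>f\<^sub>i\<close>, \<open>g\<^sub>i\<close> share each singular value evenly.\<close>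

theorem nuclear_representation:
 assumes \<Lambda>: "kernel_functional M N \<Lambda> C"
 obtains f :: "nat => 'a => complex" and g :: "nat => 'b => complex"
 where "\<And>i. f i \<in> sq M" "\<And>i. g i \<in> sq N"
  "\<And>n. (\<Sum>i<n. (l2norm M (f i))\<^sup>2) \<le> C" "\<And>n. (\<Sum>i<n. (l2norm N (g i))\<^sup>2) \<le> C"
  "\<And>k. k \<in> ksq M N ==> (\<lambda>i. pairing M N k (f i) (g i)) sums \<Lambda> k"
proof -
 let ?P = "M \<Otimes>\<^sub>M N"
 note \<Lambda>D = kernel_functionalD[OF \<Lambda>]
 obtain p where p: "p \<in> sq ?P" "\<And>k. k \<in> sq ?P ==> \<Lambda> k = ip ?P k p"
  by (rule riesz_representation[of ?P \<Lambda> C]) (use \<Lambda>D(2,3) \<Lambda>D(4)[OF _ kernel_bound_l2[OF N]] in simp_all)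
 define h where "h z = cnj (p z)" for z
 have h: "h \<in> sq ?P" and \<Lambda>h: "\<And>k. k \<in> sq ?P ==> \<Lambda> k = (LINT z|?P. k z * h z)"
  using p unfolding h_def[abs_def] by (auto simp: ip_def)
 define F where "F = operator_form M N (int_op M N h)"
 have F: "compact_form M N F" unfolding F_def by (rule compact_operator_form[OF int_op_compact[OF M N h]])
 have Fh: "F f g = pairing M N h f g" if "f \<in> sq M" "g \<in> sq N" for f g unfolding F_def by (rule operator_form_int_op[OF h that])
 have trace: "(\<Sum>t\<in>S. fst t) \<le> C" if S: "singular_system M N F 0 S" and fin: "finite S" for S
 proof -
  note D = singularD[OF singular_systemD(1)[OF S]]
  (* a partial isometry on the span of the singular vectors *)
  define k where "k z = (\<Sum>t\<in>S. 1 * (lvec t (fst z) * rvec t (snd z)))" for z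
  have ts: "(\<lambda>z. lvec t (fst z) * rvec t (snd z)) \<in> sq ?P" if "t \<in> S" for t by (rule tensor_sq(1)[OF N D(2,3)[OF that]])
  have k: "k \<in> sq ?P" unfolding k_def[abs_def] by (intro sq_sum sq_scale ts)
  have "kernel_bound M N k 1"
  proof (rule kernel_boundI[OF N])
   fix f g assume f: "f \<in> sq M" and g: "g \<in> sq N"
   define a b where "a t = ip M f (\<lambda>x. cnj (lvec t x))" and "b t = ip N g (\<lambda>y. cnj (rvec t y))"
    for t :: "real \<times> ('a => complex) \<times> ('b => complex)"
   have "(\<Sum>t\<in>S. (cmod (a t))\<^sup>2) \<le> (l2norm M f)\<^sup>2"
   proof -
    have "(l2norm M (\<lambda>x. f x - (\<Sum>t\<in>S. a t * cnj (lvec t x))))\<^sup>2 + (\<Sum>t\<in>S. (cmod (a t))\<^sup>2) = (l2norm M f)\<^sup>2" unfolding a_def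
     by (rule bessel(1)[OF fin _ _ _ f, of "\<lambda>t x. cnj (lvec t x)"]) (use D(2,4) singular_systemD(3)[OF S] in \<open>auto simp: ip_def mult.commute\<close>)
    then show ?thesis using zero_le_power2[of "l2norm M (\<lambda>x. f x - (\<Sum>t\<in>S. a t * cnj (lvec t x)))"] by linarith
   qed
   moreover have "(\<Sum>t\<in>S. (cmod (b t))\<^sup>2) \<le> (l2norm N g)\<^sup>2"
   proof -
    have "ip N (rvec t) (rvec t') = 0" if "t \<in> S" "t' \<in> S" "t \<noteq> t'" for t t'
     by (rule singular_right_orthogonal[OF singular_systemD(1)[OF S that(1)] singular_systemD(1)[OF S that(2)] singular_systemD(3)[OF S that]])
    then have "(l2norm N (\<lambda>x. g x - (\<Sum>t\<in>S. b t * cnj (rvec t x))))\<^sup>2 + (\<Sum>t\<in>S. (cmod (b t))\<^sup>2) = (l2norm N g)\<^sup>2" unfolding b_def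
     by (intro bessel(1)[OF fin _ _ _ g, of "\<lambda>t x. cnj (rvec t x)"]) (use D(3,5) in \<open>auto simp: ip_def mult.commute\<close>)
    then show ?thesis using zero_le_power2[of "l2norm N (\<lambda>x. g x - (\<Sum>t\<in>S. b t * cnj (rvec t x)))"] by linarith
   qed
   moreover have "pairing M N k f g = (\<Sum>t\<in>S. 1 * pairing M N (\<lambda>z. lvec t (fst z) * rvec t (snd z)) f g)"
    unfolding k_def[abs_def] by (rule pairing_sum[OF N _ f g]) (rule ts)
   then have "pairing M N k f g = (\<Sum>t\<in>S. a t * b t)"
    by (simp add: pairing_tensor[OF N M D(2,3) f g] a_def b_def ip_def mult.commute)
   then have "cmod (pairing M N k f g) \<le> (\<Sum>t\<in>S. \<bar>cmod (a t)\<bar> * \<bar>cmod (b t)\<bar>)" by (simp add: order_trans[OF norm_sum] norm_mult)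
   then have "cmod (pairing M N k f g) \<le> L2_set (\<lambda>t. cmod (a t)) S * L2_set (\<lambda>t. cmod (b t)) S" by (rule order_trans[OF _ L2_set_mult_ineq])
   moreover have "L2_set (\<lambda>t. cmod (a t)) S * L2_set (\<lambda>t. cmod (b t)) S \<le> l2norm M f * l2norm N g" if "(\<Sum>t\<in>S. (cmod (a t))\<^sup>2) \<le> (l2norm M f)\<^sup>2" "(\<Sum>t\<in>S. (cmod (b t))\<^sup>2) \<le> (l2norm N g)\<^sup>2"
    unfolding L2_set_def using that by (intro mult_mono real_le_lsqrt) (auto intro: sum_nonneg)
   ultimately show "cmod (pairing M N k f g) \<le> 1 * (l2norm M f * l2norm N g)" by fastforce
  qed simp
  then have "cmod (\<Lambda> k) \<le> C * 1" by (rule \<Lambda>D(4)[OF k])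
  moreover have "\<Lambda> k = of_real (\<Sum>t\<in>S. fst t)"
  proof -
   have "(\<lambda>z. k z * h z) = (\<lambda>z. \<Sum>t\<in>S. h z * (lvec t (fst z) * rvec t (snd z)))"
    by (rule ext) (simp add: k_def sum_distrib_left mult.commute)
   then have "\<Lambda> k = (\<Sum>t\<in>S. pairing M N h (lvec t) (rvec t))"
    unfolding \<Lambda>h[OF k] pairing_def by (simp only:) (intro Bochner_Integration.integral_sum sq_cauchy_schwarz(1) h ts)
   also have "\<dots> = (\<Sum>t\<in>S. of_real (fst t))"
   proof (rule sum.cong[OF refl])
    fix t assume t: "t \<in> S"
    show "pairing M N h (lvec t) (rvec t) = of_real (fst t)"
     using Fh[OF D(2,3)[OF t]] D(6)[OF t D(3)[OF t]] ip_self[OF D(3)[OF t]] D(5)[OF t] by simp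
   qed
   finally show ?thesis by simp
  qed
  ultimately show ?thesis by (simp del: of_real_sum)
 qed
 define ok where "ok n S \<longleftrightarrow> singular_system M N F (inverse (real (Suc n))) S \<and> finite S
  \<and> (\<forall>f\<in>sq M. \<forall>g\<in>sq N. cmod (F (deflation M S f) g) \<le> inverse (real (Suc n)) * (l2norm M f * l2norm N g))" for n S
 have ex: "\<exists>S'. ok n S' \<and> S \<subseteq> S'" if "singular_system M N F (inverse (real (Suc n))) S" for n S
  by (rule singular_approximation[OF F that]) (simp, auto simp: ok_def)
 have "\<exists>S. \<forall>n. ok n (S n) \<and> S n \<subseteq> S (Suc n)"
 proof (rule dependent_nat_choice)
  show "\<exists>S. ok 0 S" using ex[of 0 "{}"] by (auto simp: singular_system_def)
  fix S n assume "ok n S"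
  moreover have "inverse (real (Suc (Suc n))) < inverse (real (Suc n))" by simp
  ultimately have "singular_system M N F (inverse (real (Suc (Suc n)))) S"
   unfolding ok_def singular_system_def by (meson less_trans)
  then show "\<exists>S'. ok (Suc n) S' \<and> S \<subseteq> S'" by (rule ex)
 qed
 then obtain S where S: "\<And>n. ok n (S n)" "\<And>n. S n \<subseteq> S (Suc n)" by blast
 define T where "T = (\<Union>n. S n)"
 have mono: "S i \<subseteq> S j" if "i \<le> j" for i j using lift_Suc_mono_le[of S, OF S(2) that] .
 have T: "singular_system M N F 0 T" unfolding singular_system_def
 proof (intro conjI ballI impI)
  fix t assume "t \<in> T"
  then obtain n where n: "t \<in> S n" unfolding T_def by blast
  have "singular_system M N F (inverse (real (Suc n))) (S n)" using S(1)[of n] by (simp add: ok_def)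
  from singular_systemD(1)[OF this n] show "singular M N F t" "0 < fst t" by (simp_all add: singularD(1))
 next
  fix t t' assume "t \<in> T" "t' \<in> T" "t \<noteq> t'"
  then obtain i j where "t \<in> S i" "t' \<in> S j" unfolding T_def by blast
  then have m: "t \<in> S (max i j)" "t' \<in> S (max i j)" using mono[of i "max i j"] mono[of j "max i j"] by auto
  have sy: "singular_system M N F (inverse (real (Suc (max i j)))) (S (max i j))" using S(1)[of "max i j"] by (simp only: ok_def)
  show "ip M (lvec t) (lvec t') = 0" by (rule singular_systemD(3)[OF sy m \<open>t \<noteq> t'\<close>])
 qed
 have sub: "singular_system M N F 0 A" if "A \<subseteq> T" for A
  unfolding singular_system_def
  by (intro conjI ballI impI; (rule singular_systemD(1)[OF T] | rule singular_systemD(2)[OF T] | rule singular_systemD(3)[OF T]);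
    (assumption | erule subsetD[OF that]))
 have cT: "countable T" unfolding T_def by (rule countable_UN[OF _ countable_finite]) (use S(1) in \<open>simp_all add: ok_def\<close>)
 define c where "c = to_nat_on T"
 have inj: "inj_on c T" unfolding c_def by (rule inj_on_to_nat_on[OF cT])
 define A where "A n = {t \<in> T. c t < n}" for n
 have AT: "A n \<subseteq> T" for n unfolding A_def by blast
 have fA: "finite (A n)" for n
  by (rule finite_imageD[of c, OF finite_subset[of _ "{..<n}"]]) (auto simp: A_def intro: inj_on_subset[OF inj])
 define d where "d i = inv_into T c i" for i
 have dc: "d (c t) = t" if "t \<in> T" for t unfolding d_def by (rule inv_into_f_f[OF inj that])
 have enum: "(\<Sum>i<n. if i \<in> c ` T then Y (d i) else 0) = (\<Sum>t\<in>A n. Y t)" for Y :: "_ => 'c::comm_monoid_add" and n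
 proof -
  have "(\<Sum>i<n. if i \<in> c ` T then Y (d i) else 0) = (\<Sum>i\<in>c ` A n. Y (d i))"
   by (rule sum.mono_neutral_cong_right) (auto simp: A_def)
  also have "\<dots> = (\<Sum>t\<in>A n. Y (d (c t)))" by (rule sum.reindex_cong[OF inj_on_subset[OF inj AT]]) auto
  also have "\<dots> = (\<Sum>t\<in>A n. Y t)" by (rule sum.cong[OF refl]) (simp add: dc[OF subsetD[OF AT]])
  finally show ?thesis .
 qed
 have dT: "d i \<in> T" if "i \<in> c ` T" for i using that dc by auto
 note TD = singularD[OF singular_systemD(1)[OF T]]
 define f where "f i x = (if i \<in> c ` T then of_real (sqrt (fst (d i))) else 0) * cnj (lvec (d i) x)" for i x
 define g where "g i y = (if i \<in> c ` T then of_real (sqrt (fst (d i))) else 0) * cnj (rvec (d i) y)" for i y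
 have fs: "f i \<in> sq M" "(l2norm M (f i))\<^sup>2 = (if i \<in> c ` T then fst (d i) else 0)" for i
  unfolding f_def[abs_def] l2norm_scale using TD(1,2,4)[OF dT] by (auto simp: power_mult_distrib less_imp_le)
 have gs: "g i \<in> sq N" "(l2norm N (g i))\<^sup>2 = (if i \<in> c ` T then fst (d i) else 0)" for i
  unfolding g_def[abs_def] l2norm_scale using TD(1,3,5)[OF dT] by (auto simp: power_mult_distrib less_imp_le)
 define H where "H n z = h z - singular_kernel (A n) z" for n z
 note sk = singular_kernel_pairing[OF sub[OF AT]]
 have H: "H n \<in> sq ?P" for n unfolding H_def[abs_def] by (rule sq_diff[OF h sk(1)])
 have HF: "pairing M N (H n) f g = F (deflation M (A n) f) g" if "f \<in> sq M" "g \<in> sq N" for f g n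
  unfolding H_def[abs_def] pairing_minus[OF N h sk(1) that] deflation_props(5)[OF F sub[OF AT] fA that] Fh[OF that] sk(2)[OF that] ..
 have small: "(\<lambda>n. pairing M N (H n) f g) \<longlonglongrightarrow> 0" if f: "f \<in> sq M" and g: "g \<in> sq N" for f g
 proof (rule LIMSEQ_I)
  fix e :: real assume e: "e > 0"
  define K where "K = l2norm M f * l2norm N g"
  have K: "K \<ge> 0" by (simp add: K_def)
  obtain m where "inverse (real (Suc m)) < e / (K + 1)" using reals_Archimedean[of "e / (K + 1)"] e K by auto
  then have "inverse (real (Suc m)) * (K + 1) < e" using K by (simp add: pos_less_divide_eq)
  moreover have "inverse (real (Suc m)) * K \<le> inverse (real (Suc m)) * (K + 1)" by (intro mult_left_mono) auto
  ultimately have m: "inverse (real (Suc m)) * K < e" by linarith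
  have fm: "finite (S m)" using S(1) by (simp add: ok_def)
  have "norm (pairing M N (H n) f g - 0) < e" if n: "n \<ge> Suc (Max (insert 0 (c ` S m)))" for n
  proof -
   have SA: "S m \<subseteq> A n"
   proof
    fix t assume t: "t \<in> S m"
    have "c t \<le> Max (insert 0 (c ` S m))" by (rule Max_ge) (use fm t in auto)
    then show "t \<in> A n" using n t by (auto simp: A_def T_def)
   qed
   note P = deflation_props[OF F sub[OF AT] fA f]
   have sm: "singular_system M N F (inverse (real (Suc m))) (S m)" using S(1) by (simp add: ok_def)
   have "deflation M (S m) (deflation M (A n) f) = deflation M (A n) f"
    by (rule deflation_props(4)[OF F sm fm P(1)]) (use P(3) SA in blast)
   then have "cmod (F (deflation M (A n) f) g) \<le> inverse (real (Suc m)) * (l2norm M (deflation M (A n) f) * l2norm N g)"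
    using S(1)[of m] P(1) g unfolding ok_def by metis
   also have "\<dots> \<le> inverse (real (Suc m)) * K" unfolding K_def by (intro mult_left_mono mult_right_mono P(2)) auto
   finally show ?thesis using m by (simp add: HF[OF f g])
  qed
  then show "\<exists>no. \<forall>n\<ge>no. norm (pairing M N (H n) f g - 0) < e" by blast
 qed
 have Hn: "l2norm ?P (H n) \<le> l2norm ?P h + C" for n
 proof -
  have "l2norm ?P (singular_kernel A) \<le> (\<Sum>t\<in>A. fst t)" if "finite A" "singular_system M N F 0 A" for A
   using that
  proof (induction A)
   case empty
   show ?case unfolding singular_kernel_def[abs_def] by simp
  next
   case (insert t A)
   have sA: "singular_system M N F 0 A" using insert.prems unfolding singular_system_def by blast
   note D = singularD[OF singular_systemD(1)[OF insert.prems insertI1]]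
   note ts = tensor_sq[OF N sq_cnj[OF D(2)] sq_cnj[OF D(3)]]
   have "singular_kernel (insert t A) = (\<lambda>z. singular_kernel A z + of_real (fst t) * (cnj (lvec t (fst z)) * cnj (rvec t (snd z))))"
    by (rule ext) (use insert.hyps in \<open>simp add: singular_kernel_def add.commute\<close>)
   then have "l2norm ?P (singular_kernel (insert t A)) \<le> l2norm ?P (singular_kernel A) + fst t * l2norm ?P (\<lambda>z. cnj (lvec t (fst z)) * cnj (rvec t (snd z)))"
    using l2norm_triangle[OF singular_kernel_pairing(1)[OF sA] sq_scale[OF ts(1)], of "of_real (fst t)"] D(1) by (simp only: l2norm_scale) simp
   moreover have "fst t * l2norm ?P (\<lambda>z. cnj (lvec t (fst z)) * cnj (rvec t (snd z))) \<le> fst t * 1"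
    using ts(2) D(1,4,5) by (intro mult_left_mono) simp_all
   ultimately show ?case using insert.IH[OF sA] insert.hyps by simp
  qed
  from this[OF fA[of n] sub[OF AT[of n]]] trace[OF sub[OF AT[of n]] fA[of n]] show ?thesis
   using l2norm_triangle[OF h sq_minus[OF sk(1)[of n]]] unfolding H_def[abs_def] l2norm_minus by simp
 qed
 have lim: "(\<lambda>n. LINT z|?P. k z * H n z) \<longlonglongrightarrow> 0" if k: "k \<in> sq ?P" for k
 proof -
  have span: "(\<lambda>n. LINT z|?P. s z * H n z) \<longlonglongrightarrow> 0" if "s \<in> lin_span (finite_rectangles M N)" for s
   using that
  proof induction
   case zero show ?case by simp
  next
   case (add s q a)
   have s: "s \<in> sq ?P" by (rule lin_span_sq[OF finite_rectangles_sq[OF N] add.hyps(1)])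
   have q: "q \<in> sq ?P" using finite_rectangles_sq[OF N] add.hyps(2) by blast
   obtain X Y where XY: "X \<in> sets M" "Y \<in> sets N" "emeasure M X < \<infinity>" "emeasure N Y < \<infinity>" "q = (\<lambda>z. indicator X (fst z) * indicator Y (snd z))"
    using add.hyps(2) unfolding finite_rectangles_def by (elim CollectE exE conjE)
   have "(LINT z|?P. q z * H n z) = pairing M N (H n) (indicator X) (indicator Y)" for n
    unfolding pairing_def by (rule Bochner_Integration.integral_cong[OF refl]) (simp add: XY(5) mult.commute)
   then have q0: "(\<lambda>n. LINT z|?P. q z * H n z) \<longlonglongrightarrow> 0" using small[OF sq_indicator(1)[OF XY(1,3)] sq_indicator(1)[OF XY(2,4)]] by simp
   have "(\<lambda>z. (s z + a * q z) * H n z) = (\<lambda>z. s z * H n z + a * (q z * H n z))" for n by (rule ext) (simp add: algebra_simps)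
   then have "(LINT z|?P. (s z + a * q z) * H n z) = (LINT z|?P. s z * H n z) + a * (LINT z|?P. q z * H n z)" for n
    using sq_cauchy_schwarz(1)[OF s H] sq_cauchy_schwarz(1)[OF q H] by simp
   then show ?case using tendsto_add[OF add.IH tendsto_mult_left[OF q0, of a]] by simp
  qed
  define B where "B = l2norm ?P h + C + 1"
  have B: "B > 0" "l2norm ?P (H n) \<le> B" for n using \<Lambda>D(1) Hn[of n] by (auto simp: B_def add_nonneg_pos)
  show ?thesis
  proof (rule LIMSEQ_I)
   fix e :: real assume e: "e > 0"
   obtain s where s: "s \<in> lin_span (finite_rectangles M N)" "l2norm ?P (\<lambda>z. k z - s z) < e / (2 * B)"
   proof -
    have "e / (2 * B) > 0" using e B(1) by simp
    then have "\<exists>s\<in>lin_span (finite_rectangles M N). l2norm ?P (\<lambda>z. k z - s z) < e / (2 * B)"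
     using rectangles_l2dense[OF M N k] unfolding l2closure_def mem_Collect_eq by (elim conjE allE impE)
    then show thesis by (elim bexE) (rule that)
   qed
   have ss: "s \<in> sq ?P" by (rule lin_span_sq[OF finite_rectangles_sq[OF N] s(1)])
   obtain n0 where n0: "\<And>n. n \<ge> n0 ==> norm (LINT z|?P. s z * H n z) < e / 2" using LIMSEQ_D[OF span[OF s(1)], of "e / 2"] e by auto
   have "norm ((LINT z|?P. k z * H n z) - 0) < e" if "n \<ge> n0" for n
   proof -
    have "(LINT z|?P. k z * H n z) = (LINT z|?P. (k z - s z) * H n z) + (LINT z|?P. s z * H n z)"
     using sq_cauchy_schwarz(1)[OF k H] sq_cauchy_schwarz(1)[OF ss H] by (simp add: left_diff_distrib)
    moreover have "cmod (LINT z|?P. (k z - s z) * H n z) \<le> e / (2 * B) * B"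
     by (rule order_trans[OF sq_cauchy_schwarz(3)[OF sq_diff[OF k ss] H]]) (intro mult_mono B(2), use s(2) e B(1) in auto)
    ultimately show ?thesis using n0[OF that] B(1) norm_triangle_ineq[of "LINT z|?P. (k z - s z) * H n z" "LINT z|?P. s z * H n z"] by simp
   qed
   then show "\<exists>no. \<forall>n\<ge>no. norm ((LINT z|?P. k z * H n z) - 0) < e" by blast
  qed
 qed
 show thesis
 proof (rule that[OF fs(1) gs(1)])
  show "(\<Sum>i<n. (l2norm M (f i))\<^sup>2) \<le> C" "(\<Sum>i<n. (l2norm N (g i))\<^sup>2) \<le> C" for n
   unfolding fs(2) gs(2) enum by (rule trace[OF sub[OF AT] fA])+
  fix k assume k: "k \<in> sq ?P"
  have "pairing M N k (f i) (g i) = (if i \<in> c ` T then of_real (fst (d i)) * pairing M N k (\<lambda>x. cnj (lvec (d i) x)) (\<lambda>y. cnj (rvec (d i) y)) else 0)" for i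
  proof (cases "i \<in> c ` T")
   case True
   have sq: "of_real (sqrt (fst (d i))) * of_real (sqrt (fst (d i))) = complex_of_real (fst (d i))"
    using TD(1)[OF dT[OF True]] unfolding of_real_mult[symmetric] by simp
   have "(\<lambda>z. k z * (f i (fst z) * g i (snd z))) = (\<lambda>z. of_real (fst (d i)) * (k z * (cnj (lvec (d i) (fst z)) * cnj (rvec (d i) (snd z)))))"
   proof
    fix z
    have "k z * (f i (fst z) * g i (snd z)) = (of_real (sqrt (fst (d i))) * of_real (sqrt (fst (d i)))) * (k z * (cnj (lvec (d i) (fst z)) * cnj (rvec (d i) (snd z))))"
     using True by (simp only: f_def g_def if_True mult_ac)
    then show "k z * (f i (fst z) * g i (snd z)) = of_real (fst (d i)) * (k z * (cnj (lvec (d i) (fst z)) * cnj (rvec (d i) (snd z))))"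
     unfolding sq .
   qed
   then show ?thesis using True by (simp add: pairing_def)
  qed (simp add: pairing_def f_def)
  then have "(\<Sum>i<n. pairing M N k (f i) (g i)) = (LINT z|?P. k z * singular_kernel (A n) z)" for n
   using enum[of "\<lambda>t. of_real (fst t) * pairing M N k (\<lambda>x. cnj (lvec t x)) (\<lambda>y. cnj (rvec t y))" n]
   by (simp only: sk(3)[OF k])
  moreover have "(LINT z|?P. k z * singular_kernel (A n) z) = \<Lambda> k - (LINT z|?P. k z * H n z)" for n
   using sq_cauchy_schwarz(1)[OF k h] sq_cauchy_schwarz(1)[OF k sk(1)[of n]] by (simp add: \<Lambda>h[OF k] H_def right_diff_distrib)
  ultimately have "(\<Sum>i<n. pairing M N k (f i) (g i)) = \<Lambda> k - (LINT z|?P. k z * H n z)" for n by simp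
  then show "(\<lambda>i. pairing M N k (f i) (g i)) sums \<Lambda> k"
   using tendsto_diff[OF tendsto_const[of "\<Lambda> k"] lim[OF k]] by (simp add: sums_def)
 qed
qed

end

section \<open>Functionals on the compact operators as functionals of kernels\<close>

abbreviation compacts :: "'a measure => 'b measure => (('a => complex) set => ('b => complex) set) cnormed" where
 "compacts M N \<equiv> compact_ops (L2 M) (L2 N)"

context
 fixes M :: "'a measure" and N :: "'b measure"
 assumes M: "sigma_finite_measure M" and N: "sigma_finite_measure N"
begin

lemma compacts_bounded: "T \<in> vecs (compacts M N) ==> T \<in> vecs (bounded_ops (L2 M) (L2 N))"
 by (simp add: compact_ops_simps is_compact_op_def)

lemma int_op_mem: "k \<in> ksq M N ==> int_op M N k \<in> vecs (compacts M N)"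
 using int_op_compact[OF M N] by (simp add: compact_ops_simps)

lemma int_op_add:
 assumes k: "k \<in> ksq M N" and l: "l \<in> ksq M N"
 shows "int_op M N (\<lambda>z. k z + l z) = vadd (compacts M N) (int_op M N k) (int_op M N l)"
proof (rule extensionalityI)
 fix A assume "A \<in> vecs (L2 M)"
 then obtain f where f: "f \<in> sq M" "A = ae_class M f" by (rule L2_memE)
 have "AE y in N. kernel_apply M (\<lambda>z. k z + l z) f y = kernel_apply M k f y + kernel_apply M l f y"
  using sq_section[OF M N k] sq_section[OF M N l]
  by eventually_elim (simp add: kernel_apply_def distrib_right sq_cauchy_schwarz(1) f(1))
 then have "ae_class N (kernel_apply M (\<lambda>z. k z + l z) f) = ae_class N (\<lambda>y. kernel_apply M k f y + kernel_apply M l f y)"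
  by (subst ae_class_eq_iff) (auto intro!: sqD(1)[OF kernel_apply_sq[OF M N]] borel_measurable_add sq_add k l f)
 then show "int_op M N (\<lambda>z. k z + l z) A = vadd (compacts M N) (int_op M N k) (int_op M N l) A"
  using L2_memI[OF f(1)] L2_add[OF kernel_apply_sq[OF M N k f(1)] kernel_apply_sq[OF M N l f(1)]]
  by (simp add: f(2) compact_ops_simps bounded_ops_simps int_op_apply[OF M N _ f(1)] k l)
qed (simp_all add: int_op_def compact_ops_simps bounded_ops_simps)

lemma int_op_scale:
 assumes k: "k \<in> ksq M N"
 shows "int_op M N (\<lambda>z. c * k z) = vscale (compacts M N) c (int_op M N k)"
proof (rule extensionalityI)
 fix A assume "A \<in> vecs (L2 M)"
 then obtain f where f: "f \<in> sq M" "A = ae_class M f" by (rule L2_memE)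
 have "kernel_apply M (\<lambda>z. c * k z) f = (\<lambda>y. c * kernel_apply M k f y)"
  by (rule ext) (simp add: kernel_apply_def mult.assoc)
 then show "int_op M N (\<lambda>z. c * k z) A = vscale (compacts M N) c (int_op M N k) A"
  using L2_memI[OF f(1)] L2_scale[OF kernel_apply_sq[OF M N k f(1)], of c]
  by (simp add: f(2) compact_ops_simps bounded_ops_simps int_op_apply[OF M N _ f(1)] k)
qed (simp_all add: int_op_def compact_ops_simps bounded_ops_simps)

lemma linear_mult_graph: "linear_graph (compacts M N) (mult_graph M N \<phi>)"
 unfolding linear_graph_def
proof (intro conjI allI impI)
 show "mult_graph M N \<phi> \<subseteq> vecs (compacts M N) \<times> vecs (compacts M N)"
  unfolding mult_graph_def mult_domain_def by (auto intro!: int_op_mem)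
 have "(\<lambda>z. 0) \<in> mult_domain M N \<phi>" by (simp add: mult_domain_def)
 then show "mult_graph M N \<phi> \<noteq> {}" unfolding mult_graph_def by blast
 fix v w assume "(v, w) \<in> mult_graph M N \<phi>"
 then obtain k where k: "k \<in> ksq M N" "(\<lambda>z. \<phi> z * k z) \<in> ksq M N"
  "v = int_op M N k" "w = int_op M N (\<lambda>z. \<phi> z * k z)" by (auto simp: mult_graph_def mult_domain_def)
 have mem: "(int_op M N l, int_op M N m) \<in> mult_graph M N \<phi>"
  if "l \<in> ksq M N" "m \<in> ksq M N" "m = (\<lambda>z. \<phi> z * l z)" for l m
  using that unfolding mult_graph_def mult_domain_def by blast
 show "(vscale (compacts M N) c v, vscale (compacts M N) c w) \<in> mult_graph M N \<phi>" for c
  unfolding k(3,4) int_op_scale[OF k(1), symmetric] int_op_scale[OF k(2), symmetric]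
  by (rule mem) (use k in \<open>auto simp: mult_ac\<close>)
 fix v' w' assume "(v', w') \<in> mult_graph M N \<phi>"
 then obtain k' where k': "k' \<in> ksq M N" "(\<lambda>z. \<phi> z * k' z) \<in> ksq M N"
  "v' = int_op M N k'" "w' = int_op M N (\<lambda>z. \<phi> z * k' z)" by (auto simp: mult_graph_def mult_domain_def)
 show "(vadd (compacts M N) v v', vadd (compacts M N) w w') \<in> mult_graph M N \<phi>"
  unfolding k(3,4) k'(3,4) int_op_add[OF k(1) k'(1), symmetric] int_op_add[OF k(2) k'(2), symmetric]
  by (rule mem) (use k k' in \<open>auto simp: distrib_left\<close>)
qed

lemma dual_kernel_functional:
 assumes F: "F \<in> vecs (dual (compacts M N))"
 shows "kernel_functional M N (\<lambda>k. F (int_op M N k)) (vnorm (dual (compacts M N)) F)"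
 unfolding kernel_functional_def
proof (intro conjI ballI allI impI)
 note K = seminormed_compact_ops[OF M N]
 show "vnorm (dual (compacts M N)) F \<ge> 0" by (rule dual_norm(1)[OF K F])
 fix k assume k: "k \<in> ksq M N"
 show "F (int_op M N (\<lambda>z. k z + l z)) = F (int_op M N k) + F (int_op M N l)" if "l \<in> ksq M N" for l
  unfolding int_op_add[OF k that] by (rule dualD(2)[OF F int_op_mem[OF k] int_op_mem[OF that]])
 show "F (int_op M N (\<lambda>z. c * k z)) = c * F (int_op M N k)" for c
  unfolding int_op_scale[OF k] by (rule dualD(3)[OF F int_op_mem[OF k]])
 fix c assume c: "kernel_bound M N k c"
 have "vnorm (compacts M N) (int_op M N k) \<le> c"
  using int_op_norm_le_iff[OF M N k kernel_boundD(1)[OF N c]] c by (simp add: compact_ops_simps)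
 then show "cmod (F (int_op M N k)) \<le> vnorm (dual (compacts M N)) F * c"
  using dual_norm(2)[OF K F int_op_mem[OF k]] mult_left_mono[OF _ dual_norm(1)[OF K F]] order_trans by blast
qed

lemma int_ops_dense:
 assumes T: "T \<in> vecs (compacts M N)" and e: "e > 0"
 obtains k where "k \<in> ksq M N"
  "vnorm (compacts M N) (vadd (compacts M N) T (vscale (compacts M N) (-1) (int_op M N k))) \<le> e"
proof -
 note K = seminormed_spaceD[OF seminormed_compact_ops[OF M N]]
 have Tc: "is_compact_op (L2 M) (L2 N) T" using T by (simp add: compact_ops_simps)
 obtain k where k: "k \<in> ksq M N"
  "\<And>f g. f \<in> sq M ==> g \<in> sq N ==> cmod (operator_form M N T f g - pairing M N k f g) \<le> e * (l2norm M f * l2norm N g)"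
  by (rule compact_op_kernel_approximation[OF M N Tc e], rule that)
 define S where "S = vadd (compacts M N) T (vscale (compacts M N) (-1) (int_op M N k))"
 note kneg = K(7)[OF int_op_mem[OF k(1)], of "-1"]
 have S: "S \<in> vecs (bounded_ops (L2 M) (L2 N))" unfolding S_def by (rule compacts_bounded[OF K(2)[OF T kneg]])
 have "vnorm (bounded_ops (L2 M) (L2 N)) S \<le> e"
 proof (rule bounded_ops_norm(3)[OF seminormed_L2 seminormed_L2 S])
  fix A assume "A \<in> vecs (L2 M)"
  then obtain f where f: "f \<in> sq M" "A = ae_class M f" by (rule L2_memE)
  define t where "t = rep (T (ae_class M f))"
  have t: "t \<in> sq N" "T A = ae_class N t"
   unfolding t_def f(2) using L2_rep[OF bounded_opsD(2)[OF compacts_bounded[OF T] L2_memI[OF f(1)]]] by simp_all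
  note ka = kernel_apply_sq[OF M N k(1) f(1)]
  have "S A = vadd (L2 N) (ae_class N t) (vscale (L2 N) (-1) (ae_class N (kernel_apply M k f)))"
   using L2_memI[OF f(1)] t(2) by (simp add: S_def compact_ops_simps bounded_ops_simps f(2) int_op_apply[OF M N k(1) f(1)])
  then have "vnorm (L2 N) (S A) = l2norm N (\<lambda>y. t y - kernel_apply M k f y)"
   using L2_dist[OF t(1) ka] by (simp add: vdist_def)
  also have "\<dots> \<le> e * l2norm M f"
  proof (rule l2norm_le_by_duality[OF sq_diff[OF t(1) ka]])
   fix g assume g: "g \<in> sq N"
   have "(LINT y|N. (t y - kernel_apply M k f y) * g y) = operator_form M N T f g - pairing M N k f g"
    using sq_cauchy_schwarz(1)[OF t(1) g] sq_cauchy_schwarz(1)[OF ka g]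
    by (simp add: left_diff_distrib operator_form_def t_def integral_kernel_apply[OF M N k(1) f(1) g])
   then show "cmod (LINT y|N. (t y - kernel_apply M k f y) * g y) \<le> e * l2norm M f * l2norm N g"
    using k(2)[OF f(1) g] by (simp add: mult.assoc)
  qed (use e in simp)
  finally show "vnorm (L2 N) (S A) \<le> e * vnorm (L2 M) A" by (simp add: f(2) L2_norm[OF f(1)])
 qed (use e in simp)
 then show thesis using that[OF k(1)] by (simp add: S_def compact_ops_simps)
qed

text \<open>Integral operators with square integrable kernels are dense in the compact operators, so a bound for a functional can be checked on them.\<close>

lemma dual_norm_on_kernels:
 assumes F: "F \<in> vecs (dual (compacts M N))" and C: "C \<ge> 0"
  and bound: "\<And>k c. k \<in> ksq M N ==> kernel_bound M N k c ==> cmod (F (int_op M N k)) \<le> C * c"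
  and T: "T \<in> vecs (compacts M N)"
 shows "cmod (F T) \<le> C * vnorm (compacts M N) T"
proof (rule field_le_epsilon)
 fix e :: real assume e: "e > 0"
 note Ks = seminormed_compact_ops[OF M N]
 note K = seminormed_spaceD[OF Ks]
 define B where "B = vnorm (dual (compacts M N)) F"
 have B: "B \<ge> 0" unfolding B_def by (rule dual_norm(1)[OF Ks F])
 define \<delta> where "\<delta> = e / (B + C + 1)"
 have \<delta>: "\<delta> > 0" "(B + C) * \<delta> \<le> e"
 proof -
  show "\<delta> > 0" using e B C by (simp add: \<delta>_def)
  have "(B + C) * \<delta> \<le> (B + C + 1) * \<delta>" using \<open>\<delta> > 0\<close> by (intro mult_right_mono) auto
  also have "\<dots> = e" using B C by (simp add: \<delta>_def)
  finally show "(B + C) * \<delta> \<le> e" .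
 qed
 obtain k where k: "k \<in> ksq M N"
  "vnorm (compacts M N) (vadd (compacts M N) T (vscale (compacts M N) (-1) (int_op M N k))) \<le> \<delta>"
  by (rule int_ops_dense[OF T \<delta>(1)], rule that)
 define I where "I = int_op M N k"
 define S where "S = vadd (compacts M N) T (vscale (compacts M N) (-1) I)"
 have I: "I \<in> vecs (compacts M N)" unfolding I_def by (rule int_op_mem[OF k(1)])
 note nI = K(7)[OF I, of "-1"]
 have S: "S \<in> vecs (compacts M N)" unfolding S_def by (rule K(2)[OF T nI])
 have Sn: "vnorm (compacts M N) S \<le> \<delta>" using k(2) by (simp add: S_def I_def)
 have FS: "F S = F T - F I" using dualD(2)[OF F T nI] dualD(3)[OF F I, of "-1"] by (simp add: S_def)
 define Z where "Z = vscale (compacts M N) 0 T"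
 have "vnorm (compacts M N) I \<le> vnorm (compacts M N) T + \<delta>"
 proof -
  have mS: "vscale (compacts M N) (-1) S \<in> vecs (compacts M N)" by (rule K(7)[OF S])
  have "vscale (compacts M N) (-1) S = vadd (compacts M N) (vscale (compacts M N) (-1) T) I"
   using K(5)[OF T nI, of "-1"] K(9)[OF I, of "-1" "-1"] K(12)[OF I] by (simp add: S_def)
  then have "vadd (compacts M N) T (vscale (compacts M N) (-1) S) = vadd (compacts M N) Z I"
   using K(6)[OF T K(7)[OF T, of "-1"] I] K(11)[OF T, of 1 "-1"] K(12)[OF T] by (simp add: Z_def)
  also have "\<dots> = I"
  proof (rule extensionalityI[of _ "vecs (L2 M)"])
   show "vadd (compacts M N) Z I \<in> extensional (vecs (L2 M))" "I \<in> extensional (vecs (L2 M))"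
    using bounded_opsD(1)[OF compacts_bounded[OF I]] by (simp_all add: compact_ops_simps bounded_ops_simps)
   fix A assume A: "A \<in> vecs (L2 M)"
   note TA = bounded_opsD(2)[OF compacts_bounded[OF T] A] and IA = bounded_opsD(2)[OF compacts_bounded[OF I] A]
   show "vadd (compacts M N) Z I A = I A"
    using A L2_scale[OF L2_rep(1)[OF TA], of 0] L2_rep(2)[OF TA] L2_add[OF sq_zero L2_rep(1)[OF IA]] L2_rep(2)[OF IA]
    by (simp add: Z_def compact_ops_simps bounded_ops_simps)
  qed
  finally have "I = vadd (compacts M N) T (vscale (compacts M N) (-1) S)" by simp
  then show ?thesis using K(4)[OF T mS] K(8)[OF S, of "-1"] Sn by simp
 qed
 moreover have "cmod (F I) \<le> C * vnorm (compacts M N) I"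
  unfolding I_def
 proof (rule bound[OF k(1)])
  have "vnorm (bounded_ops (L2 M) (L2 N)) (int_op M N k) \<ge> 0" using K(10)[OF I] by (simp add: I_def compact_ops_simps)
  then show "kernel_bound M N k (vnorm (compacts M N) (int_op M N k))"
   using int_op_norm_le_iff[OF M N k(1), THEN iffD1, OF _ order_refl] by (simp add: compact_ops_simps)
 qed
 ultimately have "cmod (F I) \<le> C * (vnorm (compacts M N) T + \<delta>)"
  using mult_left_mono[OF _ C] order_trans by blast
 moreover have "cmod (F S) \<le> B * \<delta>"
  using dual_norm(2)[OF Ks F S] mult_left_mono[OF Sn B] unfolding B_def by linarith
 moreover have "cmod (F T) \<le> cmod (F S) + cmod (F I)" unfolding FS using norm_triangle_ineq[of "F T - F I" "F I"] by simp
 ultimately show "cmod (F T) \<le> C * vnorm (compacts M N) T + e" using \<delta>(2) by (simp add: distrib_left distrib_right)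
qed

text \<open>The nuclear representation makes sense for every compact operator: replace the pairing with \<open>k\<close> by the form of the operator.\<close>

theorem kernel_functional_extension:
 assumes \<Lambda>: "kernel_functional M N \<Lambda> C"
 obtains F where "F \<in> vecs (dual (compacts M N))" "\<And>k. k \<in> ksq M N ==> F (int_op M N k) = \<Lambda> k"
proof -
 note K = seminormed_spaceD[OF seminormed_compact_ops[OF M N]]
 obtain f g where fg: "\<And>i. f i \<in> sq M" "\<And>i. g i \<in> sq N"
  "\<And>n. (\<Sum>i<n. (l2norm M (f i))\<^sup>2) \<le> C" "\<And>n. (\<Sum>i<n. (l2norm N (g i))\<^sup>2) \<le> C"
  "\<And>k. k \<in> ksq M N ==> (\<lambda>i. pairing M N k (f i) (g i)) sums \<Lambda> k"
  by (rule nuclear_representation[OF M N \<Lambda>], rule that)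
 have "(\<Sum>i<n. l2norm M (f i) * l2norm N (g i)) \<le> C" for n
 proof -
  have "l2norm M (f i) * l2norm N (g i) \<le> ((l2norm M (f i))\<^sup>2 + (l2norm N (g i))\<^sup>2) / 2" for i
   using zero_le_power2[of "l2norm M (f i) - l2norm N (g i)"] unfolding power2_diff by simp
  then have "(\<Sum>i<n. l2norm M (f i) * l2norm N (g i)) \<le> (\<Sum>i<n. ((l2norm M (f i))\<^sup>2 + (l2norm N (g i))\<^sup>2) / 2)"
   by (rule sum_mono)
  also have "\<dots> \<le> C" using fg(3,4)[of n] by (simp add: sum_divide_distrib[symmetric] sum.distrib)
  finally show ?thesis .
 qed
 then have sm: "summable (\<lambda>i. l2norm M (f i) * l2norm N (g i))" by (intro bounded_imp_summable[of _ "C"]) (simp, simp only: lessThan_Suc_atMost[symmetric])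
 have one: "cmod (operator_form M N T (f i) (g i)) \<le> vnorm (compacts M N) T * (l2norm M (f i) * l2norm N (g i))"
  if "T \<in> vecs (compacts M N)" for T i
  using operator_form_bound[OF compacts_bounded[OF that] fg(1,2)] by (simp add: compact_ops_simps)
 have sT: "summable (\<lambda>i. operator_form M N T (f i) (g i))" if "T \<in> vecs (compacts M N)" for T
  by (rule summable_comparison_test'[OF summable_mult[OF sm] one[OF that]])
 have val: "(\<lambda>y. rep (V A) y) \<in> sq N" if "V \<in> vecs (compacts M N)" "A \<in> vecs (L2 M)" for V A
  using L2_rep(1)[OF bounded_opsD(2)[OF compacts_bounded[OF that(1)] that(2)]] by simp
 define F where "F = (\<lambda>T\<in>vecs (compacts M N). \<Sum>i. operator_form M N T (f i) (g i))"
 have "F \<in> vecs (dual (compacts M N))"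
 proof (rule dualI)
  show "F \<in> extensional (vecs (compacts M N))" by (simp add: F_def)
  fix T assume T: "T \<in> vecs (compacts M N)"
  note Tm = bounded_opsD(2)[OF compacts_bounded[OF T]]
  show "cmod (F T) \<le> (\<Sum>i. l2norm M (f i) * l2norm N (g i)) * vnorm (compacts M N) T"
  proof -
   have "cmod (F T) \<le> (\<Sum>i. vnorm (compacts M N) T * (l2norm M (f i) * l2norm N (g i)))"
    using suminf_le[OF one[OF T] _ summable_mult[OF sm]] summable_norm[of "\<lambda>i. operator_form M N T (f i) (g i)"]
     summable_comparison_test'[OF summable_mult[OF sm], of 0 "\<lambda>i. cmod (operator_form M N T (f i) (g i))"] one[OF T] T
    by (simp add: F_def) (meson order_trans)
   then show ?thesis by (simp add: suminf_mult[OF sm] mult.commute)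
  qed
  have "operator_form M N (vscale (compacts M N) c T) (f i) (g i) = c * operator_form M N T (f i) (g i)" for c i
  proof -
   note r = L2_rep[OF Tm[OF L2_memI[OF fg(1)]], of i]
   have "vscale (compacts M N) c T (ae_class M (f i)) = ae_class N (\<lambda>y. c * rep (T (ae_class M (f i))) y)"
    using L2_scale[OF r(1), of c] r(2) L2_memI[OF fg(1)] by (simp add: compact_ops_simps bounded_ops_simps)
   moreover have "(LINT y|N. rep (ae_class N (\<lambda>y. c * rep (T (ae_class M (f i))) y)) y * g i y)
     = (LINT y|N. c * (rep (T (ae_class M (f i))) y * g i y))"
    using rep_ae_class[OF sqD(1)[OF sq_scale[OF r(1), of c]]] sqD(1)[OF r(1)] sqD(1)[OF fg(2)]
    by (intro integral_cong_AE) (auto simp: mult.assoc)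
   ultimately show ?thesis by (simp add: operator_form_def)
  qed
  then show "F (vscale (compacts M N) c T) = c * F T" for c using suminf_mult[OF sT[OF T], of c] K(7)[OF T] T by (simp add: F_def)
  fix S assume S: "S \<in> vecs (compacts M N)"
  note Sm = bounded_opsD(2)[OF compacts_bounded[OF S]]
  have "operator_form M N (vadd (compacts M N) T S) (f i) (g i) = operator_form M N T (f i) (g i) + operator_form M N S (f i) (g i)" for i
  proof -
   note r = L2_rep[OF Tm[OF L2_memI[OF fg(1)]], of i] and s = L2_rep[OF Sm[OF L2_memI[OF fg(1)]], of i]
   have "vadd (compacts M N) T S (ae_class M (f i)) = ae_class N (\<lambda>y. rep (T (ae_class M (f i))) y + rep (S (ae_class M (f i))) y)"
    using L2_add[OF r(1) s(1)] r(2) s(2) L2_memI[OF fg(1)] by (simp add: compact_ops_simps bounded_ops_simps)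
   moreover have "(LINT y|N. rep (ae_class N (\<lambda>y. rep (T (ae_class M (f i))) y + rep (S (ae_class M (f i))) y)) y * g i y)
     = (LINT y|N. rep (T (ae_class M (f i))) y * g i y + rep (S (ae_class M (f i))) y * g i y)"
    using rep_ae_class[OF sqD(1)[OF sq_add[OF r(1) s(1)]]] sqD(1)[OF r(1)] sqD(1)[OF s(1)] sqD(1)[OF fg(2)]
    by (intro integral_cong_AE) (auto simp: distrib_right)
   ultimately show ?thesis
    using sq_cauchy_schwarz(1)[OF r(1) fg(2)] sq_cauchy_schwarz(1)[OF s(1) fg(2)] by (simp add: operator_form_def)
  qed
  then show "F (vadd (compacts M N) T S) = F T + F S"
   using suminf_add[OF sT[OF T] sT[OF S]] K(2)[OF T S] T S by (simp add: F_def)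
 qed
 moreover have "F (int_op M N k) = \<Lambda> k" if "k \<in> ksq M N" for k
  using int_op_mem[OF that] sums_unique[OF fg(5)[OF that]] by (simp add: F_def operator_form_int_op[OF M N that fg(1,2)])
 ultimately show thesis by (rule that)
qed

end

section \<open>Square summable families and Schur multiplication\<close>

text \<open>Families with row bounds turn this into a function that is everywhere an absolutely convergent sum.\<close>

definition dot :: "(nat => 'a => complex) => (nat => 'b => complex) => 'a \<times> 'b => complex" where
 "dot a b z = (\<Sum>i. a i (fst z) * b i (snd z))"

lemma dot_bounds:
 assumes a: "row_bound M a s" and b: "row_bound N b t" and z: "z \<in> space (M \<Otimes>\<^sub>M N)"
 shows "(\<Sum>i<n. cmod (a i (fst z) * b i (snd z))) \<le> s (fst z) * t (snd z)"
  "(\<lambda>i. a i (fst z) * b i (snd z)) sums dot a b z" "cmod (dot a b z) \<le> s (fst z) * t (snd z)"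
proof -
 have x: "fst z \<in> space M" and y: "snd z \<in> space N" using z by (auto simp: space_pair_measure)
 note A = row_boundD[OF a] and B = row_boundD[OF b]
 have *: "(\<Sum>i<n. cmod (a i (fst z) * b i (snd z))) \<le> s (fst z) * t (snd z)" for n
 proof -
  have "(\<Sum>i<n. cmod (a i (fst z) * b i (snd z))) = (\<Sum>i<n. \<bar>cmod (a i (fst z))\<bar> * \<bar>cmod (b i (snd z))\<bar>)" by (simp add: norm_mult)
  also have "\<dots> \<le> L2_set (\<lambda>i. cmod (a i (fst z))) {..<n} * L2_set (\<lambda>i. cmod (b i (snd z))) {..<n}" by (rule L2_set_mult_ineq)
  also have "\<dots> \<le> s (fst z) * t (snd z)"
   unfolding L2_set_def using A(2,3)[OF x] B(2,3)[OF y] by (intro mult_mono real_le_lsqrt) (auto intro: sum_nonneg)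
  finally show ?thesis .
 qed
 then show "(\<Sum>i<n. cmod (a i (fst z) * b i (snd z))) \<le> s (fst z) * t (snd z)" .
 have s: "summable (\<lambda>i. cmod (a i (fst z) * b i (snd z)))"
  by (rule bounded_imp_summable[of _ "s (fst z) * t (snd z)"]) (simp, simp only: lessThan_Suc_atMost[symmetric] *)
 show "(\<lambda>i. a i (fst z) * b i (snd z)) sums dot a b z"
  unfolding dot_def by (rule summable_sums[OF summable_norm_cancel[OF s]])
 show "cmod (dot a b z) \<le> s (fst z) * t (snd z)"
  unfolding dot_def by (rule order_trans[OF summable_norm[OF s] suminf_le_const[OF s *]])
qed

lemma dot_measurable:
 assumes "row_bound M a s" "row_bound N b t"
 shows "dot a b \<in> kmeasurable M N"
proof -
 note [measurable] = row_boundD(1)[OF assms(1)] row_boundD(1)[OF assms(2)]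
 show ?thesis unfolding dot_def[abs_def] by measurable
qed

lemma sum_pairings_dot:
 assumes N: "sigma_finite_measure N" and k: "k \<in> ksq M N" and a: "row_bound M a s" and b: "row_bound N b t"
  and p: "p \<in> borel_measurable M" and q: "q \<in> borel_measurable N"
  and sp: "(\<lambda>x. of_real (s x) * p x) \<in> sq M" and tq: "(\<lambda>y. of_real (t y) * q y) \<in> sq N"
 shows "(\<lambda>i. pairing M N k (\<lambda>x. a i x * p x) (\<lambda>y. b i y * q y)) sums (LINT z|(M \<Otimes>\<^sub>M N). k z * (dot a b z * (p (fst z) * q (snd z))))"
  and "(\<lambda>x. a i x * p x) \<in> sq M" "(\<lambda>y. b i y * q y) \<in> sq N"
  and "(\<lambda>z. dot a b z * (p (fst z) * q (snd z))) \<in> ksq M N"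
proof -
 note [measurable] = row_boundD(1)[OF a] row_boundD(1)[OF b] p q dot_measurable[OF a b] sqD(1)[OF k]
 have one: "cmod (c i x) \<le> u x" if "row_bound L c u" "x \<in> space L" for L :: "'c measure" and c u x i
 proof -
  have "(cmod (c i x))\<^sup>2 \<le> (\<Sum>i<Suc i. (cmod (c i x))\<^sup>2)" by (simp add: sum_nonneg)
  also have "\<dots> \<le> (u x)\<^sup>2" by (rule row_boundD(3)[OF that])
  finally show ?thesis by (rule power2_le_imp_le) (rule row_boundD(2)[OF that])
 qed
 have A: "(\<lambda>x. a i x * p x) \<in> sq M" for i
  by (rule sq_dominated(1)[OF sp, of _ 1], measurable)
   (use one[OF a] row_boundD(2)[OF a] in \<open>auto simp: norm_mult intro!: AE_I2 mult_right_mono\<close>)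
 have B: "(\<lambda>y. b i y * q y) \<in> sq N" for i
  by (rule sq_dominated(1)[OF tq, of _ 1], measurable)
   (use one[OF b] row_boundD(2)[OF b] in \<open>auto simp: norm_mult intro!: AE_I2 mult_right_mono\<close>)
 show "(\<lambda>x. a i x * p x) \<in> sq M" "(\<lambda>y. b i y * q y) \<in> sq N" by (rule A B)+
 define w where "w z = (of_real (s (fst z)) * p (fst z)) * (of_real (t (snd z)) * q (snd z))" for z
 have w: "w \<in> ksq M N" unfolding w_def[abs_def] by (rule tensor_sq(1)[OF N sp tq])
 have le: "cmod (v * (p (fst z) * q (snd z))) \<le> cmod (w z)"
  if "z \<in> space (M \<Otimes>\<^sub>M N)" "cmod v \<le> s (fst z) * t (snd z)" for v z
 proof -
  have "s (fst z) \<ge> 0" "t (snd z) \<ge> 0" using that(1) row_boundD(2)[OF a] row_boundD(2)[OF b] by (auto simp: space_pair_measure)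
  then have "cmod (w z) = s (fst z) * t (snd z) * cmod (p (fst z) * q (snd z))" by (simp add: w_def norm_mult)
  then show ?thesis using mult_right_mono[OF that(2) norm_ge_zero[of "p (fst z) * q (snd z)"]] by (simp add: norm_mult)
 qed
 show "(\<lambda>z. dot a b z * (p (fst z) * q (snd z))) \<in> ksq M N"
  by (rule sq_dominated(1)[OF w, of _ 1], measurable) (use le dot_bounds(3)[OF a b] in \<open>auto intro!: AE_I2\<close>)
 have "(\<lambda>n. LINT z|(M \<Otimes>\<^sub>M N). k z * ((\<Sum>i<n. a i (fst z) * b i (snd z)) * (p (fst z) * q (snd z))))
   \<longlonglongrightarrow> (LINT z|(M \<Otimes>\<^sub>M N). k z * (dot a b z * (p (fst z) * q (snd z))))"
 proof (rule integral_dominated_convergence[where w="\<lambda>z. cmod (k z * w z)"])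
  show "integrable (M \<Otimes>\<^sub>M N) (\<lambda>z. cmod (k z * w z))" by (rule integrable_norm[OF sq_cauchy_schwarz(1)[OF k w]])
  show "AE z in M \<Otimes>\<^sub>M N. (\<lambda>n. k z * ((\<Sum>i<n. a i (fst z) * b i (snd z)) * (p (fst z) * q (snd z)))) \<longlonglongrightarrow> k z * (dot a b z * (p (fst z) * q (snd z)))"
   using dot_bounds(2)[OF a b] by (auto intro!: AE_I2 tendsto_intros simp: sums_def)
  show "AE z in M \<Otimes>\<^sub>M N. cmod (k z * ((\<Sum>i<n. a i (fst z) * b i (snd z)) * (p (fst z) * q (snd z)))) \<le> cmod (k z * w z)" for n
   by (rule AE_I2, simp only: norm_mult[of "k _"])
    (intro mult_left_mono le order_trans[OF norm_sum dot_bounds(1)[OF a b]], auto)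
 qed measurable
 moreover have "(LINT z|(M \<Otimes>\<^sub>M N). k z * ((\<Sum>i<n. a i (fst z) * b i (snd z)) * (p (fst z) * q (snd z))))
   = (\<Sum>i<n. pairing M N k (\<lambda>x. a i x * p x) (\<lambda>y. b i y * q y))" for n
 proof -
  have "(\<lambda>z. k z * ((\<Sum>i<n. a i (fst z) * b i (snd z)) * (p (fst z) * q (snd z))))
   = (\<lambda>z. \<Sum>i<n. k z * ((a i (fst z) * p (fst z)) * (b i (snd z) * q (snd z))))"
   by (rule ext) (simp add: sum_distrib_left sum_distrib_right mult_ac)
  then show ?thesis unfolding pairing_def
   by (simp only:) (intro Bochner_Integration.integral_sum pairing_integrable[OF N k A B])
 qed
 ultimately show "(\<lambda>i. pairing M N k (\<lambda>x. a i x * p x) (\<lambda>y. b i y * q y)) sums (LINT z|(M \<Otimes>\<^sub>M N). k z * (dot a b z * (p (fst z) * q (snd z))))"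
  by (simp add: sums_def)
qed

lemma row_sum_l2norm:
 assumes a: "row_bound M a s" and p: "p \<in> borel_measurable M" and sp: "(\<lambda>x. of_real (s x) * p x) \<in> sq M"
 shows "(\<Sum>i<n. (l2norm M (\<lambda>x. a i x * p x))\<^sup>2) \<le> (l2norm M (\<lambda>x. of_real (s x) * p x))\<^sup>2"
proof -
 note [measurable] = row_boundD(1)[OF a] p
 have pa: "(\<lambda>x. a i x * p x) \<in> sq M" for i
 proof (rule sq_dominated(1)[OF sp, of _ 1], measurable, rule AE_I2)
  fix x assume x: "x \<in> space M"
  have "(cmod (a i x))\<^sup>2 \<le> (\<Sum>i<Suc i. (cmod (a i x))\<^sup>2)" by (simp add: sum_nonneg)
  also have "\<dots> \<le> (s x)\<^sup>2" by (rule row_boundD(3)[OF a x])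
  finally have "cmod (a i x) \<le> s x" by (rule power2_le_imp_le) (rule row_boundD(2)[OF a x])
  then show "cmod (a i x * p x) \<le> 1 * cmod (of_real (s x) * p x)"
   using row_boundD(2)[OF a x] by (simp add: norm_mult mult_right_mono)
 qed
 have "(\<Sum>i<n. (l2norm M (\<lambda>x. a i x * p x))\<^sup>2) = (LINT x|M. (\<Sum>i<n. (cmod (a i x * p x))\<^sup>2))"
  unfolding l2norm_square by (intro Bochner_Integration.integral_sum[symmetric] sqD(2)[OF pa])
 also have "\<dots> \<le> (LINT x|M. (cmod (of_real (s x) * p x))\<^sup>2)"
 proof (rule integral_mono)
  fix x assume "x \<in> space M"
  have "(\<Sum>i<n. (cmod (a i x * p x))\<^sup>2) = (\<Sum>i<n. (cmod (a i x))\<^sup>2) * (cmod (p x))\<^sup>2"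
   by (simp add: norm_mult power_mult_distrib sum_distrib_right)
  also have "\<dots> \<le> (s x)\<^sup>2 * (cmod (p x))\<^sup>2" by (intro mult_right_mono row_boundD(3)[OF a \<open>x \<in> space M\<close>]) simp
  finally show "(\<Sum>i<n. (cmod (a i x * p x))\<^sup>2) \<le> (cmod (of_real (s x) * p x))\<^sup>2" by (simp add: norm_mult power_mult_distrib)
 qed (use sqD(2)[OF pa] sqD(2)[OF sp] in auto)
 finally show ?thesis by (simp only: l2norm_square)
qed

text \<open>Cauchy-Schwarz over the index of the sum. With constant \<open>s\<close>, \<open>t\<close> it is the Schur multiplier estimate; with indicators as \<open>p\<close>, \<open>q\<close> it measures the tail of a functional.\<close>

lemma dot_pairing_bound:
 assumes N: "sigma_finite_measure N" and a: "row_bound M a s" and b: "row_bound N b t"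
  and p: "p \<in> borel_measurable M" and q: "q \<in> borel_measurable N"
  and sp: "(\<lambda>x. of_real (s x) * p x) \<in> sq M" and tq: "(\<lambda>y. of_real (t y) * q y) \<in> sq N"
  and k: "k \<in> ksq M N" and d: "kernel_bound M N k d"
 shows "cmod (LINT z|(M \<Otimes>\<^sub>M N). k z * (dot a b z * (p (fst z) * q (snd z))))
  \<le> d * (l2norm M (\<lambda>x. of_real (s x) * p x) * l2norm N (\<lambda>y. of_real (t y) * q y))"
proof -
 have d0: "d \<ge> 0" by (rule kernel_boundD(1)[OF N d])
 note S = sum_pairings_dot[OF N k a b p q sp tq]
 have "(\<lambda>n. \<Sum>i<n. pairing M N k (\<lambda>x. a i x * p x) (\<lambda>y. b i y * q y)) \<longlonglongrightarrow> (LINT z|(M \<Otimes>\<^sub>M N). k z * (dot a b z * (p (fst z) * q (snd z))))"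
  using S(1) by (simp add: sums_def)
 then show ?thesis
 proof (rule LIMSEQ_le_const2[OF tendsto_norm], intro exI allI impI)
  fix n
  have "cmod (\<Sum>i<n. pairing M N k (\<lambda>x. a i x * p x) (\<lambda>y. b i y * q y))
    \<le> (\<Sum>i<n. d * (\<bar>l2norm M (\<lambda>x. a i x * p x)\<bar> * \<bar>l2norm N (\<lambda>y. b i y * q y)\<bar>))"
   by (rule order_trans[OF norm_sum sum_mono]) (use kernel_boundD(2)[OF N d S(2,3)] in simp)
  also have "\<dots> \<le> d * (L2_set (\<lambda>i. l2norm M (\<lambda>x. a i x * p x)) {..<n} * L2_set (\<lambda>i. l2norm N (\<lambda>y. b i y * q y)) {..<n})"
   unfolding sum_distrib_left[symmetric] by (rule mult_left_mono[OF L2_set_mult_ineq d0])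
  also have "\<dots> \<le> d * (l2norm M (\<lambda>x. of_real (s x) * p x) * l2norm N (\<lambda>y. of_real (t y) * q y))"
   unfolding L2_set_def using row_sum_l2norm[OF a p sp] row_sum_l2norm[OF b q tq] d0
   by (intro mult_left_mono mult_mono real_le_lsqrt) (auto intro: sum_nonneg)
  finally show "cmod (\<Sum>i<n. pairing M N k (\<lambda>x. a i x * p x) (\<lambda>y. b i y * q y))
    \<le> d * (l2norm M (\<lambda>x. of_real (s x) * p x) * l2norm N (\<lambda>y. of_real (t y) * q y))" .
 qed
qed

text \<open>The easy half of Grothendieck's characterisation of Schur multipliers.\<close>

theorem schur_bound:
 assumes N: "sigma_finite_measure N" and a: "row_bound M a (\<lambda>_. R)" and b: "row_bound N b (\<lambda>_. S)" and RS: "R \<ge> 0" "S \<ge> 0"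
  and k: "k \<in> ksq M N" and d: "kernel_bound M N k d"
 shows "kernel_bound M N (\<lambda>z. dot a b z * k z) (R * S * d)"
proof (rule kernel_boundI[OF N])
 show "R * S * d \<ge> 0" using RS kernel_boundD(1)[OF N d] by simp
 fix f g assume f: "f \<in> sq M" and g: "g \<in> sq N"
 show "cmod (pairing M N (\<lambda>z. dot a b z * k z) f g) \<le> R * S * d * (l2norm M f * l2norm N g)"
  using dot_pairing_bound[OF N a b sqD(1)[OF f] sqD(1)[OF g] sq_scale[OF f] sq_scale[OF g] k d] RS
  unfolding l2norm_scale norm_of_real by (simp add: pairing_def mult_ac)
qed

theorem functional_kernel:
 assumes M: "sigma_finite_measure M" and N: "sigma_finite_measure N"
  and F: "kernel_functional M N F C"
 obtains f g s t where "row_bound M f s" "row_bound N g t"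
  "real_sq M s" "(l2norm M (\<lambda>x. complex_of_real (s x)))\<^sup>2 \<le> C"
  "real_sq N t" "(l2norm N (\<lambda>x. complex_of_real (t x)))\<^sup>2 \<le> C"
  "dot f g \<in> ksq M N" "\<And>k. k \<in> ksq M N ==> F k = (LINT z|(M \<Otimes>\<^sub>M N). k z * dot f g z)"
proof -
 obtain f g where fg: "\<And>i. f i \<in> sq M" "\<And>i. g i \<in> sq N"
  "\<And>n. (\<Sum>i<n. (l2norm M (f i))\<^sup>2) \<le> C" "\<And>n. (\<Sum>i<n. (l2norm N (g i))\<^sup>2) \<le> C"
  "\<And>k. k \<in> ksq M N ==> (\<lambda>i. pairing M N k (f i) (g i)) sums F k"
  by (rule nuclear_representation[OF M N F], rule that)
 obtain f' s where f': "row_bound M f' s" "real_sq M s" "(l2norm M (\<lambda>x. complex_of_real (s x)))\<^sup>2 \<le> C"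
  "\<And>i. AE x in M. f' i x = f i x" by (rule rows_square_integrable[OF fg(1,3)], rule that)
 obtain g' t where g': "row_bound N g' t" "real_sq N t" "(l2norm N (\<lambda>x. complex_of_real (t x)))\<^sup>2 \<le> C"
  "\<And>i. AE x in N. g' i x = g i x" by (rule rows_square_integrable[OF fg(2,4)], rule that)
 have pq: "(\<lambda>x. complex_of_real (s x) * 1) \<in> sq M" "(\<lambda>y. complex_of_real (t y) * 1) \<in> sq N" using f'(2) g'(2) by simp_all
 have p: "(\<lambda>i. pairing M N k (f' i) (g' i)) sums (LINT z|(M \<Otimes>\<^sub>M N). k z * dot f' g' z)"
  "f' i \<in> sq M" "g' i \<in> sq N" "dot f' g' \<in> ksq M N" if "k \<in> ksq M N" for k i
  using sum_pairings_dot[OF N that f'(1) g'(1) borel_measurable_const borel_measurable_const pq] by simp_all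
 show thesis
 proof (rule that[OF f'(1) g'(1) f'(2,3) g'(2,3)])
  show "dot f' g' \<in> ksq M N" by (rule p(4)[OF sq_zero])
  fix k assume k: "k \<in> ksq M N"
  have "pairing M N k (f' i) (g' i) = pairing M N k (f i) (g i)" for i
  proof -
   have fs: "f' i \<in> sq M" and gs: "g' i \<in> sq N" by (rule p(2,3)[OF k])+
   have "l2norm M (\<lambda>x. f' i x - f i x) = 0" "l2norm N (\<lambda>x. g' i x - g i x) = 0"
    using f'(4)[of i] g'(4)[of i] by (simp_all add: l2norm_zero_iff fs gs fg)
   then have "pairing M N k (\<lambda>x. f' i x - f i x) (g' i) = 0" "pairing M N k (f i) (\<lambda>y. g' i y - g i y) = 0"
    using pairing_le[OF N k sq_diff[OF fs fg(1)[of i]] gs] pairing_le[OF N k fg(1)[of i] sq_diff[OF gs fg(2)[of i]]] by simp_all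
   then show ?thesis using pairing_left_diff[OF N k fs fg(1)[of i] gs] pairing_right_diff[OF N k fg(1)[of i] gs fg(2)[of i]] by simp
  qed
  then show "F k = (LINT z|(M \<Otimes>\<^sub>M N). k z * dot f' g' z)" using p(1)[OF k] fg(5)[OF k] sums_unique2 by simp
 qed
qed

text \<open>The complement of the rectangle is split as \<open>(- A) \<times> N\<close> and \<open>A \<times> (- B)\<close>, so that each part is again a product of indicators.\<close>

lemma functional_rectangle_defect:
 assumes N: "sigma_finite_measure N" and f: "row_bound M f s" and g: "row_bound N g t"
  and s: "real_sq M s" and t: "real_sq N t"
  and A: "A \<in> sets M" and B: "B \<in> sets N" and k: "k \<in> ksq M N" "kernel_bound M N k c"
 shows "cmod ((LINT z|(M \<Otimes>\<^sub>M N). k z * dot f g z) - (LINT z|(M \<Otimes>\<^sub>M N). (indicator (A \<times> B) z * k z) * dot f g z))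
  \<le> c * (l2norm M (\<lambda>x. of_real (s x) * indicator (- A) x) * l2norm N (\<lambda>y. complex_of_real (t y))
    + l2norm M (\<lambda>x. complex_of_real (s x)) * l2norm N (\<lambda>y. of_real (t y) * indicator (- B) y))"
proof -
 have ind: "(indicator A :: _ => complex) \<in> borel_measurable M" "(indicator (- A) :: _ => complex) \<in> borel_measurable M"
  "(indicator (- B) :: _ => complex) \<in> borel_measurable N"
  using A B by (auto simp: borel_measurable_indicator_iff Diff_eq[symmetric] Int_commute[of "- _"])
 have sA: "(\<lambda>x. of_real (s x) * indicator X x) \<in> sq M" "l2norm M (\<lambda>x. of_real (s x) * indicator X x) \<le> 1 * l2norm M (\<lambda>x. complex_of_real (s x))"
  if "(indicator X :: _ => complex) \<in> borel_measurable M" for X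
  by (rule sq_dominated[OF s, of _ 1], rule borel_measurable_times[OF sqD(1)[OF s] that], simp add: indicator_def)+ simp
 have tB: "(\<lambda>y. of_real (t y) * indicator (- B) y) \<in> sq N"
  by (rule sq_dominated(1)[OF t, of _ 1], rule borel_measurable_times[OF sqD(1)[OF t] ind(3)], simp add: indicator_def)
 have t1: "(\<lambda>y. of_real (t y) * (1::complex)) \<in> sq N" using t by simp
 note P1 = sum_pairings_dot(4)[OF N k(1) f g ind(2) borel_measurable_const sA(1)[OF ind(2)] t1]
 note P2 = sum_pairings_dot(4)[OF N k(1) f g ind(1,3) sA(1)[OF ind(1)] tB]
 have s1: "(\<lambda>y. of_real (s y) * (1::complex)) \<in> sq M" using s by simp
 have "dot f g \<in> ksq M N"
  using sum_pairings_dot(4)[OF N k(1) f g borel_measurable_const borel_measurable_const s1 t1] by simp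
 note i = sq_cauchy_schwarz(1)[OF k(1) this] and i' = sq_cauchy_schwarz(1)[OF sq_restrict(1)[OF k(1) pair_measureI[OF A B]] this]
 have "(\<lambda>z. k z * dot f g z - (indicator (A \<times> B) z * k z) * dot f g z)
   = (\<lambda>z. k z * (dot f g z * (indicator (- A) (fst z) * 1)) + k z * (dot f g z * (indicator A (fst z) * indicator (- B) (snd z))))"
  by (rule ext) (auto simp: indicator_def mem_Times_iff)
 then have eq: "(LINT z|(M \<Otimes>\<^sub>M N). k z * dot f g z) - (LINT z|(M \<Otimes>\<^sub>M N). (indicator (A \<times> B) z * k z) * dot f g z)
   = (LINT z|(M \<Otimes>\<^sub>M N). k z * (dot f g z * (indicator (- A) (fst z) * 1))) + (LINT z|(M \<Otimes>\<^sub>M N). k z * (dot f g z * (indicator A (fst z) * indicator (- B) (snd z))))"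
  using Bochner_Integration.integral_diff[OF i i'] Bochner_Integration.integral_add[OF sq_cauchy_schwarz(1)[OF k(1) P1] sq_cauchy_schwarz(1)[OF k(1) P2]] by simp
 have c0: "c \<ge> 0" by (rule kernel_boundD(1)[OF N k(2)])
 note b1 = dot_pairing_bound[OF N f g ind(2) borel_measurable_const sA(1)[OF ind(2)] t1 k]
 have b2: "cmod (LINT z|(M \<Otimes>\<^sub>M N). k z * (dot f g z * (indicator A (fst z) * indicator (- B) (snd z))))
   \<le> c * (l2norm M (\<lambda>x. complex_of_real (s x)) * l2norm N (\<lambda>y. of_real (t y) * indicator (- B) y))"
  by (rule order_trans[OF dot_pairing_bound[OF N f g ind(1,3) sA(1)[OF ind(1)] tB k]])
   (intro mult_left_mono mult_right_mono c0, use sA(2)[OF ind(1)] in simp_all)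
 show ?thesis unfolding eq by (rule order_trans[OF norm_triangle_ineq]) (use b1 b2 in \<open>simp add: distrib_left\<close>)
qed

section \<open>Closable multipliers are quotients of Schur kernels on an exhaustion\<close>

definition exhausts :: "'a measure => (nat => 'a set) => bool" where
 "exhausts M A \<longleftrightarrow> (\<forall>n. A n \<in> sets M) \<and> incseq A \<and> (AE x in M. \<exists>n. x \<in> A n)"

text \<open>The bound \<open>1/2\<close> for both families gives \<open>\<bar>dot f g\<bar> \<le> 1/4\<close>, which keeps \<open>1 - dot f g\<close> invertible.\<close>

definition factored_on :: "'a measure => 'b measure => ('a \<times> 'b => complex) => 'a set => 'b set => bool" where
 "factored_on M N \<phi> A B \<longleftrightarrow> A \<in> sets M \<and> B \<in> sets N \<and> (\<exists>f g a b R S. row_bound M f (\<lambda>_. 1/2) \<and> row_bound N g (\<lambda>_. 1/2)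
   \<and> R \<ge> 0 \<and> S \<ge> 0 \<and> row_bound M a (\<lambda>_. R) \<and> row_bound N b (\<lambda>_. S)
   \<and> (AE z in M \<Otimes>\<^sub>M N. z \<in> A \<times> B \<longrightarrow> \<phi> z * (1 - dot f g z) = dot a b z))"

lemma exhaustsD:
 assumes "exhausts M A"
 shows "A n \<in> sets M" "m \<le> n ==> A m \<subseteq> A n" "AE x in M. \<exists>n. x \<in> A n"
 using assms unfolding exhausts_def incseq_def by auto

lemma real_sq_measurable:
 assumes "real_sq M s"
 shows "s \<in> borel_measurable M"
proof -
 note [measurable] = sqD(1)[OF assms]
 have "(\<lambda>x. Re (complex_of_real (s x))) \<in> borel_measurable M" by measurable
 then show ?thesis by simp
qed

lemma l2_summable_tendsto_zero:
 assumes h: "\<And>n. real_sq M (h n)"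
  and C: "\<And>n. (l2norm M (\<lambda>x. complex_of_real (h n x)))\<^sup>2 \<le> C * (1/2) ^ n"
 shows "AE x in M. (\<lambda>n. h n x) \<longlonglongrightarrow> 0"
proof -
 have C0: "C \<ge> 0" using order_trans[OF zero_le_power2 C[of 0]] by simp
 have b: "(\<Sum>i<n. (l2norm M (\<lambda>x. complex_of_real (h i x)))\<^sup>2) \<le> C * 2" for n
 proof -
  have "(\<Sum>i<n. (l2norm M (\<lambda>x. complex_of_real (h i x)))\<^sup>2) \<le> (\<Sum>i<n. C * (1/2) ^ i)" by (rule sum_mono) (rule C)
  also have "\<dots> \<le> C * 2" unfolding sum_distrib_left[symmetric] sum_gp_strict using C0 by (intro mult_left_mono) auto
  finally show ?thesis .
 qed
 obtain f s where f: "row_bound M f s" "\<And>i. AE x in M. f i x = complex_of_real (h i x)"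
  by (rule rows_square_integrable[OF h b], rule that)
 have "AE x in M. \<forall>i. f i x = complex_of_real (h i x)" using f(2) by (simp add: AE_all_countable)
 with AE_space show ?thesis
 proof eventually_elim
  case (elim x)
  have "summable (\<lambda>i. (cmod (f i x))\<^sup>2)"
   by (rule bounded_imp_summable[of _ "(s x)\<^sup>2"]) (simp, simp only: lessThan_Suc_atMost[symmetric] row_boundD(3)[OF f(1) elim(1)])
  then have "(\<lambda>i. (h i x)\<^sup>2) \<longlonglongrightarrow> 0" using elim(2) by (auto dest: summable_LIMSEQ_zero)
  then have "(\<lambda>i. sqrt ((h i x)\<^sup>2)) \<longlonglongrightarrow> sqrt 0" by (rule tendsto_real_sqrt)
  then show ?case by (simp add: tendsto_rabs_zero_iff)
 qed
qed

text \<open>As the squared norms are summable, \<open>s\<^sub>n\<close> tends to zero almost everywhere, so it drops below \<open>w / 2\<close> eventually. After division by \<open>R\<^sub>n\<close> the same applies to \<open>u\<^sub>n\<close>, whose norms may grow arbitrarily.\<close>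

lemma exhaustion_by_bounds:
 assumes w: "w \<in> borel_measurable M" "\<And>x. w x > 0"
  and s: "\<And>n. real_sq M (s n)" "\<And>n. (l2norm M (\<lambda>x. complex_of_real (s n x)))\<^sup>2 \<le> 2 * (1/2) ^ n"
  and u: "\<And>n. real_sq M (u n)"
 obtains A R where "exhausts M A" "\<And>n. R n \<ge> 0"
  "\<And>n x. x \<in> A n ==> s n x \<le> 1/2 * w x" "\<And>n x. x \<in> A n ==> u n x \<le> R n * w x"
proof -
 note [measurable] = w(1) real_sq_measurable[OF s(1)] real_sq_measurable[OF u]
 (* the factor 1 + norm normalises u n, and 2 ^ n makes the squared norms summable *)
 define R where "R n = 2 ^ n * (1 + l2norm M (\<lambda>x. complex_of_real (u n x)))" for n
 have R: "R n > 0" for n by (simp add: R_def add_pos_nonneg)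
 have uR: "(\<lambda>x. complex_of_real (u n x / R n)) = (\<lambda>x. of_real (1 / R n) * complex_of_real (u n x))" for n by (rule ext) simp
 define A where "A n = {x \<in> space M. \<forall>m\<in>{n..}. s m x \<le> 1/2 * w x \<and> u m x \<le> R m * w x}" for n
 have "AE x in M. (\<lambda>n. u n x / R n) \<longlonglongrightarrow> 0"
 proof (rule l2_summable_tendsto_zero[where C=1])
  show "(\<lambda>x. complex_of_real (u n x / R n)) \<in> sq M" for n unfolding uR by (rule sq_scale[OF u])
  fix n
  define c where "c = l2norm M (\<lambda>x. complex_of_real (u n x))"
  have "c \<ge> 0" by (simp add: c_def)
  have "l2norm M (\<lambda>x. complex_of_real (u n x / R n)) = c / R n"
   unfolding uR l2norm_scale norm_of_real using R[of n] by (simp add: c_def)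
  also have "\<dots> = (1/2)^n * (c / (1 + c))" by (simp add: R_def c_def power_divide)
  also have "\<dots> \<le> (1/2)^n * 1" using \<open>c \<ge> 0\<close> by (intro mult_left_mono) auto
  finally have "(l2norm M (\<lambda>x. complex_of_real (u n x / R n)))\<^sup>2 \<le> ((1/2)^n)\<^sup>2" by (intro power_mono) simp_all
  also have "\<dots> \<le> 1 * (1/2)^n" unfolding power2_eq_square by (intro mult_right_mono) (auto simp: power_le_one)
  finally show "(l2norm M (\<lambda>x. complex_of_real (u n x / R n)))\<^sup>2 \<le> 1 * (1/2)^n" .
 qed
 moreover have "AE x in M. (\<lambda>n. s n x) \<longlonglongrightarrow> 0" by (rule l2_summable_tendsto_zero[OF s])
 ultimately have "AE x in M. \<exists>n. x \<in> A n"
  using AE_space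
 proof eventually_elim
  case (elim x)
  have "\<forall>\<^sub>F n in sequentially. s n x \<le> 1/2 * w x" using order_tendstoD(2)[OF elim(2), of "1/2 * w x"] w(2)[of x]
   by (auto elim!: eventually_mono)
  moreover have "\<forall>\<^sub>F n in sequentially. u n x / R n < w x" using order_tendstoD(2)[OF elim(1) w(2)] .
  then have "\<forall>\<^sub>F n in sequentially. u n x \<le> R n * w x"
   by eventually_elim (use R in \<open>simp add: pos_divide_less_eq mult.commute less_imp_le\<close>)
  ultimately have "\<forall>\<^sub>F n in sequentially. s n x \<le> 1/2 * w x \<and> u n x \<le> R n * w x" by (rule eventually_conj)
  then show ?case using elim(3) unfolding eventually_sequentially A_def by auto
 qed
 moreover have "A n \<in> sets M" for n unfolding A_def by measurable
 moreover have "incseq A" unfolding incseq_def A_def by fastforce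
 ultimately have "exhausts M A" unfolding exhausts_def by blast
 then show thesis by (rule that[of A R]) (use R in \<open>auto simp: A_def less_imp_le\<close>)
qed

lemma row_bound_quotient:
 assumes f: "row_bound M f s" and A: "A \<in> sets M" and w: "w \<in> borel_measurable M" "\<And>x. w x > 0" and R: "R \<ge> 0"
  and le: "\<And>x. x \<in> A ==> s x \<le> R * w x"
 shows "row_bound M (\<lambda>i x. indicator A x * f i x / complex_of_real (w x)) (\<lambda>_. R)"
 unfolding row_bound_def
proof (intro conjI allI ballI R)
 note [measurable] = row_boundD(1)[OF f] A w(1)
 show "(\<lambda>x. indicator A x * f i x / complex_of_real (w x)) \<in> borel_measurable M" for i by measurable
 fix x n assume x: "x \<in> space M"
 show "(\<Sum>i<n. (cmod (indicator A x * f i x / complex_of_real (w x)))\<^sup>2) \<le> R\<^sup>2"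
 proof (cases "x \<in> A")
  case True
  have "(\<Sum>i<n. (cmod (indicator A x * f i x / complex_of_real (w x)))\<^sup>2) = (\<Sum>i<n. (cmod (f i x))\<^sup>2) / (w x)\<^sup>2"
   using True by (simp add: norm_divide power_divide sum_divide_distrib)
  also have "\<dots> \<le> (R * w x)\<^sup>2 / (w x)\<^sup>2"
   using row_boundD(3)[OF f x, of n] power_mono[OF le[OF True] row_boundD(2)[OF f x], of 2]
   by (intro divide_right_mono) auto
  also have "\<dots> = R\<^sup>2" using w(2)[of x] by (simp add: power_mult_distrib)
  finally show ?thesis .
 qed simp
qed

text \<open>A name for the eight unknowns of the approximation, so that they can be chosen simultaneously for all \<open>n\<close>.\<close>

definition approximate_factoring where
 "approximate_factoring M N \<phi> p q e f g a b s t u v \<longleftrightarrow>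
   row_bound M f s \<and> row_bound N g t \<and> row_bound M a u \<and> row_bound N b v
   \<and> real_sq M s \<and> (l2norm M (\<lambda>x. complex_of_real (s x)))\<^sup>2 \<le> e
   \<and> real_sq N t \<and> (l2norm N (\<lambda>x. complex_of_real (t x)))\<^sup>2 \<le> e
   \<and> real_sq M u \<and> real_sq N v
   \<and> (AE z in M \<Otimes>\<^sub>M N. \<phi> z * (p (fst z) * q (snd z) - dot f g z) = dot a b z)"

context
 fixes M :: "'a measure" and N :: "'b measure"
 assumes M: "sigma_finite_measure M" and N: "sigma_finite_measure N"
begin

text \<open>The functional of \<open>p \<otimes> q\<close> is approximated by one with an adjoint image. Comparing the trace class kernels of the difference and of the adjoint image on all \<open>k\<close> with \<open>k\<close>, \<open>\<phi> k\<close> square integrable gives the identity.\<close>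

lemma approximate_factorization:
 assumes \<phi>: "\<phi> \<in> wstar_closable_multipliers M N" and p: "p \<in> sq M" and q: "q \<in> sq N" and e: "e > 0"
 shows "\<exists>f g a b s t u v. approximate_factoring M N \<phi> p q e f g a b s t u v"
proof -
 note K = seminormed_compact_ops[OF M N] and dkf = dual_kernel_functional[OF M N]
 have \<phi>m [measurable]: "\<phi> \<in> kmeasurable M N" and cl: "wstar_closable_graph (compacts M N) (mult_graph M N \<phi>)"
  using \<phi> by (auto simp: wstar_closable_multipliers_def)
 have "kernel_functional M N (\<lambda>k. pairing M N k p q) (l2norm M p * l2norm N q)"
  unfolding kernel_functional_def
  by (auto simp: pairing_add[OF N _ _ p q] pairing_scale[OF N] kernel_boundD(2)[OF N _ p q] mult.commute[of "_ * _"])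
 then obtain F1 where F1: "F1 \<in> vecs (dual (compacts M N))" "\<And>k. k \<in> ksq M N ==> F1 (int_op M N k) = pairing M N k p q"
  using kernel_functional_extension[OF M N] by metis
 obtain F H where F: "F \<in> vecs (dual (compacts M N))" "\<And>v. v \<in> vecs (compacts M N) ==> cmod (F1 v - F v) \<le> e * vnorm (compacts M N) v"
  and H: "H \<in> vecs (dual (compacts M N))" "\<And>v w. (v, w) \<in> mult_graph M N \<phi> ==> F w = H v"
 proof -
  obtain F where F: "F \<in> adjoint_domain (compacts M N) (mult_graph M N \<phi>)" "\<forall>v\<in>vecs (compacts M N). cmod (F1 v - F v) \<le> e * vnorm (compacts M N) v"
   using adjoint_dense_if_closable[OF K linear_mult_graph[OF M N] cl F1(1) e] by (elim bexE) (rule that)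
  from F(1) obtain H where H: "F \<in> vecs (dual (compacts M N))" "H \<in> vecs (dual (compacts M N))" "\<forall>(v, w)\<in>mult_graph M N \<phi>. F w = H v"
   unfolding adjoint_domain_def by (elim CollectE conjE bexE)
  show thesis by (rule that[OF H(1) _ H(2)]) (use F(2) H(3) in \<open>auto simp only: case_prod_conv dest!: bspec\<close>)
 qed
 define D where "D k = F1 (int_op M N k) - F (int_op M N k)" for k
 have D: "kernel_functional M N D e"
  unfolding kernel_functional_def
 proof (intro conjI ballI allI impI)
  fix k assume k: "k \<in> ksq M N"
  show "D (\<lambda>z. k z + l z) = D k + D l" if "l \<in> ksq M N" for l
   using kernel_functionalD(2)[OF dkf[OF F1(1)] k that] kernel_functionalD(2)[OF dkf[OF F(1)] k that] by (simp add: D_def)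
  show "D (\<lambda>z. c * k z) = c * D k" for c
   using kernel_functionalD(3)[OF dkf[OF F1(1)] k] kernel_functionalD(3)[OF dkf[OF F(1)] k] by (simp add: D_def right_diff_distrib)
  fix c assume c: "kernel_bound M N k c"
  have "vnorm (compacts M N) (int_op M N k) \<le> c"
   using int_op_norm_le_iff[OF M N k kernel_boundD(1)[OF N c]] c by (simp add: compact_ops_simps)
  then show "cmod (D k) \<le> e * c" unfolding D_def
   by (rule order_trans[OF F(2)[OF int_op_mem[OF M N k]] mult_left_mono]) (use e in simp)
 qed (use e in simp)
 obtain f g s t where fg: "row_bound M f s" "row_bound N g t"
  "real_sq M s" "(l2norm M (\<lambda>x. complex_of_real (s x)))\<^sup>2 \<le> e"
  "real_sq N t" "(l2norm N (\<lambda>x. complex_of_real (t x)))\<^sup>2 \<le> e"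
  "dot f g \<in> ksq M N" "\<And>k. k \<in> ksq M N ==> D k = (LINT z|(M \<Otimes>\<^sub>M N). k z * dot f g z)"
  by (rule functional_kernel[OF M N D], rule that)
 obtain a b u v where ab: "row_bound M a u" "row_bound N b v"
  "real_sq M u" "real_sq N v"
  "dot a b \<in> ksq M N" "\<And>k. k \<in> ksq M N ==> H (int_op M N k) = (LINT z|(M \<Otimes>\<^sub>M N). k z * dot a b z)"
  by (rule functional_kernel[OF M N dkf[OF H(1)]], rule that)
 define r where "r z = p (fst z) * q (snd z) - dot f g z" for z
 have pq: "(\<lambda>z. p (fst z) * q (snd z)) \<in> ksq M N" by (rule tensor_sq(1)[OF N p q])
 have r: "r \<in> ksq M N" unfolding r_def by (rule sq_diff[OF pq fg(7)])
 note [measurable] = sqD(1)[OF r] sqD(1)[OF ab(5)]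
 define \<theta> where "\<theta> z = \<phi> z * r z - dot a b z" for z
 have [measurable]: "\<theta> \<in> kmeasurable M N" unfolding \<theta>_def[abs_def] by measurable
 have zero: "(LINT z|(M \<Otimes>\<^sub>M N). k z * \<theta> z) = 0" if k: "k \<in> ksq M N" and \<phi>k: "(\<lambda>z. \<phi> z * k z) \<in> ksq M N" for k
 proof -
  have "F (int_op M N (\<lambda>z. \<phi> z * k z)) = H (int_op M N k)"
   by (rule H(2)) (use k \<phi>k in \<open>auto simp: mult_graph_def mult_domain_def\<close>)
  then have "pairing M N (\<lambda>z. \<phi> z * k z) p q - (LINT z|(M \<Otimes>\<^sub>M N). \<phi> z * k z * dot f g z) = (LINT z|(M \<Otimes>\<^sub>M N). k z * dot a b z)"
   using F1(2)[OF \<phi>k] fg(8)[OF \<phi>k] ab(6)[OF k] by (simp add: D_def algebra_simps)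
  moreover have "(\<lambda>z. k z * \<theta> z) = (\<lambda>z. (\<phi> z * k z * (p (fst z) * q (snd z)) - \<phi> z * k z * dot f g z) - k z * dot a b z)"
   by (rule ext) (simp add: \<theta>_def r_def algebra_simps)
  ultimately show ?thesis
   using sq_cauchy_schwarz(1)[OF \<phi>k pq] sq_cauchy_schwarz(1)[OF \<phi>k fg(7)] sq_cauchy_schwarz(1)[OF k ab(5)] by (simp add: pairing_def)
 qed
 have "AE z in M \<Otimes>\<^sub>M N. cmod (\<phi> z) \<le> real m \<longrightarrow> \<theta> z = 0" for m :: nat
 proof -
  (* the test kernel is the conjugate of \<theta>, cut off where \<phi> is large so that \<phi> k is square integrable *)
  define P where "P = {z \<in> space (M \<Otimes>\<^sub>M N). cmod (\<phi> z) \<le> real m}"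
  have [measurable]: "P \<in> sets (M \<Otimes>\<^sub>M N)" unfolding P_def by measurable
  have "(\<lambda>z. indicator P z * \<phi> z * r z) \<in> ksq M N"
   by (rule sq_dominated(1)[OF r, of _ m], measurable) (auto simp: P_def norm_mult indicator_def intro!: AE_I2 mult_right_mono)
  from sq_diff[OF this sq_restrict(1)[OF ab(5), of P]]
  have \<theta>P: "(\<lambda>z. indicator P z * \<theta> z) \<in> ksq M N" by (simp add: \<theta>_def right_diff_distrib mult.assoc)
  note k = sq_cnj[OF \<theta>P]
  have "(\<lambda>z. \<phi> z * cnj (indicator P z * \<theta> z)) \<in> ksq M N"
   by (rule sq_dominated(1)[OF \<theta>P, of _ m], intro borel_measurable_times \<phi>m sqD(1)[OF k])
    (auto simp: P_def norm_mult indicator_def intro!: AE_I2 mult_right_mono)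
  from zero[OF k this] have "(LINT z|(M \<Otimes>\<^sub>M N). complex_of_real ((cmod (indicator P z * \<theta> z))\<^sup>2)) = 0"
   by (subst Bochner_Integration.integral_cong[OF refl, where g="\<lambda>z. cnj (indicator P z * \<theta> z) * \<theta> z"])
    (auto simp: indicator_def complex_norm_square mult.commute simp del: of_real_power)
  then have "l2norm (M \<Otimes>\<^sub>M N) (\<lambda>z. indicator P z * \<theta> z) = 0" by (simp only: integral_complex_of_real of_real_eq_0_iff l2norm_def real_sqrt_zero)
  then have "AE z in M \<Otimes>\<^sub>M N. indicator P z * \<theta> z = 0" by (simp only: l2norm_zero_iff[OF \<theta>P])
  with AE_space show ?thesis by eventually_elim (auto simp: P_def indicator_def)
 qed
 then have "AE z in M \<Otimes>\<^sub>M N. \<forall>m::nat. cmod (\<phi> z) \<le> real m \<longrightarrow> \<theta> z = 0" unfolding AE_all_countable by blast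
 then have "AE z in M \<Otimes>\<^sub>M N. \<phi> z * (p (fst z) * q (snd z) - dot f g z) = dot a b z"
  by eventually_elim (use real_arch_simple in \<open>fastforce simp: \<theta>_def r_def\<close>)
 then show ?thesis unfolding approximate_factoring_def using fg(1-6) ab(1-4) by (intro exI conjI)
qed

lemma square_integrable_weight:
 fixes L :: "'c measure"
 assumes "sigma_finite_measure L"
 obtains w where "w \<in> borel_measurable L" "\<And>x. w x > 0" "real_sq L w"
proof -
 obtain h :: "'c => real" where h: "h \<in> borel_measurable L" "\<And>x. 0 < h x" "integrable L h"
  by (rule sigma_finite_measure.obtain_positive_integrable_function[OF assms], rule that)
 show thesis
  by (rule that[of "\<lambda>x. sqrt (h x)"]) (use h in \<open>auto intro!: sqI simp: less_imp_le\<close>)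
qed

theorem closable_factored_on_exhaustion:
 assumes \<phi>: "\<phi> \<in> wstar_closable_multipliers M N"
 obtains A B where "exhausts M A" "exhausts N B" "\<And>n. factored_on M N \<phi> (A n) (B n)"
proof -
 obtain w where w: "w \<in> borel_measurable M" "\<And>x. w x > 0" "real_sq M w"
  by (rule square_integrable_weight[OF M], rule that)
 obtain w' where w': "w' \<in> borel_measurable N" "\<And>x. w' x > 0" "real_sq N w'"
  by (rule square_integrable_weight[OF N], rule that)
 have e: "(0::real) < 2 * (1/2) ^ n" for n by simp
 obtain f g a b s t u v where "\<And>n. approximate_factoring M N \<phi> (\<lambda>x. of_real (w x)) (\<lambda>y. of_real (w' y)) (2 * (1/2) ^ n)
   (f n) (g n) (a n) (b n) (s n) (t n) (u n) (v n)"
  using approximate_factorization[OF \<phi> w(3) w'(3) e] by metis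
 then have fs: "\<And>n. row_bound M (f n) (s n)" and gt: "\<And>n. row_bound N (g n) (t n)"
  and au: "\<And>n. row_bound M (a n) (u n)" and bv: "\<And>n. row_bound N (b n) (v n)"
  and ss: "\<And>n. real_sq M (s n)" "\<And>n. (l2norm M (\<lambda>x. complex_of_real (s n x)))\<^sup>2 \<le> 2 * (1/2) ^ n"
  and ts: "\<And>n. real_sq N (t n)" "\<And>n. (l2norm N (\<lambda>x. complex_of_real (t n x)))\<^sup>2 \<le> 2 * (1/2) ^ n"
  and us: "\<And>n. real_sq M (u n)" and vs: "\<And>n. real_sq N (v n)"
  and eq: "\<And>n. AE z in M \<Otimes>\<^sub>M N. \<phi> z * (of_real (w (fst z)) * of_real (w' (snd z)) - dot (f n) (g n) z) = dot (a n) (b n) z"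
  unfolding approximate_factoring_def by simp_all
 obtain A R where A: "exhausts M A" "\<And>n. R n \<ge> 0"
  "\<And>n x. x \<in> A n ==> s n x \<le> 1/2 * w x" "\<And>n x. x \<in> A n ==> u n x \<le> R n * w x"
  by (rule exhaustion_by_bounds[OF w(1,2) ss us], rule that)
 obtain B S where B: "exhausts N B" "\<And>n. S n \<ge> 0"
  "\<And>n x. x \<in> B n ==> t n x \<le> 1/2 * w' x" "\<And>n x. x \<in> B n ==> v n x \<le> S n * w' x"
  by (rule exhaustion_by_bounds[OF w'(1,2) ts vs], rule that)
 have half: "(0::real) \<le> 1/2" by simp
 show thesis
 proof (rule that[OF A(1) B(1)])
  fix n
  define d where "d c i x = indicator (A n) x * c n i x / complex_of_real (w x)" for c :: "nat => nat => 'a => complex" and i x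
  define d' where "d' c i y = indicator (B n) y * c n i y / complex_of_real (w' y)" for c :: "nat => nat => 'b => complex" and i y
  note An = exhaustsD(1)[OF A(1)] and Bn = exhaustsD(1)[OF B(1)]
  have df: "row_bound M (d f) (\<lambda>_. 1/2)" unfolding d_def[abs_def] by (rule row_bound_quotient[OF fs An w(1,2) half A(3)])
  have dg: "row_bound N (d' g) (\<lambda>_. 1/2)" unfolding d'_def[abs_def] by (rule row_bound_quotient[OF gt Bn w'(1,2) half B(3)])
  have da: "row_bound M (d a) (\<lambda>_. R n)" unfolding d_def[abs_def] by (rule row_bound_quotient[OF au An w(1,2) A(2) A(4)])
  have db: "row_bound N (d' b) (\<lambda>_. S n)" unfolding d'_def[abs_def] by (rule row_bound_quotient[OF bv Bn w'(1,2) B(2) B(4)])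
  have q: "dot (d h) (d' k) z = dot (h n) (k n) z / (of_real (w (fst z)) * of_real (w' (snd z)))"
   if "row_bound M (h n) s'" "row_bound N (k n) t'" "z \<in> space (M \<Otimes>\<^sub>M N)" "z \<in> A n \<times> B n" for h k s' t' z
   using sums_unique[OF sums_divide[OF dot_bounds(2)[OF that(1-3)], of "of_real (w (fst z)) * of_real (w' (snd z))"]] that(4)
   by (auto simp: dot_def d_def d'_def)
  have "AE z in M \<Otimes>\<^sub>M N. z \<in> A n \<times> B n \<longrightarrow> \<phi> z * (1 - dot (d f) (d' g) z) = dot (d a) (d' b) z"
   using eq[of n] AE_space
  proof eventually_elim
   case (elim z)
   define W where "W = complex_of_real (w (fst z)) * of_real (w' (snd z))"
   have W: "W \<noteq> 0" using w(2)[of "fst z"] w'(2)[of "snd z"] by (simp add: W_def)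
   show ?case
   proof
    assume z: "z \<in> A n \<times> B n"
    have "\<phi> z * (W - dot (f n) (g n) z) / W = dot (a n) (b n) z / W" using elim(1) by (simp add: W_def)
    then show "\<phi> z * (1 - dot (d f) (d' g) z) = dot (d a) (d' b) z"
     unfolding q[OF fs gt elim(2) z] q[OF au bv elim(2) z] W_def[symmetric] using W by (simp add: field_simps)
   qed
  qed
  then show "factored_on M N \<phi> (A n) (B n)" unfolding factored_on_def using An Bn df dg da db A(2) B(2) by blast
 qed
qed

end

section \<open>Exhaustions by Schur multipliers characterise closability\<close>

text \<open>Multiplication by \<open>\<phi>\<close> restricted to \<open>E\<close>. With \<open>\<phi> = 1\<close> it is the restriction of the kernel.\<close>

definition cutoff :: "('a \<times> 'b) set => ('a \<times> 'b => complex) => ('a \<times> 'b => complex) => 'a \<times> 'b => complex" where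
 "cutoff E \<phi> k z = \<phi> z * (indicator E z * k z)"

text \<open>For local Schur multipliers \<open>E\<close> is a finite union of rectangles, which is why it is a general measurable set.\<close>

definition schur_on :: "'a measure => 'b measure => ('a \<times> 'b => complex) => ('a \<times> 'b) set => bool" where
 "schur_on M N \<phi> E \<longleftrightarrow> E \<in> sets (M \<Otimes>\<^sub>M N)
   \<and> (\<exists>R. AE z in M \<Otimes>\<^sub>M N. z \<in> E \<longrightarrow> cmod (\<phi> z) \<le> R)
   \<and> (\<exists>c\<ge>0. \<forall>k\<in>ksq M N. \<forall>d. kernel_bound M N k d \<longrightarrow> kernel_bound M N (cutoff E \<phi> k) (c * d))"

lemma AE_fst_snd:
 assumes "sigma_finite_measure N"
 shows "AE x in M. P x ==> AE z in M \<Otimes>\<^sub>M N. P (fst z)" "AE y in N. Q y ==> AE z in M \<Otimes>\<^sub>M N. Q (snd z)"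
proof -
 interpret N: sigma_finite_measure N by (rule assms)
 { assume "AE x in M. P x"
  then obtain Z where "Z \<in> null_sets M" "{x \<in> space M. \<not> P x} \<subseteq> Z" unfolding eventually_ae_filter by blast
  then show "AE z in M \<Otimes>\<^sub>M N. P (fst z)"
   by (intro AE_I'[OF N.times_in_null_sets1[of Z _ "space N"]]) (auto simp: space_pair_measure) }
 { assume "AE y in N. Q y"
  then obtain Z where "Z \<in> null_sets N" "{y \<in> space N. \<not> Q y} \<subseteq> Z" unfolding eventually_ae_filter by blast
  then show "AE z in M \<Otimes>\<^sub>M N. Q (snd z)"
   by (intro AE_I'[OF N.times_in_null_sets2[of "space M" _ Z]]) (auto simp: space_pair_measure) }
qed

lemma cutoff_sq:
 assumes "E \<in> sets (M \<Otimes>\<^sub>M N)" and \<phi>: "\<phi> \<in> kmeasurable M N"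
  and R: "AE z in M \<Otimes>\<^sub>M N. z \<in> E \<longrightarrow> cmod (\<phi> z) \<le> R" and k: "k \<in> ksq M N"
 shows "cutoff E \<phi> k \<in> ksq M N"
proof (rule sq_dominated(1)[OF k, of _ "max R 0"])
 note [measurable] = assms(1,2) sqD(1)[OF k]
 show "cutoff E \<phi> k \<in> kmeasurable M N" unfolding cutoff_def[abs_def] by measurable
 show "AE z in M \<Otimes>\<^sub>M N. cmod (cutoff E \<phi> k z) \<le> max R 0 * cmod (k z)"
  using R by eventually_elim (auto simp: cutoff_def norm_mult indicator_def intro!: mult_right_mono)
qed

lemma schur_onD:
 assumes S: "schur_on M N \<phi> E" and \<phi>: "\<phi> \<in> kmeasurable M N"
 obtains R c where "E \<in> sets (M \<Otimes>\<^sub>M N)" "AE z in M \<Otimes>\<^sub>M N. z \<in> E \<longrightarrow> cmod (\<phi> z) \<le> R" "c \<ge> 0"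
  "\<And>k. k \<in> ksq M N ==> cutoff E \<phi> k \<in> ksq M N"
  "\<And>k d. k \<in> ksq M N ==> kernel_bound M N k d ==> kernel_bound M N (cutoff E \<phi> k) (c * d)"
proof -
 obtain R c where *: "E \<in> sets (M \<Otimes>\<^sub>M N)" "AE z in M \<Otimes>\<^sub>M N. z \<in> E \<longrightarrow> cmod (\<phi> z) \<le> R" "c \<ge> 0"
  "\<forall>k\<in>ksq M N. \<forall>d. kernel_bound M N k d \<longrightarrow> kernel_bound M N (cutoff E \<phi> k) (c * d)"
  using S unfolding schur_on_def by (elim conjE exE)
 show thesis
  by (rule that[OF *(1-3) cutoff_sq[OF *(1) \<phi> *(2)] *(4)[THEN bspec, THEN spec, THEN mp]])
qed

lemma kernel_bound_cong_AE:
 assumes N: "sigma_finite_measure N" and eq: "AE z in M \<Otimes>\<^sub>M N. k z = l z" and k: "k \<in> kmeasurable M N" and l: "l \<in> kmeasurable M N"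
  and b: "kernel_bound M N k c"
 shows "kernel_bound M N l c"
proof (rule kernel_boundI[OF N kernel_boundD(1)[OF N b]])
 fix f g assume f: "f \<in> sq M" and g: "g \<in> sq N"
 note [measurable] = k l sqD(1)[OF f] sqD(1)[OF g]
 have "pairing M N k f g = pairing M N l f g" unfolding pairing_def
  by (rule integral_cong_AE) (measurable, use eq in \<open>auto elim: eventually_mono\<close>)
 then show "cmod (pairing M N l f g) \<le> c * (l2norm M f * l2norm N g)" using kernel_boundD(2)[OF N b f g] by simp
qed

context
 fixes M :: "'a measure" and N :: "'b measure"
 assumes M: "sigma_finite_measure M" and N: "sigma_finite_measure N"
begin

lemma cutoff_compression:
 assumes A: "A \<in> sets M" and B: "B \<in> sets N" and k: "k \<in> ksq M N"
 shows "cutoff (A \<times> B) (\<lambda>_. 1) k \<in> ksq M N"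
  "kernel_bound M N k c ==> kernel_bound M N (cutoff (A \<times> B) (\<lambda>_. 1) k) c"
proof -
 show "cutoff (A \<times> B) (\<lambda>_. 1) k \<in> ksq M N" by (rule cutoff_sq[OF pair_measureI[OF A B] _ _ k, of _ 1]) auto
 assume c: "kernel_bound M N k c"
 show "kernel_bound M N (cutoff (A \<times> B) (\<lambda>_. 1) k) c"
 proof (rule kernel_boundI[OF N kernel_boundD(1)[OF N c]])
  fix f g assume f: "f \<in> sq M" and g: "g \<in> sq N"
  note fA = sq_restrict[OF f A] and gB = sq_restrict[OF g B]
  have "pairing M N (cutoff (A \<times> B) (\<lambda>_. 1) k) f g = pairing M N k (\<lambda>x. indicator A x * f x) (\<lambda>y. indicator B y * g y)"
   unfolding pairing_def by (intro Bochner_Integration.integral_cong refl) (auto simp: cutoff_def indicator_def)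
  also have "cmod \<dots> \<le> c * (l2norm M (\<lambda>x. indicator A x * f x) * l2norm N (\<lambda>y. indicator B y * g y))"
   by (rule kernel_boundD(2)[OF N c fA(1) gB(1)])
  also have "\<dots> \<le> c * (l2norm M f * l2norm N g)" by (intro mult_left_mono mult_mono fA gB kernel_boundD(1)[OF N c]) auto
  finally show "cmod (pairing M N (cutoff (A \<times> B) (\<lambda>_. 1) k) f g) \<le> c * (l2norm M f * l2norm N g)" .
 qed
qed

lemma schur_on_subset:
 assumes S: "schur_on M N \<phi> E" and \<phi>: "\<phi> \<in> kmeasurable M N"
  and A': "A' \<in> sets M" "B' \<in> sets N" "A' \<times> B' \<subseteq> E"
 shows "schur_on M N \<phi> (A' \<times> B')"
proof -
 obtain R c where R: "E \<in> sets (M \<Otimes>\<^sub>M N)" "AE z in M \<Otimes>\<^sub>M N. z \<in> E \<longrightarrow> cmod (\<phi> z) \<le> R" and c: "c \<ge> 0"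
  "\<And>k. k \<in> ksq M N ==> cutoff E \<phi> k \<in> ksq M N"
  "\<And>k d. k \<in> ksq M N ==> kernel_bound M N k d ==> kernel_bound M N (cutoff E \<phi> k) (c * d)"
  by (rule schur_onD[OF S \<phi>], rule that)
 have "cutoff (A' \<times> B') \<phi> k = cutoff E \<phi> (cutoff (A' \<times> B') (\<lambda>_. 1) k)" for k
  by (rule ext) (use A'(3) in \<open>auto simp: cutoff_def indicator_def\<close>)
 then have "kernel_bound M N (cutoff (A' \<times> B') \<phi> k) (c * d)" if "k \<in> ksq M N" "kernel_bound M N k d" for k d
  using c(3)[OF cutoff_compression[OF A'(1,2)]] that by simp
 moreover have "AE z in M \<Otimes>\<^sub>M N. z \<in> A' \<times> B' \<longrightarrow> cmod (\<phi> z) \<le> R"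
  using R(2) by eventually_elim (use A'(3) in auto)
 ultimately show ?thesis unfolding schur_on_def using pair_measureI[OF A'(1,2)] c(1) by blast
qed

lemma schur_on_add:
 assumes S: "schur_on M N \<phi> E" and T: "schur_on M N \<psi> E"
  and m: "\<phi> \<in> kmeasurable M N" "\<psi> \<in> kmeasurable M N"
 shows "schur_on M N (\<lambda>z. \<phi> z + \<psi> z) E"
proof -
 obtain R c where R: "E \<in> sets (M \<Otimes>\<^sub>M N)" "AE z in M \<Otimes>\<^sub>M N. z \<in> E \<longrightarrow> cmod (\<phi> z) \<le> R" and c: "c \<ge> 0"
  "\<And>k. k \<in> ksq M N ==> cutoff E \<phi> k \<in> ksq M N"
  "\<And>k d. k \<in> ksq M N ==> kernel_bound M N k d ==> kernel_bound M N (cutoff E \<phi> k) (c * d)"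
  by (rule schur_onD[OF S m(1)], rule that)
 obtain R' c' where R': "E \<in> sets (M \<Otimes>\<^sub>M N)" "AE z in M \<Otimes>\<^sub>M N. z \<in> E \<longrightarrow> cmod (\<psi> z) \<le> R'" and c': "c' \<ge> 0"
  "\<And>k. k \<in> ksq M N ==> cutoff E \<psi> k \<in> ksq M N"
  "\<And>k d. k \<in> ksq M N ==> kernel_bound M N k d ==> kernel_bound M N (cutoff E \<psi> k) (c' * d)"
  by (rule schur_onD[OF T m(2)], rule that)
 have "AE z in M \<Otimes>\<^sub>M N. z \<in> E \<longrightarrow> cmod (\<phi> z + \<psi> z) \<le> R + R'"
  using R(2) R'(2) by eventually_elim (blast intro: norm_triangle_mono)
 moreover have "kernel_bound M N (cutoff E (\<lambda>z. \<phi> z + \<psi> z) k) ((c + c') * d)"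
  if k: "k \<in> ksq M N" "kernel_bound M N k d" for k d
 proof -
  have "cutoff E (\<lambda>z. \<phi> z + \<psi> z) k = (\<lambda>z. cutoff E \<phi> k z - (- 1) * cutoff E \<psi> k z)"
   by (rule ext) (simp add: cutoff_def distrib_right)
  then show ?thesis
   using kernel_bound_minus[OF N c(2)[OF k(1)] sq_scale[OF c'(2)[OF k(1)]] c(3)[OF k] kernel_bound_scale[OF N c'(3)[OF k], of "-1"]]
   by (simp add: distrib_right)
 qed
 ultimately show ?thesis unfolding schur_on_def using R(1) c(1) c'(1) by (meson add_nonneg_nonneg)
qed

lemma schur_on_mult:
 assumes S: "schur_on M N \<phi> E" and T: "schur_on M N \<psi> E"
  and m: "\<phi> \<in> kmeasurable M N" "\<psi> \<in> kmeasurable M N"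
 shows "schur_on M N (\<lambda>z. \<phi> z * \<psi> z) E"
proof -
 obtain R c where R: "E \<in> sets (M \<Otimes>\<^sub>M N)" "AE z in M \<Otimes>\<^sub>M N. z \<in> E \<longrightarrow> cmod (\<phi> z) \<le> R" and c: "c \<ge> 0"
  "\<And>k. k \<in> ksq M N ==> cutoff E \<phi> k \<in> ksq M N"
  "\<And>k d. k \<in> ksq M N ==> kernel_bound M N k d ==> kernel_bound M N (cutoff E \<phi> k) (c * d)"
  by (rule schur_onD[OF S m(1)], rule that)
 obtain R' c' where R': "E \<in> sets (M \<Otimes>\<^sub>M N)" "AE z in M \<Otimes>\<^sub>M N. z \<in> E \<longrightarrow> cmod (\<psi> z) \<le> R'" and c': "c' \<ge> 0"
  "\<And>k. k \<in> ksq M N ==> cutoff E \<psi> k \<in> ksq M N"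
  "\<And>k d. k \<in> ksq M N ==> kernel_bound M N k d ==> kernel_bound M N (cutoff E \<psi> k) (c' * d)"
  by (rule schur_onD[OF T m(2)], rule that)
 have "AE z in M \<Otimes>\<^sub>M N. z \<in> E \<longrightarrow> cmod (\<phi> z * \<psi> z) \<le> \<bar>R\<bar> * \<bar>R'\<bar>"
  using R(2) R'(2) by eventually_elim (auto simp: norm_mult intro!: mult_mono)
 moreover have "cutoff E (\<lambda>z. \<phi> z * \<psi> z) k = cutoff E \<phi> (cutoff E \<psi> k)" for k
  by (rule ext) (simp add: cutoff_def indicator_def)
 then have "kernel_bound M N (cutoff E (\<lambda>z. \<phi> z * \<psi> z) k) ((c * c') * d)"
  if "k \<in> ksq M N" "kernel_bound M N k d" for k d
  using c(3)[OF c'(2)[OF that(1)] c'(3)[OF that]] by (simp add: mult.assoc)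
 ultimately show ?thesis unfolding schur_on_def using R(1) c(1) c'(1) by (meson mult_nonneg_nonneg)
qed

lemma schur_on_const:
 assumes A: "A \<in> sets M" and B: "B \<in> sets N"
 shows "schur_on M N (\<lambda>z. u) (A \<times> B)"
proof -
 have "cutoff (A \<times> B) (\<lambda>z. u) k = (\<lambda>z. u * cutoff (A \<times> B) (\<lambda>_. 1) k z)" for k by (rule ext) (simp add: cutoff_def)
 then have "kernel_bound M N (cutoff (A \<times> B) (\<lambda>z. u) k) (cmod u * d)" if "k \<in> ksq M N" "kernel_bound M N k d" for k d
  using kernel_bound_scale[OF N cutoff_compression(2)[OF A B that]] by simp
 then show ?thesis unfolding schur_on_def using pair_measureI[OF A B] by (intro conjI exI[of _ "cmod u"]) auto
qed

text \<open>To bound \<open>\<phi> k = u k'\<close> with \<open>k' = k / (1 - v)\<close> one needs a bound for \<open>k'\<close>. Since \<open>k' = k + v k'\<close> and \<open>v\<close> multiplies norms by at most \<open>1/4\<close>, the operator norm \<open>t\<close> of \<open>k'\<close> satisfies \<open>t \<le> d + t/4\<close>.\<close>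

lemma factored_on_schur_on:
 assumes \<phi>: "\<phi> \<in> kmeasurable M N" and fac: "factored_on M N \<phi> A B"
 shows "schur_on M N \<phi> (A \<times> B)"
proof -
 obtain f g a b R S where f: "A \<in> sets M" "B \<in> sets N" "row_bound M f (\<lambda>_. 1/2)" "row_bound N g (\<lambda>_. 1/2)" "R \<ge> 0" "S \<ge> 0"
  "row_bound M a (\<lambda>_. R)" "row_bound N b (\<lambda>_. S)" "AE z in M \<Otimes>\<^sub>M N. z \<in> A \<times> B \<longrightarrow> \<phi> z * (1 - dot f g z) = dot a b z"
  using fac unfolding factored_on_def by (elim conjE exE)
 note [measurable] = f(1,2) \<phi> dot_measurable[OF f(3,4)] dot_measurable[OF f(7,8)]
 have v: "cmod (1 - dot f g z) \<ge> 1/2" if "z \<in> space (M \<Otimes>\<^sub>M N)" for z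
  using dot_bounds(3)[OF f(3,4) that] norm_triangle_ineq2[of 1 "dot f g z"] by simp
 have bd: "AE z in M \<Otimes>\<^sub>M N. z \<in> A \<times> B \<longrightarrow> cmod (\<phi> z) \<le> 2 * (R * S)"
  using f(9) AE_space
 proof eventually_elim
  case (elim z)
  show ?case
  proof
   assume "z \<in> A \<times> B"
   then have "cmod (\<phi> z) * cmod (1 - dot f g z) \<le> R * S"
    using elim dot_bounds(3)[OF f(7,8) elim(2)] by (metis norm_mult)
   moreover have "cmod (\<phi> z) * (1/2) \<le> cmod (\<phi> z) * cmod (1 - dot f g z)" by (intro mult_left_mono v elim(2)) simp
   ultimately show "cmod (\<phi> z) \<le> 2 * (R * S)" by simp
  qed
 qed
 have kb: "kernel_bound M N (cutoff (A \<times> B) \<phi> k) (2 * (R * S) * d)" if k: "k \<in> ksq M N" "kernel_bound M N k d" for k d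
 proof -
  note k1 = cutoff_compression(1)[OF f(1,2) k(1)] and k1b = cutoff_compression(2)[OF f(1,2) k]
  note [measurable] = sqD(1)[OF k1]
  define k' where "k' z = cutoff (A \<times> B) (\<lambda>_. 1) k z / (1 - dot f g z)" for z
  have [measurable]: "k' \<in> kmeasurable M N" unfolding k'_def[abs_def] by measurable
  have k': "k' \<in> ksq M N"
  proof (rule sq_dominated(1)[OF k1, of _ 2], measurable, rule AE_I2)
   fix z assume z: "z \<in> space (M \<Otimes>\<^sub>M N)"
   have "cmod (k' z) \<le> cmod (cutoff (A \<times> B) (\<lambda>_. 1) k z) / (1/2)"
    unfolding k'_def norm_divide by (intro divide_left_mono v z) (use v[OF z] in auto)
   then show "cmod (k' z) \<le> 2 * cmod (cutoff (A \<times> B) (\<lambda>_. 1) k z)" by simp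
  qed
  define t where "t = vnorm (bounded_ops (L2 M) (L2 N)) (int_op M N k')"
  have t0: "t \<ge> 0" unfolding t_def by (rule bounded_ops_norm(1)[OF seminormed_L2 seminormed_L2 int_op_bounded[OF M N k']])
  have kt: "kernel_bound M N k' t" using int_op_norm_le_iff[OF M N k' t0] by (simp add: t_def)
  have vk: "(\<lambda>z. dot f g z * k' z) \<in> ksq M N"
  proof (rule sq_dominated(1)[OF k', of _ 1], measurable, rule AE_I2)
   fix z assume z: "z \<in> space (M \<Otimes>\<^sub>M N)"
   show "cmod (dot f g z * k' z) \<le> 1 * cmod (k' z)"
    unfolding norm_mult using dot_bounds(3)[OF f(3,4) z] by (intro mult_right_mono) auto
  qed
  have "kernel_bound M N (\<lambda>z. dot f g z * k' z) (1/2 * (1/2) * t)"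
   by (rule schur_bound[OF N f(3,4) _ _ k' kt]) auto
  from kernel_bound_minus[OF N k1 sq_scale[OF vk] k1b kernel_bound_scale[OF N this, of "-1"]]
  have "kernel_bound M N (\<lambda>z. cutoff (A \<times> B) (\<lambda>_. 1) k z - - 1 * (dot f g z * k' z)) (d + t / 4)" by simp
  then have "kernel_bound M N k' (d + t / 4)"
  proof (rule kernel_bound_cong_AE[OF N, rotated 3])
   show "AE z in M \<Otimes>\<^sub>M N. cutoff (A \<times> B) (\<lambda>_. 1) k z - - 1 * (dot f g z * k' z) = k' z"
   proof (rule AE_I2)
    fix z assume "z \<in> space (M \<Otimes>\<^sub>M N)"
    then have nz: "1 - dot f g z \<noteq> 0" using v[of z] by auto
    then have "k' z * (1 - dot f g z) = cutoff (A \<times> B) (\<lambda>_. 1) k z" by (simp add: k'_def)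
    then show "cutoff (A \<times> B) (\<lambda>_. 1) k z - - 1 * (dot f g z * k' z) = k' z" by (simp add: algebra_simps)
   qed
  qed measurable
  then have "t \<le> d + t / 4"
   using int_op_norm_le_iff[OF M N k' kernel_boundD(1)[OF N \<open>kernel_bound M N k' (d + t / 4)\<close>]] by (simp add: t_def)
  then have "kernel_bound M N k' (2 * d)" using kernel_boundD(1)[OF N k(2)] by (intro kernel_bound_mono[OF N kt]) simp
  from schur_bound[OF N f(7,8,5,6) k' this]
  have "kernel_bound M N (\<lambda>z. dot a b z * k' z) (2 * (R * S) * d)" by (simp add: mult_ac)
  then show ?thesis
  proof (rule kernel_bound_cong_AE[OF N, rotated 3])
   show "AE z in M \<Otimes>\<^sub>M N. dot a b z * k' z = cutoff (A \<times> B) \<phi> k z"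
    using f(9) AE_space
   proof eventually_elim
    case (elim z)
    have nz: "1 - dot f g z \<noteq> 0" using v[OF elim(2)] by auto
    show ?case
    proof (cases "z \<in> A \<times> B")
     case True
     then have "dot a b z = \<phi> z * (1 - dot f g z)" using elim(1) by simp
     then show ?thesis using nz by (simp add: cutoff_def k'_def)
    qed (simp add: cutoff_def k'_def)
   qed
   show "cutoff (A \<times> B) \<phi> k \<in> kmeasurable M N" using sqD(1)[OF k(1)] unfolding cutoff_def[abs_def] by measurable
  qed measurable
 qed
 have "0 \<le> 2 * (R * S)" using f(5,6) by simp
 then show ?thesis unfolding schur_on_def using pair_measureI[OF f(1,2)] bd kb by blast
qed

text \<open>A functional \<open>F\<close> composed with restriction to \<open>A\<^sub>n \<times> B\<^sub>n\<close> has an adjoint image, namely \<open>F\<close> composed with multiplication by \<open>\<phi>\<close> on that rectangle; and it is close to \<open>F\<close> because its trace class kernel has small tails.\<close>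

theorem closable_if_schur_exhaustion:
 assumes \<phi>: "\<phi> \<in> kmeasurable M N" and A: "exhausts M A" and B: "exhausts N B"
  and S: "\<And>n. schur_on M N \<phi> (A n \<times> B n)"
 shows "\<phi> \<in> wstar_closable_multipliers M N"
 unfolding wstar_closable_multipliers_def
proof (rule CollectI, rule conjI[OF \<phi>], rule closable_if_adjoint_dense)
 show K: "seminormed_space (compacts M N)" by (rule seminormed_compact_ops[OF M N])
 show "mult_graph M N \<phi> \<subseteq> vecs (compacts M N) \<times> vecs (compacts M N)"
  using linear_mult_graph[OF M N] unfolding linear_graph_def by blast
 fix F and \<epsilon> :: real assume F: "F \<in> vecs (dual (compacts M N))" and \<epsilon>: "\<epsilon> > 0"
 define C where "C = vnorm (dual (compacts M N)) F"
 define \<Lambda> where "\<Lambda> k = F (int_op M N k)" for k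
 have \<Lambda>: "kernel_functional M N \<Lambda> C" unfolding \<Lambda>_def[abs_def] C_def by (rule dual_kernel_functional[OF M N F])
 obtain f g s t where fg: "row_bound M f s" "row_bound N g t"
  "real_sq M s" "(l2norm M (\<lambda>x. complex_of_real (s x)))\<^sup>2 \<le> C"
  "real_sq N t" "(l2norm N (\<lambda>x. complex_of_real (t x)))\<^sup>2 \<le> C"
  "dot f g \<in> ksq M N" "\<And>k. k \<in> ksq M N ==> \<Lambda> k = (LINT z|(M \<Otimes>\<^sub>M N). k z * dot f g z)"
  by (rule functional_kernel[OF M N \<Lambda>], rule that)
 note cc = cutoff_compression[OF exhaustsD(1)[OF A] exhaustsD(1)[OF B]]
 let ?E = "\<lambda>n. cutoff (A n \<times> B n) (\<lambda>_. 1)"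
 have tail: "(\<lambda>n. l2norm L (\<lambda>x. of_real (u x) * indicator (- D n) x)) \<longlonglongrightarrow> 0"
  if D: "exhausts L D" and u: "real_sq L u" for L :: "'c measure" and D u
 proof -
  note [measurable] = sqD(1)[OF u] exhaustsD(1)[OF D]
  have "(\<lambda>n. l2norm L (\<lambda>x. of_real (u x) - indicator (D n) x * of_real (u x))) \<longlonglongrightarrow> 0"
  proof (rule l2_dominated_convergence(3)[OF u sqD(1)[OF u], where c=1])
   show "AE x in L. (\<lambda>n. indicator (D n) x * complex_of_real (u x)) \<longlonglongrightarrow> of_real (u x)"
    using exhaustsD(3)[OF D]
   proof eventually_elim
    case (elim x)
    then obtain m where "x \<in> D m" by blast
    then have "indicator (D n) x * complex_of_real (u x) = of_real (u x)" if "n \<ge> m" for n using exhaustsD(2)[OF D that] by auto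
    then show ?case by (intro tendsto_eventually) (auto simp: eventually_sequentially)
   qed
  qed (auto simp: indicator_def)
  moreover have "(\<lambda>x. of_real (u x) - indicator (D n) x * of_real (u x)) = (\<lambda>x. of_real (u x) * indicator (- D n) x :: complex)" for n
   by (auto simp: indicator_def)
  ultimately show ?thesis by simp
 qed
 have "(\<lambda>n. l2norm M (\<lambda>x. of_real (s x) * indicator (- A n) x) * l2norm N (\<lambda>y. complex_of_real (t y))
   + l2norm M (\<lambda>x. complex_of_real (s x)) * l2norm N (\<lambda>y. of_real (t y) * indicator (- B n) y))
   \<longlonglongrightarrow> 0 * l2norm N (\<lambda>y. complex_of_real (t y)) + l2norm M (\<lambda>x. complex_of_real (s x)) * 0"
  by (intro tendsto_intros tail A B fg)
 from order_tendstoD(2)[OF this, of \<epsilon>] obtain n where n: "l2norm M (\<lambda>x. of_real (s x) * indicator (- A n) x) * l2norm N (\<lambda>y. complex_of_real (t y))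
   + l2norm M (\<lambda>x. complex_of_real (s x)) * l2norm N (\<lambda>y. of_real (t y) * indicator (- B n) y) < \<epsilon>"
  using \<epsilon> unfolding eventually_sequentially by auto
 have near: "cmod (\<Lambda> k - \<Lambda> (?E n k)) \<le> \<epsilon> * c" if k: "k \<in> ksq M N" "kernel_bound M N k c" for k c
 proof -
  have "cmod (\<Lambda> k - \<Lambda> (?E n k)) \<le> c * (l2norm M (\<lambda>x. of_real (s x) * indicator (- A n) x) * l2norm N (\<lambda>y. complex_of_real (t y))
   + l2norm M (\<lambda>x. complex_of_real (s x)) * l2norm N (\<lambda>y. of_real (t y) * indicator (- B n) y))"
   using functional_rectangle_defect[OF N fg(1,2,3,5) exhaustsD(1)[OF A, of n] exhaustsD(1)[OF B, of n] k]
   unfolding fg(8)[OF k(1)] fg(8)[OF cutoff_compression(1)[OF exhaustsD(1)[OF A] exhaustsD(1)[OF B] k(1)]] by (simp add: cutoff_def)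
  also have "\<dots> \<le> c * \<epsilon>" by (rule mult_left_mono[OF less_imp_le[OF n] kernel_boundD(1)[OF N k(2)]])
  finally show ?thesis by (simp add: mult.commute)
 qed
 have cutting: "kernel_functional M N (\<lambda>k. \<Lambda> (cutoff (A n \<times> B n) \<psi> k)) (C * c)"
  if c: "c \<ge> 0" and cs: "\<And>k. k \<in> ksq M N ==> cutoff (A n \<times> B n) \<psi> k \<in> ksq M N"
   and cb: "\<And>k d. k \<in> ksq M N ==> kernel_bound M N k d ==> kernel_bound M N (cutoff (A n \<times> B n) \<psi> k) (c * d)" for \<psi> c
  unfolding kernel_functional_def
 proof (intro conjI ballI allI impI)
  note \<Lambda>D = kernel_functionalD[OF \<Lambda>]
  show "0 \<le> C * c" using \<Lambda>D(1) c by simp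
  fix k assume k: "k \<in> ksq M N"
  show "\<Lambda> (cutoff (A n \<times> B n) \<psi> (\<lambda>z. k z + l z)) = \<Lambda> (cutoff (A n \<times> B n) \<psi> k) + \<Lambda> (cutoff (A n \<times> B n) \<psi> l)" if l: "l \<in> ksq M N" for l
   unfolding \<Lambda>D(2)[OF cs[OF k] cs[OF l], symmetric] by (rule arg_cong[where f=\<Lambda>]) (simp add: cutoff_def fun_eq_iff distrib_left)
  show "\<Lambda> (cutoff (A n \<times> B n) \<psi> (\<lambda>z. u * k z)) = u * \<Lambda> (cutoff (A n \<times> B n) \<psi> k)" for u
   unfolding \<Lambda>D(3)[OF cs[OF k], symmetric] by (rule arg_cong[where f=\<Lambda>]) (simp add: cutoff_def fun_eq_iff mult_ac)
  show "cmod (\<Lambda> (cutoff (A n \<times> B n) \<psi> k)) \<le> C * c * d'" if "kernel_bound M N k d'" for d'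
   using \<Lambda>D(4)[OF cs[OF k] cb[OF k that]] by (simp add: mult.assoc)
 qed
 have E1: "kernel_functional M N (\<lambda>k. \<Lambda> (?E n k)) (C * 1)" by (rule cutting) (use cc in simp_all)
 obtain F' where F': "F' \<in> vecs (dual (compacts M N))" "\<And>k. k \<in> ksq M N ==> F' (int_op M N k) = \<Lambda> (?E n k)"
  by (rule kernel_functional_extension[OF M N E1], rule that)
 obtain R c where c: "c \<ge> 0" "\<And>k. k \<in> ksq M N ==> cutoff (A n \<times> B n) \<phi> k \<in> ksq M N"
  "\<And>k d. k \<in> ksq M N ==> kernel_bound M N k d ==> kernel_bound M N (cutoff (A n \<times> B n) \<phi> k) (c * d)"
  by (rule schur_onD[OF S \<phi>], rule that)
 obtain H where H: "H \<in> vecs (dual (compacts M N))" "\<And>k. k \<in> ksq M N ==> H (int_op M N k) = \<Lambda> (cutoff (A n \<times> B n) \<phi> k)"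
  by (rule kernel_functional_extension[OF M N cutting[OF c]], assumption, assumption, assumption, rule that)
 have "F' \<in> adjoint_domain (compacts M N) (mult_graph M N \<phi>)"
  unfolding adjoint_domain_def mult_graph_def mult_domain_def
 proof (intro CollectI conjI bexI[OF _ H(1)] F'(1), clarify)
  fix k assume k: "k \<in> ksq M N" "(\<lambda>z. \<phi> z * k z) \<in> ksq M N"
  show "F' (int_op M N (\<lambda>z. \<phi> z * k z)) = H (int_op M N k)"
   unfolding F'(2)[OF k(2)] H(2)[OF k(1)] by (rule arg_cong[where f=\<Lambda>]) (simp add: cutoff_def fun_eq_iff)
 qed
 moreover have "cmod (F T - F' T) \<le> \<epsilon> * vnorm (compacts M N) T" if T: "T \<in> vecs (compacts M N)" for T
 proof -
  note DD = seminormed_spaceD[OF seminormed_dual[OF K]]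
  define D where "D = vadd (dual (compacts M N)) F (vscale (dual (compacts M N)) (-1) F')"
  have D: "D \<in> vecs (dual (compacts M N))" unfolding D_def by (intro DD(2,7) F F'(1))
  have val: "D v = F v - F' v" if "v \<in> vecs (compacts M N)" for v using that by (simp add: D_def dual_simps)
  have "cmod (D T) \<le> \<epsilon> * vnorm (compacts M N) T"
  proof (rule dual_norm_on_kernels[OF M N D _ _ T])
   fix k c assume k: "k \<in> ksq M N" "kernel_bound M N k c"
   show "cmod (D (int_op M N k)) \<le> \<epsilon> * c"
    unfolding val[OF int_op_mem[OF M N k(1)]] F'(2)[OF k(1)] using near[OF k] by (simp add: \<Lambda>_def)
  qed (use \<epsilon> in simp)
  then show ?thesis by (simp add: val[OF T])
 qed
 ultimately show "\<exists>F'\<in>adjoint_domain (compacts M N) (mult_graph M N \<phi>). \<forall>v\<in>vecs (compacts M N). cmod (F v - F' v) \<le> \<epsilon> * vnorm (compacts M N) v"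
  by blast
qed

lemma exhausts_inter: "exhausts L A ==> exhausts L A' ==> exhausts L (\<lambda>n. A n \<inter> A' n)"
proof -
 assume A: "exhausts L A" and A': "exhausts L A'"
 note a = exhaustsD[OF A] and a' = exhaustsD[OF A']
 have "AE x in L. \<exists>n. x \<in> A n \<inter> A' n" using a(3) a'(3)
 proof eventually_elim
  case (elim x)
  then obtain i j where "x \<in> A i" "x \<in> A' j" by blast
  then have "x \<in> A (max i j) \<inter> A' (max i j)" using a(2)[of i "max i j"] a'(2)[of j "max i j"] by auto
  then show ?case by blast
 qed
 moreover have "incseq (\<lambda>n. A n \<inter> A' n)" unfolding incseq_def using a(2) a'(2) by blast
 ultimately show ?thesis unfolding exhausts_def using a(1) a'(1) by blast
qed

theorem closable_multipliers_subalgebra: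
 assumes \<phi>: "\<phi> \<in> wstar_closable_multipliers M N" and \<psi>: "\<psi> \<in> wstar_closable_multipliers M N"
 shows "(\<lambda>z. \<phi> z + \<psi> z) \<in> wstar_closable_multipliers M N" "(\<lambda>z. \<phi> z * \<psi> z) \<in> wstar_closable_multipliers M N"
  "(\<lambda>z. c * \<phi> z) \<in> wstar_closable_multipliers M N"
proof -
 have m: "\<phi> \<in> kmeasurable M N" "\<psi> \<in> kmeasurable M N"
  using \<phi> \<psi> by (auto simp: wstar_closable_multipliers_def)
 obtain A B where 1: "exhausts M A" "exhausts N B" "\<And>n. factored_on M N \<phi> (A n) (B n)"
  by (rule closable_factored_on_exhaustion[OF M N \<phi>], rule that)
 obtain A' B' where 2: "exhausts M A'" "exhausts N B'" "\<And>n. factored_on M N \<psi> (A' n) (B' n)"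
  by (rule closable_factored_on_exhaustion[OF M N \<psi>], rule that)
 note e = exhausts_inter[OF 1(1) 2(1)] exhausts_inter[OF 1(2) 2(2)]
 note s = exhaustsD(1)[OF e(1)] exhaustsD(1)[OF e(2)]
 have S: "schur_on M N \<phi> ((A n \<inter> A' n) \<times> (B n \<inter> B' n))" "schur_on M N \<psi> ((A n \<inter> A' n) \<times> (B n \<inter> B' n))" for n
  by (rule schur_on_subset[OF factored_on_schur_on[OF m(1) 1(3)[of n]] m(1) s]
   schur_on_subset[OF factored_on_schur_on[OF m(2) 2(3)[of n]] m(2) s], blast)+
 show "(\<lambda>z. \<phi> z + \<psi> z) \<in> wstar_closable_multipliers M N"
  by (rule closable_if_schur_exhaustion[OF _ e schur_on_add[OF S m]]) (use m in auto)
 show "(\<lambda>z. \<phi> z * \<psi> z) \<in> wstar_closable_multipliers M N"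
  by (rule closable_if_schur_exhaustion[OF _ e schur_on_mult[OF S m]]) (use m in auto)
 show "(\<lambda>z. c * \<phi> z) \<in> wstar_closable_multipliers M N"
  by (rule closable_if_schur_exhaustion[OF _ e schur_on_mult[OF schur_on_const[OF s] S(1) _ m(1)]]) (use m in auto)
qed

end

section \<open>Compact exhaustions adapted to a countable cover by rectangles\<close>

text \<open>Regularity from inside for \<open>A\<close> and for its complement simultaneously. This symmetric form is stable under complements, which makes the induction over the sigma algebra short.\<close>

definition compactly_split :: "'a measure => 'a topology => 'a set => bool" where
 "compactly_split P X A \<longleftrightarrow> (\<forall>e>0. \<exists>C D. compactin X C \<and> compactin X D \<and> C \<subseteq> A \<and> D \<inter> A = {}
   \<and> measure P (space P - (C \<union> D)) < e)"

context
 fixes P :: "'a measure" and X :: "'a topology"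
 assumes P: "finite_measure P" and X: "completely_metrizable_space X" "second_countable X" "topspace X = space P"
  and sets_P: "sets P = sigma_sets (space P) {U. openin X U}"
begin

interpretation P: finite_measure P by (rule P)

lemma closed_measurable: "closedin X C ==> C \<in> sets P"
proof -
 assume C: "closedin X C"
 then have "space P - C \<in> sets P" unfolding sets_P X(3)[symmetric] by (intro sigma_sets.Basic) (simp add: openin_diff)
 then have "space P - (space P - C) \<in> sets P" by (rule sets.compl_sets)
 then show "C \<in> sets P" using closedin_subset[OF C] by (simp add: X(3) double_diff)
qed

lemma compact_closed: "compactin X C ==> closedin X C"
 by (rule compactin_imp_closedin[OF metrizable_imp_Hausdorff_space[OF completely_metrizable_imp_metrizable_space[OF X(1)]]])

lemmas compact_measurable = closed_measurable[OF compact_closed]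

lemma measure_UN_geometric:
 assumes E: "\<And>i::nat. E i \<in> sets P" and le: "\<And>i. measure P (E i) < e * (1/2) ^ Suc i"
 shows "measure P (\<Union>i. E i) \<le> e"
proof -
 have s: "(\<lambda>i. e * (1/2) ^ Suc i) sums e" using sums_mult[OF power_half_series, of e] by simp
 have sm: "summable (\<lambda>i. measure P (E i))"
  by (rule summable_comparison_test'[OF sums_summable[OF s], of 0]) (use le in \<open>simp add: less_imp_le\<close>)
 have "measure P (\<Union>i. E i) \<le> (\<Sum>i. measure P (E i))"
  by (rule P.finite_measure_subadditive_countably[OF _ sm]) (use E in auto)
 also have "\<dots> \<le> (\<Sum>i. e * (1/2) ^ Suc i)" by (rule suminf_le[OF less_imp_le[OF le] sm sums_summable[OF s]])
 also have "\<dots> = e" by (rule sums_unique[OF s, symmetric])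
 finally show ?thesis .
qed

text \<open>For each radius finitely many closed balls cover the space up to small measure; the intersection of these finite unions is closed and totally bounded.\<close>

lemma tight:
 assumes e: "e > 0"
 shows "\<exists>K. compactin X K \<and> measure P (space P - K) < e"
proof -
 obtain S d where S: "Metric_space S d" "Metric_space.mcomplete S d" and XS: "X = Metric_space.mtopology S d"
  using X(1) unfolding completely_metrizable_space_def by blast
 interpret S: Metric_space S d by (rule S(1))
 have SP: "S = space P" using X(3) by (simp add: XS)
 obtain Q where Q: "countable Q" "Q \<subseteq> S" "X closure_of Q = S"
  using second_countable_imp_separable_space[OF X(2)] unfolding separable_space_def by (auto simp: XS)
 show ?thesis
 proof (cases "S = {}")
  case True
  then show ?thesis using e by (intro exI[of _ "{}"]) (simp add: SP[symmetric])
 next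
  case False
  then have "Q \<noteq> {}" using Q(3) by auto
  define q where "q = from_nat_into Q"
  have q: "q i \<in> S" for i unfolding q_def using from_nat_into[OF \<open>Q \<noteq> {}\<close>] Q(2) by blast
  define B where "B m n = (\<Union>i<n. S.mcball (q i) (inverse (Suc m)))" for m n :: nat
  have Bc: "closedin X (B m n)" for m n unfolding B_def XS by (intro closedin_Union) auto
  have "\<exists>n. measure P (space P - B m n) < e / 2 * (1/2) ^ Suc m" for m
  proof -
   have "(\<Union>n. B m n) = space P"
   proof (intro equalityI subsetI)
    fix x assume "x \<in> (\<Union>n. B m n)" then show "x \<in> space P" unfolding SP[symmetric] by (auto simp: B_def)
   next
    fix x assume x: "x \<in> space P"
    then have "x \<in> X closure_of Q" by (simp add: Q(3) SP)
    then have "\<forall>r>0. \<exists>y\<in>Q. y \<in> S.mball x r" unfolding XS S.metric_closure_of by blast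
    from this[rule_format, of "inverse (Suc m)"] obtain y where "y \<in> Q" "y \<in> S.mball x (inverse (Suc m))" by (auto simp del: of_nat_Suc)
    moreover then obtain i where "y = q i" unfolding q_def using from_nat_into_surj[OF Q(1)] by metis
    ultimately have "x \<in> B m (Suc i)" unfolding B_def by (auto simp: S.in_mball S.in_mcball S.commute intro!: bexI[of _ i])
    then show "x \<in> (\<Union>n. B m n)" by blast
   qed
   moreover have "incseq (B m)" unfolding B_def incseq_def by fastforce
   ultimately have "(\<lambda>n. measure P (B m n)) \<longlonglongrightarrow> measure P (space P)"
    using P.finite_Lim_measure_incseq[of "B m"] closed_measurable[OF Bc] by auto
   from order_tendstoD(1)[OF this, of "measure P (space P) - e / 2 * (1/2) ^ Suc m"]
   obtain n where "measure P (space P) - e / 2 * (1/2) ^ Suc m < measure P (B m n)"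
    using e unfolding eventually_sequentially by auto
   then show ?thesis using P.finite_measure_compl[OF closed_measurable[OF Bc, of m n]] by (intro exI[of _ n]) simp
  qed
  then obtain n where n: "\<And>m. measure P (space P - B m (n m)) < e / 2 * (1/2) ^ Suc m" by metis
  define K where "K = (\<Inter>m. B m (n m))"
  have Kc: "closedin X K" unfolding K_def by (intro closedin_Inter) (use Bc in auto)
  have "S.mtotally_bounded K"
   unfolding S.mtotally_bounded_def
  proof (intro allI impI)
   fix r :: real assume "r > 0"
   then obtain m where m: "inverse (real (Suc m)) < r / 2" using reals_Archimedean[of "r / 2"] by auto
   let ?C = "\<lambda>i. S.mcball (q i) (inverse (real (Suc m)))"
   define p where "p i = (SOME x. x \<in> K \<inter> ?C i)" for i
   have p: "p i \<in> K \<inter> ?C i" if "K \<inter> ?C i \<noteq> {}" for i unfolding p_def some_in_eq by (rule that)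
   have "x \<in> (\<Union>y\<in>p ` {i \<in> {..<n m}. K \<inter> ?C i \<noteq> {}}. S.mball y r)" if x: "x \<in> K" for x
   proof -
    obtain i where i: "i < n m" "x \<in> ?C i" using x unfolding K_def B_def by blast
    have "K \<inter> ?C i \<noteq> {}" using x i(2) by blast
    then have "p i \<in> ?C i" using p by blast
    then have a: "p i \<in> S" "d (q i) (p i) < r / 2" "x \<in> S" "d (q i) x < r / 2" using i(2) m by auto
    then have "d (p i) x < r" using S.triangle[OF a(1) q a(3), of i] S.commute[of "p i" "q i"] by linarith
    then have "x \<in> S.mball (p i) r" using a by (simp add: S.in_mball)
    then show ?thesis using i x by blast
   qed
   then show "\<exists>F. finite F \<and> F \<subseteq> K \<and> K \<subseteq> (\<Union>x\<in>F. S.mball x r)"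
    by (intro exI[of _ "p ` {i \<in> {..<n m}. K \<inter> ?C i \<noteq> {}}"] conjI subsetI) (simp, use p in blast, blast)
  qed
  then have "compactin X K"
   using S.mtotally_bounded_eq_compact_closure_of[OF S(2), of K] closure_of_closedin[OF Kc] by (simp add: XS)
  moreover have "measure P (space P - K) < e"
  proof -
   have m: "space P - B m (n m) \<in> sets P" for m by (rule sets.compl_sets[OF closed_measurable[OF Bc]])
   have "measure P (space P - K) \<le> measure P (\<Union>m. space P - B m (n m))"
    by (rule P.finite_measure_mono) (simp add: K_def, use m in blast)
   also have "\<dots> \<le> e / 2" by (rule measure_UN_geometric[OF m n])
   finally show ?thesis using e by simp
  qed
  ultimately show ?thesis by blast
 qed
qed

lemma compactly_split_UN:
 assumes A: "\<And>i::nat. compactly_split P X (A i)"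
 shows "compactly_split P X (\<Union>i. A i)"
 unfolding compactly_split_def
proof (intro allI impI)
 fix e :: real assume e: "e > 0"
 have "\<exists>C D. compactin X C \<and> compactin X D \<and> C \<subseteq> A i \<and> D \<inter> A i = {} \<and> measure P (space P - (C \<union> D)) < e / 2 * (1/2) ^ Suc i" for i
  by (rule A[unfolded compactly_split_def, THEN spec, THEN mp]) (use e in simp)
 then obtain C D where CD: "\<And>i. compactin X (C i)" "\<And>i. compactin X (D i)" "\<And>i. C i \<subseteq> A i" "\<And>i. D i \<inter> A i = {}"
  "\<And>i. measure P (space P - (C i \<union> D i)) < e / 2 * (1/2) ^ Suc i" by metis
 define E where "E = (\<Inter>i. D i)"
 define R where "R n = space P - ((\<Union>i<n. C i) \<union> E)" for n
 have Ec: "closedin X E" unfolding E_def by (intro closedin_Inter) (use CD(2) compact_closed in auto)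
 have E: "compactin X E" by (rule closed_compactin[OF CD(2)[of 0] _ Ec]) (auto simp: E_def)
 have Cf: "compactin X (\<Union>i<n. C i)" for n by (intro compactin_Union) (use CD(1) in auto)
 have Rm: "R n \<in> sets P" for n unfolding R_def using compact_measurable[OF Cf] compact_measurable[OF E] by auto
 have m: "space P - (C i \<union> D i) \<in> sets P" for i using compact_measurable[OF CD(1)] compact_measurable[OF CD(2)] by auto
 have "(\<lambda>n. measure P (R n)) \<longlonglongrightarrow> measure P (\<Inter>n. R n)"
  by (rule P.finite_Lim_measure_decseq) (use Rm in \<open>fastforce simp: decseq_def R_def\<close>)+
 moreover have "measure P (\<Inter>n. R n) \<le> measure P (\<Union>i. space P - (C i \<union> D i))"
 proof (rule P.finite_measure_mono)
  show "(\<Union>i. space P - (C i \<union> D i)) \<in> sets P" using m by blast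
  show "(\<Inter>n. R n) \<subseteq> (\<Union>i. space P - (C i \<union> D i))"
  proof
   fix x assume x: "x \<in> (\<Inter>n. R n)"
   then have R: "x \<in> R n" for n by blast
   obtain i where "x \<notin> D i" using R[of 0] by (auto simp: R_def E_def)
   moreover have "x \<notin> C i" "x \<in> space P" using R[of "Suc i"] by (auto simp: R_def)
   ultimately show "x \<in> (\<Union>i. space P - (C i \<union> D i))" by blast
  qed
 qed
 moreover have "\<dots> \<le> e / 2" by (rule measure_UN_geometric[OF m CD(5)])
 ultimately have "(\<lambda>n. measure P (R n)) \<longlonglongrightarrow> measure P (\<Inter>n. R n)" "measure P (\<Inter>n. R n) < e" using e by linarith+
 from order_tendstoD(2)[OF this] obtain n where "measure P (R n) < e" unfolding eventually_sequentially by auto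
 moreover have "(\<Union>i<n. C i) \<subseteq> (\<Union>i. A i)" using CD(3) by fast
 moreover have "E \<inter> (\<Union>i. A i) = {}" using CD(4) by (fastforce simp: E_def)
 ultimately show "\<exists>C D. compactin X C \<and> compactin X D \<and> C \<subseteq> (\<Union>i. A i) \<and> D \<inter> (\<Union>i. A i) = {} \<and> measure P (space P - (C \<union> D)) < e"
  unfolding R_def by (intro exI conjI) (rule Cf, rule E)
qed

lemma measurable_compactly_split:
 assumes "A \<in> sets P"
 shows "compactly_split P X A"
proof -
 have "A \<in> sigma_sets (space P) {U. openin X U}" using assms sets_P by simp
 then show ?thesis
 proof induction
  case (Basic U)
  then have U: "openin X U" by simp
  obtain F :: "nat => 'a set" where F: "\<And>n. closedin X (F n)" "\<And>n. F n \<subseteq> F (Suc n)" "(\<Union>n. F n) = U"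
   using open_imp_fsigma_in[OF completely_metrizable_imp_metrizable_space[OF X(1)] U] unfolding fsigma_in_ascending by blast
  show ?case unfolding compactly_split_def
  proof (intro allI impI)
   fix e :: real assume e: "e > 0"
   obtain K where K: "compactin X K" "measure P (space P - K) < e / 2" using tight[of "e / 2"] e by auto
   have Us: "U \<in> sets P" unfolding sets_P using U by (intro sigma_sets.Basic) simp
   have "(\<lambda>n. measure P (F n)) \<longlonglongrightarrow> measure P (\<Union>n. F n)"
    by (rule P.finite_Lim_measure_incseq) (use F closed_measurable in \<open>auto intro: incseq_SucI\<close>)
   from order_tendstoD(1)[OF this, of "measure P U - e / 2"] obtain n where "measure P U - e / 2 < measure P (F n)"
    using e unfolding F(3) eventually_sequentially by auto
   moreover have Fn: "F n \<subseteq> U" using F(3) by blast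
   ultimately have UF: "measure P (U - F n) < e / 2" using P.finite_measure_Diff[OF Us closed_measurable[OF F(1)]] by simp
   have "measure P (space P - (K \<inter> F n \<union> (K - U))) \<le> measure P ((space P - K) \<union> (U - F n))"
    by (rule P.finite_measure_mono) (use closed_measurable[OF F(1)] Us compact_measurable[OF K(1)] in auto)
   also have "\<dots> \<le> measure P (space P - K) + measure P (U - F n)"
    by (rule measure_Un_le) (use closed_measurable[OF F(1)] Us compact_measurable[OF K(1)] in auto)
   also have "\<dots> < e" using K(2) UF by simp
   finally have "measure P (space P - (K \<inter> F n \<union> (K - U))) < e" .
   moreover have "compactin X (K \<inter> F n)" using compact_Int_closedin[OF K(1) F(1)] .
   moreover have "compactin X (K - U)" by (rule closed_compactin[OF K(1) _ closedin_diff[OF compact_closed[OF K(1)] U]]) auto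
   ultimately show "\<exists>C D. compactin X C \<and> compactin X D \<and> C \<subseteq> U \<and> D \<inter> U = {} \<and> measure P (space P - (C \<union> D)) < e"
    using Fn by (intro exI[of _ "K \<inter> F n"] exI[of _ "K - U"]) auto
  qed
 next
  case Empty
  show ?case unfolding compactly_split_def
  proof (intro allI impI)
   fix e :: real assume "e > 0"
   then obtain K where "compactin X K" "measure P (space P - K) < e" using tight by blast
   then show "\<exists>C D. compactin X C \<and> compactin X D \<and> C \<subseteq> {} \<and> D \<inter> {} = {} \<and> measure P (space P - (C \<union> D)) < e"
    by (intro exI[of _ "{}"] exI[of _ K]) simp
  qed
 next
  case (Compl A)
  show ?case unfolding compactly_split_def
  proof (intro allI impI)
   fix e :: real assume "e > 0"
   then obtain C D where "compactin X C" "compactin X D" "C \<subseteq> A" "D \<inter> A = {}" "measure P (space P - (C \<union> D)) < e"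
    using Compl.IH unfolding compactly_split_def by blast
   moreover then have "D \<subseteq> space P" using compactin_subset_topspace X(3) by metis
   ultimately show "\<exists>C D. compactin X C \<and> compactin X D \<and> C \<subseteq> space P - A \<and> D \<inter> (space P - A) = {} \<and> measure P (space P - (C \<union> D)) < e"
    by (intro exI[of _ D] exI[of _ C]) (auto simp: Un_commute)
  qed
 next
  case (Union A)
  then show ?case by (intro compactly_split_UN)
 qed
qed

text \<open>On the intersection of the sets \<open>C\<^sub>i \<union> D\<^sub>i\<close> the trace of \<open>A\<^sub>i\<close> is the complement of the closed set \<open>D\<^sub>i\<close>, hence relatively open: a form of Lusin's theorem for countably many sets.\<close>

lemma compact_with_clopen_traces:
 assumes A: "\<And>i::nat. A i \<in> sets P" and Z: "Z \<in> null_sets P" and e: "e > 0"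
 obtains K where "compactin X K" "K \<inter> Z = {}" "measure P (space P - K) < e" "\<And>i. \<exists>U. openin X U \<and> A i \<inter> K = U \<inter> K"
proof -
 have "\<exists>C D. compactin X C \<and> compactin X D \<and> C \<subseteq> A i \<and> D \<inter> A i = {} \<and> measure P (space P - (C \<union> D)) < e / 4 * (1/2) ^ Suc i" for i
  by (rule measurable_compactly_split[OF A, unfolded compactly_split_def, THEN spec, THEN mp]) (use e in simp)
 then obtain C D where CD: "\<And>i. compactin X (C i)" "\<And>i. compactin X (D i)" "\<And>i. C i \<subseteq> A i" "\<And>i. D i \<inter> A i = {}"
  "\<And>i. measure P (space P - (C i \<union> D i)) < e / 4 * (1/2) ^ Suc i" by metis
 obtain E F where EF: "compactin X E" "compactin X F" "E \<subseteq> space P - Z" "F \<inter> (space P - Z) = {}" "measure P (space P - (E \<union> F)) < e / 2"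
  using measurable_compactly_split[of "space P - Z"] Z e unfolding compactly_split_def by (meson half_gt_zero null_setsD2 sets.compl_sets)
 define K where "K = E \<inter> (\<Inter>i. C i \<union> D i)"
 have Gc: "closedin X (\<Inter>i. C i \<union> D i)" by (intro closedin_Inter) (use CD(1,2) compact_closed in auto)
 have K: "compactin X K" unfolding K_def by (rule compact_Int_closedin[OF EF(1) Gc])
 have m: "space P - (C i \<union> D i) \<in> sets P" for i using compact_measurable[OF CD(1)] compact_measurable[OF CD(2)] by auto
 have 1: "measure P (\<Union>i. space P - (C i \<union> D i)) \<le> e / 4" by (rule measure_UN_geometric[OF m CD(5)])
 have Fn: "F \<subseteq> Z" using EF(2,4) compactin_subset_topspace[of X F] X(3) by auto
 have ZP: "Z \<in> sets P" "measure P Z = 0" using Z by (auto simp: measure_def)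
 have um: "(\<Union>i. space P - (C i \<union> D i)) \<in> sets P" using m by blast
 have em: "space P - (E \<union> F) \<in> sets P" using compact_measurable EF(1,2) by auto
 have "measure P (space P - K) \<le> measure P ((\<Union>i. space P - (C i \<union> D i)) \<union> ((space P - (E \<union> F)) \<union> Z))"
  by (rule P.finite_measure_mono) (use Fn um em ZP(1) in \<open>auto simp: K_def\<close>)
 also have "\<dots> \<le> measure P (\<Union>i. space P - (C i \<union> D i)) + measure P ((space P - (E \<union> F)) \<union> Z)"
  by (rule measure_Un_le[OF um]) (use em ZP(1) in auto)
 also have "measure P ((space P - (E \<union> F)) \<union> Z) \<le> measure P (space P - (E \<union> F)) + measure P Z"
  by (rule measure_Un_le[OF em ZP(1)])
 finally have small: "measure P (space P - K) < e" using 1 EF(5) ZP(2) e by linarith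
 have "\<exists>U. openin X U \<and> A i \<inter> K = U \<inter> K" for i
 proof (intro exI conjI)
  show "openin X (topspace X - D i)" using compact_closed[OF CD(2)] by auto
  show "A i \<inter> K = (topspace X - D i) \<inter> K"
   using CD(3,4)[of i] compactin_subset_topspace[OF K] unfolding K_def by blast
 qed
 then show thesis by (intro that[OF K _ small]) (use EF(3) in \<open>auto simp: K_def\<close>)
qed

end

lemma finite_equivalent_measure:
 assumes "sigma_finite_measure (M :: 'a measure)"
 obtains h :: "'a => real" where "finite_measure (density M h)" "\<And>Q. (AE x in density M h. Q x) \<longleftrightarrow> (AE x in M. Q x)"
  "null_sets (density M h) = null_sets M"
proof -
 obtain h :: "'a => real" where h: "h \<in> borel_measurable M" "\<And>x. 0 < h x" "integrable M h"
  by (rule sigma_finite_measure.obtain_positive_integrable_function[OF assms], rule that)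
 have ae: "(AE x in density M h. Q x) \<longleftrightarrow> (AE x in M. Q x)" for Q using h(1,2) by (subst AE_density) auto
 show thesis
 proof (rule that[of h, OF _ ae])
  show "finite_measure (density M h)"
   by (rule finite_measureI) (use h in \<open>simp add: emeasure_density nn_integral_eq_integral less_imp_le cong: nn_integral_cong_simp\<close>)
  show "null_sets (density M h) = null_sets M"
  proof (rule set_eqI)
   fix Z show "Z \<in> null_sets (density M h) \<longleftrightarrow> Z \<in> null_sets M"
    using AE_iff_null_sets[of Z "density M h"] AE_iff_null_sets[of Z M] ae[of "\<lambda>x. x \<notin> Z"] null_setsD2 by (cases "Z \<in> sets M") auto
  qed
 qed
qed

lemma compact_exhaustion:
 assumes st: "standard_borel_measure M" and sf: "sigma_finite_measure M" and A: "\<And>i::nat. A i \<in> sets M" and Z: "Z \<in> null_sets M"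
 obtains X K where "\<And>n::nat. compactin X (K n)" "\<And>n. K n \<in> sets M" "\<And>n. K n \<inter> Z = {}" "AE x in M. \<exists>n. x \<in> K n"
  "\<And>n i. \<exists>U. openin X U \<and> A i \<inter> K n = U \<inter> K n"
proof -
 obtain X where X: "topspace X = space M" "completely_metrizable_space X" "second_countable X" "sets M = sigma_sets (space M) {U. openin X U}"
  using st unfolding standard_borel_measure_def by blast
 obtain h :: "'a => real" where h: "finite_measure (density M h)" "\<And>Q. (AE x in density M h. Q x) \<longleftrightarrow> (AE x in M. Q x)" "null_sets (density M h) = null_sets M"
  by (rule finite_equivalent_measure[OF sf], rule that)
 let ?P = "density M h"
 have P: "topspace X = space ?P" "sets ?P = sigma_sets (space ?P) {U. openin X U}" using X by simp_all
 note ctx = h(1) X(2,3) P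
 have "\<exists>K. compactin X K \<and> K \<inter> Z = {} \<and> measure ?P (space ?P - K) < inverse (Suc n) \<and> (\<forall>i. \<exists>U. openin X U \<and> A i \<inter> K = U \<inter> K)" for n
  by (rule compact_with_clopen_traces[OF ctx, of A Z "inverse (Suc n)"]) (use A Z h(3) in auto)
 then obtain K where K: "\<And>n. compactin X (K n)" "\<And>n. K n \<inter> Z = {}" "\<And>n. measure ?P (space ?P - K n) < inverse (Suc n)"
  "\<And>n i. \<exists>U. openin X U \<and> A i \<inter> K n = U \<inter> K n" by metis
 have Km: "K n \<in> sets M" for n using compact_measurable[OF ctx K(1)] by simp
 interpret P: finite_measure ?P by (rule h(1))
 let ?N = "space ?P - (\<Union>n. K n)"
 have Nm: "?N \<in> sets ?P" using Km by auto
 have "measure ?P ?N \<le> inverse (Suc n)" for n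
  using P.finite_measure_mono[of ?N "space ?P - K n"] K(3)[of n] Km by fastforce
 then have "measure ?P ?N \<le> 0" by (intro LIMSEQ_le_const[OF LIMSEQ_inverse_real_of_nat]) auto
 then have "emeasure ?P ?N = 0" using P.emeasure_eq_measure by (simp add: measure_le_0_iff)
 then have "?N \<in> null_sets ?P" using Nm by auto
 then have "AE x in ?P. \<exists>n. x \<in> K n" by (rule AE_I') auto
 then have "AE x in M. \<exists>n. x \<in> K n" by (simp only: h(2))
 then show thesis by (rule that[OF K(1) Km K(2) _ K(4)])
qed

text \<open>On a product of two compact sets of the preceding kind the rectangles have relatively open traces, so finitely many of them cover it. Finite unions of such products are again rectangles inside finite unions.\<close>

theorem finite_cover_exhaustion:
 assumes M: "standard_borel_measure M" "sigma_finite_measure M" and N: "standard_borel_measure N" "sigma_finite_measure N"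
  and R: "countable R" "R \<subseteq> sets M \<times> sets N" and cover: "marginally_equiv M N (\<Union>(\<alpha>, \<beta>)\<in>R. \<alpha> \<times> \<beta>) (space M \<times> space N)"
 obtains A B where "exhausts M A" "exhausts N B" "\<And>n. \<exists>F. finite F \<and> F \<subseteq> R \<and> A n \<times> B n \<subseteq> (\<Union>(\<alpha>, \<beta>)\<in>F. \<alpha> \<times> \<beta>)"
proof -
 obtain Z W where Z: "Z \<in> null_sets M" "W \<in> null_sets N"
  "sym_diff (\<Union>(\<alpha>, \<beta>)\<in>R. \<alpha> \<times> \<beta>) (space M \<times> space N) \<subseteq> (Z \<times> space N) \<union> (space M \<times> W)"
  using cover unfolding marginally_equiv_def marginally_null_def by blast
 (* the empty rectangle is added because an enumeration needs a nonempty set *)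
 define r where "r = from_nat_into (insert ({}, {}) R)"
 have rr: "range r = insert ({}, {}) R" unfolding r_def using R(1) by (intro range_from_nat_into) auto
 have rM: "fst (r i) \<in> sets M" "snd (r i) \<in> sets N" for i using rangeI[of r i] R(2) unfolding rr by auto
 obtain X K where K: "\<And>n::nat. compactin X (K n)" "\<And>n. K n \<in> sets M" "\<And>n. K n \<inter> Z = {}" "AE x in M. \<exists>n. x \<in> K n"
  "\<And>n i. \<exists>U. openin X U \<and> fst (r i) \<inter> K n = U \<inter> K n"
  by (rule compact_exhaustion[OF M rM(1) Z(1)], rule that)
 obtain Y L where L: "\<And>n::nat. compactin Y (L n)" "\<And>n. L n \<in> sets N" "\<And>n. L n \<inter> W = {}" "AE y in N. \<exists>n. y \<in> L n"
  "\<And>n i. \<exists>U. openin Y U \<and> snd (r i) \<inter> L n = U \<inter> L n"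
  by (rule compact_exhaustion[OF N rM(2) Z(2)], rule that)
 have one: "\<exists>I. finite I \<and> K m \<times> L n \<subseteq> (\<Union>i\<in>I. fst (r i) \<times> snd (r i))" for m n
 proof -
  have "\<forall>i. \<exists>U. openin X U \<and> fst (r i) \<inter> K m = U \<inter> K m" "\<forall>i. \<exists>V. openin Y V \<and> snd (r i) \<inter> L n = V \<inter> L n"
   using K(5) L(5) by blast+
  then obtain U V where U: "\<And>i. openin X (U i)" "\<And>i. fst (r i) \<inter> K m = U i \<inter> K m"
   and V: "\<And>i. openin Y (V i)" "\<And>i. snd (r i) \<inter> L n = V i \<inter> L n" unfolding choice_iff by (elim exE) (rule that, simp_all)
  have comp: "compactin (prod_topology X Y) (K m \<times> L n)" using K(1) L(1) by (simp add: compactin_Times)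
  have cov: "K m \<times> L n \<subseteq> (\<Union>i. U i \<times> V i)"
  proof
   fix z assume z: "z \<in> K m \<times> L n"
   then have "z \<in> space M \<times> space N" using sets.sets_into_space[OF K(2)[of m]] sets.sets_into_space[OF L(2)[of n]] by auto
   moreover have "z \<notin> (Z \<times> space N) \<union> (space M \<times> W)" using z K(3)[of m] L(3)[of n] by auto
   ultimately have "z \<in> (\<Union>(\<alpha>, \<beta>)\<in>R. \<alpha> \<times> \<beta>)" using Z(3) by blast
   then obtain p where "p \<in> R" "z \<in> fst p \<times> snd p" by auto
   moreover then obtain i where "p = r i" using rr by (metis insertI2 rangeE)
   ultimately have "z \<in> U i \<times> V i" using z U(2)[of i] V(2)[of i] by (auto simp: mem_Times_iff)
   then show "z \<in> (\<Union>i. U i \<times> V i)" by blast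
  qed
  have op: "openin (prod_topology X Y) B" if "B \<in> range (\<lambda>i. U i \<times> V i)" for B
   using that U(1) V(1) by (auto simp: openin_prod_Times_iff)
  have "\<exists>\<F>. finite \<F> \<and> \<F> \<subseteq> range (\<lambda>i. U i \<times> V i) \<and> K m \<times> L n \<subseteq> \<Union>\<F>" by (rule compactinD[OF comp op cov])
  then
  obtain \<F> where \<F>: "finite \<F>" "\<F> \<subseteq> range (\<lambda>i. U i \<times> V i)" "K m \<times> L n \<subseteq> \<Union>\<F>" by (elim exE conjE)
  from finite_subset_image[OF \<F>(1,2)] obtain I where I: "finite I" "\<F> = (\<lambda>i. U i \<times> V i) ` I" by (elim exE conjE)
  have "K m \<times> L n \<subseteq> (\<Union>i\<in>I. fst (r i) \<times> snd (r i))"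
  proof
   fix z assume z: "z \<in> K m \<times> L n"
   then obtain i where "i \<in> I" "z \<in> U i \<times> V i" using \<F>(3) I(2) by blast
   then show "z \<in> (\<Union>i\<in>I. fst (r i) \<times> snd (r i))" using z U(2)[of i] V(2)[of i] by (auto simp: mem_Times_iff intro!: bexI[of _ i])
  qed
  then show ?thesis using I(1) by blast
 qed
 define I where "I m n = (SOME I. finite I \<and> K m \<times> L n \<subseteq> (\<Union>i\<in>I. fst (r i) \<times> snd (r i)))" for m n
 have I: "finite (I m n)" "K m \<times> L n \<subseteq> (\<Union>i\<in>I m n. fst (r i) \<times> snd (r i))" for m n
  using someI_ex[OF one[of m n]] unfolding I_def by simp_all
 show thesis
 proof (rule that)
  show "exhausts M (\<lambda>n. \<Union>m\<le>n. K m)"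
   unfolding exhausts_def using K(2,4) by (auto simp: incseq_def intro: order_trans elim!: eventually_mono)
  show "exhausts N (\<lambda>n. \<Union>m\<le>n. L m)"
   unfolding exhausts_def using L(2,4) by (auto simp: incseq_def intro: order_trans elim!: eventually_mono)
  fix n
  define F where "F = r ` (\<Union>i\<le>n. \<Union>j\<le>n. I i j) \<inter> R"
  have "(\<Union>m\<le>n. K m) \<times> (\<Union>m\<le>n. L m) \<subseteq> (\<Union>(\<alpha>, \<beta>)\<in>F. \<alpha> \<times> \<beta>)"
  proof
   fix z assume "z \<in> (\<Union>m\<le>n. K m) \<times> (\<Union>m\<le>n. L m)"
   then obtain i j where "i \<le> n" "j \<le> n" "z \<in> K i \<times> L j" by auto
   then obtain k where k: "k \<in> I i j" "z \<in> fst (r k) \<times> snd (r k)" using I(2)[of i j] by blast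
   then have "r k \<in> R" using rangeI[of r k] unfolding rr by (auto simp: mem_Times_iff)
   then have "r k \<in> F" unfolding F_def using k(1) \<open>i \<le> n\<close> \<open>j \<le> n\<close> by blast
   then show "z \<in> (\<Union>(\<alpha>, \<beta>)\<in>F. \<alpha> \<times> \<beta>)" using k(2) by (auto simp: case_prod_beta)
  qed
  moreover have "finite F" "F \<subseteq> R" unfolding F_def using I(1) by auto
  ultimately show "\<exists>F. finite F \<and> F \<subseteq> R \<and> (\<Union>m\<le>n. K m) \<times> (\<Union>m\<le>n. L m) \<subseteq> (\<Union>(\<alpha>, \<beta>)\<in>F. \<alpha> \<times> \<beta>)" by blast
 qed
qed

section \<open>Local Schur multipliers are closable\<close>

lemma pair_restrict_space:
 assumes M: "sigma_finite_measure M" and N: "sigma_finite_measure N" and A: "\<alpha> \<in> sets M" and B: "\<beta> \<in> sets N"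
 shows "restrict_space M \<alpha> \<Otimes>\<^sub>M restrict_space N \<beta> = restrict_space (M \<Otimes>\<^sub>M N) (\<alpha> \<times> \<beta>)" (is "?P = ?R")
proof (rule pair_measure_eqI)
 show "sigma_finite_measure (restrict_space M \<alpha>)" "sigma_finite_measure (restrict_space N \<beta>)"
  using sigma_finite_measure_restrict_space[OF M A] sigma_finite_measure_restrict_space[OF N B] .
 interpret N: sigma_finite_measure N by (rule N)
 have E: "\<alpha> \<times> \<beta> \<in> sets (M \<Otimes>\<^sub>M N)" using A B by simp
 have sp: "space ?P = \<alpha> \<times> \<beta>"
  using sets.sets_into_space[OF A] sets.sets_into_space[OF B] by (auto simp: space_pair_measure space_restrict_space)
 show eq: "sets ?P = sets ?R"
 proof
  show "sets ?P \<subseteq> sets ?R" unfolding sets_pair_measure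
  proof (rule sets.sigma_sets_subset')
   show "{a \<times> b |a b. a \<in> sets (restrict_space M \<alpha>) \<and> b \<in> sets (restrict_space N \<beta>)} \<subseteq> sets ?R"
    using A B E by (auto simp: sets_restrict_space_iff)
   show "space (restrict_space M \<alpha>) \<times> space (restrict_space N \<beta>) \<in> sets ?R"
    using sets.top[of ?R] sp E by (simp add: space_pair_measure space_restrict_space sets_restrict_space_iff)
  qed
  have m: "(\<lambda>z. (fst z, snd z)) \<in> measurable ?P (M \<Otimes>\<^sub>M N)"
   by (rule measurable_Pair; rule measurable_compose[OF measurable_fst] measurable_compose[OF measurable_snd];
     rule measurable_restrict_space1, rule measurable_ident_sets[OF refl, unfolded id_def])
  have "F \<inter> space ?P \<in> sets ?P" if "F \<in> sets (M \<Otimes>\<^sub>M N)" for F using measurable_sets[OF m that] by simp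
  then show "sets ?R \<subseteq> sets ?P" using E unfolding sp by (auto simp: sets_restrict_space Int_commute)
 qed
 fix a b assume a: "a \<in> sets (restrict_space M \<alpha>)" and b: "b \<in> sets (restrict_space N \<beta>)"
 then have "a \<in> sets M" "b \<in> sets N" "a \<subseteq> \<alpha>" "b \<subseteq> \<beta>" using A B by (auto simp: sets_restrict_space_iff)
 then show "emeasure (restrict_space M \<alpha>) a * emeasure (restrict_space N \<beta>) b = emeasure ?R (a \<times> b)"
  using A B E by (subst emeasure_restrict_space; (subst emeasure_restrict_space)?; (subst emeasure_restrict_space)?)
   (auto simp: N.emeasure_pair_measure_Times)
qed

lemma restrict_space_integrals:
 fixes f :: "'a => complex"
 assumes A: "A \<in> sets L"
 shows "integral\<^sup>L (restrict_space L A) f = (LINT x|L. indicator A x * f x)"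
  "f \<in> sq (restrict_space L A) \<longleftrightarrow> (\<lambda>x. indicator A x * f x) \<in> sq L"
  "l2norm (restrict_space L A) f = l2norm L (\<lambda>x. indicator A x * f x)"
proof -
 have A': "A \<inter> space L \<in> sets L" using A by simp
 have e: "(\<lambda>x. indicator A x *\<^sub>R f x) = (\<lambda>x. indicator A x * f x)" by (auto simp: indicator_def)
 have e2: "(\<lambda>x. indicator A x *\<^sub>R (cmod (f x))\<^sup>2) = (\<lambda>x. (cmod (indicator A x * f x))\<^sup>2)" by (auto simp: indicator_def)
 show "integral\<^sup>L (restrict_space L A) f = (LINT x|L. indicator A x * f x)"
  unfolding integral_restrict_space[OF A'] e ..
 show "f \<in> sq (restrict_space L A) \<longleftrightarrow> (\<lambda>x. indicator A x * f x) \<in> sq L"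
  unfolding square_integrable_def mem_Collect_eq borel_measurable_restrict_space_iff[OF A'] integrable_restrict_space[OF A'] e e2 ..
 show "l2norm (restrict_space L A) f = l2norm L (\<lambda>x. indicator A x * f x)"
  unfolding l2norm_def integral_restrict_space[OF A'] e2 ..
qed

context
 fixes M :: "'a measure" and N :: "'b measure"
 assumes M: "sigma_finite_measure M" and N: "sigma_finite_measure N"
begin

lemma schur_multiplier_schur_on:
 assumes A: "\<alpha> \<in> sets M" and B: "\<beta> \<in> sets N" and S: "schur_multiplier (restrict_space M \<alpha>) (restrict_space N \<beta>) \<phi>"
 shows "schur_on M N \<phi> (\<alpha> \<times> \<beta>)"
proof -
 let ?M = "restrict_space M \<alpha>" and ?N = "restrict_space N \<beta>"
 note pr = pair_restrict_space[OF M N A B]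
 have E: "\<alpha> \<times> \<beta> \<in> sets (M \<Otimes>\<^sub>M N)" using A B by simp
 note M' = sigma_finite_measure_restrict_space[OF M A] and N' = sigma_finite_measure_restrict_space[OF N B]
 note rA = restrict_space_integrals[OF A] and rB = restrict_space_integrals[OF B] and rE = restrict_space_integrals[OF E]
 obtain C R where \<phi>: "\<phi> \<in> borel_measurable (?M \<Otimes>\<^sub>M ?N)" and R: "AE z in ?M \<Otimes>\<^sub>M ?N. cmod (\<phi> z) \<le> R" and C: "C > 0"
  "\<And>k. k \<in> sq (?M \<Otimes>\<^sub>M ?N) ==> vnorm (bounded_ops (L2 ?M) (L2 ?N)) (int_op ?M ?N (\<lambda>z. \<phi> z * k z))
   \<le> C * vnorm (bounded_ops (L2 ?M) (L2 ?N)) (int_op ?M ?N k)"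
  using S unfolding schur_multiplier_def by blast
 have R': "AE z in M \<Otimes>\<^sub>M N. z \<in> \<alpha> \<times> \<beta> \<longrightarrow> cmod (\<phi> z) \<le> R"
  using R unfolding pr by (subst (asm) AE_restrict_space_iff) (use E in auto)
 have prs: "pairing ?M ?N k f g = (LINT z|(M \<Otimes>\<^sub>M N). indicator (\<alpha> \<times> \<beta>) z * (k z * (f (fst z) * g (snd z))))" for k f g
  unfolding pairing_def pr rE(1) ..
 have kb: "kernel_bound M N (cutoff (\<alpha> \<times> \<beta>) \<phi> k) (C * d)" if k: "k \<in> ksq M N" "kernel_bound M N k d" for k d
 proof -
  have d: "d \<ge> 0" by (rule kernel_boundD(1)[OF N k(2)])
  have k': "k \<in> sq (?M \<Otimes>\<^sub>M ?N)" unfolding pr rE(2) by (rule sq_restrict(1)[OF k(1) E])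
  have \<phi>k: "(\<lambda>z. \<phi> z * k z) \<in> sq (?M \<Otimes>\<^sub>M ?N)"
   by (rule sq_dominated(1)[OF k', of _ R])
    (use R in \<open>auto intro!: borel_measurable_times \<phi> sqD(1)[OF k'] elim!: eventually_mono simp: norm_mult mult_right_mono\<close>)
  have "kernel_bound ?M ?N k d"
  proof (rule kernel_boundI[OF N' d])
   fix f g assume f: "f \<in> sq ?M" and g: "g \<in> sq ?N"
   have "pairing ?M ?N k f g = pairing M N k (\<lambda>x. indicator \<alpha> x * f x) (\<lambda>y. indicator \<beta> y * g y)"
    unfolding prs unfolding pairing_def by (rule Bochner_Integration.integral_cong[OF refl]) (auto simp: indicator_def mem_Times_iff)
   then show "cmod (pairing ?M ?N k f g) \<le> d * (l2norm ?M f * l2norm ?N g)"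
    using kernel_boundD(2)[OF N k(2)] f g unfolding rA(2,3) rB(2,3) by simp
  qed
  then have "vnorm (bounded_ops (L2 ?M) (L2 ?N)) (int_op ?M ?N k) \<le> d" using int_op_norm_le_iff[OF M' N' k' d] by simp
  then have "vnorm (bounded_ops (L2 ?M) (L2 ?N)) (int_op ?M ?N (\<lambda>z. \<phi> z * k z)) \<le> C * d"
   using C(2)[OF k'] mult_left_mono[OF _ less_imp_le[OF C(1)]] order_trans by blast
  then have b: "kernel_bound ?M ?N (\<lambda>z. \<phi> z * k z) (C * d)" using int_op_norm_le_iff[OF M' N' \<phi>k] C(1) d by simp
  show ?thesis
  proof (rule kernel_boundI[OF N])
   show "C * d \<ge> 0" using C(1) d by simp
   fix f g assume f: "f \<in> sq M" and g: "g \<in> sq N"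
   have fr: "f \<in> sq ?M" "l2norm ?M f \<le> l2norm M f" unfolding rA(2,3) by (rule sq_restrict[OF f A])+
   have gr: "g \<in> sq ?N" "l2norm ?N g \<le> l2norm N g" unfolding rB(2,3) by (rule sq_restrict[OF g B])+
   have "pairing M N (cutoff (\<alpha> \<times> \<beta>) \<phi> k) f g = pairing ?M ?N (\<lambda>z. \<phi> z * k z) f g"
    unfolding prs unfolding pairing_def cutoff_def by (simp add: mult_ac)
   also have "cmod \<dots> \<le> C * d * (l2norm ?M f * l2norm ?N g)" by (rule kernel_boundD(2)[OF N' b fr(1) gr(1)])
   also have "\<dots> \<le> C * d * (l2norm M f * l2norm N g)" using fr gr C(1) d by (intro mult_left_mono mult_mono) auto
   finally show "cmod (pairing M N (cutoff (\<alpha> \<times> \<beta>) \<phi> k) f g) \<le> C * d * (l2norm M f * l2norm N g)" .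
  qed
 qed
 show ?thesis unfolding schur_on_def using E R' kb C(1) less_imp_le by blast
qed

text \<open>Restriction to a rectangle is contractive on operators, so \<open>1\<^sub>E\<^sub>\<union>\<^sub>F = 1\<^sub>F - 1\<^sub>E (1\<^sub>F - 1)\<close> gives a bound.\<close>

lemma schur_on_Un_rectangle:
 assumes \<phi>: "\<phi> \<in> kmeasurable M N" and E: "schur_on M N \<phi> E" and F: "schur_on M N \<phi> (\<alpha> \<times> \<beta>)"
  and AB: "\<alpha> \<in> sets M" "\<beta> \<in> sets N"
 shows "schur_on M N \<phi> (E \<union> \<alpha> \<times> \<beta>)"
proof -
 let ?F = "\<alpha> \<times> \<beta>"
 obtain R c where e: "E \<in> sets (M \<Otimes>\<^sub>M N)" "AE z in M \<Otimes>\<^sub>M N. z \<in> E \<longrightarrow> cmod (\<phi> z) \<le> R" "c \<ge> 0"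
  "\<And>k. k \<in> ksq M N ==> cutoff E \<phi> k \<in> ksq M N"
  "\<And>k d. k \<in> ksq M N ==> kernel_bound M N k d ==> kernel_bound M N (cutoff E \<phi> k) (c * d)"
  by (rule schur_onD[OF E \<phi>], rule that)
 obtain R' c' where f: "?F \<in> sets (M \<Otimes>\<^sub>M N)" "AE z in M \<Otimes>\<^sub>M N. z \<in> ?F \<longrightarrow> cmod (\<phi> z) \<le> R'" "c' \<ge> 0"
  "\<And>k. k \<in> ksq M N ==> cutoff ?F \<phi> k \<in> ksq M N"
  "\<And>k d. k \<in> ksq M N ==> kernel_bound M N k d ==> kernel_bound M N (cutoff ?F \<phi> k) (c' * d)"
  by (rule schur_onD[OF F \<phi>], rule that)
 have kb: "kernel_bound M N (cutoff (E \<union> ?F) \<phi> k) ((c' + 2 * c) * d)" if k: "k \<in> ksq M N" "kernel_bound M N k d" for k d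
 proof -
  define l where "l z = cutoff ?F (\<lambda>_. 1) k z - k z" for z
  note F1 = cutoff_compression(1)[OF M N AB k(1)] and F2 = cutoff_compression(2)[OF M N AB k]
  have l: "l \<in> ksq M N" "kernel_bound M N l (d + d)"
   unfolding l_def[abs_def] by (rule sq_diff[OF F1 k(1)], rule kernel_bound_minus[OF N F1 k(1) F2 k(2)])
  have "cutoff (E \<union> ?F) \<phi> k = (\<lambda>z. cutoff ?F \<phi> k z - cutoff E \<phi> l z)"
   by (rule ext) (auto simp: cutoff_def l_def indicator_def)
  then show ?thesis using kernel_bound_minus[OF N f(4)[OF k(1)] e(4)[OF l(1)] f(5)[OF k] e(5)[OF l]] by (simp add: algebra_simps)
 qed
 have "AE z in M \<Otimes>\<^sub>M N. z \<in> E \<union> ?F \<longrightarrow> cmod (\<phi> z) \<le> max R R'"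
  using e(2) f(2) by eventually_elim auto
 moreover have "c' + 2 * c \<ge> 0" using e(3) f(3) by simp
 ultimately show ?thesis unfolding schur_on_def using sets.Un[OF e(1) f(1)] kb by blast
qed

theorem local_schur_multipliers_closable:
 assumes st: "standard_borel_measure M" "standard_borel_measure N" and \<phi>: "\<phi> \<in> local_schur_multipliers M N"
 shows "\<phi> \<in> wstar_closable_multipliers M N"
proof -
 have \<phi>m: "\<phi> \<in> kmeasurable M N" using \<phi> by (simp add: local_schur_multipliers_def)
 obtain R where R: "countable R" "R \<subseteq> sets M \<times> sets N" "marginally_equiv M N (\<Union>(\<alpha>, \<beta>)\<in>R. \<alpha> \<times> \<beta>) (space M \<times> space N)"
  and S: "\<forall>(\<alpha>, \<beta>)\<in>R. schur_multiplier (restrict_space M \<alpha>) (restrict_space N \<beta>) \<phi>"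
  using \<phi> unfolding local_schur_multipliers_def by blast
 obtain A B where AB: "exhausts M A" "exhausts N B" "\<And>n. \<exists>F. finite F \<and> F \<subseteq> R \<and> A n \<times> B n \<subseteq> (\<Union>(\<alpha>, \<beta>)\<in>F. \<alpha> \<times> \<beta>)"
  by (rule finite_cover_exhaustion[OF st(1) M st(2) N R], rule that)
 show ?thesis
 proof (rule closable_if_schur_exhaustion[OF M N \<phi>m AB(1,2)])
  fix n
  obtain F where F: "finite F" "F \<subseteq> R" "A n \<times> B n \<subseteq> (\<Union>(\<alpha>, \<beta>)\<in>F. \<alpha> \<times> \<beta>)" using AB(3)[of n] by blast
  have "schur_on M N \<phi> (\<Union>(\<alpha>, \<beta>)\<in>F. \<alpha> \<times> \<beta>)" using F(1,2)
  proof (induction F)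
   case empty
   have "schur_on M N \<phi> ({} \<times> {})"
    unfolding schur_on_def cutoff_def[abs_def] by (auto simp: kernel_bound_def pairing_def N intro!: exI[of _ 0])
   then show ?case by simp
  next
   case (insert p F)
   obtain \<alpha> \<beta> where p: "p = (\<alpha>, \<beta>)" by fastforce
   have "\<alpha> \<in> sets M" "\<beta> \<in> sets N" "schur_multiplier (restrict_space M \<alpha>) (restrict_space N \<beta>) \<phi>"
    using insert.prems R(2) S unfolding p by auto
   from schur_on_Un_rectangle[OF \<phi>m insert.IH schur_multiplier_schur_on[OF this] this(1,2)] insert.prems
   show ?case by (simp add: p Un_commute)
  qed
  then show "schur_on M N \<phi> (A n \<times> B n)"
   using schur_on_subset[OF M N _ \<phi>m exhaustsD(1)[OF AB(1)] exhaustsD(1)[OF AB(2)] F(3)] by blast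
 qed
qed

end

section \<open>Representatives continuous in the omega topology\<close>

text \<open>Exact countable unions of rectangles. Exceptional null sets appear only when the pieces are glued.\<close>

definition rect_open :: "'a measure => 'b measure => ('a \<times> 'b) set => bool" where
 "rect_open M N E \<longleftrightarrow> (\<exists>K. countable K \<and> K \<subseteq> sets M \<times> sets N \<and> E = (\<Union>p\<in>K. fst p \<times> snd p))"

definition rect_continuous :: "'a measure => 'b measure => ('a \<times> 'b => complex) => bool" where
 "rect_continuous M N h \<longleftrightarrow> (\<forall>U. open U \<longrightarrow> rect_open M N (h -` U \<inter> space (M \<Otimes>\<^sub>M N)))"

lemma rect_continuousD: "rect_continuous M N h ==> open U ==> rect_open M N (h -` U \<inter> space (M \<Otimes>\<^sub>M N))"
 by (simp add: rect_continuous_def)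

lemma rect_open_rectangle: "\<alpha> \<in> sets M ==> \<beta> \<in> sets N ==> rect_open M N (\<alpha> \<times> \<beta>)"
 unfolding rect_open_def by (intro exI[of _ "{(\<alpha>, \<beta>)}"]) simp

lemma rect_open_UN:
 assumes I: "countable I" and E: "\<And>i. i \<in> I ==> rect_open M N (E i)"
 shows "rect_open M N (\<Union>i\<in>I. E i)"
proof -
 have "\<forall>i\<in>I. \<exists>K. countable K \<and> K \<subseteq> sets M \<times> sets N \<and> E i = (\<Union>p\<in>K. fst p \<times> snd p)" using E unfolding rect_open_def by blast
 then obtain K where K: "\<forall>i\<in>I. countable (K i) \<and> K i \<subseteq> sets M \<times> sets N \<and> E i = (\<Union>p\<in>K i. fst p \<times> snd p)"
  by (rule bchoice[THEN exE])
 show ?thesis unfolding rect_open_def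
  by (intro exI[of _ "\<Union>i\<in>I. K i"] conjI countable_UN[OF I]) (use K in auto)
qed

lemma rect_open_Int:
 assumes "rect_open M N E" "rect_open M N F"
 shows "rect_open M N (E \<inter> F)"
proof -
 obtain K L where K: "countable K" "K \<subseteq> sets M \<times> sets N" "E = (\<Union>p\<in>K. fst p \<times> snd p)"
  and L: "countable L" "L \<subseteq> sets M \<times> sets N" "F = (\<Union>p\<in>L. fst p \<times> snd p)" using assms unfolding rect_open_def by blast
 have "E \<inter> F = (\<Union>(p, q)\<in>K \<times> L. (fst p \<inter> fst q) \<times> (snd p \<inter> snd q))" unfolding K(3) L(3) by auto
 moreover have "rect_open M N (\<Union>(p, q)\<in>K \<times> L. (fst p \<inter> fst q) \<times> (snd p \<inter> snd q))"
  by (rule rect_open_UN) (use K(1) L(1) in simp, clarify, intro rect_open_rectangle sets.Int, use K(2) L(2) in auto)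
 ultimately show ?thesis by simp
qed

lemma rect_continuous_fst: "a \<in> borel_measurable M ==> rect_continuous M N (\<lambda>z. a (fst z))"
 unfolding rect_continuous_def
proof (intro allI impI)
 fix U :: "complex set" assume a: "a \<in> borel_measurable M" and U: "open U"
 have "(\<lambda>z. a (fst z)) -` U \<inter> space (M \<Otimes>\<^sub>M N) = (a -` U \<inter> space M) \<times> space N" by (auto simp: space_pair_measure)
 then show "rect_open M N ((\<lambda>z. a (fst z)) -` U \<inter> space (M \<Otimes>\<^sub>M N))"
  using measurable_sets[OF a borel_open[OF U]] by (simp add: rect_open_rectangle)
qed

lemma rect_continuous_snd: "b \<in> borel_measurable N ==> rect_continuous M N (\<lambda>z. b (snd z))"
 unfolding rect_continuous_def
proof (intro allI impI)
 fix U :: "complex set" assume b: "b \<in> borel_measurable N" and U: "open U"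
 have "(\<lambda>z. b (snd z)) -` U \<inter> space (M \<Otimes>\<^sub>M N) = space M \<times> (b -` U \<inter> space N)" by (auto simp: space_pair_measure)
 then show "rect_open M N ((\<lambda>z. b (snd z)) -` U \<inter> space (M \<Otimes>\<^sub>M N))"
  using measurable_sets[OF b borel_open[OF U]] by (simp add: rect_open_rectangle)
qed

text \<open>An open set of pairs is a countable union of products of basic open sets.\<close>

lemma rect_continuous_compose:
 fixes F :: "complex \<times> complex => complex"
 assumes h: "rect_continuous M N h" and k: "rect_continuous M N k" and D: "open D" and F: "continuous_on D F"
  and hk: "\<And>z. z \<in> space (M \<Otimes>\<^sub>M N) ==> (h z, k z) \<in> D"
 shows "rect_continuous M N (\<lambda>z. F (h z, k z))"
 unfolding rect_continuous_def
proof (intro allI impI)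
 fix U :: "complex set" assume U: "open U"
 define V where "V = F -` U \<inter> D"
 have V: "open V" unfolding V_def using continuous_on_open_vimage[OF D] F U by blast
 obtain B :: "complex set set" where B: "countable B" "topological_basis B" using ex_countable_basis by blast
 let ?I = "{p \<in> B \<times> B. fst p \<times> snd p \<subseteq> V}"
 have I: "countable ?I" by (rule countable_subset[of _ "B \<times> B"]) (use B(1) in auto)
 have "(\<lambda>z. F (h z, k z)) -` U \<inter> space (M \<Otimes>\<^sub>M N)
   = (\<Union>p\<in>?I. (h -` fst p \<inter> space (M \<Otimes>\<^sub>M N)) \<inter> (k -` snd p \<inter> space (M \<Otimes>\<^sub>M N)))" (is "?L = ?R")
 proof
  show "?R \<subseteq> ?L" unfolding V_def by fast
  show "?L \<subseteq> ?R"
  proof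
   fix z assume z: "z \<in> ?L"
   then have "(h z, k z) \<in> V" using hk by (simp add: V_def)
   then obtain S T where ST: "open S" "open T" "(h z, k z) \<in> S \<times> T" "S \<times> T \<subseteq> V" by (rule open_prod_elim[OF V])
   obtain S' where S': "S' \<in> B" "h z \<in> S'" "S' \<subseteq> S" by (rule topological_basisE[OF B(2) ST(1), of "h z"]) (use ST(3) in auto)
   obtain T' where T': "T' \<in> B" "k z \<in> T'" "T' \<subseteq> T" by (rule topological_basisE[OF B(2) ST(2), of "k z"]) (use ST(3) in auto)
   have "(S', T') \<in> ?I" using S' T' ST(4) by auto
   then show "z \<in> ?R" using z S'(2) T'(2) by (intro UN_I[of "(S', T')"]) auto
  qed
 qed
 moreover have "rect_open M N ?R"
  by (rule rect_open_UN[OF I], intro rect_open_Int rect_continuousD[OF h] rect_continuousD[OF k])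
   (use topological_basis_open[OF B(2)] in auto)
 ultimately show "rect_open M N ?L" by simp
qed

lemma rect_continuous_arith:
 assumes h: "rect_continuous M N h" and k: "rect_continuous M N k"
 shows "rect_continuous M N (\<lambda>z. h z + k z)" "rect_continuous M N (\<lambda>z. h z - k z)" "rect_continuous M N (\<lambda>z. h z * k z)"
  "(\<And>z. z \<in> space (M \<Otimes>\<^sub>M N) ==> k z \<noteq> 0) ==> rect_continuous M N (\<lambda>z. h z / k z)"
proof -
 have c: "continuous_on UNIV (\<lambda>p. fst p + snd p :: complex)" "continuous_on UNIV (\<lambda>p. fst p - snd p :: complex)"
  "continuous_on UNIV (\<lambda>p. fst p * snd p :: complex)" "continuous_on (UNIV \<times> (- {0})) (\<lambda>p. fst p / snd p :: complex)"
  by (auto intro!: continuous_intros)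
 show "rect_continuous M N (\<lambda>z. h z + k z)" "rect_continuous M N (\<lambda>z. h z - k z)" "rect_continuous M N (\<lambda>z. h z * k z)"
  using rect_continuous_compose[OF h k open_UNIV c(1)] rect_continuous_compose[OF h k open_UNIV c(2)]
   rect_continuous_compose[OF h k open_UNIV c(3)] by simp_all
 have "open (UNIV \<times> - {0 :: complex} :: (complex \<times> complex) set)" by (intro open_Times) auto
 from rect_continuous_compose[OF h k this c(4)]
 show "(\<And>z. z \<in> space (M \<Otimes>\<^sub>M N) ==> k z \<noteq> 0) ==> rect_continuous M N (\<lambda>z. h z / k z)" by simp
qed

text \<open>Finite sums of products are continuous in the sense above. Near a point the tail of the sum is uniformly small on a rectangle \<open>X \<times> N\<close>, where \<open>X\<close> is the set of \<open>x\<close> with small tail.\<close>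

lemma rect_continuous_dot:
 assumes a: "row_bound M a (\<lambda>_. R)" and b: "row_bound N b (\<lambda>_. S)" and S: "S \<ge> 0"
 shows "rect_continuous M N (dot a b)"
proof -
 note [measurable] = row_boundD(1)[OF a] row_boundD(1)[OF b]
 define t where "t n x = sqrt (\<Sum>i. (cmod (a (i + n) x))\<^sup>2)" for n x
 have sa: "summable (\<lambda>i. (cmod (a i x))\<^sup>2)" if "x \<in> space M" for x
  by (rule bounded_imp_summable[of _ "R\<^sup>2"]) (simp, simp only: lessThan_Suc_atMost[symmetric] row_boundD(3)[OF a that])
 have rt: "row_bound M (\<lambda>i. a (i + n)) (t n)" for n
  unfolding row_bound_def
 proof (intro conjI allI ballI)
  fix x m assume x: "x \<in> space M"
  have s: "summable (\<lambda>i. (cmod (a (i + n) x))\<^sup>2)" by (rule summable_ignore_initial_segment[OF sa[OF x]])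
  show "t n x \<ge> 0" unfolding t_def by (simp add: suminf_nonneg[OF s])
  show "(\<Sum>i<m. (cmod (a (i + n) x))\<^sup>2) \<le> (t n x)\<^sup>2"
   unfolding t_def using sum_le_suminf[OF s, of "{..<m}"] suminf_nonneg[OF s] by simp
 qed measurable
 have rb: "row_bound N (\<lambda>i. b (i + n)) (\<lambda>_. S)" for n
  unfolding row_bound_def
 proof (intro conjI allI ballI S)
  fix y m assume y: "y \<in> space N"
  have "(\<Sum>i<m. (cmod (b (i + n) y))\<^sup>2) = (\<Sum>i\<in>{n..<m + n}. (cmod (b i y))\<^sup>2)"
   using sum.shift_bounds_nat_ivl[of "\<lambda>i. (cmod (b i y))\<^sup>2" 0 n m] by (simp add: atLeast0LessThan)
  also have "\<dots> \<le> (\<Sum>i<m + n. (cmod (b i y))\<^sup>2)" by (rule sum_mono2) auto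
  also have "\<dots> \<le> S\<^sup>2" by (rule row_boundD(3)[OF b y])
  finally show "(\<Sum>i<m. (cmod (b (i + n) y))\<^sup>2) \<le> S\<^sup>2" .
 qed measurable
 define D where "D n z = (\<Sum>i<n. a i (fst z) * b i (snd z))" for n z
 have D: "rect_continuous M N (D n)" for n
 proof (induction n)
  case 0
  show ?case unfolding D_def[abs_def] using rect_continuous_fst[of "\<lambda>_. 0" M N] by simp
 next
  case (Suc n)
  have "D (Suc n) = (\<lambda>z. D n z + a n (fst z) * b n (snd z))" by (rule ext) (simp add: D_def)
  then show ?case
   using rect_continuous_arith(1)[OF Suc rect_continuous_arith(3)[OF rect_continuous_fst rect_continuous_snd]] row_boundD(1)[OF a] row_boundD(1)[OF b] by simp
 qed
 have near: "cmod (dot a b z - D n z) \<le> t n (fst z) * S" if z: "z \<in> space (M \<Otimes>\<^sub>M N)" for z n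
 proof -
  have "dot a b z - D n z = dot (\<lambda>i. a (i + n)) (\<lambda>i. b (i + n)) z"
   unfolding D_def dot_def using suminf_minus_initial_segment[OF sums_summable[OF dot_bounds(2)[OF a b z]]] by simp
  then show ?thesis using dot_bounds(3)[OF rt rb z] by simp
 qed
 have tm: "t n \<in> borel_measurable M" for n unfolding t_def[abs_def] by measurable
 have t0: "(\<lambda>n. t n x) \<longlonglongrightarrow> 0" if "x \<in> space M" for x
 proof -
  have "(\<lambda>n. (\<Sum>i. (cmod (a i x))\<^sup>2) - (\<Sum>i<n. (cmod (a i x))\<^sup>2)) \<longlonglongrightarrow> (\<Sum>i. (cmod (a i x))\<^sup>2) - (\<Sum>i. (cmod (a i x))\<^sup>2)"
   by (intro tendsto_intros summable_LIMSEQ sa that)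
  then have "(\<lambda>n. \<Sum>i. (cmod (a (i + n) x))\<^sup>2) \<longlonglongrightarrow> 0" by (simp add: suminf_minus_initial_segment[OF sa[OF that]])
  from tendsto_real_sqrt[OF this] show ?thesis by (simp add: t_def)
 qed
 show ?thesis unfolding rect_continuous_def
 proof (intro allI impI)
  fix U :: "complex set" assume U: "open U"
  define e where "e m = inverse (real (Suc m)) * S" for m
  (* points at distance more than e m from the complement of U *)
  define V where "V m = {w. \<exists>r>e m. ball w r \<subseteq> U}" for m
  have "open (V m)" for m unfolding open_contains_ball
  proof
   fix w assume "w \<in> V m"
   then obtain r where r: "r > e m" "ball w r \<subseteq> U" by (auto simp: V_def)
   have "ball w (r - (r + e m) / 2) \<subseteq> V m"
   proof
    fix w' assume "w' \<in> ball w (r - (r + e m) / 2)"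
    then have w': "dist w w' < r - (r + e m) / 2" by simp
    have "ball w' ((r + e m) / 2) \<subseteq> ball w r"
    proof
     fix v assume "v \<in> ball w' ((r + e m) / 2)"
     then show "v \<in> ball w r" using w' dist_triangle[of w v w'] unfolding mem_ball by linarith
    qed
    then show "w' \<in> V m" unfolding V_def using r by (intro CollectI exI[of _ "(r + e m) / 2"]) auto
   qed
   then show "\<exists>r>0. ball w r \<subseteq> V m" using r(1) by (intro exI[of _ "r - (r + e m) / 2"]) auto
  qed
  note Vo = this
  define X where "X m n = {x \<in> space M. t n x \<le> inverse (real (Suc m))}" for m n
  have Xm: "X m n \<in> sets M" for m n unfolding X_def using tm by measurable
  have "dot a b -` U \<inter> space (M \<Otimes>\<^sub>M N) = (\<Union>p\<in>UNIV. (X (fst p) (snd p) \<times> space N) \<inter> (D (snd p) -` V (fst p) \<inter> space (M \<Otimes>\<^sub>M N)))" (is "?L = ?R")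
  proof
   show "?R \<subseteq> ?L"
   proof
    fix z assume "z \<in> ?R"
    then obtain m n where mn: "fst z \<in> X m n" "D n z \<in> V m" "z \<in> space (M \<Otimes>\<^sub>M N)" by auto
    then obtain r where r: "r > e m" "ball (D n z) r \<subseteq> U" by (auto simp: V_def)
    have "t n (fst z) * S \<le> e m" unfolding e_def using mn(1) S by (intro mult_right_mono) (auto simp: X_def)
    then have "dot a b z \<in> ball (D n z) r" using near[OF mn(3), of n] r(1) by (simp add: dist_norm norm_minus_commute)
    then show "z \<in> ?L" using r(2) mn(3) by auto
   qed
   show "?L \<subseteq> ?R"
   proof
    fix z assume z: "z \<in> ?L"
    then obtain \<rho> where \<rho>: "\<rho> > 0" "ball (dot a b z) \<rho> \<subseteq> U" using U unfolding open_contains_ball by auto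
    have "(\<lambda>m. 2 * e m) \<longlonglongrightarrow> 2 * (0 * S)" unfolding e_def by (intro tendsto_intros LIMSEQ_inverse_real_of_nat)
    from order_tendstoD(2)[OF this, of \<rho>] obtain m where m: "2 * e m < \<rho>" using \<rho>(1) unfolding eventually_sequentially by auto
    have x: "fst z \<in> space M" "z \<in> space (M \<Otimes>\<^sub>M N)" using z by (auto simp: space_pair_measure)
    from order_tendstoD(2)[OF t0[OF x(1)], of "inverse (real (Suc m))"] obtain n where n: "t n (fst z) < inverse (real (Suc m))"
     unfolding eventually_sequentially by auto
    have "t n (fst z) * S \<le> e m" unfolding e_def using n S by (intro mult_right_mono) auto
    then have d: "dist (D n z) (dot a b z) \<le> e m" using near[OF x(2), of n] by (simp add: dist_norm norm_minus_commute)
    have "ball (D n z) (\<rho> - e m) \<subseteq> ball (dot a b z) \<rho>"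
    proof
     fix w assume "w \<in> ball (D n z) (\<rho> - e m)"
     then show "w \<in> ball (dot a b z) \<rho>" using d dist_triangle[of "dot a b z" w "D n z"] by (simp add: dist_commute)
    qed
    then have "D n z \<in> V m" unfolding V_def using m \<rho>(2) by (intro CollectI exI[of _ "\<rho> - e m"]) auto
    moreover have "z \<in> X m n \<times> space N" using x n by (auto simp: X_def mem_Times_iff space_pair_measure)
    ultimately show "z \<in> ?R" using x(2) by (intro UN_I[of "(m, n)"]) auto
   qed
  qed
  moreover have "rect_open M N ?R"
   by (rule rect_open_UN) (auto intro!: rect_open_Int rect_open_rectangle Xm rect_continuousD[OF D] Vo)
  ultimately show "rect_open M N ?L" by simp
 qed
qed

lemma marginally_null_UN:
 assumes "countable I" "\<And>i. i \<in> I ==> marginally_null M N (E i)"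
 shows "marginally_null M N (\<Union>i\<in>I. E i)"
proof -
 obtain Z W where ZW: "\<And>i. i \<in> I ==> Z i \<in> null_sets M" "\<And>i. i \<in> I ==> W i \<in> null_sets N"
  "\<And>i. i \<in> I ==> E i \<subseteq> (Z i \<times> space N) \<union> (space M \<times> W i)" using assms(2) unfolding marginally_null_def by metis
 show ?thesis unfolding marginally_null_def
  by (intro bexI[of _ "\<Union>i\<in>I. Z i"] bexI[of _ "\<Union>i\<in>I. W i"] null_sets_UN' assms(1) ZW) (use ZW(3) in fast)
qed

text \<open>A rectangle of measure zero has a side of measure zero.\<close>

lemma null_rect_open_marginally_null:
 assumes N: "sigma_finite_measure N" and E: "rect_open M N E" and z: "AE z in M \<Otimes>\<^sub>M N. z \<notin> E"
 shows "marginally_null M N E"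
proof -
 interpret N: sigma_finite_measure N by (rule N)
 obtain K where K: "countable K" "K \<subseteq> sets M \<times> sets N" "E = (\<Union>p\<in>K. fst p \<times> snd p)" using E unfolding rect_open_def by blast
 have "marginally_null M N (fst p \<times> snd p)" if p: "p \<in> K" for p
 proof -
  have m: "fst p \<in> sets M" "snd p \<in> sets N" using K(2) p by auto
  have "AE z in M \<Otimes>\<^sub>M N. z \<notin> fst p \<times> snd p" using z by eventually_elim (use p K(3) in blast)
  then have "fst p \<times> snd p \<in> null_sets (M \<Otimes>\<^sub>M N)" using m by (subst AE_iff_null_sets) auto
  then have "emeasure M (fst p) * emeasure N (snd p) = 0" using N.emeasure_pair_measure_Times[OF m] by (simp add: null_setsD1)
  then have "fst p \<in> null_sets M \<or> snd p \<in> null_sets N" using m by auto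
  then show ?thesis
  proof
   assume "fst p \<in> null_sets M"
   then show ?thesis unfolding marginally_null_def
    using sets.sets_into_space[OF m(2)] by (intro bexI[of _ "fst p"] bexI[of _ "{}"]) auto
  next
   assume "snd p \<in> null_sets N"
   then show ?thesis unfolding marginally_null_def
    using sets.sets_into_space[OF m(1)] by (intro bexI[of _ "{}"] bexI[of _ "snd p"]) auto
  qed
 qed
 then show ?thesis unfolding K(3) by (rule marginally_null_UN[OF K(1)])
qed

lemma marginally_null_subset: "marginally_null M N F ==> E \<subseteq> F ==> marginally_null M N E"
 unfolding marginally_null_def by (meson subset_trans)

lemma exhausts_marginally:
 assumes A: "exhausts M A" and B: "exhausts N B"
 shows "marginally_null M N (space (M \<Otimes>\<^sub>M N) - (\<Union>n. A n \<times> B n))"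
proof -
 have Z: "space M - (\<Union>n. A n) \<in> null_sets M" "space N - (\<Union>n. B n) \<in> null_sets N"
  using exhaustsD(1,3)[OF A] exhaustsD(1,3)[OF B] by (subst AE_iff_null_sets; auto elim!: eventually_mono)+
 have "space (M \<Otimes>\<^sub>M N) - (\<Union>n. A n \<times> B n) \<subseteq> (space M - (\<Union>n. A n)) \<times> space N \<union> space M \<times> (space N - (\<Union>n. B n))"
 proof
  fix z assume z: "z \<in> space (M \<Otimes>\<^sub>M N) - (\<Union>n. A n \<times> B n)"
  have "\<exists>n. z \<in> A n \<times> B n" if "fst z \<in> A i" "snd z \<in> B j" for i j
   using that exhaustsD(2)[OF A, of i "max i j"] exhaustsD(2)[OF B, of j "max i j"] by (auto simp: mem_Times_iff)
  then show "z \<in> (space M - (\<Union>n. A n)) \<times> space N \<union> space M \<times> (space N - (\<Union>n. B n))" using z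
   by (auto simp: space_pair_measure mem_Times_iff)
 qed
 then show ?thesis unfolding marginally_null_def using Z by blast
qed

text \<open>On \<open>A\<^sub>n \<times> B\<^sub>n\<close> take \<open>u / (1 - v)\<close>. Where two of these functions differ is a countable union of rectangles and a null set, hence marginally null.\<close>

theorem closable_omega_continuous_representative:
 assumes M: "sigma_finite_measure M" and N: "sigma_finite_measure N" and \<phi>: "\<phi> \<in> wstar_closable_multipliers M N"
 shows "\<exists>g. omega_continuous M N g \<and> (AE z in M \<Otimes>\<^sub>M N. \<phi> z = g z)"
proof -
 let ?S = "space (M \<Otimes>\<^sub>M N)"
 obtain A B where A: "exhausts M A" and B: "exhausts N B" and fac: "\<And>n. factored_on M N \<phi> (A n) (B n)"
  by (rule closable_factored_on_exhaustion[OF M N \<phi>], rule that)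
 define Q where "Q n h \<longleftrightarrow> h \<in> kmeasurable M N \<and> rect_continuous M N h
  \<and> (AE z in M \<Otimes>\<^sub>M N. z \<in> A n \<times> B n \<longrightarrow> \<phi> z = h z)" for n h
 have "\<exists>h. Q n h" for n
 proof -
  obtain f g a b R S where f: "row_bound M f (\<lambda>_. 1/2)" "row_bound N g (\<lambda>_. 1/2)" "R \<ge> 0" "S \<ge> 0"
   "row_bound M a (\<lambda>_. R)" "row_bound N b (\<lambda>_. S)" "AE z in M \<Otimes>\<^sub>M N. z \<in> A n \<times> B n \<longrightarrow> \<phi> z * (1 - dot f g z) = dot a b z"
   using fac[of n] unfolding factored_on_def by (elim conjE exE)
  note [measurable] = dot_measurable[OF f(1,2)] dot_measurable[OF f(5,6)]
  have nz: "1 - dot f g z \<noteq> 0" if "z \<in> ?S" for z using dot_bounds(3)[OF f(1,2) that] by auto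
  have one: "rect_continuous M N (\<lambda>z. 1)" using rect_continuous_fst[of "\<lambda>_. 1"] by simp
  have "rect_continuous M N (\<lambda>z. dot a b z / (1 - dot f g z))"
   by (intro rect_continuous_arith rect_continuous_dot[OF f(5,6,4)] one rect_continuous_dot[OF f(1,2)] nz) auto
  moreover have "AE z in M \<Otimes>\<^sub>M N. z \<in> A n \<times> B n \<longrightarrow> \<phi> z = dot a b z / (1 - dot f g z)"
   using f(7) AE_space by eventually_elim (use nz in \<open>auto simp: eq_divide_eq\<close>)
  moreover have "(\<lambda>z. dot a b z / (1 - dot f g z)) \<in> kmeasurable M N" by measurable
  ultimately show ?thesis unfolding Q_def by (intro exI conjI)
 qed
 then have "Q n (SOME h. Q n h)" for n by (rule someI_ex)
 moreover define g where "g n = (SOME h. Q n h)" for n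
 ultimately have "Q n (g n)" for n by (simp only:)
 then have g: "\<And>n. g n \<in> kmeasurable M N" "\<And>n. rect_continuous M N (g n)"
  "\<And>n. AE z in M \<Otimes>\<^sub>M N. z \<in> A n \<times> B n \<longrightarrow> \<phi> z = g n z" unfolding Q_def by simp_all
 note [measurable] = g(1) exhaustsD(1)[OF A] exhaustsD(1)[OF B]
 (* off all rectangles the value of LEAST is the same unspecified number at every point, so G stays measurable *)
 define G where "G z = g (LEAST n. z \<in> A n \<times> B n) z" for z
 have Gm: "G \<in> kmeasurable M N"
  unfolding G_def by (rule measurable_compose_countable[OF g(1)]) measurable
 define bad where "bad m n = (A m \<times> B m) \<inter> (A n \<times> B n) \<inter> ((\<lambda>z. g m z - g n z) -` (- {0}) \<inter> ?S)" for m n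
 have bad: "marginally_null M N (bad m n)" for m n
 proof (rule null_rect_open_marginally_null[OF N])
  show "rect_open M N (bad m n)" unfolding bad_def
   by (intro rect_open_Int rect_open_rectangle rect_continuousD[OF rect_continuous_arith(2)[OF g(2) g(2)]] exhaustsD(1)[OF A] exhaustsD(1)[OF B]) auto
  show "AE z in M \<Otimes>\<^sub>M N. z \<notin> bad m n" using g(3)[of m] g(3)[of n] by eventually_elim (auto simp: bad_def)
 qed
 define E where "E = (\<Union>p\<in>UNIV. bad (fst p) (snd p)) \<union> (?S - (\<Union>n. A n \<times> B n))"
 have "marginally_null M N (\<Union>b\<in>UNIV. if b then \<Union>p\<in>UNIV. bad (fst p) (snd p) else ?S - (\<Union>n. A n \<times> B n))"
  by (rule marginally_null_UN) (use marginally_null_UN[of UNIV M N "\<lambda>p. bad (fst p) (snd p)"] bad exhausts_marginally[OF A B] in auto)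
 then have E: "marginally_null M N E" by (rule marginally_null_subset) (auto simp: E_def split: if_splits)
 have Gg: "G z = g n z" if "z \<in> ?S" "z \<notin> E" "z \<in> A n \<times> B n" for z n
 proof -
  define l where "l = (LEAST n. z \<in> A n \<times> B n)"
  have "z \<in> A l \<times> B l" unfolding l_def by (rule LeastI[of "\<lambda>n. z \<in> A n \<times> B n", OF that(3)])
  moreover have "z \<notin> bad l n" using that(2) unfolding E_def by auto
  ultimately show ?thesis using that(1,3) by (auto simp: bad_def G_def l_def)
 qed
 have "omega_open M N (G -` U \<inter> ?S)" if U: "open U" for U
 proof -
  have "rect_open M N (\<Union>n\<in>UNIV. (A n \<times> B n) \<inter> (g n -` U \<inter> ?S))"
   by (rule rect_open_UN) (auto intro!: rect_open_Int rect_open_rectangle rect_continuousD[OF g(2) U])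
  then obtain K where K: "countable K" "K \<subseteq> sets M \<times> sets N" "(\<Union>n. (A n \<times> B n) \<inter> (g n -` U \<inter> ?S)) = (\<Union>p\<in>K. fst p \<times> snd p)"
   unfolding rect_open_def by auto
  have "sym_diff (G -` U \<inter> ?S) (\<Union>n. (A n \<times> B n) \<inter> (g n -` U \<inter> ?S)) \<subseteq> E"
  proof
   fix z assume z: "z \<in> sym_diff (G -` U \<inter> ?S) (\<Union>n. (A n \<times> B n) \<inter> (g n -` U \<inter> ?S))"
   show "z \<in> E"
   proof (rule ccontr)
    assume nE: "z \<notin> E"
    have zS: "z \<in> ?S" using z by auto
    obtain n where n: "z \<in> A n \<times> B n" using nE zS unfolding E_def by auto
    have "G z \<in> U \<longleftrightarrow> z \<in> (\<Union>n. (A n \<times> B n) \<inter> (g n -` U \<inter> ?S))"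
    proof
     assume "G z \<in> U"
     then have "g n z \<in> U" using Gg[OF zS nE n] by simp
     then show "z \<in> (\<Union>n. (A n \<times> B n) \<inter> (g n -` U \<inter> ?S))" using n zS by blast
    next
     assume "z \<in> (\<Union>n. (A n \<times> B n) \<inter> (g n -` U \<inter> ?S))"
     then obtain m where m: "z \<in> A m \<times> B m" "g m z \<in> U" by blast
     then show "G z \<in> U" using Gg[OF zS nE m(1)] by simp
    qed
    then show False using z zS by auto
   qed
  qed
  then have "marginally_equiv M N (G -` U \<inter> ?S) (\<Union>(\<alpha>, \<beta>)\<in>K. \<alpha> \<times> \<beta>)"
   unfolding marginally_equiv_def K(3) by (simp add: case_prod_beta marginally_null_subset[OF E])
  then show ?thesis unfolding omega_open_def using K(1,2) by blast
 qed
 then have "omega_continuous M N G" unfolding omega_continuous_def using Gm by blast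
 moreover have "AE z in M \<Otimes>\<^sub>M N. \<phi> z = G z"
 proof -
  have "AE z in M \<Otimes>\<^sub>M N. \<forall>n. z \<in> A n \<times> B n \<longrightarrow> \<phi> z = g n z" using g(3) unfolding AE_all_countable by blast
  moreover have "AE z in M \<Otimes>\<^sub>M N. \<exists>i. fst z \<in> A i" "AE z in M \<Otimes>\<^sub>M N. \<exists>i. snd z \<in> B i"
   using AE_fst_snd(1)[OF N exhaustsD(3)[OF A]] AE_fst_snd(2)[OF N exhaustsD(3)[OF B]] .
  ultimately show ?thesis
  proof eventually_elim
   case (elim z)
   then obtain i j where "fst z \<in> A i" "snd z \<in> B j" by blast
   then have "z \<in> A (max i j) \<times> B (max i j)"
    using exhaustsD(2)[OF A, of i "max i j"] exhaustsD(2)[OF B, of j "max i j"] by (auto simp: mem_Times_iff)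
   then have "z \<in> A (LEAST n. z \<in> A n \<times> B n) \<times> B (LEAST n. z \<in> A n \<times> B n)" by (rule LeastI)
   then show ?case using elim(1) unfolding G_def by blast
  qed
 qed
 ultimately show ?thesis by blast
qed

theorem corollary4p5:
  fixes \<mu> :: "'a measure" and \<nu> :: "'b measure"
  assumes "standard_borel_measure \<mu>" and "sigma_finite_measure \<mu>"
    and "standard_borel_measure \<nu>" and "sigma_finite_measure \<nu>"
  shows "wstar_closable_multipliers \<mu> \<nu> \<subseteq> borel_measurable (\<mu> \<Otimes>\<^sub>M \<nu>)
    \<and> (\<lambda>z. 0) \<in> wstar_closable_multipliers \<mu> \<nu>
    \<and> (\<forall>\<phi>\<in>wstar_closable_multipliers \<mu> \<nu>. \<forall>\<psi>\<in>wstar_closable_multipliers \<mu> \<nu>.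
         (\<lambda>z. \<phi> z + \<psi> z) \<in> wstar_closable_multipliers \<mu> \<nu>
         \<and> (\<lambda>z. \<phi> z * \<psi> z) \<in> wstar_closable_multipliers \<mu> \<nu>)
    \<and> (\<forall>c. \<forall>\<phi>\<in>wstar_closable_multipliers \<mu> \<nu>.
         (\<lambda>z. c * \<phi> z) \<in> wstar_closable_multipliers \<mu> \<nu>)
    \<and> local_schur_multipliers \<mu> \<nu> \<subseteq> wstar_closable_multipliers \<mu> \<nu>
    \<and> (\<forall>\<phi>\<in>wstar_closable_multipliers \<mu> \<nu>.
         \<exists>g. omega_continuous \<mu> \<nu> g \<and> (AE z in \<mu> \<Otimes>\<^sub>M \<nu>. \<phi> z = g z))"
proof (intro conjI ballI allI subsetI)
 note \<mu>\<nu> = assms(2,4)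
 show "\<phi> \<in> borel_measurable (\<mu> \<Otimes>\<^sub>M \<nu>)" if "\<phi> \<in> wstar_closable_multipliers \<mu> \<nu>" for \<phi>
  using that by (simp add: wstar_closable_multipliers_def)
 have "exhausts \<mu> (\<lambda>_. space \<mu>)" "exhausts \<nu> (\<lambda>_. space \<nu>)" by (auto simp: exhausts_def incseq_def)
 then show "(\<lambda>z. 0) \<in> wstar_closable_multipliers \<mu> \<nu>"
  by (rule closable_if_schur_exhaustion[OF \<mu>\<nu> borel_measurable_const _ _ schur_on_const[OF \<mu>\<nu>]]) auto
 show "(\<lambda>z. \<phi> z + \<psi> z) \<in> wstar_closable_multipliers \<mu> \<nu>" "(\<lambda>z. \<phi> z * \<psi> z) \<in> wstar_closable_multipliers \<mu> \<nu>"
  if "\<phi> \<in> wstar_closable_multipliers \<mu> \<nu>" "\<psi> \<in> wstar_closable_multipliers \<mu> \<nu>" for \<phi> \<psi>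
  by (rule closable_multipliers_subalgebra[OF \<mu>\<nu> that])+
 show "(\<lambda>z. c * \<phi> z) \<in> wstar_closable_multipliers \<mu> \<nu>" if "\<phi> \<in> wstar_closable_multipliers \<mu> \<nu>" for c \<phi>
  by (rule closable_multipliers_subalgebra(3)[OF \<mu>\<nu> that that])
 show "\<phi> \<in> wstar_closable_multipliers \<mu> \<nu>" if "\<phi> \<in> local_schur_multipliers \<mu> \<nu>" for \<phi>
  by (rule local_schur_multipliers_closable[OF \<mu>\<nu> assms(1,3) that])
 show "\<exists>g. omega_continuous \<mu> \<nu> g \<and> (AE z in \<mu> \<Otimes>\<^sub>M \<nu>. \<phi> z = g z)" if "\<phi> \<in> wstar_closable_multipliers \<mu> \<nu>" for \<phi>
  by (rule closable_omega_continuous_representative[OF \<mu>\<nu> that])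
qed

end
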